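(* Consider the problem $$\text{Minimize}\quad \mathbf E\int_0^T u(t)^\top\Gamma(t)u(t)\,dt\quad\text{over } u\in U$$ $$\text{subject to}\quad \frac{dx}{dt}(t)=Ax(t)+bu(t),\ \ t\in(0,T),\qquad x(0)=a,\qquad x(T)=f\ \ \text{a.s.}$$ This problem has a unique solution in $U$. This solution is $$\widehat u(t)=\Gamma(t)^{-1}b^\top e^{A^\top(T-t)}\mu(t),$$ where $\mu(t)$ is the path-wise continuous process such that $$\mu(t)=\bar\mu+\int_0^t k_\mu(s)\,dw(s),$$ with $\bar\mu=R(0)^{-1}(\mathbf E f-q)$, $q=e^{AT}a$, and $k_\mu(t)=R(t)^{-1}k_f(t)$, where $$R(s)=\int_s^T Q(t)\,dt,\qquad Q(t)=e^{A(T-t)}\,b\,\Gamma(t)^{-1}b^\top e^{A^\top(T-t)}.$$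
   Context: Fix $T>0$ and positive integers $n,d$. Let $(\Omega,\mathcal F,\mathbf P)$ be a standard probability space and $w(t)$, $t\in[0,T]$, a standard $d$-dimensional Wiener process with $w(0)=0$, generating the filtration $\mathcal F_t=\sigma\{w(r):0\le r\le t\}$ augmented by all $\mathbf P$-null sets in $\mathcal F$. $\mathbf E$ denotes expectation with respect to $\mathbf P$. $|\cdot|$ is the Euclidean norm for vectors and the Frobenius norm for matrices. For $p,q\ge 1$, $L_{pq}^{n\times m}$ is the class of random processes $v(t)$, $t\in[0,T]$, adapted to $\mathcal F_t$, with values in $\mathbf R^{n\times m}$, such that $\mathbf E\big(\|v(\cdot)\|_{L_q(0,T)}\big)^p<+\infty$. Processes that coincide $dt\times\mathbf P$-almost everywhere are identified; uniqueness is understood in this sense. Let $f\in L_2(\Omega,\mathcal F_T,\mathbf P;\mathbf R^n)$ be an $\mathcal F_T$-measurable square integrable random vector. By the Martingale Representation Theorem there is a unique $k_f\in L_{22}^{n\times d}$ such that $f=\mathbf E f+\int_0^T k_f(t)\,dw(t)$. It is assumed that there exists $\theta\in(0,T)$ such that $$\operatorname{ess\,sup}_{t\in[\theta,T]}\mathbf E|k_f(t)|^2<+\infty.$$ Let $g:[0,T)\to\mathbf R$ be a given measurable function for which there exist $c>0$ and $\alpha\in(0.5,1)$ such that $$0<g(t)\le c(T-t)^\alpha,\qquad g(t)^{-1}\le c\big(1+(T-t)^{-\alpha}\big),\qquad t\in[0,T).$$ Let $U$ be the set of all processes $u\in L_{21}^{n\times 1}$ such that $\mathbf E\int_0^T g(t)|u(t)|^2dt<+\infty$.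 Let $\Gamma(t)=g(t)G(t)$, where $G(t)\in\mathbf R^{n\times n}$ is a deterministic measurable function of $t\in[0,T)$ whose values are symmetric positive definite matrices, such that $G(t)$ and $G(t)^{-1}$ are both bounded. Let $A\in\mathbf R^{n\times n}$, $a\in\mathbf R^n$, and let $b\in\mathbf R^{n\times n}$ be a non-degenerate (invertible) matrix. The process $k_\mu$ in the claim, defined for $t\in[0,T)$, belongs to $L_{22}^{n\times d}$, so the stochastic integral defining $\mu$ is well defined. *)

theory Defs
  imports "HOL-Probability.Probability"
begin

section \<open>Matrices\<close>

text \<open>The type \<open>real ^ 'n ^ 'n\<close> has no ring structure for the matrix product that the generic
  \<open>exp\<close> could use, so the matrix exponential is defined by its power series in \<open>**\<close>.
  The library norm on \<open>real ^ 'm ^ 'n\<close> is the Frobenius norm.\<close>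

primrec mat_pow :: "real ^ 'n ^ 'n \<Rightarrow> nat \<Rightarrow> real ^ 'n ^ 'n" where
  "mat_pow A 0 = mat 1"
| "mat_pow A (Suc k) = A ** mat_pow A k"

definition mat_exp :: "real ^ 'n ^ 'n \<Rightarrow> real ^ 'n ^ 'n" where
  "mat_exp A = (\<Sum>k. (1 / fact k) *\<^sub>R mat_pow A k)"

definition sym_pos_def :: "real ^ 'n ^ 'n \<Rightarrow> bool" where
  "sym_pos_def S \<longleftrightarrow> transpose S = S \<and> (\<forall>x. x \<noteq> 0 \<longrightarrow> 0 < x \<bullet> (S *v x))"


section \<open>The Wiener process and its augmented filtration\<close>

text \<open>The density below is that of the Gaussian law with mean 0 and covariance
  \<open>(t - s) I\<close>. Continuity and \<open>w 0 = 0\<close> are only required almost surely.\<close>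

definition wiener_process :: "'a measure \<Rightarrow> real \<Rightarrow> (real \<Rightarrow> 'a \<Rightarrow> real ^ 'd) \<Rightarrow> bool" where
  "wiener_process M T w \<longleftrightarrow>
     (\<forall>t\<in>{0..T}. w t \<in> borel_measurable M) \<and>
     (AE \<omega> in M. w 0 \<omega> = 0) \<and>
     (AE \<omega> in M. continuous_on {0..T} (\<lambda>t. w t \<omega>)) \<and>
     (\<forall>m ts. 0 \<le> ts 0 \<and> ts m \<le> T \<and> (\<forall>i<m. ts i < ts (Suc i)) \<longrightarrow>
        prob_space.indep_vars M (\<lambda>_::nat. borel)
          (\<lambda>i \<omega>. w (ts (Suc i)) \<omega> - w (ts i) \<omega>) {..<m}) \<and>
     (\<forall>s t. 0 \<le> s \<and> s < t \<and> t \<le> T \<longrightarrow>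
        distributed M lborel (\<lambda>\<omega>. w t \<omega> - w s \<omega>)
          (\<lambda>x. ennreal (\<Prod>i\<in>UNIV. normal_density 0 (sqrt (t - s)) (x $ i))))"

definition wiener_filtration ::
  "'a measure \<Rightarrow> (real \<Rightarrow> 'a \<Rightarrow> real ^ 'd) \<Rightarrow> real \<Rightarrow> 'a measure" where
  "wiener_filtration M w t =
     sigma (space M)
       ({w r -` B \<inter> space M | r B. r \<in> {0..t} \<and> B \<in> sets borel} \<union> null_sets M)"


section \<open>Classes of adapted processes\<close>

text \<open>Processes on \<open>[0,T]\<close> are functions of time and outcome, jointly measurable
  (Lebesgue measurable in time) and adapted.\<close>

definition adapted_process ::
  "'a measure \<Rightarrow> (real \<Rightarrow> 'a \<Rightarrow> real ^ 'd) \<Rightarrow> real \<Rightarrow>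
    (real \<Rightarrow> 'a \<Rightarrow> 'b::euclidean_space) \<Rightarrow> bool" where
  "adapted_process M w T v \<longleftrightarrow>
     (\<lambda>(t, \<omega>). v t \<omega>) \<in> borel_measurable (lebesgue_on {0..T} \<Otimes>\<^sub>M M) \<and>
     (\<forall>t\<in>{0..T}. v t \<in> borel_measurable (wiener_filtration M w t))"

text \<open>\<open>L_class M w T p q\<close> consists of the adapted \<open>v\<close> for which the \<open>p\<close>-th moment of the
  \<open>L_q(0,T)\<close> norm of the path is finite: \<open>p\<close> is the exponent in \<open>\<omega>\<close> and \<open>q\<close> the one in
  time. The almost sure condition is needed because the Bochner integral of a non-integrable
  function is 0.\<close>

definition L_class ::
  "'a measure \<Rightarrow> (real \<Rightarrow> 'a \<Rightarrow> real ^ 'd) \<Rightarrow> real \<Rightarrow> real \<Rightarrow> real \<Rightarrow>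
    (real \<Rightarrow> 'a \<Rightarrow> 'b::euclidean_space) set" where
  "L_class M w T p q =
     {v. adapted_process M w T v \<and>
         (AE \<omega> in M. integrable (lebesgue_on {0..T}) (\<lambda>t. norm (v t \<omega>) powr q)) \<and>
         integrable M
           (\<lambda>\<omega>. ((LINT t|lebesgue_on {0..T}. norm (v t \<omega>) powr q) powr (1 / q)) powr p)}"

definition AE_equal_processes ::
  "'a measure \<Rightarrow> real \<Rightarrow> (real \<Rightarrow> 'a \<Rightarrow> 'b) \<Rightarrow> (real \<Rightarrow> 'a \<Rightarrow> 'b) \<Rightarrow> bool" where
  "AE_equal_processes M T u v \<longleftrightarrow>
     (AE (t, \<omega>) in lebesgue_on {0..T} \<Otimes>\<^sub>M M. u t \<omega> = v t \<omega>)"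


section \<open>The Ito integral\<close>

text \<open>The simple process \<open>(m, ts, \<xi>)\<close> is \<open>\<xi> i\<close> on \<open>(ts i, ts (i+1)]\<close> for \<open>i < m\<close> and
  0 elsewhere.\<close>

definition simple_integrand ::
  "'a measure \<Rightarrow> (real \<Rightarrow> 'a \<Rightarrow> real ^ 'd) \<Rightarrow> real \<Rightarrow>
    nat \<Rightarrow> (nat \<Rightarrow> real) \<Rightarrow> (nat \<Rightarrow> 'a \<Rightarrow> real ^ 'd ^ 'n) \<Rightarrow> bool" where
  "simple_integrand M w T m ts \<xi> \<longleftrightarrow>
     0 \<le> ts 0 \<and> ts m \<le> T \<and> (\<forall>i<m. ts i < ts (Suc i)) \<and>
     (\<forall>i<m. \<xi> i \<in> borel_measurable (wiener_filtration M w (ts i))) \<and>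
     (\<exists>C. \<forall>i<m. \<forall>\<omega>\<in>space M. norm (\<xi> i \<omega>) \<le> C)"

definition simple_process ::
  "nat \<Rightarrow> (nat \<Rightarrow> real) \<Rightarrow> (nat \<Rightarrow> 'a \<Rightarrow> real ^ 'd ^ 'n) \<Rightarrow> real \<Rightarrow> 'a \<Rightarrow> real ^ 'd ^ 'n" where
  "simple_process m ts \<xi> t \<omega> = (\<Sum>i<m. indicator {ts i<..ts (Suc i)} t *\<^sub>R \<xi> i \<omega>)"

definition simple_integral ::
  "(real \<Rightarrow> 'a \<Rightarrow> real ^ 'd) \<Rightarrow> nat \<Rightarrow> (nat \<Rightarrow> real) \<Rightarrow> (nat \<Rightarrow> 'a \<Rightarrow> real ^ 'd ^ 'n) \<Rightarrow>
    real \<Rightarrow> 'a \<Rightarrow> real ^ 'n" where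
  "simple_integral w m ts \<xi> t \<omega> =
     (\<Sum>i<m. \<xi> i \<omega> *v (w (min t (ts (Suc i))) \<omega> - w (min t (ts i)) \<omega>))"

text \<open>\<open>has_ito_integral M w T k t I\<close>: the random vector \<open>I\<close> is a version of
  \<open>\<integral>\<^sub>0\<^sup>t k(s) dw(s)\<close>, i.e. the mean square limit of the integrals of simple processes that
  converge to \<open>k\<close> in \<open>L_22\<close>. By the Ito isometry the limit does not depend on the
  approximating sequence.\<close>

definition has_ito_integral ::
  "'a measure \<Rightarrow> (real \<Rightarrow> 'a \<Rightarrow> real ^ 'd) \<Rightarrow> real \<Rightarrow> (real \<Rightarrow> 'a \<Rightarrow> real ^ 'd ^ 'n) \<Rightarrow>
    real \<Rightarrow> ('a \<Rightarrow> real ^ 'n) \<Rightarrow> bool" where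
  "has_ito_integral M w T k t I \<longleftrightarrow>
     k \<in> L_class M w T 2 2 \<and> I \<in> borel_measurable M \<and>
     (\<exists>m ts \<xi>.
        (\<forall>j::nat. simple_integrand M w T (m j) (ts j) (\<xi> j)) \<and>
        (\<lambda>j. \<integral>\<^sup>+\<omega>. \<integral>\<^sup>+s. ennreal ((norm (simple_process (m j) (ts j) (\<xi> j) s \<omega> - k s \<omega>))\<^sup>2)
               \<partial>lebesgue_on {0..T} \<partial>M) \<longlonglongrightarrow> 0 \<and>
        (\<lambda>j. \<integral>\<^sup>+\<omega>. ennreal ((norm (simple_integral w (m j) (ts j) (\<xi> j) t \<omega> - I \<omega>))\<^sup>2)
               \<partial>M) \<longlonglongrightarrow> 0)"


section \<open>The control problem\<close>

definition control_set ::
  "'a measure \<Rightarrow> (real \<Rightarrow> 'a \<Rightarrow> real ^ 'd) \<Rightarrow> real \<Rightarrow> (real \<Rightarrow> real) \<Rightarrow>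
    (real \<Rightarrow> 'a \<Rightarrow> real ^ 'n) set" where
  "control_set M w T g =
     {u \<in> L_class M w T 2 1.
        (\<integral>\<^sup>+\<omega>. \<integral>\<^sup>+t. ennreal (g t * (norm (u t \<omega>))\<^sup>2) \<partial>lebesgue_on {0..T} \<partial>M) < \<infinity>}"

text \<open>As controls are merely integrable in time, \<open>dx/dt = A x + b u\<close>, \<open>x(0) = a\<close> is the
  integral (Caratheodory) equation.\<close>

definition state_path ::
  "real \<Rightarrow> real ^ 'n ^ 'n \<Rightarrow> real ^ 'n ^ 'n \<Rightarrow> real ^ 'n \<Rightarrow>
    (real \<Rightarrow> real ^ 'n) \<Rightarrow> (real \<Rightarrow> real ^ 'n) \<Rightarrow> bool" where
  "state_path T A b a u x \<longleftrightarrow>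
     continuous_on {0..T} x \<and>
     (\<forall>t\<in>{0..T}. ((\<lambda>s. A *v x s + b *v u s) has_integral (x t - a)) {0..t})"

definition feasible_controls ::
  "'a measure \<Rightarrow> (real \<Rightarrow> 'a \<Rightarrow> real ^ 'd) \<Rightarrow> real \<Rightarrow> (real \<Rightarrow> real) \<Rightarrow>
    real ^ 'n ^ 'n \<Rightarrow> real ^ 'n ^ 'n \<Rightarrow> real ^ 'n \<Rightarrow> ('a \<Rightarrow> real ^ 'n) \<Rightarrow>
    (real \<Rightarrow> 'a \<Rightarrow> real ^ 'n) set" where
  "feasible_controls M w T g A b a f =
     {u \<in> control_set M w T g.
        \<exists>x. AE \<omega> in M. state_path T A b a (\<lambda>t. u t \<omega>) (\<lambda>t. x t \<omega>) \<and> x T \<omega> = f \<omega>}"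

definition cost ::
  "'a measure \<Rightarrow> real \<Rightarrow> (real \<Rightarrow> real ^ 'n ^ 'n) \<Rightarrow> (real \<Rightarrow> 'a \<Rightarrow> real ^ 'n) \<Rightarrow> real" where
  "cost M T \<Gamma> u =
     prob_space.expectation M
       (\<lambda>\<omega>. LINT t|lebesgue_on {0..T}. u t \<omega> \<bullet> (\<Gamma> t *v u t \<omega>))"

definition optimal_controls ::
  "'a measure \<Rightarrow> (real \<Rightarrow> 'a \<Rightarrow> real ^ 'd) \<Rightarrow> real \<Rightarrow> (real \<Rightarrow> real) \<Rightarrow>
    (real \<Rightarrow> real ^ 'n ^ 'n) \<Rightarrow>
    real ^ 'n ^ 'n \<Rightarrow> real ^ 'n ^ 'n \<Rightarrow> real ^ 'n \<Rightarrow> ('a \<Rightarrow> real ^ 'n) \<Rightarrow>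
    (real \<Rightarrow> 'a \<Rightarrow> real ^ 'n) set" where
  "optimal_controls M w T g \<Gamma> A b a f =
     {u \<in> feasible_controls M w T g A b a f.
        \<forall>v\<in>feasible_controls M w T g A b a f. cost M T \<Gamma> u \<le> cost M T \<Gamma> v}"

definition unique_optimal_control ::
  "'a measure \<Rightarrow> (real \<Rightarrow> 'a \<Rightarrow> real ^ 'd) \<Rightarrow> real \<Rightarrow> (real \<Rightarrow> real) \<Rightarrow>
    (real \<Rightarrow> real ^ 'n ^ 'n) \<Rightarrow>
    real ^ 'n ^ 'n \<Rightarrow> real ^ 'n ^ 'n \<Rightarrow> real ^ 'n \<Rightarrow> ('a \<Rightarrow> real ^ 'n) \<Rightarrow>
    (real \<Rightarrow> 'a \<Rightarrow> real ^ 'n) \<Rightarrow> bool" where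
  "unique_optimal_control M w T g \<Gamma> A b a f u \<longleftrightarrow>
     u \<in> optimal_controls M w T g \<Gamma> A b a f \<and>
     (\<forall>v\<in>optimal_controls M w T g \<Gamma> A b a f. AE_equal_processes M T u v)"


section \<open>The candidate solution\<close>

text \<open>The functions \<open>\<Gamma>\<close> and \<open>\<Gamma>\<inverse>\<close> are only specified on \<open>[0,T)\<close>; their values at the
  null point \<open>T\<close> do not influence any of the integrals.\<close>

definition Q_mat ::
  "real \<Rightarrow> real ^ 'n ^ 'n \<Rightarrow> real ^ 'n ^ 'n \<Rightarrow> (real \<Rightarrow> real ^ 'n ^ 'n) \<Rightarrow> real \<Rightarrow> real ^ 'n ^ 'n" where
  "Q_mat T A b \<Gamma> t =
     mat_exp ((T - t) *\<^sub>R A) ** b ** matrix_inv (\<Gamma> t) ** transpose b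
       ** mat_exp ((T - t) *\<^sub>R transpose A)"

definition R_mat ::
  "real \<Rightarrow> real ^ 'n ^ 'n \<Rightarrow> real ^ 'n ^ 'n \<Rightarrow> (real \<Rightarrow> real ^ 'n ^ 'n) \<Rightarrow> real \<Rightarrow> real ^ 'n ^ 'n" where
  "R_mat T A b \<Gamma> s = (LINT t|lebesgue_on {s..T}. Q_mat T A b \<Gamma> t)"

definition mu_bar ::
  "'a measure \<Rightarrow> real \<Rightarrow> real ^ 'n ^ 'n \<Rightarrow> real ^ 'n ^ 'n \<Rightarrow> real ^ 'n \<Rightarrow>
    (real \<Rightarrow> real ^ 'n ^ 'n) \<Rightarrow> ('a \<Rightarrow> real ^ 'n) \<Rightarrow> real ^ 'n" where
  "mu_bar M T A b a \<Gamma> f =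
     matrix_inv (R_mat T A b \<Gamma> 0) *v
       (prob_space.expectation M f - mat_exp (T *\<^sub>R A) *v a)"

definition k_mu ::
  "real \<Rightarrow> real ^ 'n ^ 'n \<Rightarrow> real ^ 'n ^ 'n \<Rightarrow> (real \<Rightarrow> real ^ 'n ^ 'n) \<Rightarrow>
    (real \<Rightarrow> 'a \<Rightarrow> real ^ 'd ^ 'n) \<Rightarrow> real \<Rightarrow> 'a \<Rightarrow> real ^ 'd ^ 'n" where
  "k_mu T A b \<Gamma> k\<^sub>f t \<omega> = matrix_inv (R_mat T A b \<Gamma> t) ** k\<^sub>f t \<omega>"

text \<open>\<open>ito_process M w T y k \<mu>\<close>: \<open>\<mu>\<close> is a path-wise continuous process with
  \<open>\<mu>(t) = y + \<integral>\<^sub>0\<^sup>t k dw\<close> almost surely for each \<open>t\<close> in \<open>[0,T]\<close>.\<close>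

definition ito_process ::
  "'a measure \<Rightarrow> (real \<Rightarrow> 'a \<Rightarrow> real ^ 'd) \<Rightarrow> real \<Rightarrow> real ^ 'n \<Rightarrow>
    (real \<Rightarrow> 'a \<Rightarrow> real ^ 'd ^ 'n) \<Rightarrow> (real \<Rightarrow> 'a \<Rightarrow> real ^ 'n) \<Rightarrow> bool" where
  "ito_process M w T y k \<mu> \<longleftrightarrow>
     (\<forall>\<omega>\<in>space M. continuous_on {0..T} (\<lambda>t. \<mu> t \<omega>)) \<and>
     (\<forall>t\<in>{0..T}. has_ito_integral M w T k t (\<lambda>\<omega>. \<mu> t \<omega> - y))"

definition u_hat ::
  "real \<Rightarrow> real ^ 'n ^ 'n \<Rightarrow> real ^ 'n ^ 'n \<Rightarrow> (real \<Rightarrow> real ^ 'n ^ 'n) \<Rightarrow>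
    (real \<Rightarrow> 'a \<Rightarrow> real ^ 'n) \<Rightarrow> real \<Rightarrow> 'a \<Rightarrow> real ^ 'n" where
  "u_hat T A b \<Gamma> \<mu> t \<omega> =
     matrix_inv (\<Gamma> t) *v (transpose b *v (mat_exp ((T - t) *\<^sub>R transpose A) *v \<mu> t \<omega>))"

end

theory Submission
  imports Defs
begin

text \<open>Write \<open>B(t) = e\<^sup>A\<^sup>(\<^sup>T\<^sup>-\<^sup>t\<^sup>) b\<close>. By variation of constants the constraint \<open>x(T) = f\<close> says that
  \<open>\<integral>\<^sub>0\<^sup>T B(t) u(t) dt = f - q\<close>, with \<open>q = e\<^sup>A\<^sup>T a\<close>, so the problem is to minimise a strictly convex
  quadratic functional under an affine constraint on adapted processes. The candidate is
  \<open>u = \<Gamma>\<^sup>-\<^sup>1 B\<^sup>T \<mu>\<close> with a martingale \<open>\<mu>\<close> as Lagrange multiplier.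

  The candidate is feasible. Since \<open>B u = Q \<mu>\<close>, exchanging the order of integration gives
  \<open>\<integral>\<^sub>0\<^sup>T Q \<mu> dt = R(0) y + \<integral>\<^sub>0\<^sup>T R k\<^sub>\<mu> dw\<close>, where \<open>y\<close> is the initial value of \<open>\<mu>\<close>, and the choice
  \<open>k\<^sub>\<mu> = R\<^sup>-\<^sup>1 k\<^sub>f\<close> turns the right-hand side into \<open>f - q\<close>. This stochastic Fubini theorem
  (\<open>stochastic_Fubini\<close>) is obtained inside \<open>L\<^sub>2\<close>: the difference of the two sides is orthogonal to
  every Ito integral, which the polarised isometry (\<open>ito_isometry\<close>) reduces to the ordinary theorem
  of Fubini, and the difference is itself a superposition of Ito integrals.

  The candidate is optimal. Let \<open>v\<close> be feasible and \<open>h = v - u\<close>. Then \<open>\<integral> B h dt = 0\<close> almost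
  surely, and the cross term is \<open>E \<integral> u \<bullet> \<Gamma> h dt = E \<integral> \<mu>(t) \<bullet> B h dt\<close>. As \<open>h(t)\<close> is known at time
  \<open>t\<close> and \<open>\<mu>\<close> is a martingale, \<open>\<mu>(t)\<close> may be replaced by \<open>\<mu>(T)\<close>, which leaves
  \<open>E (\<mu>(T) \<bullet> \<integral> B h dt) = 0\<close> (\<open>cross_term_zero\<close>). Hence the cost of \<open>v\<close> exceeds that of \<open>u\<close> by
  \<open>E \<integral> h \<bullet> \<Gamma> h dt\<close>, which is positive unless \<open>h = 0\<close> almost everywhere (\<open>cost_decomposition\<close>).

  The weight controls the singularity at \<open>T\<close>. The upper bound for \<open>g\<close> makes the Gramian at least of
  order \<open>(T - s)\<^sup>1\<^sup>-\<^sup>\<alpha>\<close> (\<open>R_coercive\<close>), so \<open>R\<^sup>-\<^sup>1\<close> is at most of order \<open>(T - s)\<^sup>\<alpha>\<^sup>-\<^sup>1\<close>. This is square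
  integrable because \<open>\<alpha> > 1/2\<close>, and the second moment of \<open>k\<^sub>f\<close> is bounded near \<open>T\<close>, so \<open>k\<^sub>\<mu>\<close> belongs to
  \<open>L\<^sub>2\<^sub>2\<close>. The lower bound for \<open>g\<close> makes \<open>1/g\<close> integrable because \<open>\<alpha> < 1\<close>, which gives the integrability
  of \<open>Q\<close> and of the candidate.

  The facts on the Ito integral that this needs start from the independence of the Wiener increments
  from the past: the isometry, the martingale property in the form of orthogonality to the past
  (\<open>ito_orthogonal\<close>), and the existence of a continuous version (\<open>ito_continuous_version\<close>) by a
  maximal inequality and the Borel--Cantelli lemma.\<close>

section \<open>Matrices as bounded bilinear operations\<close>

lemma norm_matrix_vector_mult_le:
  fixes A :: "real ^ 'm ^ 'n" and x :: "real ^ 'm"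
  shows "norm (A *v x) \<le> norm A * norm x"
proof -
  have "norm (A *v x) = L2_set (\<lambda>i. \<bar>A $ i \<bullet> x\<bar>) UNIV"
    by (simp add: norm_vec_def matrix_mult_dot)
  also have "\<dots> \<le> L2_set (\<lambda>i. norm x * norm (A $ i)) UNIV"
    by (intro L2_set_mono) (auto simp: mult.commute[of "norm x"] Cauchy_Schwarz_ineq2)
  also have "\<dots> = norm A * norm x"
    by (simp add: L2_set_right_distrib[symmetric] norm_vec_def[of A] mult.commute)
  finally show ?thesis .
qed

lemma inner_matrix_entries:
  fixes A B :: "real ^ 'm ^ 'n"
  shows "A \<bullet> B = (\<Sum>i\<in>UNIV. \<Sum>j\<in>UNIV. A $ i $ j * B $ i $ j)"
  by (simp add: inner_vec_def)

lemma norm_transpose: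
  fixes A :: "real ^ 'm ^ 'n"
  shows "norm (transpose A) = norm A"
proof -
  have "transpose A \<bullet> transpose A = A \<bullet> A"
    unfolding inner_matrix_entries by (subst sum.swap) (simp add: transpose_def)
  then show ?thesis by (simp add: norm_eq_sqrt_inner)
qed

lemma row_matrix_mult:
  fixes A :: "real ^ 'm ^ 'n" and B :: "real ^ 'k ^ 'm"
  shows "(A ** B) $ i = transpose B *v (A $ i)"
  by (simp add: matrix_matrix_mult_def matrix_vector_mult_def vec_eq_iff transpose_def mult.commute)

lemma norm_matrix_mult_le:
  fixes A :: "real ^ 'm ^ 'n" and B :: "real ^ 'k ^ 'm"
  shows "norm (A ** B) \<le> norm A * norm B"
proof -
  have "norm (A ** B) = L2_set (\<lambda>i. norm (transpose B *v (A $ i))) UNIV"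
    by (simp add: norm_vec_def[of "A ** B"] row_matrix_mult)
  also have "\<dots> \<le> L2_set (\<lambda>i. norm B * norm (A $ i)) UNIV"
    by (intro L2_set_mono order.trans[OF norm_matrix_vector_mult_le]) (auto simp: norm_transpose)
  also have "\<dots> = norm A * norm B"
    by (simp add: L2_set_right_distrib[symmetric] norm_vec_def[of A] mult.commute)
  finally show ?thesis .
qed

lemma bounded_bilinear_matrix_vector_mult:
  "bounded_bilinear ((*v) :: real ^ 'm ^ 'n \<Rightarrow> real ^ 'm \<Rightarrow> real ^ 'n)"
proof
  show "\<exists>K. \<forall>(a::real ^ 'm ^ 'n) b. norm (a *v b) \<le> norm a * norm b * K"
    by (rule exI[of _ 1]) (simp add: norm_matrix_vector_mult_le)
qed (auto simp: matrix_vector_mult_add_rdistrib matrix_vector_right_distrib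
       scaleR_matrix_vector_assoc matrix_vector_mult_scaleR)

lemma bounded_bilinear_matrix_mult:
  "bounded_bilinear ((**) :: real ^ 'm ^ 'n \<Rightarrow> real ^ 'k ^ 'm \<Rightarrow> real ^ 'k ^ 'n)"
proof
  show "\<exists>K. \<forall>(a::real ^ 'm ^ 'n) (b::real ^ 'k ^ 'm). norm (a ** b) \<le> norm a * norm b * K"
    by (rule exI[of _ 1]) (simp add: norm_matrix_mult_le)
qed (auto simp: matrix_matrix_mult_def vec_eq_iff algebra_simps sum.distrib sum_distrib_left)


lemma bounded_bilinear_borel_measurable:
  fixes h :: "'b::euclidean_space \<Rightarrow> 'c::euclidean_space \<Rightarrow> 'd::euclidean_space"
  assumes "bounded_bilinear h" "f \<in> borel_measurable N" "g \<in> borel_measurable N"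
  shows "(\<lambda>x. h (f x) (g x)) \<in> borel_measurable N"
proof -
  have "continuous_on UNIV (\<lambda>p. h (fst p) (snd p))"
    by (intro bounded_bilinear.continuous_on[OF assms(1)] continuous_intros)
  then show ?thesis
    using borel_measurable_continuous_Pair[of f N g "\<lambda>x y. h x y"] assms by simp
qed

lemmas matrix_vector_mult_borel [measurable (raw)] =
  bounded_bilinear_borel_measurable[OF bounded_bilinear_matrix_vector_mult]
lemmas matrix_mult_borel [measurable (raw)] =
  bounded_bilinear_borel_measurable[OF bounded_bilinear_matrix_mult]

lemma bounded_linear_transpose: "bounded_linear (transpose :: real ^ 'm ^ 'n \<Rightarrow> real ^ 'n ^ 'm)"
proof
  show "\<exists>K. \<forall>x::real ^ 'm ^ 'n. norm (transpose x) \<le> norm x * K"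
    by (rule exI[of _ 1]) (simp add: norm_transpose)
qed (auto simp: transpose_def vec_eq_iff)

lemma inner_transpose_mult:
  fixes A :: "real ^ 'm ^ 'n"
  shows "x \<bullet> (A *v y) = (transpose A *v x) \<bullet> y"
  by (simp add: transpose_matrix_vector dot_lmul_matrix)

section \<open>The matrix exponential\<close>

lemma norm_mat_pow_le:
  fixes A :: "real ^ 'n ^ 'n"
  shows "norm (mat_pow A k) \<le> norm A ^ k * norm (mat 1 :: real ^ 'n ^ 'n)"
proof (induction k)
  case (Suc k)
  have "norm (mat_pow A (Suc k)) \<le> norm A * norm (mat_pow A k)"
    by (simp add: norm_matrix_mult_le)
  also have "\<dots> \<le> norm A * (norm A ^ k * norm (mat 1 :: real ^ 'n ^ 'n))"
    by (intro mult_left_mono Suc) auto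
  finally show ?case by simp
qed simp

lemma mat_pow_scaleR: "mat_pow (c *\<^sub>R A) k = c ^ k *\<^sub>R mat_pow A k"
  for A :: "real ^ 'n ^ 'n"
  by (induction k)
    (simp_all add: bounded_bilinear.scaleR_left[OF bounded_bilinear_matrix_mult]
      bounded_bilinear.scaleR_right[OF bounded_bilinear_matrix_mult])

lemma mat_pow_commute: "A ** mat_pow A k = mat_pow A k ** A"
  for A :: "real ^ 'n ^ 'n"
  by (induction k) (simp_all add: matrix_mul_assoc)

lemma transpose_mat_pow: "transpose (mat_pow A k) = mat_pow (transpose A) k"
  for A :: "real ^ 'n ^ 'n"
proof (induction k)
  case (Suc k)
  then show ?case
    by (simp add: matrix_transpose_mul mat_pow_commute)
qed (simp add: transpose_mat)

lemma summable_mat_exp: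
  fixes A :: "real ^ 'n ^ 'n"
  shows "summable (\<lambda>k. (1 / fact k) *\<^sub>R mat_pow A k)"
proof (rule summable_comparison_test)
  have "summable (\<lambda>k. (norm A ^ k /\<^sub>R fact k) * norm (mat 1 :: real ^ 'n ^ 'n))"
    by (intro summable_mult2 summable_exp_generic)
  then show "summable (\<lambda>k. norm A ^ k * norm (mat 1 :: real ^ 'n ^ 'n) / fact k)"
    by (simp add: field_simps)
  show "\<exists>N. \<forall>n\<ge>N. norm ((1 / fact n) *\<^sub>R mat_pow A n)
           \<le> norm A ^ n * norm (mat 1 :: real ^ 'n ^ 'n) / fact n"
    by (auto intro!: divide_right_mono norm_mat_pow_le)
qed

lemma mat_exp_sums: "(\<lambda>k. (1 / fact k) *\<^sub>R mat_pow A k) sums mat_exp A"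
  for A :: "real ^ 'n ^ 'n"
  unfolding mat_exp_def by (intro summable_sums summable_mat_exp)

lemma transpose_mat_exp: "transpose (mat_exp A) = mat_exp (transpose A)"
  for A :: "real ^ 'n ^ 'n"
proof -
  have "(\<lambda>k. (1 / fact k) *\<^sub>R mat_pow (transpose A) k) sums transpose (mat_exp A)"
    using bounded_linear.sums[OF bounded_linear_transpose mat_exp_sums[of A]]
    by (simp add: linear_scale[OF bounded_linear.linear[OF bounded_linear_transpose]]
        transpose_mat_pow)
  then show ?thesis
    using mat_exp_sums sums_unique2 by blast
qed

lemma mat_exp_commute: "A ** mat_exp (t *\<^sub>R A) = mat_exp (t *\<^sub>R A) ** A"
  for A :: "real ^ 'n ^ 'n"
proof -
  note bb = bounded_bilinear_matrix_mult
  let ?f = "\<lambda>k. (1 / fact k) *\<^sub>R mat_pow (t *\<^sub>R A) k"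
  have "(\<lambda>k. A ** ?f k) sums (A ** mat_exp (t *\<^sub>R A))"
    by (rule bounded_linear.sums[OF bounded_bilinear.bounded_linear_right[OF bb] mat_exp_sums])
  moreover have "(\<lambda>k. ?f k ** A) sums (mat_exp (t *\<^sub>R A) ** A)"
    by (rule bounded_linear.sums[OF bounded_bilinear.bounded_linear_left[OF bb] mat_exp_sums])
  moreover have "A ** ?f k = ?f k ** A" for k
    by (simp add: mat_pow_scaleR bounded_bilinear.scaleR_left[OF bb]
       bounded_bilinear.scaleR_right[OF bb] mat_pow_commute)
  ultimately show ?thesis using sums_unique2 by fastforce
qed

lemma mat_exp_zero: "mat_exp (0::real ^ 'n ^ 'n) = mat 1"
proof -
  have "(1 / fact k) *\<^sub>R mat_pow (0::real ^ 'n ^ 'n) k = 0" if "k \<notin> {0}" for k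
    using that by (cases k) auto
  then have "mat_exp (0::real ^ 'n ^ 'n) = (\<Sum>k\<in>{0}. (1 / fact k) *\<^sub>R mat_pow (0::real ^ 'n ^ 'n) k)"
    unfolding mat_exp_def by (intro suminf_finite) auto
  then show ?thesis by simp
qed

text \<open>Each entry of \<open>mat_exp (t A)\<close> is an everywhere convergent power series in \<open>t\<close>, so that
  termwise differentiation of scalar power series applies.\<close>

lemma mat_exp_has_vector_derivative:
  fixes A :: "real ^ 'n ^ 'n"
  shows "((\<lambda>t. mat_exp (t *\<^sub>R A)) has_vector_derivative A ** mat_exp (t *\<^sub>R A)) (at t within S)"
proof -
  have entry: "((\<lambda>t. mat_exp (t *\<^sub>R A) $ i $ j) has_real_derivative
                  (A ** mat_exp (t *\<^sub>R A)) $ i $ j) (at t)" for i j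
  proof -
    define c where "c k = (1 / fact k) * (mat_pow A k $ i $ j)" for k
    have bl: "bounded_linear (\<lambda>X::real ^ 'n ^ 'n. X $ i $ j)"
      by (rule bounded_linear_compose[OF bounded_linear_vec_nth bounded_linear_vec_nth])
    have s: "(\<lambda>k. c k * y ^ k) sums (mat_exp (y *\<^sub>R A) $ i $ j)" for y
      using bounded_linear.sums[OF bl mat_exp_sums[of "y *\<^sub>R A"]]
      by (simp add: c_def mat_pow_scaleR mult.assoc mult.commute mult.left_commute)
    have "(\<lambda>k. A ** ((1 / fact k) *\<^sub>R mat_pow (t *\<^sub>R A) k)) sums (A ** mat_exp (t *\<^sub>R A))"
      by (rule bounded_linear.sums
          [OF bounded_bilinear.bounded_linear_right[OF bounded_bilinear_matrix_mult] mat_exp_sums])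
    from bounded_linear.sums[OF bl this]
    have "(\<lambda>k. (A ** ((1 / fact k) *\<^sub>R mat_pow (t *\<^sub>R A) k)) $ i $ j)
             sums ((A ** mat_exp (t *\<^sub>R A)) $ i $ j)" .
    moreover have "(A ** ((1 / fact k) *\<^sub>R mat_pow (t *\<^sub>R A) k)) $ i $ j = diffs c k * t ^ k" for k
      by (simp add: diffs_def c_def mat_pow_scaleR
          bounded_bilinear.scaleR_right[OF bounded_bilinear_matrix_mult] field_simps
          del: of_nat_Suc)
    ultimately have "(\<lambda>k. diffs c k * t ^ k) sums ((A ** mat_exp (t *\<^sub>R A)) $ i $ j)"
      by simp
    moreover have "(\<lambda>y. \<Sum>k. c k * y ^ k) = (\<lambda>y. mat_exp (y *\<^sub>R A) $ i $ j)"
      using s by (auto simp: sums_iff)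
    ultimately show ?thesis
      using termdiffs_strong_converges_everywhere[of c t] s
      by (auto simp: sums_iff)
  qed
  have "((\<lambda>t. mat_exp (t *\<^sub>R A) $ i $ j) has_derivative
                  (\<lambda>h. (h *\<^sub>R (A ** mat_exp (t *\<^sub>R A))) $ i $ j)) (at t within S)" for i j
  proof -
    have "(*) ((A ** mat_exp (t *\<^sub>R A)) $ i $ j) = (\<lambda>h. (h *\<^sub>R (A ** mat_exp (t *\<^sub>R A))) $ i $ j)"
      by (auto simp: fun_eq_iff)
    then show ?thesis
      using has_field_derivative_at_within[OF entry[of i j]] unfolding has_field_derivative_def by metis
  qed
  then show ?thesis
    unfolding has_vector_derivative_def
    by (subst has_derivative_componentwise_within) (auto simp: Basis_vec_def inner_axis)
qed

lemma continuous_on_mat_exp: "continuous_on S (\<lambda>t. mat_exp (t *\<^sub>R A))"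
  for A :: "real ^ 'n ^ 'n"
  using mat_exp_has_vector_derivative[of A]
  by (meson continuous_on_eq_continuous_within has_vector_derivative_continuous)

lemma mat_exp_minus_vector_derivative:
  fixes A :: "real ^ 'n ^ 'n"
  shows "((\<lambda>t. mat_exp ((c - t) *\<^sub>R A)) has_vector_derivative - (A ** mat_exp ((c - t) *\<^sub>R A)))
     (at t within S)"
proof -
  have "((\<lambda>t. c - t) has_real_derivative -1) (at t within S)"
    by (auto intro!: derivative_eq_intros)
  show ?thesis
    using vector_diff_chain_within[of "\<lambda>t. c - t" "-1" t S "\<lambda>t. mat_exp (t *\<^sub>R A)"]
      mat_exp_has_vector_derivative[of A "c - t"] \<open>((\<lambda>t. c - t) has_real_derivative -1) (at t within S)\<close>
      has_vector_derivative_at_within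
    by (simp add: o_def has_real_derivative_iff_has_vector_derivative)
qed

lemma continuous_on_mat_exp_minus: "continuous_on S (\<lambda>t. mat_exp ((c - t) *\<^sub>R A))"
  for A :: "real ^ 'n ^ 'n"
  using mat_exp_minus_vector_derivative[of c A]
  by (meson continuous_on_eq_continuous_within has_vector_derivative_continuous)

text \<open>The product has derivative zero in \<open>t\<close>, since \<open>A\<close> commutes with its exponential.\<close>

lemma mat_exp_inverse:
  fixes A :: "real ^ 'n ^ 'n"
  shows "mat_exp (t *\<^sub>R A) ** mat_exp ((- t) *\<^sub>R A) = mat 1"
proof -
  have "((\<lambda>t. mat_exp (t *\<^sub>R A) ** mat_exp ((0 - t) *\<^sub>R A)) has_vector_derivative 0) (at t within UNIV)" for t
    by (rule has_vector_derivative_eq_rhs,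
      rule bounded_bilinear.has_vector_derivative[OF bounded_bilinear_matrix_mult
         mat_exp_has_vector_derivative mat_exp_minus_vector_derivative])
      (simp add: mat_exp_commute matrix_mul_assoc
         bounded_bilinear.minus_right[OF bounded_bilinear_matrix_mult])
  then obtain c where "\<And>t. mat_exp (t *\<^sub>R A) ** mat_exp ((0 - t) *\<^sub>R A) = c"
    using has_vector_derivative_zero_constant[of UNIV "\<lambda>t. mat_exp (t *\<^sub>R A) ** mat_exp ((0 - t) *\<^sub>R A)"]
    by auto
  from this[of t] this[of 0] show ?thesis by (simp add: mat_exp_zero)
qed

section \<open>Inverse matrices\<close>

lemma matrix_inv_both:
  assumes "invertible (A :: real ^ 'n ^ 'n)"
  shows "A ** matrix_inv A = mat 1" "matrix_inv A ** A = mat 1"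
  using someI_ex[of "\<lambda>A'. A ** A' = mat 1 \<and> A' ** A = mat 1"] assms
  unfolding invertible_def matrix_inv_def by auto

lemma right_inverse_eq_matrix_inv: "invertible A \<Longrightarrow> A ** B = mat 1 \<Longrightarrow> B = matrix_inv A"
  for A B :: "real ^ 'n ^ 'n"
  by (metis matrix_inv_both(2) matrix_mul_assoc matrix_mul_lid matrix_mul_rid)

lemma invertible_if_kernel_trivial:
  fixes A :: "real ^ 'n ^ 'n"
  assumes "\<And>x. x \<noteq> 0 \<Longrightarrow> A *v x \<noteq> 0"
  shows "invertible A"
  using assms matrix_left_invertible_ker[of A] invertible_left_inverse[of A] by blast

text \<open>From \<open>Y\<^sup>-\<^sup>1 - X\<^sup>-\<^sup>1 = Y\<^sup>-\<^sup>1 (X - Y) X\<^sup>-\<^sup>1\<close>: for \<open>Y\<close> close to \<open>X\<close> this first bounds \<open>Y\<^sup>-\<^sup>1\<close> by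
  \<open>2 |X\<^sup>-\<^sup>1|\<close> and then shows continuity.\<close>

lemma continuous_on_matrix_inv:
  "continuous_on {A :: real ^ 'n ^ 'n. invertible A} matrix_inv"
proof -
  have "continuous (at A within {A. invertible A}) matrix_inv" 
    if A: "invertible A" for A :: "real ^ 'n ^ 'n"
  proof -
    let ?F = "at A within {A. invertible A}"
    let ?c = "norm (matrix_inv A)"
    note bb = bounded_bilinear_matrix_mult
    have key: "norm (matrix_inv B - matrix_inv A) \<le> 2 * ?c * ?c * norm (A - B)"
      if B: "invertible B" "norm (A - B) * ?c \<le> 1/2" for B
    proof -
      have "matrix_inv B - matrix_inv A = matrix_inv B ** ((A - B) ** matrix_inv A)"
      proof -
        have "matrix_inv B ** ((A - B) ** matrix_inv A)
            = matrix_inv B ** (A ** matrix_inv A) - (matrix_inv B ** B) ** matrix_inv A"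
          by (simp add: bounded_bilinear.diff_left[OF bb] bounded_bilinear.diff_right[OF bb]
             matrix_mul_assoc)
        then show ?thesis by (simp add: matrix_inv_both A B)
      qed
      then have le: "norm (matrix_inv B - matrix_inv A) \<le> norm (matrix_inv B) * (norm (A - B) * ?c)"
        using order_trans[OF norm_matrix_mult_le mult_left_mono[OF norm_matrix_mult_le norm_ge_zero]]
        by simp
      also have "\<dots> \<le> norm (matrix_inv B) * (1/2)"
        using B by (intro mult_left_mono) auto
      finally have "norm (matrix_inv B) \<le> 2 * ?c"
        using norm_triangle_sub[of "matrix_inv B" "matrix_inv A"] by linarith
      then have "norm (matrix_inv B) * (norm (A - B) * ?c) \<le> (2 * ?c) * (norm (A - B) * ?c)"
        by (intro mult_right_mono) auto
      with le show ?thesis by (simp add: algebra_simps)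
    qed
    have lim: "((\<lambda>B. A - B) \<longlongrightarrow> 0) ?F"
      by (auto intro!: tendsto_eq_intros)
    have "((\<lambda>B. norm (A - B) * ?c) \<longlongrightarrow> 0) ?F"
      using tendsto_mult_left_zero[OF tendsto_norm_zero[OF lim]] .
    then have "eventually (\<lambda>B. norm (A - B) * ?c < 1/2) ?F"
      by (rule order_tendstoD) simp
    moreover have "eventually (\<lambda>B. invertible B) ?F"
      by (simp add: eventually_at_filter)
    ultimately have "eventually (\<lambda>B. norm (matrix_inv B - matrix_inv A) \<le> 2 * ?c * ?c * norm (A - B)) ?F"
      by eventually_elim (use key in auto)
    moreover have "((\<lambda>B. 2 * ?c * ?c * norm (A - B)) \<longlongrightarrow> 0) ?F"
      using tendsto_mult_right_zero[OF tendsto_norm_zero[OF lim]] .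
    ultimately have "((\<lambda>B. matrix_inv B - matrix_inv A) \<longlongrightarrow> 0) ?F"
      by (rule Lim_null_comparison)
    then show ?thesis
      by (simp add: continuous_within LIM_zero_iff)
  qed
  then show ?thesis by (auto simp: continuous_on_eq_continuous_within)
qed

lemma borel_measurable_matrix_inv:
  assumes "f \<in> borel_measurable N" "\<And>x. x \<in> space N \<Longrightarrow> invertible (f x)"
  shows "(\<lambda>x. matrix_inv (f x :: real ^ 'n ^ 'n)) \<in> borel_measurable N"
proof -
  have "matrix_inv \<in> borel_measurable (restrict_space borel {A :: real ^ 'n ^ 'n. invertible A})"
    by (rule borel_measurable_continuous_on_restrict[OF continuous_on_matrix_inv])
  moreover have "f \<in> measurable N (restrict_space borel {A :: real ^ 'n ^ 'n. invertible A})"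
    using assms by (auto intro!: measurable_restrict_space2)
  ultimately show ?thesis
    by (rule measurable_compose[rotated])
qed

section \<open>Positive definite matrices\<close>

lemma sym_pos_def_inner_commute:
  assumes "sym_pos_def S" shows "x \<bullet> (S *v y) = y \<bullet> (S *v x)"
  using assms inner_transpose_mult[of x S y] by (simp add: sym_pos_def_def inner_commute)

lemma sym_pos_def_nonneg: "sym_pos_def S \<Longrightarrow> 0 \<le> x \<bullet> (S *v x)"
  unfolding sym_pos_def_def by (cases "x = 0") (auto intro: less_imp_le)

lemma sym_pos_def_invertible: "sym_pos_def S \<Longrightarrow> invertible S"
  by (rule invertible_if_kernel_trivial) (auto simp: sym_pos_def_def)

text \<open>Cauchy--Schwarz for the inner product \<open>x \<bullet> S y\<close>, applied to \<open>S\<^sup>-\<^sup>1 y\<close> and \<open>y\<close>. It is written out as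
  the nonnegativity of the form at \<open>S\<^sup>-\<^sup>1 y - c y\<close> for the minimising \<open>c\<close>.\<close>

lemma sym_pos_def_inverse_lower_bound:
  fixes S :: "real ^ 'n ^ 'n"
  assumes S: "sym_pos_def S" and K: "norm S \<le> K" "0 < K"
  shows "(norm y)\<^sup>2 / K \<le> y \<bullet> (matrix_inv S *v y)"
proof (cases "y = 0")
  case False
  define z where "z = matrix_inv S *v y"
  have Sz: "S *v z = y"
    by (simp add: z_def matrix_vector_mul_assoc matrix_inv_both sym_pos_def_invertible[OF S])
  define p where "p = z \<bullet> (S *v z)"
  define r where "r = y \<bullet> (S *v y)"
  have r: "0 < r" using False S by (auto simp: r_def sym_pos_def_def)
  have rK: "r \<le> K * (norm y)\<^sup>2"
  proof -
    have "r \<le> norm y * norm (S *v y)"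
      unfolding r_def by (rule norm_cauchy_schwarz)
    also have "\<dots> \<le> norm y * (K * norm y)"
      by (intro mult_left_mono order.trans[OF norm_matrix_vector_mult_le] mult_right_mono K) auto
    finally show ?thesis by (simp add: power2_eq_square algebra_simps)
  qed
  let ?c = "(norm y)\<^sup>2 / r"
  have "0 \<le> (z - ?c *\<^sub>R y) \<bullet> (S *v (z - ?c *\<^sub>R y))"
    by (rule sym_pos_def_nonneg[OF S])
  also have "\<dots> = p - 2 * ?c * (norm y)\<^sup>2 + ?c * ?c * r"
    using sym_pos_def_inner_commute[OF S, of z y]
    by (simp add: matrix_vector_mult_diff_distrib matrix_vector_mult_scaleR inner_diff_left 
       inner_diff_right Sz p_def r_def algebra_simps power2_norm_eq_inner)
  also have "\<dots> = p - (norm y)\<^sup>2 * (norm y)\<^sup>2 / r"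
    using r by (simp add: field_simps power2_eq_square)
  finally have "(norm y)\<^sup>2 * (norm y)\<^sup>2 / r \<le> p" by simp
  moreover have "(norm y)\<^sup>2 / K \<le> (norm y)\<^sup>2 * (norm y)\<^sup>2 / r"
    using mult_left_mono[OF rK, of "(norm y)\<^sup>2"] r K(2) by (simp add: field_simps)
  ultimately show ?thesis
    by (simp add: p_def Sz inner_commute flip: z_def)
qed simp

lemma scaleR_matrix_inv:
  fixes S :: "real ^ 'n ^ 'n"
  assumes "invertible S" "c \<noteq> 0"
  shows "matrix_inv (c *\<^sub>R S) = inverse c *\<^sub>R matrix_inv S"
proof (rule right_inverse_eq_matrix_inv[symmetric])
  show "c *\<^sub>R S ** (inverse c *\<^sub>R matrix_inv S) = mat 1"
    using assms by (simp add: matrix_inv_both bounded_bilinear.scaleR_left[OF bounded_bilinear_matrix_mult]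
         bounded_bilinear.scaleR_right[OF bounded_bilinear_matrix_mult])
  then show "invertible (c *\<^sub>R S)"
    using invertible_right_inverse by blast
qed

section \<open>Integration over intervals and the linear state equation\<close>

lemma lebesgue_on_subset_eq:
  assumes "S \<subseteq> U" "S \<in> sets lebesgue" "U \<in> sets lebesgue"
  shows "lebesgue_on S = restrict_space (lebesgue_on U) S"
proof -
  have "restrict_space (restrict_space lebesgue U) S = restrict_space lebesgue (U \<inter> S)"
    using assms by (intro restrict_restrict_space) auto
  moreover have "U \<inter> S = S" using assms(1) by blast
  ultimately show ?thesis by simp
qed

lemma integral_lebesgue_on_subset:
  fixes f :: "real \<Rightarrow> 'b::{banach, second_countable_topology}"
  assumes "S \<subseteq> U" "S \<in> sets lebesgue" "U \<in> sets lebesgue"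
  shows "(LINT x|lebesgue_on S. f x) = (LINT x|lebesgue_on U. indicator S x *\<^sub>R f x)"
    and "integrable (lebesgue_on S) f \<longleftrightarrow> integrable (lebesgue_on U) (\<lambda>x. indicator S x *\<^sub>R f x)"
proof -
  have "S \<inter> space (lebesgue_on U) \<in> sets (lebesgue_on U)"
    using assms by (auto simp: sets_restrict_space_iff Int_absorb2)
  then show "(LINT x|lebesgue_on S. f x) = (LINT x|lebesgue_on U. indicator S x *\<^sub>R f x)"
    "integrable (lebesgue_on S) f \<longleftrightarrow> integrable (lebesgue_on U) (\<lambda>x. indicator S x *\<^sub>R f x)"
    unfolding lebesgue_on_subset_eq[OF assms]
    by (rule integral_restrict_space, rule integrable_restrict_space)
qed

lemma integrable_lebesgue_on_subset:
  fixes f :: "real \<Rightarrow> 'b::{banach, second_countable_topology}"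
  assumes "integrable (lebesgue_on U) f" "S \<subseteq> U" "S \<in> sets lebesgue" "U \<in> sets lebesgue"
  shows "integrable (lebesgue_on S) f"
proof -
  have "S \<in> sets (lebesgue_on U)"
    using assms by (auto simp: sets_restrict_space_iff)
  then show ?thesis
    unfolding integral_lebesgue_on_subset(2)[OF assms(2-4)]
    using assms(1) by (intro integrable_mult_indicator)
qed

lemma finite_measure_lebesgue_on_interval: "finite_measure (lebesgue_on {a..b::real})"
  by (intro finite_measure_lebesgue_on) auto

lemma measurable_ident_lebesgue_on: "(\<lambda>x. x) \<in> borel_measurable (lebesgue_on S)"
  using id_borel_measurable_lebesgue_on by (simp add: id_def)

lemma integral_derivative_lebesgue_on:
  fixes F :: "real \<Rightarrow> 'b::euclidean_space"
  assumes "s \<le> t" "\<And>r. r \<in> {s..t} \<Longrightarrow> (F has_vector_derivative F' r) (at r within {s..t})"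
    and "continuous_on {s..t} F'"
  shows "(LINT r|lebesgue_on {s..t}. F' r) = F t - F s"
  using fundamental_theorem_of_calculus[OF assms(1,2)]
    has_integral_integral_lebesgue_on[OF continuous_imp_integrable_real[OF assms(3)]]
  by (auto intro: has_integral_unique)

lemma continuous_on_borel_lebesgue_on:
  fixes F :: "real \<Rightarrow> 'b::euclidean_space"
  assumes "continuous_on {a..b} F" shows "F \<in> borel_measurable (lebesgue_on {a..b})"
  using continuous_imp_integrable_real[OF assms] by auto

lemma integrable_bounded_matrix_mult:
  fixes F :: "'x \<Rightarrow> real ^ 'm ^ 'n" and z :: "'x \<Rightarrow> real ^ 'm"
  assumes "integrable N z" and "F \<in> borel_measurable N" 
    and "\<And>x. x \<in> space N \<Longrightarrow> norm (F x) \<le> K"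
  shows "integrable N (\<lambda>x. F x *v z x)"
proof (rule Bochner_Integration.integrable_bound)
  show "integrable N (\<lambda>x. K * norm (z x))" using assms(1) by auto
  show "(\<lambda>x. F x *v z x) \<in> borel_measurable N" using assms by measurable
  show "AE x in N. norm (F x *v z x) \<le> norm (K * norm (z x))"
  proof (rule AE_I2)
    fix x assume "x \<in> space N"
    then have "norm (F x) * norm (z x) \<le> \<bar>K\<bar> * norm (z x)"
      using assms(3)[of x] by (intro mult_right_mono) auto
    then show "norm (F x *v z x) \<le> norm (K * norm (z x))"
      using norm_matrix_vector_mult_le[of "F x" "z x"] by (simp add: abs_mult)
  qed
qed

lemma continuous_on_interval_norm_bound:
  fixes F :: "real \<Rightarrow> 'b::real_normed_vector"
  assumes "continuous_on {a..b} F"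
  obtains K where "0 < K" "\<And>x. x \<in> {a..b} \<Longrightarrow> norm (F x) \<le> K"
proof -
  have "bounded (F ` {a..b})"
    by (intro compact_imp_bounded compact_continuous_image assms) auto
  then show ?thesis using that unfolding bounded_pos by auto
qed

text \<open>An indefinite Lebesgue integral need not be differentiable at a given point, so the by-parts
  formula is obtained from Fubini's theorem on the triangle \<open>s \<le> r\<close>.\<close>

lemma integration_by_parts_indefinite:
  fixes F F' :: "real \<Rightarrow> real ^ 'n ^ 'n" and z :: "real \<Rightarrow> real ^ 'n"
  assumes t: "0 \<le> t"
    and F: "\<And>r. r \<in> {0..t} \<Longrightarrow> (F has_vector_derivative F' r) (at r within {0..t})"
    and F': "continuous_on {0..t} F'"
    and z: "integrable (lebesgue_on {0..t}) z"
  defines "Z \<equiv> \<lambda>r. LINT s|lebesgue_on {0..r}. z s"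
  shows "(LINT s|lebesgue_on {0..t}. F s *v z s)
           = F t *v Z t - (LINT r|lebesgue_on {0..t}. F' r *v Z r)"
proof -
  let ?N = "lebesgue_on {0..t}"
  interpret N: finite_measure ?N by (rule finite_measure_lebesgue_on_interval)
  interpret NN: pair_sigma_finite ?N ?N ..
  note bb = bounded_bilinear_matrix_vector_mult
  have [measurable]: "F' \<in> borel_measurable ?N" "z \<in> borel_measurable ?N"
    using F' z by (auto intro: continuous_on_borel_lebesgue_on)
  have contF: "continuous_on {0..t} F"
    using F by (meson continuous_on_eq_continuous_within has_vector_derivative_continuous)
  have [measurable]: "F \<in> borel_measurable ?N"
    using contF by (rule continuous_on_borel_lebesgue_on)
  obtain K where K: "0 < K" "\<And>r. r \<in> {0..t} \<Longrightarrow> norm (F' r) \<le> K"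
    using continuous_on_interval_norm_bound[OF F'] by blast
  obtain L where L: "0 < L" "\<And>r. r \<in> {0..t} \<Longrightarrow> norm (F r) \<le> L"
    using continuous_on_interval_norm_bound[OF contF] by blast
  define h where "h r s = (if s \<le> r then F' r *v z s else 0)" for r s
  note [measurable] = measurable_ident_lebesgue_on
  have h_meas [measurable]: "(\<lambda>(r, s). h r s) \<in> borel_measurable (?N \<Otimes>\<^sub>M ?N)"
    unfolding h_def by measurable
  have h_int: "integrable (?N \<Otimes>\<^sub>M ?N) (\<lambda>(r, s). h r s)"
  proof (rule Bochner_Integration.integrable_bound)
    show "integrable (?N \<Otimes>\<^sub>M ?N) (\<lambda>(r, s). K * norm (z s))"
      using z by (intro NN.Fubini_integrable) auto
    show "AE x in ?N \<Otimes>\<^sub>M ?N. norm (case x of (r, s) \<Rightarrow> h r s) \<le> norm (case x of (r, s) \<Rightarrow> K * norm (z s))"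
    proof (rule AE_I2, clarify)
      fix r s assume "(r, s) \<in> space (?N \<Otimes>\<^sub>M ?N)"
      then have "norm (F' r) * norm (z s) \<le> K * norm (z s)"
        by (intro mult_right_mono K) (auto simp: space_pair_measure)
      then show "norm (h r s) \<le> norm (K * norm (z s))"
        using norm_matrix_vector_mult_le[of "F' r" "z s"] K(1) by (auto simp: h_def)
    qed
  qed simp
  have inner_s: "(LINT s|?N. h r s) = F' r *v Z r" if r: "r \<in> {0..t}" for r
  proof -
    have "(LINT s|?N. h r s) = (LINT s|?N. F' r *v (indicator {0..r} s *\<^sub>R z s))"
      by (rule Bochner_Integration.integral_cong) (auto simp: h_def indicator_def)
    also have "\<dots> = F' r *v (LINT s|?N. indicator {0..r} s *\<^sub>R z s)"
      using r by (intro integral_bounded_linear bounded_bilinear.bounded_linear_right[OF bb]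
          integrable_mult_indicator z) (auto simp: sets_restrict_space_iff)
    also have "(LINT s|?N. indicator {0..r} s *\<^sub>R z s) = Z r"
      using r unfolding Z_def by (subst integral_lebesgue_on_subset(1)[of "{0..r}" "{0..t}"]) auto
    finally show ?thesis .
  qed
  have inner_r: "(LINT r|?N. h r s) = (F t - F s) *v z s" if s: "s \<in> {0..t}" for s
  proof -
    have "(LINT r|?N. h r s) = (LINT r|?N. (indicator {s..t} r *\<^sub>R F' r) *v z s)"
      by (rule Bochner_Integration.integral_cong) (auto simp: h_def indicator_def)
    also have "\<dots> = (LINT r|?N. indicator {s..t} r *\<^sub>R F' r) *v z s"
      using s by (intro integral_bounded_linear bounded_bilinear.bounded_linear_left[OF bb]
          integrable_mult_indicator continuous_imp_integrable_real F') (auto simp: sets_restrict_space_iff)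
    also have "(LINT r|?N. indicator {s..t} r *\<^sub>R F' r) = (LINT r|lebesgue_on {s..t}. F' r)"
      using s by (subst integral_lebesgue_on_subset(1)[of "{s..t}" "{0..t}"]) auto
    also have "\<dots> = F t - F s"
      using s by (intro integral_derivative_lebesgue_on continuous_on_subset[OF F'])
        (auto intro!: has_vector_derivative_within_subset[OF F])
    finally show ?thesis .
  qed
  have Fz: "integrable ?N (\<lambda>s. F s *v z s)"
    by (rule integrable_bounded_matrix_mult[OF z _ L(2)]) auto
  have "(LINT r|?N. F' r *v Z r) = (LINT r|?N. LINT s|?N. h r s)"
    by (rule Bochner_Integration.integral_cong) (auto simp: inner_s)
  also have "\<dots> = (LINT s|?N. LINT r|?N. h r s)"
    using NN.integral_fst[OF h_int] NN.integral_snd[OF h_int] by simp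
  also have "\<dots> = (LINT s|?N. F t *v z s - F s *v z s)"
    by (rule Bochner_Integration.integral_cong) (auto simp: inner_r matrix_vector_mult_diff_rdistrib)
  also have "\<dots> = F t *v Z t - (LINT s|?N. F s *v z s)"
    using z Fz unfolding Z_def
    by (subst Bochner_Integration.integral_diff)
      (auto intro!: integrable_bounded_linear[OF bounded_bilinear.bounded_linear_right[OF bb]]
         integral_bounded_linear bounded_bilinear.bounded_linear_right[OF bb])
  finally show ?thesis by simp
qed

lemma continuous_on_indefinite_integral:
  fixes z :: "real \<Rightarrow> 'b::euclidean_space"
  assumes z: "integrable (lebesgue_on {0..T}) z"
  shows "continuous_on {0..T} (\<lambda>t. LINT s|lebesgue_on {0..t}. z s)"
proof -
  have "z integrable_on {0..T}"
    using has_integral_integral_lebesgue_on[OF z] by auto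
  then have "continuous_on {0..T} (\<lambda>t. integral {0..t} z)"
    by (rule indefinite_integral_continuous_1)
  moreover have "(LINT s|lebesgue_on {0..t}. z s) = integral {0..t} z" if "t \<in> {0..T}" for t
    using that by (intro lebesgue_integral_eq_integral integrable_lebesgue_on_subset[OF z]) auto
  ultimately show ?thesis by (subst continuous_on_cong[OF refl]) auto
qed

text \<open>Variation of constants at the end point. The by-parts formula is applied to
  \<open>F s = exp ((T - s) A)\<close> and to the integrand \<open>A x + b u\<close> of the state equation, whose indefinite
  integral is \<open>x - a\<close>; the terms with \<open>A x\<close> then cancel.\<close>

lemma state_path_endpoint:
  fixes A b :: "real ^ 'n ^ 'n"
  assumes T: "0 \<le> T" and u: "integrable (lebesgue_on {0..T}) u"
    and x: "state_path T A b a u x"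
  shows "x T = mat_exp (T *\<^sub>R A) *v a
          + (LINT s|lebesgue_on {0..T}. mat_exp ((T - s) *\<^sub>R A) *v (b *v u s))"
proof -
  let ?N = "lebesgue_on {0..T}"
  let ?E = "\<lambda>s. mat_exp ((T - s) *\<^sub>R A)"
  note bb = bounded_bilinear_matrix_vector_mult
  note bbm = bounded_bilinear_matrix_mult
  have xc: "continuous_on {0..T} x" 
    and xi: "\<And>t. t \<in> {0..T} \<Longrightarrow> ((\<lambda>s. A *v x s + b *v u s) has_integral (x t - a)) {0..t}"
    using x by (auto simp: state_path_def)
  have Ec: "continuous_on S ?E" for S by (rule continuous_on_mat_exp_minus)
  have EcA: "continuous_on S (\<lambda>s. - (A ** ?E s))" for S
    by (intro continuous_on_minus bounded_bilinear.continuous_on[OF bbm] continuous_on_const Ec)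
  have bu: "integrable ?N (\<lambda>s. b *v u s)"
    by (rule integrable_bounded_linear[OF bounded_bilinear.bounded_linear_right[OF bb] u])
  have Ax: "continuous_on {0..T} (\<lambda>s. A *v x s)"
    by (intro bounded_bilinear.continuous_on[OF bb] continuous_on_const xc)
  have Axi: "integrable ?N (\<lambda>s. A *v x s)"
    using Ax by (rule continuous_imp_integrable_real)
  define z where "z s = A *v x s + b *v u s" for s
  have z: "integrable ?N z" unfolding z_def using bu Axi by simp
  have Z: "(LINT s|lebesgue_on {0..t}. z s) = x t - a" if t: "t \<in> {0..T}" for t
  proof -
    have "integrable (lebesgue_on {0..t}) z"
      by (rule integrable_lebesgue_on_subset[OF z]) (use t in auto)
    from has_integral_integral_lebesgue_on[OF this] have
      "(z has_integral (LINT s|lebesgue_on {0..t}. z s)) {0..t}" by simp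
    moreover have "(z has_integral (x t - a)) {0..t}" using xi[OF t] by (simp add: z_def[abs_def])
    ultimately show ?thesis by (rule has_integral_unique)
  qed
  obtain K where K: "0 < K" "\<And>s. s \<in> {0..T} \<Longrightarrow> norm (?E s) \<le> K"
    using continuous_on_interval_norm_bound[OF Ec[of "{0..T}"]] by blast
  have iE: "integrable ?N (\<lambda>s. ?E s *v y s)" if "integrable ?N y" for y
    by (rule integrable_bounded_matrix_mult[OF that _ K(2)])
      (auto intro: continuous_on_borel_lebesgue_on Ec)
  have iA: "integrable ?N (\<lambda>s. A *v (?E s *v y s))" if "integrable ?N y" for y
    by (rule integrable_bounded_linear[OF bounded_bilinear.bounded_linear_right[OF bb] iE[OF that]])
  have A_E: "A *v (?E s *v v) = ?E s *v (A *v v)" for s v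
    by (simp add: matrix_vector_mul_assoc mat_exp_commute)
  have xint: "integrable ?N x" using xc by (rule continuous_imp_integrable_real)
  have aint: "integrable ?N (\<lambda>s. a)" by (intro continuous_imp_integrable_real continuous_on_const)
  have "(LINT s|?N. ?E s *v z s)
      = ?E T *v (x T - a) - (LINT r|?N. - (A ** ?E r) *v (x r - a))"
  proof -
    have "(LINT r|?N. - (A ** ?E r) *v (LINT s|lebesgue_on {0..r}. z s))
          = (LINT r|?N. - (A ** ?E r) *v (x r - a))"
      by (rule Bochner_Integration.integral_cong) (auto simp: Z)
    then show ?thesis
      using integration_by_parts_indefinite[OF T mat_exp_minus_vector_derivative EcA z] Z[of T] T
      by simp
  qed
  also have "(LINT r|?N. - (A ** ?E r) *v (x r - a))
      = (LINT r|?N. A *v (?E r *v a) - A *v (?E r *v x r))"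
    by (rule Bochner_Integration.integral_cong)
      (auto simp: bounded_bilinear.minus_left[OF bb] matrix_vector_mult_diff_distrib
        matrix_vector_mul_assoc)
  also have "\<dots> = (LINT r|?N. A *v (?E r *v a)) - (LINT r|?N. A *v (?E r *v x r))"
    by (rule Bochner_Integration.integral_diff[OF iA[OF aint] iA[OF xint]])
  also have "(LINT r|?N. A *v (?E r *v a)) = - (?E T *v a - ?E 0 *v a)"
  proof -
    have "(LINT r|?N. - (A ** ?E r) *v a) = ?E T *v a - ?E 0 *v a"
      by (rule integral_derivative_lebesgue_on[OF T])
        (auto intro!: bounded_linear.has_vector_derivative[OF
             bounded_bilinear.bounded_linear_left[OF bb]] mat_exp_minus_vector_derivative
          bounded_bilinear.continuous_on[OF bb] EcA continuous_on_const)
    then show ?thesis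
      by (simp add: bounded_bilinear.minus_left[OF bb] matrix_vector_mul_assoc)
        (metis minus_diff_eq minus_minus)
  qed
  finally have "(LINT s|?N. ?E s *v z s)
     = x T - mat_exp (T *\<^sub>R A) *v a + (LINT r|?N. A *v (?E r *v x r))"
    by (simp add: mat_exp_zero)
  moreover have "(LINT s|?N. ?E s *v z s)
     = (LINT r|?N. A *v (?E r *v x r)) + (LINT s|?N. ?E s *v (b *v u s))"
    unfolding z_def
    by (simp add: matrix_vector_right_distrib A_E Bochner_Integration.integral_add[OF iE[OF Axi] iE[OF bu]])
  ultimately show ?thesis by simp
qed

text \<open>For \<open>F s = exp (s A)\<close> and the integrand \<open>exp (- s A) b u\<close> the by-parts formula says exactly that
  the classical solution formula satisfies the integral equation.\<close>

lemma state_path_exists: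
  fixes A b :: "real ^ 'n ^ 'n"
  assumes u: "integrable (lebesgue_on {0..T}) u"
  shows "\<exists>x. state_path T A b a u x"
proof -
  let ?N = "lebesgue_on {0..T}"
  note bb = bounded_bilinear_matrix_vector_mult
  note bbm = bounded_bilinear_matrix_mult
  let ?E = "\<lambda>s. mat_exp (s *\<^sub>R A)"
  let ?E' = "\<lambda>s. mat_exp ((0 - s) *\<^sub>R A)"
  have Ec: "continuous_on S ?E" for S by (rule continuous_on_mat_exp)
  have Ec': "continuous_on S ?E'" for S by (rule continuous_on_mat_exp_minus)
  have EcA: "continuous_on S (\<lambda>s. A ** ?E s)" for S
    by (intro bounded_bilinear.continuous_on[OF bbm] continuous_on_const Ec)
  have bu: "integrable ?N (\<lambda>s. b *v u s)"
    by (rule integrable_bounded_linear[OF bounded_bilinear.bounded_linear_right[OF bb] u])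
  obtain K where K: "0 < K" "\<And>s. s \<in> {0..T} \<Longrightarrow> norm (?E' s) \<le> K"
    using continuous_on_interval_norm_bound[OF Ec'[of "{0..T}"]] by blast
  define z where "z s = ?E' s *v (b *v u s)" for s
  have z: "integrable ?N z" unfolding z_def
    by (rule integrable_bounded_matrix_mult[OF bu continuous_on_borel_lebesgue_on[OF Ec'] K(2)]) auto
  define Z where "Z t = (LINT s|lebesgue_on {0..t}. z s)" for t
  define x where "x t = ?E t *v (a + Z t)" for t
  have Zc: "continuous_on {0..T} Z"
    unfolding Z_def by (rule continuous_on_indefinite_integral[OF z])
  have xc: "continuous_on {0..T} x"
    unfolding x_def by (intro bounded_bilinear.continuous_on[OF bb] Ec continuous_intros Zc)
  have "((\<lambda>s. A *v x s + b *v u s) has_integral (x t - a)) {0..t}" if t: "t \<in> {0..T}" for t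
  proof -
    let ?Nt = "lebesgue_on {0..t}"
    have t0: "0 \<le> t" using t by simp
    have sub: "{0..t} \<subseteq> {0..T}" using t by auto
    have zt: "integrable ?Nt z" and but: "integrable ?Nt (\<lambda>s. b *v u s)"
      using sub by (auto intro!: integrable_lebesgue_on_subset[OF z] integrable_lebesgue_on_subset[OF bu])
    have Eza: "?E s *v z s = b *v u s" for s
      by (simp add: z_def matrix_vector_mul_assoc mat_exp_inverse[of s A, simplified] matrix_mul_assoc)
    have 1: "(LINT s|?Nt. b *v u s) = ?E t *v Z t - (LINT r|?Nt. (A ** ?E r) *v Z r)"
      using integration_by_parts_indefinite[OF t0 mat_exp_has_vector_derivative EcA zt]
      by (simp add: Eza Z_def)
    have c1: "continuous_on {0..t} (\<lambda>r. (A ** ?E r) *v a)"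
      by (intro bounded_bilinear.continuous_on[OF bb] EcA continuous_on_const)
    have c2: "continuous_on {0..t} (\<lambda>r. (A ** ?E r) *v Z r)"
      by (intro bounded_bilinear.continuous_on[OF bb] EcA continuous_on_subset[OF Zc sub])
    have 2: "(LINT r|?Nt. (A ** ?E r) *v a) = ?E t *v a - ?E 0 *v a"
      by (rule integral_derivative_lebesgue_on[OF t0 _ c1])
        (auto intro!: bounded_linear.has_vector_derivative[OF
             bounded_bilinear.bounded_linear_left[OF bb]] mat_exp_has_vector_derivative)
    have Ax: "A *v x r = (A ** ?E r) *v a + (A ** ?E r) *v Z r" for r
      by (simp add: x_def matrix_vector_right_distrib matrix_vector_mul_assoc)
    have "integrable ?Nt (\<lambda>s. A *v x s + b *v u s)"
      unfolding Ax by (intro Bochner_Integration.integrable_add but continuous_imp_integrable_real c1 c2)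
    then have "((\<lambda>s. A *v x s + b *v u s) has_integral (LINT s|?Nt. A *v x s + b *v u s)) {0..t}"
      by (rule has_integral_integral_lebesgue_on) auto
    also have "(LINT s|?Nt. A *v x s + b *v u s)
        = (LINT r|?Nt. (A ** ?E r) *v a) + (LINT r|?Nt. (A ** ?E r) *v Z r) + (LINT s|?Nt. b *v u s)"
      unfolding Ax
      by (simp add: Bochner_Integration.integral_add but continuous_imp_integrable_real c1 c2)
    also have "\<dots> = x t - a"
      unfolding 1 2 by (simp add: x_def mat_exp_zero matrix_vector_right_distrib)
    finally show ?thesis .
  qed
  then show ?thesis using xc unfolding state_path_def by blast
qed

section \<open>Increments of the Wiener process\<close>

text \<open>Lebesgue measure on \<open>real ^ 'd\<close> is the image of the product of the one-dimensional ones, so all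
  mixed moments of the increments reduce to one-dimensional moments.\<close>

lemma gaussian_product_moment:
  fixes h :: "'d::finite \<Rightarrow> real \<Rightarrow> real"
  assumes "\<And>i. integrable lborel (\<lambda>y. normal_density 0 \<sigma> y * h i y)"
  shows "has_bochner_integral lborel
           (\<lambda>x::real ^ 'd. (\<Prod>i\<in>UNIV. normal_density 0 \<sigma> (x $ i)) * (\<Prod>i\<in>UNIV. h i (x $ i)))
           (\<Prod>i\<in>UNIV. \<integral>y. normal_density 0 \<sigma> y * h i y \<partial>lborel)"
proof -
  interpret product_sigma_finite "\<lambda>_::real ^ 'd. lborel :: real measure" ..
  define ax :: "'d \<Rightarrow> real ^ 'd" where "ax i = axis i 1" for i
  define \<phi> where "\<phi> i y = normal_density 0 \<sigma> y * h i y" for i y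
  define k where "k b = inv ax b" for b
  have inj: "inj ax" by (auto simp: inj_def ax_def axis_eq_axis)
  have k: "k (ax i) = i" for i by (simp add: k_def inj)
  have B: "Basis = range ax" by (auto simp: Basis_vec_def ax_def)
  have prodB: "(\<Prod>b\<in>Basis. \<psi> b) = (\<Prod>i\<in>UNIV. \<psi> (ax i))" for \<psi> :: "real ^ 'd \<Rightarrow> real"
    unfolding B by (simp add: prod.reindex inj)
  have int: "integrable lborel (\<phi> i)" for i using assms unfolding \<phi>_def .
  let ?F = "\<lambda>x::real ^ 'd. \<Prod>i\<in>UNIV. \<phi> i (x $ i)"
  let ?S = "\<lambda>f. \<Sum>b\<in>(Basis::(real ^ 'd) set). f b *\<^sub>R b"
  have [measurable]: "\<phi> i \<in> borel_measurable borel" for i using int[of i] by auto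
  have F_meas: "?F \<in> borel_measurable borel"
    by measurable
  have S: "?S f $ i = f (ax i)" for f i
  proof -
    have "?S f $ i = (\<Sum>j\<in>UNIV. f (ax j) * (ax j $ i))"
      unfolding B by (simp add: sum.reindex inj)
    also have "\<dots> = (\<Sum>j\<in>UNIV. if i = j then f (ax j) else 0)"
      by (intro sum.cong) (auto simp: ax_def axis_def)
    finally show ?thesis by simp
  qed
  have S_meas: "?S \<in> measurable (\<Pi>\<^sub>M b\<in>(Basis::(real ^ 'd) set). lborel) borel"
    by measurable
  have FS: "?F (?S f) = (\<Prod>b\<in>Basis. \<phi> (k b) (f b))" for f
    unfolding prodB k S ..
  have "integrable (\<Pi>\<^sub>M b\<in>(Basis::(real ^ 'd) set). lborel) (\<lambda>f. ?F (?S f))"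
    unfolding FS by (intro product_integrable_prod int) auto
  then have 1: "integrable lborel ?F"
    by (subst lborel_eq) (simp add: integrable_distr_eq[OF S_meas F_meas])
  have "(\<integral>x. ?F x \<partial>lborel) = (\<integral>f. ?F (?S f) \<partial>(\<Pi>\<^sub>M b\<in>(Basis::(real ^ 'd) set). lborel))"
    by (subst lborel_eq) (simp add: integral_distr[OF S_meas F_meas])
  also have "\<dots> = (\<Prod>b\<in>(Basis::(real ^ 'd) set). \<integral>y. \<phi> (k b) y \<partial>lborel)"
    unfolding FS by (intro product_integral_prod int) auto
  also have "\<dots> = (\<Prod>i\<in>UNIV. \<integral>y. \<phi> i y \<partial>lborel)"
    by (simp add: prodB k)
  finally have 2: "(\<integral>x. ?F x \<partial>lborel) = (\<Prod>i\<in>UNIV. \<integral>y. \<phi> i y \<partial>lborel)" .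
  from 1 2 have "has_bochner_integral lborel ?F (\<Prod>i\<in>UNIV. \<integral>y. \<phi> i y \<partial>lborel)"
    by (simp add: has_bochner_integral_iff)
  then show ?thesis by (simp only: \<phi>_def prod.distrib)
qed

locale wiener_space = prob_space M for M :: "'a measure" +
  fixes T :: real and w :: "real \<Rightarrow> 'a \<Rightarrow> real ^ 'd"
  assumes T_pos: "0 < T" and wiener: "wiener_process M T w"
begin

abbreviation F :: "real \<Rightarrow> 'a measure" where "F t \<equiv> wiener_filtration M w t"

lemma w_measurable [measurable (raw)]: "t \<in> {0..T} \<Longrightarrow> w t \<in> borel_measurable M"
  using wiener by (simp add: wiener_process_def)

lemma w_zero: "AE \<omega> in M. w 0 \<omega> = 0" and w_continuous: "AE \<omega> in M. continuous_on {0..T} (\<lambda>t. w t \<omega>)"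
  using wiener by (simp_all add: wiener_process_def)

lemma space_F [simp]: "space (F t) = space M"
  by (simp add: wiener_filtration_def space_measure_of_conv)

lemma sets_F: "sets (F t) = sigma_sets (space M)
       ({w r -` B \<inter> space M | r B. r \<in> {0..t} \<and> B \<in> sets borel} \<union> null_sets M)"
  unfolding wiener_filtration_def
  by (intro sets_measure_of) (auto dest: sets.sets_into_space)

lemma sets_F_mono: "s \<le> t \<Longrightarrow> sets (F s) \<subseteq> sets (F t)"
proof -
  assume "s \<le> t"
  then have "{0..s} \<subseteq> {0..t}" by auto
  then show ?thesis unfolding sets_F by (intro sigma_sets_mono' Un_mono) blast+
qed

lemma sets_F_subset: "t \<le> T \<Longrightarrow> sets (F t) \<subseteq> sets M"
proof -
  assume t: "t \<le> T"
  have "{w r -` B \<inter> space M | r B. r \<in> {0..t} \<and> B \<in> sets borel} \<union> null_sets M \<subseteq> sets M"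
    using t by (auto intro!: measurable_sets[of "w _" M borel] w_measurable)
  then show ?thesis unfolding sets_F by (rule sets.sigma_sets_subset)
qed

lemma null_set_F: "N \<in> null_sets M \<Longrightarrow> N \<in> sets (F t)"
  unfolding sets_F by auto

lemma F_measurable_mono: "f \<in> measurable (F s) N \<Longrightarrow> s \<le> t \<Longrightarrow> f \<in> measurable (F t) N"
  using measurable_mono[of N N "F s" "F t"] sets_F_mono[of s t] by auto

lemma F_measurable_M: "f \<in> measurable (F t) N \<Longrightarrow> t \<le> T \<Longrightarrow> f \<in> measurable M N"
  using measurable_mono[of N N "F t" M] sets_F_subset[of t] by auto

lemma w_F_measurable: "r \<in> {0..t} \<Longrightarrow> w r \<in> borel_measurable (F t)"
  by (rule measurableI) (auto simp: sets_F)

text \<open>The two preimages of a Borel set differ by a null set, and the filtration contains all null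
  sets.\<close>

lemma F_measurable_AE_eq:
  fixes X Y :: "'a \<Rightarrow> 'b::topological_space"
  assumes X: "X \<in> borel_measurable (F t)" and t: "t \<le> T"
    and Y: "Y \<in> borel_measurable M" and eq: "AE \<omega> in M. X \<omega> = Y \<omega>"
  shows "Y \<in> borel_measurable (F t)"
proof (rule measurableI)
  fix B :: "'b set" assume B: "B \<in> sets borel"
  from eq obtain N where N: "N \<in> null_sets M" "{\<omega>\<in>space M. X \<omega> \<noteq> Y \<omega>} \<subseteq> N"
    by (auto elim!: AE_E simp: null_sets_def)
  have YB: "Y -` B \<inter> space M \<in> sets M" using Y B by (rule measurable_sets)
  have split: "Y -` B \<inter> space M = ((X -` B \<inter> space M) - N) \<union> ((Y -` B \<inter> space M) \<inter> N)"
    using N(2) by auto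
  have "X -` B \<inter> space M \<in> sets (F t)"
    using measurable_sets[OF X B] by simp
  moreover have "(Y -` B \<inter> space M) \<inter> N \<in> null_sets M"
    using N(1) YB by (auto intro: null_set_Int1 null_set_Int2)
  ultimately show "Y -` B \<inter> space (F t) \<in> sets (F t)"
    unfolding space_F
    by (subst split) (rule sets.Un[OF sets.Diff[OF _ null_set_F[OF N(1)]] null_set_F])
qed simp

text \<open>The values of \<open>w\<close> at the times in \<open>J\<close> are sums of increments before \<open>s\<close>, up to the null set where
  \<open>w 0\<close> is not zero, and these increments are independent of the one from \<open>s\<close> to \<open>t\<close>.\<close>

lemma cylinder_indep_increment:
  assumes st: "0 \<le> s" "s < t" "t \<le> T" and J: "finite J" "J \<subseteq> {0..s}"
    and B: "\<And>r. B r \<in> sets borel" and D: "D \<in> sets borel"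
  shows "prob ({\<omega>\<in>space M. \<forall>r\<in>J. w r \<omega> \<in> B r} \<inter> ((\<lambda>\<omega>. w t \<omega> - w s \<omega>) -` D \<inter> space M))
       = prob {\<omega>\<in>space M. \<forall>r\<in>J. w r \<omega> \<in> B r} * prob ((\<lambda>\<omega>. w t \<omega> - w s \<omega>) -` D \<inter> space M)"
proof -
  \<comment> \<open>Enumerate the times \<open>0, s\<close> and \<open>J\<close> increasingly and append \<open>t\<close>.\<close>
  define S where "S = insert 0 (insert s J)"
  define L where "L = sorted_list_of_set S"
  define m where "m = length L - 1"
  have S: "finite S" "S \<subseteq> {0..s}" "0 \<in> S" "s \<in> S" using J st by (auto simp: S_def)
  have setL: "set L = S" using S(1) by (simp add: L_def)
  have sortL: "sorted_wrt (<) L" by (simp add: L_def)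
  have lenL: "length L = Suc m" using setL S(3) by (cases L) (auto simp: m_def)
  have less: "L ! i < L ! j" if "i < j" "j \<le> m" for i j
    using sorted_wrt_nth_less[OF sortL that(1)] that(2) lenL by simp
  have inL: "L ! i \<in> {0..s}" if "i \<le> m" for i
    using S(2) setL lenL that nth_mem[of i L] by auto
  obtain i0 where i0: "i0 \<le> m" "L ! i0 = 0"
    using S(3) setL lenL by (metis in_set_conv_nth less_Suc_eq_le)
  have L0: "L ! 0 = 0"
    using less[of 0 i0] inL[of 0] i0 by (cases "i0 = 0") auto
  obtain im where im: "im \<le> m" "L ! im = s"
    using S(4) setL lenL by (metis in_set_conv_nth less_Suc_eq_le)
  have Lm: "L ! m = s"
    using less[of im m] inL[of m] im by (cases "im = m") auto
  define ts where "ts i = (if i \<le> m then L ! i else t)" for i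
  have ts_less: "ts i < ts (Suc i)" if "i < Suc m" for i
    using that less[of i "Suc i"] Lm st(2) by (auto simp: ts_def less_Suc_eq)
  define Y where "Y i \<omega> = w (ts (Suc i)) \<omega> - w (ts i) \<omega>" for i \<omega>
  have "indep_vars (\<lambda>_. borel) Y {..<Suc m}"
  proof -
    have "0 \<le> ts 0 \<and> ts (Suc m) \<le> T \<and> (\<forall>i<Suc m. ts i < ts (Suc i))"
      using ts_less st by (simp add: L0 ts_def)
    then show ?thesis
      using wiener unfolding wiener_process_def Y_def[abs_def] by blast
  qed
  from indep_var_restrict[OF this, of "{..<m}" "{m}"]
  have ind: "indep_var (PiM {..<m} (\<lambda>_. borel)) (\<lambda>\<omega>. restrict (\<lambda>i. Y i \<omega>) {..<m})
      (PiM {m} (\<lambda>_. borel)) (\<lambda>\<omega>. restrict (\<lambda>i. Y i \<omega>) {m})"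
    by auto
  have Ym: "Y m = (\<lambda>\<omega>. w t \<omega> - w s \<omega>)"
    by (auto simp: Y_def ts_def Lm)
  have tele: "(\<Sum>k<i. Y k \<omega>) = w (ts i) \<omega> - w 0 \<omega>" for i \<omega>
    by (induction i) (auto simp: Y_def ts_def L0)
  have "\<exists>i. i \<le> m \<and> ts i = r" if "r \<in> J" for r
  proof -
    have "r \<in> set L" using that setL by (simp add: S_def)
    then show ?thesis using lenL by (auto simp: in_set_conv_nth ts_def less_Suc_eq_le)
  qed
  then obtain n where n: "\<And>r. r \<in> J \<Longrightarrow> n r \<le> m \<and> ts (n r) = r" by metis
  define P where "P = {y \<in> space (PiM {..<m} (\<lambda>_. borel :: (real ^ 'd) measure)).
        \<forall>r\<in>J. (\<Sum>k<n r. y k) \<in> B r}"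
  have P: "P \<in> sets (PiM {..<m} (\<lambda>_. borel))"
  proof -
    have "(\<lambda>y. \<Sum>k<n r. y k) \<in> borel_measurable (PiM {..<m} (\<lambda>_. borel :: (real ^ 'd) measure))" if "r \<in> J" for r
      using n[OF that] by (intro borel_measurable_sum measurable_component_singleton) auto
    then show ?thesis unfolding P_def using J(1) B
      by (intro sets.sets_Collect_finite_All) (auto simp: Int_def vimage_def dest: measurable_sets)
  qed
  define R where "R = {y \<in> space (PiM {m} (\<lambda>_. borel :: (real ^ 'd) measure)). y m \<in> D}"
  have R: "R \<in> sets (PiM {m} (\<lambda>_. borel))"
    unfolding R_def using D by measurable
  let ?C = "{\<omega>\<in>space M. \<forall>r\<in>J. w r \<omega> \<in> B r}"
  let ?X = "(\<lambda>\<omega>. w t \<omega> - w s \<omega>) -` D \<inter> space M"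
  let ?CP = "(\<lambda>\<omega>. restrict (\<lambda>i. Y i \<omega>) {..<m}) -` P \<inter> space M"
  have Xeq: "(\<lambda>\<omega>. restrict (\<lambda>i. Y i \<omega>) {m}) -` R \<inter> space M = ?X"
    by (auto simp: R_def space_PiM Ym)
  have [measurable]: "w t \<in> borel_measurable M" "w s \<in> borel_measurable M"
    using st by (auto intro: w_measurable)
  have X_meas: "?X \<in> sets M"
    by (rule measurable_sets[OF _ D]) simp
  have C_meas: "?C \<in> sets M"
    using J st B by (intro sets.sets_Collect_finite_All)
       (auto simp: Int_def vimage_def dest!: measurable_sets[OF w_measurable])
  have rv: "(\<lambda>\<omega>. restrict (\<lambda>i. Y i \<omega>) {..<m}) \<in> measurable M (PiM {..<m} (\<lambda>_. borel))"
    using ind by (auto dest: indep_var_rv1)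
  have CP_meas: "?CP \<in> sets M"
    using rv P by (rule measurable_sets)
  have C_eq: "AE \<omega> in M. (\<omega> \<in> ?C) = (\<omega> \<in> ?CP)"
    using w_zero
  proof eventually_elim
    case (elim \<omega>)
    have "(\<Sum>k<n r. restrict (\<lambda>i. Y i \<omega>) {..<m} k) = w r \<omega>" if "r \<in> J" for r
    proof -
      have "(\<Sum>k<n r. restrict (\<lambda>i. Y i \<omega>) {..<m} k) = (\<Sum>k<n r. Y k \<omega>)"
        using n[OF that] by (intro sum.cong) auto
      then show ?thesis using tele[of \<omega> "n r"] n[OF that] elim by simp
    qed
    then show ?case by (auto simp: P_def space_PiM)
  qed
  have "prob (?C \<inter> ?X) = prob (?CP \<inter> ?X)"
    using C_eq C_meas CP_meas X_meas by (intro finite_measure_eq_AE) auto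
  also have "?CP \<inter> ?X = (\<lambda>\<omega>. (restrict (\<lambda>i. Y i \<omega>) {..<m}, restrict (\<lambda>i. Y i \<omega>) {m})) -` (P \<times> R) \<inter> space M"
    unfolding Xeq[symmetric] by auto
  also have "prob \<dots> = prob ?CP * prob ?X"
    unfolding indep_varD[OF ind P R] Xeq ..
  also have "prob ?CP = prob ?C"
    using C_eq C_meas CP_meas by (intro finite_measure_eq_AE) auto
  finally show ?thesis .
qed

text \<open>Cylinder sets together with the null sets form a generator of \<open>F s\<close> that is stable under
  intersection, so independence extends from the cylinder sets to \<open>F s\<close>.\<close>

lemma indep_var_increment:
  fixes \<eta> :: "'a \<Rightarrow> real" and h :: "real ^ 'd \<Rightarrow> real"
  assumes st: "0 \<le> s" "s < t" "t \<le> T" and \<eta>: "\<eta> \<in> borel_measurable (F s)"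
    and h [measurable]: "h \<in> borel_measurable borel"
  shows "indep_var borel \<eta> borel (\<lambda>\<omega>. h (w t \<omega> - w s \<omega>))"
proof -
  define C where "C J B = {\<omega>\<in>space M. \<forall>r\<in>J. w r \<omega> \<in> B r}" for J B
  define \<C> where "\<C> = {C J B | J B. finite J \<and> J \<subseteq> {0..s} \<and> (\<forall>r. B r \<in> sets borel)} \<union> null_sets M"
  define X where "X = (\<lambda>\<omega>. h (w t \<omega> - w s \<omega>))"
  define \<D> where "\<D> = {X -` D \<inter> space M | D. D \<in> sets borel}"
  have X_meas [measurable]: "X \<in> borel_measurable M"
    unfolding X_def using st
    by (intro measurable_compose[OF _ h] borel_measurable_diff w_measurable) auto
  have \<D>: "\<D> \<subseteq> events" unfolding \<D>_def by (auto intro: measurable_sets[OF X_meas])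
  have C_meas: "C J B \<in> events" if "finite J" "J \<subseteq> {0..s}" "\<forall>r. B r \<in> sets borel" for J B
    unfolding C_def using that st by (intro sets.sets_Collect_finite_All)
       (auto simp: Int_def vimage_def dest!: measurable_sets[OF w_measurable])
  have \<C>: "\<C> \<subseteq> events" unfolding \<C>_def using C_meas by auto
  have "Int_stable \<C>"
  proof (rule Int_stableI)
    fix a b assume ab: "a \<in> \<C>" "b \<in> \<C>"
    show "a \<inter> b \<in> \<C>"
    proof (cases "a \<in> null_sets M \<or> b \<in> null_sets M")
      case True
      then have "a \<inter> b \<in> null_sets M"
        using ab \<C> by (auto intro: null_set_Int1 null_set_Int2)
      then show ?thesis by (simp add: \<C>_def)
    next
      case False
      with ab obtain J B K D where
        a: "a = C J B" "finite J" "J \<subseteq> {0..s}" "\<forall>r. B r \<in> sets borel" and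
        b: "b = C K D" "finite K" "K \<subseteq> {0..s}" "\<forall>r. D r \<in> sets borel"
        by (auto simp: \<C>_def)
      have "a \<inter> b = C (J \<union> K) (\<lambda>r. (if r \<in> J then B r else UNIV) \<inter> (if r \<in> K then D r else UNIV))"
        by (auto simp: a(1) b(1) C_def)
      then show ?thesis unfolding \<C>_def using a b
        by (intro UnI1 CollectI exI[of _ "J \<union> K"]) auto
    qed
  qed
  moreover have "Int_stable \<D>"
  proof (rule Int_stableI)
    fix a b assume "a \<in> \<D>" "b \<in> \<D>"
    then obtain A B where "a = X -` A \<inter> space M" "b = X -` B \<inter> space M" "A \<in> sets borel" "B \<in> sets borel"
      by (auto simp: \<D>_def)
    then show "a \<inter> b \<in> \<D>" unfolding \<D>_def by (intro CollectI exI[of _ "A \<inter> B"]) auto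
  qed
  moreover have "indep_set \<C> \<D>"
  proof (rule indep_setI[OF \<C> \<D>])
    fix a b assume a: "a \<in> \<C>" and "b \<in> \<D>"
    then obtain D where D: "D \<in> sets borel" "b = X -` D \<inter> space M" by (auto simp: \<D>_def)
    show "prob (a \<inter> b) = prob a * prob b"
    proof (cases "a \<in> null_sets M")
      case True
      moreover have "a \<inter> b \<in> null_sets M" using True D by (auto intro: null_set_Int1 null_set_Int2)
      ultimately show ?thesis by (simp add: measure_def null_setsD1)
    next
      case False
      with a obtain J B where "a = C J B" "finite J" "J \<subseteq> {0..s}" "\<And>r. B r \<in> sets borel"
        by (auto simp: \<C>_def)
      moreover have "h -` D \<in> sets borel"
        using measurable_sets[OF h D(1)] by simp
      moreover have "b = (\<lambda>\<omega>. w t \<omega> - w s \<omega>) -` (h -` D) \<inter> space M"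
        using D(2) by (auto simp: X_def)
      ultimately show ?thesis
        using cylinder_indep_increment[OF st, of J B "h -` D"] by (simp add: C_def)
    qed
  qed
  ultimately have ind: "indep_set (sigma_sets (space M) \<C>) (sigma_sets (space M) \<D>)"
    by (intro indep_set_sigma_sets)
  have "sets (F s) \<subseteq> sigma_sets (space M) \<C>"
    unfolding sets_F
  proof (rule sigma_sets_mono')
    have "w r -` B \<inter> space M \<in> \<C>" if "r \<in> {0..s}" "B \<in> sets borel" for r B
    proof -
      have "w r -` B \<inter> space M = C {r} (\<lambda>_. B)" by (auto simp: C_def)
      then show ?thesis unfolding \<C>_def using that
        by (intro UnI1 CollectI exI[of _ "{r}"] exI[of _ "\<lambda>_. B"]) auto
    qed
    then have "{w r -` B \<inter> space M | r B. r \<in> {0..s} \<and> B \<in> sets borel} \<subseteq> \<C>" by blast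
    moreover have "null_sets M \<subseteq> \<C>" by (simp add: \<C>_def)
    ultimately show "{w r -` B \<inter> space M | r B. r \<in> {0..s} \<and> B \<in> sets borel} \<union> null_sets M \<subseteq> \<C>"
      by (rule Un_least)
  qed
  moreover have "\<eta> -` A \<inter> space M \<in> sets (F s)" if "A \<in> sets borel" for A
    using measurable_sets[OF \<eta> that] by simp
  ultimately have \<eta>C: "\<eta> -` A \<inter> space M \<in> sigma_sets (space M) \<C>" if "A \<in> sets borel" for A
    using that by blast
  have \<eta>_M: "\<eta> \<in> borel_measurable M" using F_measurable_M[OF \<eta>] st by simp
  have ind2: "indep_set {\<eta> -` A \<inter> space M |A. A \<in> sets borel} {X -` A \<inter> space M |A. A \<in> sets borel}"
  proof (rule indep_setI)
    show "{\<eta> -` A \<inter> space M |A. A \<in> sets borel} \<subseteq> events"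
      by (auto intro: measurable_sets[OF \<eta>_M])
    show "{X -` A \<inter> space M |A. A \<in> sets borel} \<subseteq> events"
      by (auto intro: measurable_sets[OF X_meas])
    fix a b assume "a \<in> {\<eta> -` A \<inter> space M |A. A \<in> sets borel}"
      "b \<in> {X -` A \<inter> space M |A. A \<in> sets borel}"
    then have "a \<in> sigma_sets (space M) \<C>" "b \<in> sigma_sets (space M) \<D>"
      using \<eta>C by (auto simp: \<D>_def)
    then show "prob (a \<inter> b) = prob a * prob b" by (rule indep_setD[OF ind])
  qed
  have "indep_var borel \<eta> borel X"
    unfolding indep_var_eq
  proof (intro conjI indep_set_sigma_sets ind2 \<eta>_M X_meas)
    show "Int_stable {\<eta> -` A \<inter> space M |A. A \<in> sets borel}"
    proof (rule Int_stableI)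
      fix a b assume "a \<in> {\<eta> -` A \<inter> space M |A. A \<in> sets borel}" "b \<in> {\<eta> -` A \<inter> space M |A. A \<in> sets borel}"
      then obtain A B where "a = \<eta> -` A \<inter> space M" "b = \<eta> -` B \<inter> space M" "A \<in> sets borel" "B \<in> sets borel"
        by auto
      then show "a \<inter> b \<in> {\<eta> -` A \<inter> space M |A. A \<in> sets borel}"
        by (intro CollectI exI[of _ "A \<inter> B"]) auto
    qed
    show "Int_stable {X -` A \<inter> space M |A. A \<in> sets borel}"
      using \<open>Int_stable \<D>\<close> by (simp add: \<D>_def)
  qed
  then show ?thesis by (simp add: X_def)
qed

text \<open>A mixed moment is a product over the coordinates with exponents \<open>p l\<close>; the two claims are the
  exponent vectors \<open>e\<^sub>i\<close> and \<open>e\<^sub>i + e\<^sub>j\<close>.\<close>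

lemma increment_moments:
  assumes st: "0 \<le> s" "s < t" "t \<le> T"
  shows "has_bochner_integral M (\<lambda>\<omega>. (w t \<omega> - w s \<omega>) $ i) 0"
    and "has_bochner_integral M (\<lambda>\<omega>. (w t \<omega> - w s \<omega>) $ i * (w t \<omega> - w s \<omega>) $ j)
           (if i = j then t - s else 0)"
proof -
  let ?\<sigma> = "sqrt (t - s)"
  have \<sigma>: "0 < ?\<sigma>" using st by simp
  let ?f = "\<lambda>x::real ^ 'd. \<Prod>i\<in>UNIV. normal_density 0 ?\<sigma> (x $ i)"
  have d: "distributed M lborel (\<lambda>\<omega>. w t \<omega> - w s \<omega>) (\<lambda>x. ennreal (?f x))"
    using wiener st by (auto simp: wiener_process_def)
  have fpos: "0 \<le> ?f x" for x by (intro prod_nonneg) simp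
  define N where "N = (\<lambda>p::nat. \<integral>y. normal_density 0 ?\<sigma> y * y ^ p \<partial>lborel)"
  have N0: "N 0 = 1" and N1: "N 1 = 0" and N2: "N 2 = t - s"
    using integral_normal_moment_even[OF \<sigma>, of 0 0] integral_normal_moment_odd[OF \<sigma>, of 0 0]
      integral_normal_moment_even[OF \<sigma>, of 0 1] st by (auto simp: N_def numeral_2_eq_2)
  have Nint: "integrable lborel (\<lambda>y. normal_density 0 ?\<sigma> y * y ^ p)" for p
    using integrable_normal_moment[OF \<sigma>, of 0 p] by simp
  have main: "has_bochner_integral M (\<lambda>\<omega>. \<Prod>l\<in>UNIV. (w t \<omega> - w s \<omega>) $ l ^ p l) (\<Prod>l\<in>UNIV. N (p l))"
    for p :: "'d \<Rightarrow> nat"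
  proof -
    note * = gaussian_product_moment[of ?\<sigma> "\<lambda>l y. y ^ p l", OF Nint, unfolded has_bochner_integral_iff]
    have g: "(\<lambda>x::real ^ 'd. \<Prod>l\<in>UNIV. x $ l ^ p l) \<in> borel_measurable lborel" by measurable
    show ?thesis
      using distributed_integral[OF d g fpos] distributed_integrable[OF d g fpos] *
      unfolding has_bochner_integral_iff N_def by auto
  qed
  have one: "(\<Prod>l\<in>UNIV. x l ^ (if l = i then 1 else 0)) = x i" for x :: "'d \<Rightarrow> real" and i
    by (simp add: if_distrib[of "\<lambda>n. _ ^ n"] prod.delta cong: if_cong)
  have "(\<Prod>l\<in>UNIV. N (if l = i then 1 else 0)) = 0"
    using N1 by (intro prod_zero bexI[of _ i]) auto
  with main[of "\<lambda>l. if l = i then 1 else 0"] 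
  show "has_bochner_integral M (\<lambda>\<omega>. (w t \<omega> - w s \<omega>) $ i) 0"
    unfolding one by simp
  have two: "(\<Prod>l\<in>UNIV. x l ^ ((if l = i then 1 else 0) + (if l = j then 1 else 0))) = x i * x j"
    for x :: "'d \<Rightarrow> real"
    unfolding power_add prod.distrib one ..
  have "(\<Prod>l\<in>UNIV. N ((if l = i then 1 else 0) + (if l = j then 1 else 0))) = (if i = j then t - s else 0)"
  proof (cases "i = j")
    case True
    have "(\<Prod>l\<in>UNIV. N ((if l = i then 1 else 0) + (if l = j then 1 else 0)))
        = (\<Prod>l\<in>UNIV. if l = i then t - s else 1)"
      using True N0 N2 by (intro prod.cong) (auto simp: numeral_2_eq_2)
    then show ?thesis using True by simp
  next
    case False
    then have "(\<Prod>l\<in>UNIV. N ((if l = i then 1 else 0) + (if l = j then 1 else 0))) = 0"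
      using N1 by (intro prod_zero bexI[of _ i]) auto
    then show ?thesis using False by simp
  qed
  with main[of "\<lambda>l. (if l = i then 1 else 0) + (if l = j then 1 else 0)"]
  show "has_bochner_integral M (\<lambda>\<omega>. (w t \<omega> - w s \<omega>) $ i * (w t \<omega> - w s \<omega>) $ j)
           (if i = j then t - s else 0)"
    unfolding two by simp
qed

lemma increment_mean_zero:
  fixes \<eta> :: "'a \<Rightarrow> real"
  assumes st: "0 \<le> s" "s \<le> t" "t \<le> T" and \<eta>: "\<eta> \<in> borel_measurable (F s)" "integrable M \<eta>"
  shows "has_bochner_integral M (\<lambda>\<omega>. \<eta> \<omega> * (w t \<omega> - w s \<omega>) $ i) 0"
proof (cases "s = t")
  case False
  then have st': "s < t" using st by simp
  have "indep_var borel \<eta> borel (\<lambda>\<omega>. (w t \<omega> - w s \<omega>) $ i)"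
    by (rule indep_var_increment[OF st(1) st' st(3) \<eta>(1)]) simp
  from indep_var_integrable[OF this \<eta>(2)] indep_var_lebesgue_integral[OF this \<eta>(2)]
    increment_moments(1)[OF st(1) st' st(3), of i]
  show ?thesis by (simp add: has_bochner_integral_iff)
qed (simp add: has_bochner_integral_iff)

lemma increment_covariance:
  fixes \<eta> :: "'a \<Rightarrow> real"
  assumes st: "0 \<le> s" "s \<le> t" "t \<le> T" and \<eta>: "\<eta> \<in> borel_measurable (F s)" "integrable M \<eta>"
  shows "has_bochner_integral M (\<lambda>\<omega>. \<eta> \<omega> * ((w t \<omega> - w s \<omega>) $ i * (w t \<omega> - w s \<omega>) $ j))
           (if i = j then (t - s) * expectation \<eta> else 0)"
proof (cases "s = t")
  case False
  then have st': "s < t" using st by simp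
  have "indep_var borel \<eta> borel (\<lambda>\<omega>. (w t \<omega> - w s \<omega>) $ i * (w t \<omega> - w s \<omega>) $ j)"
    by (rule indep_var_increment[OF st(1) st' st(3) \<eta>(1), where h="\<lambda>x. x $ i * x $ j"]) simp
  from indep_var_integrable[OF this \<eta>(2)] indep_var_lebesgue_integral[OF this \<eta>(2)]
    increment_moments(2)[OF st(1) st' st(3), of i j]
  show ?thesis by (auto simp: has_bochner_integral_iff)
qed (simp add: has_bochner_integral_iff)

end

section \<open>Square integrable functions\<close>

lemma norm_add_square_le: "(norm (a + b))\<^sup>2 \<le> 2 * (norm a)\<^sup>2 + 2 * (norm b)\<^sup>2"
  for a b :: "'b::real_normed_vector"
proof -
  have "(norm (a + b))\<^sup>2 \<le> (norm a + norm b)\<^sup>2"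
    by (intro power_mono norm_triangle_ineq) simp
  also have "\<dots> \<le> 2 * (norm a)\<^sup>2 + 2 * (norm b)\<^sup>2"
    using zero_le_power2[of "norm a - norm b"] by (simp add: power2_sum power2_diff)
  finally show ?thesis .
qed

lemma norm_mult_le_sum_squares: "norm a * norm b \<le> (norm a)\<^sup>2 + (norm b)\<^sup>2"
  for a :: "'b::real_normed_vector" and b :: "'c::real_normed_vector"
proof -
  have "2 * (norm a * norm b) \<le> (norm a)\<^sup>2 + (norm b)\<^sup>2"
    using zero_le_power2[of "norm a - norm b"] by (simp add: power2_diff)
  moreover have "0 \<le> norm a * norm b" by simp
  ultimately show ?thesis by linarith
qed

definition square_integrable :: "'x measure \<Rightarrow> ('x \<Rightarrow> 'b::euclidean_space) \<Rightarrow> bool" where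
  "square_integrable N f \<longleftrightarrow> f \<in> borel_measurable N \<and> integrable N (\<lambda>x. (norm (f x))\<^sup>2)"

lemma square_integrableD:
  assumes "square_integrable N f"
  shows "f \<in> borel_measurable N" "integrable N (\<lambda>x. (norm (f x))\<^sup>2)"
  using assms by (auto simp: square_integrable_def)

lemma square_integrable_iff_nn:
  "square_integrable N f \<longleftrightarrow> f \<in> borel_measurable N \<and> (\<integral>\<^sup>+x. ennreal ((norm (f x))\<^sup>2) \<partial>N) < \<infinity>"
  unfolding square_integrable_def integrable_iff_bounded by auto

lemma square_integrable_bound:
  fixes f :: "'x \<Rightarrow> 'b::euclidean_space" and g :: "'x \<Rightarrow> 'c::euclidean_space"
  assumes "square_integrable N f" "g \<in> borel_measurable N" "AE x in N. norm (g x) \<le> K * norm (f x)"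
  shows "square_integrable N g"
  unfolding square_integrable_def
proof (intro conjI assms(2))
  note [measurable] = assms(2)
  show "integrable N (\<lambda>x. (norm (g x))\<^sup>2)"
  proof (rule Bochner_Integration.integrable_bound)
    show "integrable N (\<lambda>x. K\<^sup>2 * (norm (f x))\<^sup>2)"
      using square_integrableD(2)[OF assms(1)] by simp
    show "AE x in N. norm ((norm (g x))\<^sup>2) \<le> norm (K\<^sup>2 * (norm (f x))\<^sup>2)"
      using assms(3)
    proof eventually_elim
      case (elim x)
      then have "(norm (g x))\<^sup>2 \<le> (K * norm (f x))\<^sup>2" by (rule power_mono) simp
      then show ?case by (simp add: power_mult_distrib)
    qed
  qed measurable
qed

lemma square_integrable_add:
  fixes f g :: "'x \<Rightarrow> 'b::euclidean_space"
  assumes f: "square_integrable N f" and g: "square_integrable N g"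
  shows "square_integrable N (\<lambda>x. f x + g x)"
  unfolding square_integrable_def
proof
  note [measurable] = square_integrableD(1)[OF f] square_integrableD(1)[OF g]
  show "(\<lambda>x. f x + g x) \<in> borel_measurable N" by measurable
  show "integrable N (\<lambda>x. (norm (f x + g x))\<^sup>2)"
  proof (rule Bochner_Integration.integrable_bound)
    show "integrable N (\<lambda>x. 2 * (norm (f x))\<^sup>2 + 2 * (norm (g x))\<^sup>2)"
      using square_integrableD(2)[OF f] square_integrableD(2)[OF g] by simp
    show "AE x in N. norm ((norm (f x + g x))\<^sup>2) \<le> norm (2 * (norm (f x))\<^sup>2 + 2 * (norm (g x))\<^sup>2)"
      using norm_add_square_le by (intro AE_I2) simp
  qed measurable
qed

lemma square_integrable_minus: "square_integrable N f \<Longrightarrow> square_integrable N (\<lambda>x. - f x)"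
  by (auto simp: square_integrable_def)

lemma square_integrable_diff:
  fixes f g :: "'x \<Rightarrow> 'b::euclidean_space"
  assumes "square_integrable N f" "square_integrable N g"
  shows "square_integrable N (\<lambda>x. f x - g x)"
  using square_integrable_add[OF assms(1) square_integrable_minus[OF assms(2)]] by simp

lemma square_integrable_inner:
  assumes f: "square_integrable N f" and g: "square_integrable N g"
  shows "integrable N (\<lambda>x. norm (f x) * norm (g x))" "integrable N (\<lambda>x. f x \<bullet> g x)"
proof -
  note [measurable] = square_integrableD(1)[OF f] square_integrableD(1)[OF g]
  have s: "integrable N (\<lambda>x. (norm (f x))\<^sup>2 + (norm (g x))\<^sup>2)"
    using square_integrableD(2)[OF f] square_integrableD(2)[OF g] by simp
  note le = norm_mult_le_sum_squares
  show "integrable N (\<lambda>x. norm (f x) * norm (g x))"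
    by (rule Bochner_Integration.integrable_bound[OF s]) (auto intro: order_trans[OF le])
  show "integrable N (\<lambda>x. f x \<bullet> g x)"
    by (rule Bochner_Integration.integrable_bound[OF s])
      (auto intro: order_trans[OF Cauchy_Schwarz_ineq2] order_trans[OF le])
qed

text \<open>The quadratic polynomial \<open>r \<mapsto> \<integral> (|f| - r |g|)\<^sup>2\<close> is nonnegative.\<close>

lemma integral_Cauchy_Schwarz:
  fixes f g :: "'x \<Rightarrow> 'b::euclidean_space"
  assumes f: "square_integrable N f" and g: "square_integrable N g"
  shows "(LINT x|N. norm (f x) * norm (g x))\<^sup>2 \<le> (LINT x|N. (norm (f x))\<^sup>2) * (LINT x|N. (norm (g x))\<^sup>2)"
    and "\<bar>LINT x|N. f x \<bullet> g x\<bar> \<le> sqrt (LINT x|N. (norm (f x))\<^sup>2) * sqrt (LINT x|N. (norm (g x))\<^sup>2)"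
proof -
  define a where "a = (LINT x|N. (norm (f x))\<^sup>2)"
  define b where "b = (LINT x|N. (norm (g x))\<^sup>2)"
  define p where "p = (LINT x|N. norm (f x) * norm (g x))"
  note i = square_integrableD(2)[OF f] square_integrableD(2)[OF g] square_integrable_inner(1)[OF f g]
  have q: "0 \<le> a - 2 * r * p + r\<^sup>2 * b" for r
  proof -
    have "0 \<le> (LINT x|N. (norm (f x) - r * norm (g x))\<^sup>2)" by simp
    also have "\<dots> = (LINT x|N. (norm (f x))\<^sup>2 - 2 * r * (norm (f x) * norm (g x)) + r\<^sup>2 * (norm (g x))\<^sup>2)"
      by (intro Bochner_Integration.integral_cong) (auto simp: power2_diff power_mult_distrib)
    also have "\<dots> = a - 2 * r * p + r\<^sup>2 * b"
      using i by (simp add: a_def b_def p_def)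
    finally show ?thesis .
  qed
  have b: "0 \<le> b" and a: "0 \<le> a" and p: "0 \<le> p" by (simp_all add: a_def b_def p_def)
  show 1: "p\<^sup>2 \<le> a * b"
  proof (cases "b = 0")
    case True
    have "p = 0"
    proof (rule ccontr)
      assume "p \<noteq> 0"
      then show False using q[of "(a + 1) / (2 * p)"] True by (simp add: field_simps)
    qed
    then show ?thesis using a b by simp
  next
    case False
    then have "0 \<le> a - p\<^sup>2 / b"
      using q[of "p / b"] by (simp add: power2_eq_square field_simps)
    then show ?thesis using b False by (simp add: field_simps)
  qed
  have "\<bar>LINT x|N. f x \<bullet> g x\<bar> \<le> (LINT x|N. \<bar>f x \<bullet> g x\<bar>)" by (rule integral_abs_bound)
  also have "\<dots> \<le> p"
    unfolding p_def using square_integrable_inner[OF f g]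
    by (intro integral_mono) (auto simp: Cauchy_Schwarz_ineq2)
  also have "\<dots> \<le> sqrt (a * b)" using 1 by (rule real_le_rsqrt)
  finally show "\<bar>LINT x|N. f x \<bullet> g x\<bar> \<le> sqrt a * sqrt b" by (simp add: real_sqrt_mult)
qed

text \<open>Stated with the nonnegative integral, so that no integrability of the limit is presupposed.\<close>

definition L2_tendsto :: "'x measure \<Rightarrow> (nat \<Rightarrow> 'x \<Rightarrow> 'b::euclidean_space) \<Rightarrow> ('x \<Rightarrow> 'b) \<Rightarrow> bool" where
  "L2_tendsto N fs f \<longleftrightarrow> (\<lambda>j. \<integral>\<^sup>+x. ennreal ((norm (fs j x - f x))\<^sup>2) \<partial>N) \<longlonglongrightarrow> 0"

lemma L2_tendsto_square_integrable:
  assumes lim: "L2_tendsto N fs f" and fs: "\<And>j. square_integrable N (fs j)" and f: "f \<in> borel_measurable N"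
  shows "square_integrable N f"
proof -
  have "eventually (\<lambda>j. (\<integral>\<^sup>+x. ennreal ((norm (fs j x - f x))\<^sup>2) \<partial>N) < 1) sequentially"
    using lim unfolding L2_tendsto_def by (rule order_tendstoD) simp
  then obtain j where j: "(\<integral>\<^sup>+x. ennreal ((norm (fs j x - f x))\<^sup>2) \<partial>N) < 1"
    by (auto simp: eventually_sequentially)
  then have "square_integrable N (\<lambda>x. fs j x - f x)"
    unfolding square_integrable_iff_nn using fs[of j] f
    by (auto dest: square_integrableD(1) intro: order.strict_trans)
  from square_integrable_diff[OF fs[of j] this] show ?thesis by simp
qed

lemma L2_tendsto_real:
  assumes lim: "L2_tendsto N fs f" and fs: "\<And>j. square_integrable N (fs j)" and f: "square_integrable N f"
  shows "(\<lambda>j. LINT x|N. (norm (fs j x - f x))\<^sup>2) \<longlonglongrightarrow> 0"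
proof -
  have "ennreal (LINT x|N. (norm (fs j x - f x))\<^sup>2) = (\<integral>\<^sup>+x. ennreal ((norm (fs j x - f x))\<^sup>2) \<partial>N)" for j
    using square_integrableD(2)[OF square_integrable_diff[OF fs f]]
    by (intro nn_integral_eq_integral[symmetric]) auto
  then have "(\<lambda>j. ennreal (LINT x|N. (norm (fs j x - f x))\<^sup>2)) \<longlonglongrightarrow> ennreal 0"
    using lim unfolding L2_tendsto_def by simp
  then show ?thesis by (subst (asm) tendsto_ennreal_iff) auto
qed

text \<open>Expand the difference into \<open>(f\<^sub>j - f) \<bullet> (g\<^sub>j - g) + (f\<^sub>j - f) \<bullet> g + f \<bullet> (g\<^sub>j - g)\<close> and apply
  Cauchy--Schwarz to each term.\<close>

lemma L2_tendsto_inner: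
  assumes f: "L2_tendsto N fs f" "\<And>j. square_integrable N (fs j)" "square_integrable N f"
    and g: "L2_tendsto N gs g" "\<And>j. square_integrable N (gs j)" "square_integrable N g"
  shows "(\<lambda>j. LINT x|N. fs j x \<bullet> gs j x) \<longlonglongrightarrow> (LINT x|N. f x \<bullet> g x)"
proof -
  let ?u = "\<lambda>j. sqrt (LINT x|N. (norm (fs j x - f x))\<^sup>2)"
  let ?v = "\<lambda>j. sqrt (LINT x|N. (norm (gs j x - g x))\<^sup>2)"
  let ?f = "sqrt (LINT x|N. (norm (f x))\<^sup>2)" and ?g = "sqrt (LINT x|N. (norm (g x))\<^sup>2)"
  have u: "?u \<longlonglongrightarrow> 0" and v: "?v \<longlonglongrightarrow> 0"
    using tendsto_real_sqrt[OF L2_tendsto_real[OF f]] tendsto_real_sqrt[OF L2_tendsto_real[OF g]] by auto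
  have "(\<lambda>j. ?u j * ?v j + ?u j * ?g + ?f * ?v j) \<longlonglongrightarrow> 0 * 0 + 0 * ?g + ?f * 0"
    by (intro tendsto_intros u v)
  then have lim: "(\<lambda>j. ?u j * ?v j + ?u j * ?g + ?f * ?v j) \<longlonglongrightarrow> 0" by simp
  have "norm ((LINT x|N. fs j x \<bullet> gs j x) - (LINT x|N. f x \<bullet> g x)) \<le> ?u j * ?v j + ?u j * ?g + ?f * ?v j" for j
  proof -
    note df = square_integrable_diff[OF f(2)[of j] f(3)] and dg = square_integrable_diff[OF g(2)[of j] g(3)]
    note i = square_integrable_inner(2)[OF df dg] square_integrable_inner(2)[OF df g(3)]
      square_integrable_inner(2)[OF f(3) dg]
    have "(LINT x|N. fs j x \<bullet> gs j x) - (LINT x|N. f x \<bullet> g x) = (LINT x|N. fs j x \<bullet> gs j x - f x \<bullet> g x)"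
      by (intro Bochner_Integration.integral_diff[symmetric] square_integrable_inner f g)
    also have "\<dots> = (LINT x|N. (fs j x - f x) \<bullet> (gs j x - g x) + (fs j x - f x) \<bullet> g x + f x \<bullet> (gs j x - g x))"
      by (intro Bochner_Integration.integral_cong) (auto simp: inner_diff_left inner_diff_right)
    also have "\<dots> = (LINT x|N. (fs j x - f x) \<bullet> (gs j x - g x)) + (LINT x|N. (fs j x - f x) \<bullet> g x)
        + (LINT x|N. f x \<bullet> (gs j x - g x))"
      by (simp only: Bochner_Integration.integral_add i Bochner_Integration.integrable_add)
    finally show ?thesis
      using integral_Cauchy_Schwarz(2)[OF df dg] integral_Cauchy_Schwarz(2)[OF df g(3)]
        integral_Cauchy_Schwarz(2)[OF f(3) dg] by simp
  qed
  then have "(\<lambda>j. (LINT x|N. fs j x \<bullet> gs j x) - (LINT x|N. f x \<bullet> g x)) \<longlonglongrightarrow> 0"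
    by (intro Lim_null_comparison[OF _ lim] always_eventually allI)
  then show ?thesis by (simp add: LIM_zero_iff)
qed

lemma has_bochner_integral_pair_mult:
  fixes f :: "'x \<Rightarrow> real" and g :: "'y \<Rightarrow> real"
  assumes "sigma_finite_measure N1" "sigma_finite_measure N2"
    and f: "integrable N1 f" and g: "integrable N2 g"
  shows "has_bochner_integral (N1 \<Otimes>\<^sub>M N2) (\<lambda>(x, y). f x * g y) ((LINT x|N1. f x) * (LINT y|N2. g y))"
proof -
  interpret pair_sigma_finite N1 N2 using assms by (simp add: pair_sigma_finite_def)
  have [measurable]: "f \<in> borel_measurable N1" "g \<in> borel_measurable N2" using f g by auto
  have i: "integrable (N1 \<Otimes>\<^sub>M N2) (\<lambda>(x, y). f x * g y)"
    by (rule Fubini_integrable) (use f g in \<open>auto simp: abs_mult\<close>)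
  then show ?thesis using integral_fst[OF i] by (simp add: has_bochner_integral_iff)
qed

lemma vec_nth_measurable:
  fixes X :: "'x \<Rightarrow> 'b::euclidean_space ^ 'k"
  assumes "X \<in> borel_measurable N" shows "(\<lambda>x. X x $ l) \<in> borel_measurable N"
proof -
  have "(\<lambda>X::'b ^ 'k. X $ l) \<in> borel_measurable borel"
    by (intro borel_measurable_continuous_onI continuous_intros)
  from measurable_compose[OF assms this] show ?thesis .
qed

section \<open>Integrals of simple processes\<close>

context wiener_space
begin

abbreviation TM :: "(real \<times> 'a) measure" where "TM \<equiv> lebesgue_on {0..T} \<Otimes>\<^sub>M M"

lemma finite_measure_interval: "finite_measure (lebesgue_on {0..T})"
  by (rule finite_measure_lebesgue_on_interval)

lemma pair_sigma_finite_TM: "pair_sigma_finite (lebesgue_on {0..T}) M"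
  unfolding pair_sigma_finite_def
  using finite_measure_interval sigma_finite_measure_axioms
  by (auto simp: finite_measure.axioms)

lemma finite_measure_TM: "finite_measure TM"
proof -
  interpret I: finite_measure "lebesgue_on {0..T}" by (rule finite_measure_interval)
  interpret pair_sigma_finite "lebesgue_on {0..T}" M by (rule pair_sigma_finite_TM)
  show ?thesis by (intro finite_measure_pair_measure I.finite_measure_axioms finite_measure_axioms)
qed

lemma increment_measurable:
  assumes "0 \<le> a" "a \<le> b" "b \<le> t"
  shows "(\<lambda>\<omega>. (w b \<omega> - w a \<omega>)) \<in> borel_measurable (F t)"
  using assms by (intro borel_measurable_diff w_F_measurable) auto

lemma integrable_bounded_increment:
  fixes \<zeta> :: "'a \<Rightarrow> real"
  assumes ab: "0 \<le> a" "a \<le> b" "b \<le> T" and \<zeta>: "\<zeta> \<in> borel_measurable M" "\<And>\<omega>. \<omega> \<in> space M \<Longrightarrow> \<bar>\<zeta> \<omega>\<bar> \<le> K"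
  shows "integrable M (\<lambda>\<omega>. \<zeta> \<omega> * (w b \<omega> - w a \<omega>) $ i)"
proof -
  have i: "integrable M (\<lambda>\<omega>. (w b \<omega> - w a \<omega>) $ i)"
  proof (cases "a = b")
    case False
    then show ?thesis using increment_moments(1)[of a b i] ab by (simp add: has_bochner_integral_iff)
  qed simp
  show ?thesis
  proof (rule Bochner_Integration.integrable_bound)
    show "integrable M (\<lambda>\<omega>. K * (w b \<omega> - w a \<omega>) $ i)" using i by simp
    show "(\<lambda>\<omega>. \<zeta> \<omega> * (w b \<omega> - w a \<omega>) $ i) \<in> borel_measurable M"
      using \<zeta>(1) i by (intro borel_measurable_times) auto
    show "AE \<omega> in M. norm (\<zeta> \<omega> * (w b \<omega> - w a \<omega>) $ i) \<le> norm (K * (w b \<omega> - w a \<omega>) $ i)"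
    proof (rule AE_I2)
      fix \<omega> assume "\<omega> \<in> space M"
      then have "\<bar>\<zeta> \<omega>\<bar> * \<bar>(w b \<omega> - w a \<omega>) $ i\<bar> \<le> \<bar>K\<bar> * \<bar>(w b \<omega> - w a \<omega>) $ i\<bar>"
        using \<zeta>(2)[of \<omega>] by (intro mult_right_mono) auto
      then show "norm (\<zeta> \<omega> * (w b \<omega> - w a \<omega>) $ i) \<le> norm (K * (w b \<omega> - w a \<omega>) $ i)"
        by (simp only: real_norm_def abs_mult)
    qed
  qed
qed

text \<open>Split the first increment at \<open>c\<close> and \<open>d\<close>: only the part over \<open>[c, d]\<close> contributes, because in all
  other products one factor is an increment over an interval that lies after everything else.\<close>

lemma increments_overlap_scalar:
  fixes \<zeta> :: "'a \<Rightarrow> real"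
  assumes ab: "0 \<le> a" "a \<le> b" "b \<le> T" and cd: "a \<le> c" "c \<le> d" "d \<le> T"
    and \<zeta>: "\<zeta> \<in> borel_measurable (F c)" "\<And>\<omega>. \<omega> \<in> space M \<Longrightarrow> \<bar>\<zeta> \<omega>\<bar> \<le> K"
  shows "has_bochner_integral M (\<lambda>\<omega>. \<zeta> \<omega> * ((w b \<omega> - w a \<omega>) $ i * (w d \<omega> - w c \<omega>) $ j))
           (if i = j then max 0 (min b d - c) * expectation \<zeta> else 0)"
proof -
  define p where "p = min b c"
  define q where "q = min b d"
  let ?X = "\<lambda>x y \<omega>. w y \<omega> - w x \<omega>"
  have c0: "0 \<le> c" "c \<le> T" using ab cd by auto
  have \<zeta>M: "\<zeta> \<in> borel_measurable M" using F_measurable_M[OF \<zeta>(1)] c0 by simp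
  have \<zeta>i: "integrable M \<zeta>"
    by (rule integrable_const_bound[of _ K]) (use \<zeta> \<zeta>M in auto)
  have 1: "has_bochner_integral M (\<lambda>\<omega>. (\<zeta> \<omega> * ?X a p \<omega> $ i) * ?X c d \<omega> $ j) 0"
  proof (rule increment_mean_zero)
    show "(\<lambda>\<omega>. \<zeta> \<omega> * ?X a p \<omega> $ i) \<in> borel_measurable (F c)"
      using ab cd by (intro borel_measurable_times vec_nth_measurable \<zeta>(1) increment_measurable) (auto simp: p_def)
    show "integrable M (\<lambda>\<omega>. \<zeta> \<omega> * ?X a p \<omega> $ i)"
      using ab cd by (intro integrable_bounded_increment[where K=K] \<zeta>M \<zeta>(2)) (auto simp: p_def)
  qed (use c0 cd in auto)
  have 2: "has_bochner_integral M (\<lambda>\<omega>. \<zeta> \<omega> * (?X p q \<omega> $ i * ?X c d \<omega> $ j))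
      (if i = j then max 0 (min b d - c) * expectation \<zeta> else 0)"
  proof (cases "b \<le> c")
    case True
    then have "p = q" using cd by (auto simp: p_def q_def)
    then show ?thesis using True by (simp add: has_bochner_integral_iff)
  next
    case False
    then have pq: "p = c" "c \<le> q" "q \<le> d" "q \<le> T" using cd by (auto simp: p_def q_def)
    have A: "has_bochner_integral M (\<lambda>\<omega>. \<zeta> \<omega> * (?X c q \<omega> $ i * ?X c q \<omega> $ j))
        (if i = j then (q - c) * expectation \<zeta> else 0)"
      by (rule increment_covariance) (use c0 pq \<zeta> \<zeta>i in auto)
    have B: "has_bochner_integral M (\<lambda>\<omega>. (\<zeta> \<omega> * ?X c q \<omega> $ i) * ?X q d \<omega> $ j) 0"
    proof (rule increment_mean_zero)
      show "(\<lambda>\<omega>. \<zeta> \<omega> * ?X c q \<omega> $ i) \<in> borel_measurable (F q)"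
        using c0 pq F_measurable_mono[OF \<zeta>(1) pq(2)]
        by (intro borel_measurable_times vec_nth_measurable increment_measurable) auto
      show "integrable M (\<lambda>\<omega>. \<zeta> \<omega> * ?X c q \<omega> $ i)"
        using c0 pq by (intro integrable_bounded_increment[where K=K] \<zeta>M \<zeta>(2)) auto
    qed (use c0 pq cd in auto)
    have "(\<lambda>\<omega>. \<zeta> \<omega> * (?X p q \<omega> $ i * ?X c d \<omega> $ j))
       = (\<lambda>\<omega>. \<zeta> \<omega> * (?X c q \<omega> $ i * ?X c q \<omega> $ j) + (\<zeta> \<omega> * ?X c q \<omega> $ i) * ?X q d \<omega> $ j)"
      unfolding pq(1) by (auto simp: algebra_simps)
    moreover have "max 0 (min b d - c) = q - c" using pq by (simp add: q_def)
    ultimately show ?thesis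
      using has_bochner_integral_add[OF A B] by (simp only: add_0_right)
  qed
  have 3: "has_bochner_integral M (\<lambda>\<omega>. (\<zeta> \<omega> * ?X c d \<omega> $ j) * ?X q b \<omega> $ i) 0"
  proof (cases "b \<le> d")
    case True
    then have "q = b" by (simp add: q_def)
    then show ?thesis by (simp add: has_bochner_integral_iff)
  next
    case False
    then have q: "q = d" by (simp add: q_def)
    show ?thesis unfolding q
    proof (rule increment_mean_zero)
      show "(\<lambda>\<omega>. \<zeta> \<omega> * ?X c d \<omega> $ j) \<in> borel_measurable (F d)"
        using c0 cd F_measurable_mono[OF \<zeta>(1) cd(2)]
        by (intro borel_measurable_times vec_nth_measurable increment_measurable) auto
      show "integrable M (\<lambda>\<omega>. \<zeta> \<omega> * ?X c d \<omega> $ j)"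
        using c0 cd by (intro integrable_bounded_increment[where K=K] \<zeta>M \<zeta>(2)) auto
    qed (use c0 cd ab False in auto)
  qed
  have "(\<lambda>\<omega>. \<zeta> \<omega> * (?X a b \<omega> $ i * ?X c d \<omega> $ j))
     = (\<lambda>\<omega>. (\<zeta> \<omega> * ?X a p \<omega> $ i) * ?X c d \<omega> $ j + \<zeta> \<omega> * (?X p q \<omega> $ i * ?X c d \<omega> $ j)
          + (\<zeta> \<omega> * ?X c d \<omega> $ j) * ?X q b \<omega> $ i)"
    by (auto simp: algebra_simps)
  then show ?thesis
    using has_bochner_integral_add[OF has_bochner_integral_add[OF 1 2] 3] by simp
qed

lemma abs_entry_le_norm: "\<bar>X $ l $ j\<bar> \<le> norm X" for X :: "real ^ 'm ^ 'k"
  using component_le_norm_cart[of "X $ l" j] Finite_Cartesian_Product.norm_nth_le[of X l] by simp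

lemma increments_overlap:
  fixes \<xi> \<eta> :: "'a \<Rightarrow> real ^ 'd ^ 'n"
  assumes ab: "0 \<le> a" "a \<le> b" "b \<le> T" and cd: "0 \<le> c" "c \<le> d" "d \<le> T"
    and \<xi>: "\<xi> \<in> borel_measurable (F a)" "\<And>\<omega>. \<omega> \<in> space M \<Longrightarrow> norm (\<xi> \<omega>) \<le> K"
    and \<eta>: "\<eta> \<in> borel_measurable (F c)" "\<And>\<omega>. \<omega> \<in> space M \<Longrightarrow> norm (\<eta> \<omega>) \<le> L"
  shows "has_bochner_integral M (\<lambda>\<omega>. (\<xi> \<omega> *v (w b \<omega> - w a \<omega>)) \<bullet> (\<eta> \<omega> *v (w d \<omega> - w c \<omega>)))
           (max 0 (min b d - max a c) * expectation (\<lambda>\<omega>. \<xi> \<omega> \<bullet> \<eta> \<omega>))"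
  using assms
proof (induction a c arbitrary: \<xi> \<eta> b d K L rule: linorder_wlog)
  case (le a c)
  let ?X = "\<lambda>x y \<omega>. w y \<omega> - w x \<omega>"
  let ?\<zeta> = "\<lambda>l i j \<omega>. \<xi> \<omega> $ l $ i * \<eta> \<omega> $ l $ j"
  have \<xi>c: "\<xi> \<in> borel_measurable (F c)" by (rule F_measurable_mono[OF le.prems(7) le.hyps])
  have mF: "?\<zeta> l i j \<in> borel_measurable (F c)" for l i j
    by (intro borel_measurable_times vec_nth_measurable \<xi>c le.prems)
  have bd: "\<bar>?\<zeta> l i j \<omega>\<bar> \<le> K * L" if "\<omega> \<in> space M" for l i j \<omega>
    unfolding abs_mult using le.prems(8)[OF that] le.prems(10)[OF that]
    by (intro mult_mono order_trans[OF abs_entry_le_norm]) (auto intro: order_trans[OF norm_ge_zero])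
  have \<zeta>i: "integrable M (?\<zeta> l i j)" for l i j
    by (rule integrable_const_bound[of _ "K * L"])
      (use bd F_measurable_M[OF mF] le.prems in auto)
  have "has_bochner_integral M (\<lambda>\<omega>. \<Sum>l\<in>UNIV. \<Sum>i\<in>UNIV. \<Sum>j\<in>UNIV. ?\<zeta> l i j \<omega> * (?X a b \<omega> $ i * ?X c d \<omega> $ j))
     (\<Sum>l\<in>UNIV. \<Sum>i\<in>UNIV. \<Sum>j\<in>UNIV. if i = j then max 0 (min b d - c) * expectation (?\<zeta> l i j) else 0)"
    by (intro has_bochner_integral_sum increments_overlap_scalar[of _ _ _ _ _ "K * L"])
      (use le.prems le.hyps mF bd in auto)
  also have "(\<Sum>l\<in>UNIV. \<Sum>i\<in>UNIV. \<Sum>j\<in>UNIV. if i = j then max 0 (min b d - c) * expectation (?\<zeta> l i j) else 0)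
     = max 0 (min b d - c) * (\<Sum>l\<in>UNIV. \<Sum>i\<in>UNIV. expectation (?\<zeta> l i i))"
    by (simp add: sum_distrib_left)
  also have "(\<Sum>l\<in>UNIV. \<Sum>i\<in>UNIV. expectation (?\<zeta> l i i)) = expectation (\<lambda>\<omega>. \<xi> \<omega> \<bullet> \<eta> \<omega>)"
    unfolding inner_matrix_entries using \<zeta>i by (simp add: Bochner_Integration.integral_sum)
  also have "(\<lambda>\<omega>. \<Sum>l\<in>UNIV. \<Sum>i\<in>UNIV. \<Sum>j\<in>UNIV. ?\<zeta> l i j \<omega> * (?X a b \<omega> $ i * ?X c d \<omega> $ j))
     = (\<lambda>\<omega>. (\<xi> \<omega> *v ?X a b \<omega>) \<bullet> (\<eta> \<omega> *v ?X c d \<omega>))"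
    unfolding inner_vec_def matrix_vector_mult_def vec_lambda_beta inner_real_def sum_product
    by (intro ext sum.cong refl) (simp add: mult_ac)
  finally show ?case using le.hyps by (simp add: max_def)
next
  case (sym a c)
  from sym.IH[of d b \<eta> L \<xi> K] sym.prems show ?case
    by (simp add: inner_commute min.commute max.commute)
qed

lemma simple_integrandD:
  assumes "simple_integrand M w T m ts \<xi>"
  shows "i \<le> m \<Longrightarrow> 0 \<le> ts i" "i \<le> m \<Longrightarrow> ts i \<le> T" "i < m \<Longrightarrow> ts i \<le> ts (Suc i)"
    "i < m \<Longrightarrow> \<xi> i \<in> borel_measurable (F (ts i))"
    "i < m \<Longrightarrow> \<xi> i \<in> borel_measurable M"
    "\<exists>C. \<forall>i<m. \<forall>\<omega>\<in>space M. norm (\<xi> i \<omega>) \<le> C"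
proof -
  note * = assms[unfolded simple_integrand_def]
  have mono: "ts i \<le> ts j" if "i \<le> j" "j \<le> m" for i j
    using that
  proof (induction j)
    case (Suc j)
    show ?case
    proof (cases "i = Suc j")
      case False
      then have "ts i \<le> ts j" using Suc by simp
      moreover have "ts j < ts (Suc j)" using * Suc.prems by auto
      ultimately show ?thesis by simp
    qed simp
  qed simp
  show "0 \<le> ts i" if "i \<le> m" using mono[of 0 i] * that by linarith
  show T: "ts i \<le> T" if "i \<le> m" for i using mono[of i m] * that by linarith
  show "ts i \<le> ts (Suc i)" if "i < m" using * that less_imp_le by blast
  show m: "\<xi> i \<in> borel_measurable (F (ts i))" if "i < m" for i using * that by blast
  show "\<xi> i \<in> borel_measurable M" if "i < m"
    using F_measurable_M[OF m[OF that] T] that by simp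
  show "\<exists>C. \<forall>i<m. \<forall>\<omega>\<in>space M. norm (\<xi> i \<omega>) \<le> C" using * by blast
qed

text \<open>Stopping cuts the intervals off at \<open>t\<close> and \<open>t'\<close>. If one of them starts too late, then its increment
  vanishes and the overlap is empty.\<close>

lemma increments_overlap_stopped:
  fixes \<xi> \<eta> :: "'a \<Rightarrow> real ^ 'd ^ 'n"
  assumes ab: "0 \<le> a" "a \<le> b" "b \<le> T" and cd: "0 \<le> c" "c \<le> d" "d \<le> T"
    and \<xi>: "\<xi> \<in> borel_measurable (F a)" "\<And>\<omega>. \<omega> \<in> space M \<Longrightarrow> norm (\<xi> \<omega>) \<le> K"
    and \<eta>: "\<eta> \<in> borel_measurable (F c)" "\<And>\<omega>. \<omega> \<in> space M \<Longrightarrow> norm (\<eta> \<omega>) \<le> L"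
    and t: "t \<in> {0..T}" "t' \<in> {0..T}"
  shows "has_bochner_integral M
     (\<lambda>\<omega>. (\<xi> \<omega> *v (w (min t b) \<omega> - w (min t a) \<omega>)) \<bullet> (\<eta> \<omega> *v (w (min t' d) \<omega> - w (min t' c) \<omega>)))
     (max 0 (min (min t t') (min b d) - max a c) * expectation (\<lambda>\<omega>. \<xi> \<omega> \<bullet> \<eta> \<omega>))"
proof (cases "a \<le> t \<and> c \<le> t'")
  case True
  have e: "min (min t b) (min t' d) = min (min t t') (min b d)" by (simp only: ac_simps)
  have m: "min t a = a" "min t' c = c" using True by auto
  have "has_bochner_integral M
     (\<lambda>\<omega>. (\<xi> \<omega> *v (w (min t b) \<omega> - w a \<omega>)) \<bullet> (\<eta> \<omega> *v (w (min t' d) \<omega> - w c \<omega>)))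
     (max 0 (min (min t b) (min t' d) - max a c) * expectation (\<lambda>\<omega>. \<xi> \<omega> \<bullet> \<eta> \<omega>))"
    by (rule increments_overlap[OF ab(1) _ _ cd(1) _ _ \<xi> \<eta>]) (use True ab cd in auto)
  then show ?thesis by (simp only: e m)
next
  case False
  then have "min (min t t') (min b d) \<le> max a c" by (auto simp: min_le_iff_disj le_max_iff_disj)
  then have "max 0 (min (min t t') (min b d) - max a c) = 0" by simp
  moreover have "(\<lambda>\<omega>. (\<xi> \<omega> *v (w (min t b) \<omega> - w (min t a) \<omega>)) \<bullet> (\<eta> \<omega> *v (w (min t' d) \<omega> - w (min t' c) \<omega>))) = (\<lambda>_. 0)"
  proof (cases "a \<le> t")
    case True
    then have "min t' c = t'" "min t' d = t'" using False cd by auto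
    then show ?thesis by simp
  next
    case False
    then have "min t a = t" "min t b = t" using ab by auto
    then show ?thesis by simp
  qed
  ultimately show ?thesis by (simp add: has_bochner_integral_iff)
qed

text \<open>The polarised isometry for partitions that are not related and for different final times: the
  matrix of overlaps of the two partitions occurs on both sides, so that no common refinement has to
  be formed.\<close>

lemma simple_isometry:
  fixes \<xi> \<xi>' :: "nat \<Rightarrow> 'a \<Rightarrow> real ^ 'd ^ 'n"
  assumes S: "simple_integrand M w T m ts \<xi>" and S': "simple_integrand M w T m' ts' \<xi>'"
    and t: "t \<in> {0..T}" "t' \<in> {0..T}"
  shows "has_bochner_integral M (\<lambda>\<omega>. simple_integral w m ts \<xi> t \<omega> \<bullet> simple_integral w m' ts' \<xi>' t' \<omega>)
      (LINT (s, \<omega>)|TM. indicator {..min t t'} s * (simple_process m ts \<xi> s \<omega> \<bullet> simple_process m' ts' \<xi>' s \<omega>))"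
proof -
  note D = simple_integrandD[OF S] and D' = simple_integrandD[OF S']
  obtain C where C: "\<And>i \<omega>. i < m \<Longrightarrow> \<omega> \<in> space M \<Longrightarrow> norm (\<xi> i \<omega>) \<le> C" using D(6) by blast
  obtain C' where C': "\<And>i \<omega>. i < m' \<Longrightarrow> \<omega> \<in> space M \<Longrightarrow> norm (\<xi>' i \<omega>) \<le> C'" using D'(6) by blast
  let ?ov = "\<lambda>i j. max 0 (min (min t t') (min (ts (Suc i)) (ts' (Suc j))) - max (ts i) (ts' j))"
  let ?E = "\<lambda>i j. expectation (\<lambda>\<omega>. \<xi> i \<omega> \<bullet> \<xi>' j \<omega>)"
  let ?I = "\<lambda>i j s. indicator {..min t t'} s * indicator {ts i<..ts (Suc i)} s * indicator {ts' j<..ts' (Suc j)} s :: real"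
  have "has_bochner_integral M
     (\<lambda>\<omega>. \<Sum>i<m. \<Sum>j<m'. (\<xi> i \<omega> *v (w (min t (ts (Suc i))) \<omega> - w (min t (ts i)) \<omega>)) \<bullet>
         (\<xi>' j \<omega> *v (w (min t' (ts' (Suc j))) \<omega> - w (min t' (ts' j)) \<omega>)))
     (\<Sum>i<m. \<Sum>j<m'. ?ov i j * ?E i j)"
    by (intro has_bochner_integral_sum increments_overlap_stopped[of _ _ _ _ _ C _ C'])
      (use t C C' D D' in auto)
  then have 1: "has_bochner_integral M (\<lambda>\<omega>. simple_integral w m ts \<xi> t \<omega> \<bullet> simple_integral w m' ts' \<xi>' t' \<omega>)
     (\<Sum>i<m. \<Sum>j<m'. ?ov i j * ?E i j)"
    by (simp only: simple_integral_def inner_sum_left) (simp only: inner_sum_right)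
  have E_int: "integrable M (\<lambda>\<omega>. \<xi> i \<omega> \<bullet> \<xi>' j \<omega>)" if "i < m" "j < m'" for i j
  proof (rule integrable_const_bound[of _ "C * C'"])
    show "AE \<omega> in M. norm (\<xi> i \<omega> \<bullet> \<xi>' j \<omega>) \<le> C * C'"
    proof (rule AE_I2)
      fix \<omega> assume "\<omega> \<in> space M"
      then have "norm (\<xi> i \<omega>) * norm (\<xi>' j \<omega>) \<le> C * C'"
        using C[OF that(1)] C'[OF that(2)]
        by (intro mult_mono) (auto intro: order_trans[OF norm_ge_zero])
      then show "norm (\<xi> i \<omega> \<bullet> \<xi>' j \<omega>) \<le> C * C'"
        using Cauchy_Schwarz_ineq2[of "\<xi> i \<omega>" "\<xi>' j \<omega>"] by simp
    qed
  qed (use D(5) D'(5) that in auto)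
  have I_int: "has_bochner_integral (lebesgue_on {0..T}) (?I i j) (?ov i j)" if "i < m" "j < m'" for i j
  proof -
    interpret I: finite_measure "lebesgue_on {0..T}" by (rule finite_measure_interval)
    let ?S = "{max (ts i) (ts' j) <.. min (min t t') (min (ts (Suc i)) (ts' (Suc j)))}"
    have sub: "?S \<subseteq> {0..T}" using t D(1)[of i] that by auto
    have "?I i j s = indicator ?S s" for s by (auto simp: indicator_def)
    then have eq: "?I i j = indicator ?S" by auto
    have S: "?S \<in> sets (lebesgue_on {0..T})" using sub by (auto simp: sets_restrict_space_iff)
    have "measure (lebesgue_on {0..T}) ?S = ?ov i j"
    proof -
      have "measure (lebesgue_on {0..T}) ?S = measure lborel ?S"
        using sub by (subst measure_restrict_space) auto
      also have "\<dots> = ?ov i j"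
      proof (cases "max (ts i) (ts' j) \<le> min (min t t') (min (ts (Suc i)) (ts' (Suc j)))")
        case True
        then show ?thesis by (subst measure_lborel_Ioc) simp_all
      next
        case False
        then have "?S = {}" by (intro greaterThanAtMost_empty) linarith
        then show ?thesis using False by (simp only: measure_empty)
      qed
      finally show ?thesis .
    qed
    moreover have "has_bochner_integral (lebesgue_on {0..T}) (indicator ?S) (measure (lebesgue_on {0..T}) ?S)"
      using S by (intro has_bochner_integral_real_indicator) (auto simp: I.emeasure_finite less_top[symmetric])
    ultimately show ?thesis unfolding eq by simp
  qed
  have "has_bochner_integral TM (\<lambda>x. \<Sum>i<m. \<Sum>j<m'. case x of (s, \<omega>) \<Rightarrow> ?I i j s * (\<xi> i \<omega> \<bullet> \<xi>' j \<omega>))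
      (\<Sum>i<m. \<Sum>j<m'. ?ov i j * ?E i j)"
  proof (intro has_bochner_integral_sum)
    fix i j assume "i \<in> {..<m}" "j \<in> {..<m'}"
    then have ij: "i < m" "j < m'" by auto
    have "integrable (lebesgue_on {0..T}) (?I i j)" "(LINT s|lebesgue_on {0..T}. ?I i j s) = ?ov i j"
      using I_int[OF ij] by (simp_all add: has_bochner_integral_iff)
    then show "has_bochner_integral TM (\<lambda>x. case x of (s, \<omega>) \<Rightarrow> ?I i j s * (\<xi> i \<omega> \<bullet> \<xi>' j \<omega>)) (?ov i j * ?E i j)"
      using has_bochner_integral_pair_mult[OF _ _ _ E_int[OF ij], of "lebesgue_on {0..T}" "?I i j"]
        pair_sigma_finite_TM by (simp add: pair_sigma_finite_def)
  qed
  also have "(\<lambda>x. \<Sum>i<m. \<Sum>j<m'. case x of (s, \<omega>) \<Rightarrow> ?I i j s * (\<xi> i \<omega> \<bullet> \<xi>' j \<omega>))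
     = (\<lambda>(s, \<omega>). indicator {..min t t'} s * (simple_process m ts \<xi> s \<omega> \<bullet> simple_process m' ts' \<xi>' s \<omega>))"
    by (rule ext, clarify, simp only: simple_process_def inner_sum_left,
        simp only: inner_sum_right sum_distrib_left, intro sum.cong refl, simp)
  finally show ?thesis using 1 by (simp add: has_bochner_integral_iff)
qed

lemma simple_process_square_integrable:
  fixes \<xi> :: "nat \<Rightarrow> 'a \<Rightarrow> real ^ 'd ^ 'n"
  assumes S: "simple_integrand M w T m ts \<xi>"
  shows "square_integrable TM (\<lambda>(s, \<omega>). simple_process m ts \<xi> s \<omega>)"
proof -
  note D = simple_integrandD[OF S]
  obtain C where C: "\<And>i \<omega>. i < m \<Longrightarrow> \<omega> \<in> space M \<Longrightarrow> norm (\<xi> i \<omega>) \<le> C" using D(6) by blast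
  interpret TM: finite_measure TM by (rule finite_measure_TM)
  have m: "(\<lambda>(s, \<omega>). simple_process m ts \<xi> s \<omega>) \<in> borel_measurable TM"
  proof -
    have "(\<lambda>x. indicat_real {ts i<..ts (Suc i)} (fst x) *\<^sub>R \<xi> i (snd x)) \<in> borel_measurable TM" if "i < m" for i
    proof (intro borel_measurable_scaleR)
      show "(\<lambda>x. indicat_real {ts i<..ts (Suc i)} (fst x)) \<in> borel_measurable TM"
        by (rule measurable_compose[OF measurable_compose[OF measurable_fst measurable_ident_lebesgue_on]])
          simp
      show "(\<lambda>x. \<xi> i (snd x)) \<in> borel_measurable TM"
        by (rule measurable_compose[OF measurable_snd D(5)[OF that]])
    qed
    then show ?thesis
      unfolding simple_process_def split_beta by (intro borel_measurable_sum) auto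
  qed
  have "norm (simple_process m ts \<xi> s \<omega>) \<le> (\<Sum>i<m. \<bar>C\<bar>)" if "\<omega> \<in> space M" for s \<omega>
    unfolding simple_process_def
  proof (rule sum_norm_le)
    fix i assume "i \<in> {..<m}"
    then have "norm (\<xi> i \<omega>) \<le> \<bar>C\<bar>" using C[of i \<omega>] that by auto
    then show "norm (indicat_real {ts i<..ts (Suc i)} s *\<^sub>R \<xi> i \<omega>) \<le> \<bar>C\<bar>"
      by (auto simp: indicator_def)
  qed
  then have bd: "(norm (simple_process m ts \<xi> s \<omega>))\<^sup>2 \<le> (\<Sum>i<m. \<bar>C\<bar>)\<^sup>2" if "\<omega> \<in> space M" for s \<omega>
    using that by (intro power_mono) auto
  have "integrable TM (\<lambda>x. (norm (case x of (s, \<omega>) \<Rightarrow> simple_process m ts \<xi> s \<omega>))\<^sup>2)"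
    by (rule TM.integrable_const_bound[of _ "(\<Sum>i<m. \<bar>C\<bar>)\<^sup>2"])
      (use bd m in \<open>auto simp: space_pair_measure intro!: AE_I2\<close>)
  then show ?thesis using m by (simp add: square_integrable_def)
qed

lemma simple_integral_F_measurable:
  fixes \<xi> :: "nat \<Rightarrow> 'a \<Rightarrow> real ^ 'd ^ 'n"
  assumes S: "simple_integrand M w T m ts \<xi>" and t: "t \<in> {0..T}"
  shows "simple_integral w m ts \<xi> t \<in> borel_measurable (F t)"
proof -
  note D = simple_integrandD[OF S]
  have "(\<lambda>\<omega>. \<xi> i \<omega> *v (w (min t (ts (Suc i))) \<omega> - w (min t (ts i)) \<omega>)) \<in> borel_measurable (F t)" if i: "i < m" for i
  proof (cases "ts i \<le> t")
    case True
    then show ?thesis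
      using D(1,3)[of i] i t
      by (intro matrix_vector_mult_borel F_measurable_mono[OF D(4)] borel_measurable_diff w_F_measurable) auto
  next
    case False
    then have "w (min t (ts (Suc i))) = w (min t (ts i))" using D(3)[OF i] by (simp add: min_def)
    then show ?thesis by simp
  qed
  then show ?thesis unfolding simple_integral_def by (intro borel_measurable_sum) auto
qed

lemma simple_integral_square_integrable:
  fixes \<xi> :: "nat \<Rightarrow> 'a \<Rightarrow> real ^ 'd ^ 'n"
  assumes S: "simple_integrand M w T m ts \<xi>" and t: "t \<in> {0..T}"
  shows "square_integrable M (simple_integral w m ts \<xi> t)"
  using simple_isometry[OF S S t t] F_measurable_M[OF simple_integral_F_measurable[OF S t]] t
  by (auto simp: square_integrable_def has_bochner_integral_iff power2_norm_eq_inner)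

text \<open>Only the part of the partition after \<open>t\<close> remains in the difference, and its increments have mean
  zero given the past, which contains both \<open>\<eta>\<close> and the integrand.\<close>

lemma simple_integral_orthogonal:
  fixes \<xi> :: "nat \<Rightarrow> 'a \<Rightarrow> real ^ 'd ^ 'n"
  assumes S: "simple_integrand M w T m ts \<xi>" and t: "0 \<le> t" "t \<le> t'" "t' \<le> T"
    and \<eta>: "\<eta> \<in> borel_measurable (F t)" "square_integrable M \<eta>"
  shows "(LINT \<omega>|M. (simple_integral w m ts \<xi> t' \<omega> - simple_integral w m ts \<xi> t \<omega>) \<bullet> \<eta> \<omega>) = 0"
proof -
  note D = simple_integrandD[OF S]
  obtain C where C: "\<And>i \<omega>. i < m \<Longrightarrow> \<omega> \<in> space M \<Longrightarrow> norm (\<xi> i \<omega>) \<le> C" using D(6) by blast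
  \<comment> \<open>\<open>\<tau>\<close> projects onto \<open>[t, t']\<close>.\<close>
  define \<tau> where "\<tau> s = max t (min t' s)" for s
  have \<tau>: "w (min t' s) \<omega> - w (min t s) \<omega> = w (\<tau> s) \<omega> - w t \<omega>" for s \<omega>
    using t by (auto simp: \<tau>_def min_def max_def)
  have "has_bochner_integral M (\<lambda>\<omega>. (\<eta> \<omega> $ l * \<xi> i \<omega> $ l $ j) * (w (\<tau> (ts (Suc i))) \<omega> - w (\<tau> (ts i)) \<omega>) $ j) 0"
    if i: "i < m" for i l j
  proof (cases "ts i \<le> t'")
    case True
    show ?thesis
    proof (rule increment_mean_zero)
      have "\<eta> \<in> borel_measurable (F (\<tau> (ts i)))"
        by (rule F_measurable_mono[OF \<eta>(1)]) (simp add: \<tau>_def)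
      moreover have "\<xi> i \<in> borel_measurable (F (\<tau> (ts i)))"
        by (rule F_measurable_mono[OF D(4)[OF i]]) (use True in \<open>simp add: \<tau>_def\<close>)
      ultimately show "(\<lambda>\<omega>. \<eta> \<omega> $ l * \<xi> i \<omega> $ l $ j) \<in> borel_measurable (F (\<tau> (ts i)))"
        by (intro borel_measurable_times vec_nth_measurable) auto
      have "square_integrable M (\<lambda>\<omega>. \<eta> \<omega> $ l)"
        by (rule square_integrable_bound[OF \<eta>(2), of _ 1])
          (use square_integrableD(1)[OF \<eta>(2)] in \<open>auto simp: component_le_norm_cart intro!: vec_nth_measurable\<close>)
      moreover have "square_integrable M (\<lambda>\<omega>. \<xi> i \<omega> $ l $ j)"
        by (rule square_integrable_bound[of _ "\<lambda>_. 1::real" _ C])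
          (use C i in \<open>auto simp: square_integrable_def intro!: vec_nth_measurable D(5) AE_I2
             order_trans[OF abs_entry_le_norm]\<close>)
      ultimately show "integrable M (\<lambda>\<omega>. \<eta> \<omega> $ l * \<xi> i \<omega> $ l $ j)"
        using square_integrable_inner(2) by fastforce
    qed (use t D(3)[OF i] in \<open>auto simp: \<tau>_def min_def max_def\<close>)
  next
    case False
    then have "\<tau> (ts (Suc i)) = \<tau> (ts i)" using D(3)[OF i] by (simp add: \<tau>_def min_def)
    then show ?thesis by (simp add: has_bochner_integral_iff)
  qed
  then have "has_bochner_integral M
     (\<lambda>\<omega>. \<Sum>i<m. \<Sum>l\<in>UNIV. \<Sum>j\<in>UNIV. (\<eta> \<omega> $ l * \<xi> i \<omega> $ l $ j) * (w (\<tau> (ts (Suc i))) \<omega> - w (\<tau> (ts i)) \<omega>) $ j)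
     (\<Sum>i<m. \<Sum>l\<in>(UNIV::'n set). \<Sum>j\<in>(UNIV::'d set). 0)"
    by (intro has_bochner_integral_sum) auto
  moreover have "(\<Sum>i<m. \<Sum>l\<in>UNIV. \<Sum>j\<in>UNIV. (\<eta> \<omega> $ l * \<xi> i \<omega> $ l $ j) * (w (\<tau> (ts (Suc i))) \<omega> - w (\<tau> (ts i)) \<omega>) $ j)
     = (simple_integral w m ts \<xi> t' \<omega> - simple_integral w m ts \<xi> t \<omega>) \<bullet> \<eta> \<omega>" for \<omega>
  proof -
    have "simple_integral w m ts \<xi> t' \<omega> - simple_integral w m ts \<xi> t \<omega>
       = (\<Sum>i<m. \<xi> i \<omega> *v (w (\<tau> (ts (Suc i))) \<omega> - w (\<tau> (ts i)) \<omega>))"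
      unfolding simple_integral_def sum_subtractf[symmetric] matrix_vector_mult_diff_distrib[symmetric]
    proof (intro sum.cong arg_cong2[where f="(*v)"] refl)
      fix i
      have "(w (min t' (ts (Suc i))) \<omega> - w (min t' (ts i)) \<omega>) - (w (min t (ts (Suc i))) \<omega> - w (min t (ts i)) \<omega>)
        = (w (min t' (ts (Suc i))) \<omega> - w (min t (ts (Suc i))) \<omega>) - (w (min t' (ts i)) \<omega> - w (min t (ts i)) \<omega>)"
        by simp
      then show "(w (min t' (ts (Suc i))) \<omega> - w (min t' (ts i)) \<omega>) - (w (min t (ts (Suc i))) \<omega> - w (min t (ts i)) \<omega>)
        = w (\<tau> (ts (Suc i))) \<omega> - w (\<tau> (ts i)) \<omega>"
        unfolding \<tau> by simp
    qed
    then have "(simple_integral w m ts \<xi> t' \<omega> - simple_integral w m ts \<xi> t \<omega>) \<bullet> \<eta> \<omega>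
       = (\<Sum>i<m. (\<xi> i \<omega> *v (w (\<tau> (ts (Suc i))) \<omega> - w (\<tau> (ts i)) \<omega>)) \<bullet> \<eta> \<omega>)"
      by (simp only: inner_sum_left)
    then show ?thesis
      by (simp only:, intro sum.cong refl)
        (simp add: inner_vec_def matrix_vector_mult_def sum_distrib_left sum_distrib_right mult_ac)
  qed
  ultimately show ?thesis by (simp add: has_bochner_integral_iff)
qed

end

section \<open>Mean square limits and the Ito integral\<close>

lemma nn_integral_norm_diff_triangle:
  fixes f g h :: "'x \<Rightarrow> 'b::euclidean_space"
  assumes [measurable]: "f \<in> borel_measurable N" "g \<in> borel_measurable N" "h \<in> borel_measurable N"
  shows "(\<integral>\<^sup>+x. ennreal ((norm (f x - h x))\<^sup>2) \<partial>N)
    \<le> 2 * (\<integral>\<^sup>+x. ennreal ((norm (f x - g x))\<^sup>2) \<partial>N) + 2 * (\<integral>\<^sup>+x. ennreal ((norm (g x - h x))\<^sup>2) \<partial>N)"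
proof -
  have "(\<integral>\<^sup>+x. ennreal ((norm (f x - h x))\<^sup>2) \<partial>N)
     \<le> (\<integral>\<^sup>+x. 2 * ennreal ((norm (f x - g x))\<^sup>2) + 2 * ennreal ((norm (g x - h x))\<^sup>2) \<partial>N)"
  proof (rule nn_integral_mono)
    fix x
    have "(norm (f x - h x))\<^sup>2 \<le> 2 * (norm (f x - g x))\<^sup>2 + 2 * (norm (g x - h x))\<^sup>2"
      using norm_add_square_le[of "f x - g x" "g x - h x"] by simp
    then have "ennreal ((norm (f x - h x))\<^sup>2) \<le> ennreal (2 * (norm (f x - g x))\<^sup>2 + 2 * (norm (g x - h x))\<^sup>2)"
      by (rule ennreal_leI)
    then show "ennreal ((norm (f x - h x))\<^sup>2) \<le> 2 * ennreal ((norm (f x - g x))\<^sup>2) + 2 * ennreal ((norm (g x - h x))\<^sup>2)"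
      by (simp add: ennreal_mult')
  qed
  also have "\<dots> = 2 * (\<integral>\<^sup>+x. ennreal ((norm (f x - g x))\<^sup>2) \<partial>N) + 2 * (\<integral>\<^sup>+x. ennreal ((norm (g x - h x))\<^sup>2) \<partial>N)"
    by (simp add: nn_integral_add nn_integral_cmult)
  finally show ?thesis .
qed

lemma L2_tendsto_dominated:
  fixes fs :: "nat \<Rightarrow> 'x \<Rightarrow> 'b::euclidean_space" and gs :: "nat \<Rightarrow> 'x \<Rightarrow> 'c::euclidean_space"
  assumes lim: "L2_tendsto N fs f" and [measurable]: "\<And>j. fs j \<in> borel_measurable N" "f \<in> borel_measurable N"
    and le: "\<And>j x. x \<in> space N \<Longrightarrow> norm (gs j x - g x) \<le> K * norm (fs j x - f x)"
  shows "L2_tendsto N gs g"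
proof -
  have le2: "(\<integral>\<^sup>+x. ennreal ((norm (gs j x - g x))\<^sup>2) \<partial>N)
      \<le> ennreal (K\<^sup>2) * (\<integral>\<^sup>+x. ennreal ((norm (fs j x - f x))\<^sup>2) \<partial>N)" for j
  proof -
    have "(\<integral>\<^sup>+x. ennreal ((norm (gs j x - g x))\<^sup>2) \<partial>N)
       \<le> (\<integral>\<^sup>+x. ennreal (K\<^sup>2) * ennreal ((norm (fs j x - f x))\<^sup>2) \<partial>N)"
    proof (rule nn_integral_mono)
      fix x assume "x \<in> space N"
      from power_mono[OF le[OF this, of j], of 2]
      show "ennreal ((norm (gs j x - g x))\<^sup>2) \<le> ennreal (K\<^sup>2) * ennreal ((norm (fs j x - f x))\<^sup>2)"
        by (simp add: power_mult_distrib ennreal_mult'[symmetric] ennreal_leI)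
    qed
    then show ?thesis by (simp add: nn_integral_cmult)
  qed
  have "(\<lambda>j. ennreal (K\<^sup>2) * (\<integral>\<^sup>+x. ennreal ((norm (fs j x - f x))\<^sup>2) \<partial>N)) \<longlonglongrightarrow> ennreal (K\<^sup>2) * 0"
    using lim unfolding L2_tendsto_def by (intro ennreal_tendsto_cmult) auto
  then have "(\<lambda>j. ennreal (K\<^sup>2) * (\<integral>\<^sup>+x. ennreal ((norm (fs j x - f x))\<^sup>2) \<partial>N)) \<longlonglongrightarrow> 0" by simp
  then show ?thesis unfolding L2_tendsto_def
    by (rule tendsto_sandwich[OF _ _ tendsto_const, rotated 2]) (auto intro!: always_eventually le2)
qed

lemma L2_tendsto_trans:
  fixes fs gs :: "nat \<Rightarrow> 'x \<Rightarrow> 'b::euclidean_space"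
  assumes fg: "(\<lambda>j. \<integral>\<^sup>+x. ennreal ((norm (fs j x - gs j x))\<^sup>2) \<partial>N) \<longlonglongrightarrow> 0" and g: "L2_tendsto N gs g"
    and m: "\<And>j. fs j \<in> borel_measurable N" "\<And>j. gs j \<in> borel_measurable N" "g \<in> borel_measurable N"
  shows "L2_tendsto N fs g"
proof -
  let ?u = "\<lambda>j. \<integral>\<^sup>+x. ennreal ((norm (fs j x - gs j x))\<^sup>2) \<partial>N"
  let ?v = "\<lambda>j. \<integral>\<^sup>+x. ennreal ((norm (gs j x - g x))\<^sup>2) \<partial>N"
  have "(\<lambda>j. 2 * ?u j + 2 * ?v j) \<longlonglongrightarrow> 2 * 0 + 2 * 0"
    using fg g unfolding L2_tendsto_def by (intro tendsto_add ennreal_tendsto_cmult) auto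
  then have "(\<lambda>j. 2 * ?u j + 2 * ?v j) \<longlonglongrightarrow> 0" by simp
  then show ?thesis unfolding L2_tendsto_def
    by (rule tendsto_sandwich[OF _ _ tendsto_const, rotated 2])
      (auto intro!: always_eventually nn_integral_norm_diff_triangle m)
qed

text \<open>The squared norms tend to zero in \<open>L\<^sub>1\<close>.\<close>

lemma L2_tendsto_AE_subseq:
  fixes fs :: "nat \<Rightarrow> 'x \<Rightarrow> 'b::euclidean_space"
  assumes lim: "L2_tendsto N fs f" and fs: "\<And>j. square_integrable N (fs j)" and f: "square_integrable N f"
  shows "\<exists>r::nat \<Rightarrow> nat. strict_mono r \<and> (AE x in N. (\<lambda>n. fs (r n) x) \<longlonglongrightarrow> f x)"
proof -
  have "(\<lambda>j. LINT x|N. norm ((norm (fs j x - f x))\<^sup>2)) \<longlonglongrightarrow> 0"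
    using L2_tendsto_real[OF lim fs f] by simp
  then obtain r :: "nat \<Rightarrow> nat" where r: "strict_mono r" "AE x in N. (\<lambda>n. (norm (fs (r n) x - f x))\<^sup>2) \<longlonglongrightarrow> 0"
    using tendsto_L1_AE_subseq[of N "\<lambda>j x. (norm (fs j x - f x))\<^sup>2"]
      square_integrableD(2)[OF square_integrable_diff[OF fs f]] by blast
  have "AE x in N. (\<lambda>n. fs (r n) x) \<longlonglongrightarrow> f x"
    using r(2)
  proof eventually_elim
    case (elim x)
    from tendsto_real_sqrt[OF elim] have "(\<lambda>n. norm (fs (r n) x - f x)) \<longlonglongrightarrow> 0" by simp
    then show ?case by (simp add: tendsto_norm_zero_iff LIM_zero_iff)
  qed
  with r(1) show ?thesis by blast
qed

context wiener_space
begin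

lemma nn_integral_TM:
  assumes "(\<lambda>(s, \<omega>). f s \<omega>) \<in> borel_measurable TM"
  shows "(\<integral>\<^sup>+\<omega>. \<integral>\<^sup>+s. f s \<omega> \<partial>lebesgue_on {0..T} \<partial>M) = (\<integral>\<^sup>+x. (case x of (s, \<omega>) \<Rightarrow> f s \<omega>) \<partial>TM)"
    and "(\<integral>\<^sup>+s. \<integral>\<^sup>+\<omega>. f s \<omega> \<partial>M \<partial>lebesgue_on {0..T}) = (\<integral>\<^sup>+x. (case x of (s, \<omega>) \<Rightarrow> f s \<omega>) \<partial>TM)"
proof -
  interpret P: pair_sigma_finite "lebesgue_on {0..T}" M by (rule pair_sigma_finite_TM)
  show "(\<integral>\<^sup>+\<omega>. \<integral>\<^sup>+s. f s \<omega> \<partial>lebesgue_on {0..T} \<partial>M) = (\<integral>\<^sup>+x. (case x of (s, \<omega>) \<Rightarrow> f s \<omega>) \<partial>TM)"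
    using P.nn_integral_snd[OF assms] by simp
  show "(\<integral>\<^sup>+s. \<integral>\<^sup>+\<omega>. f s \<omega> \<partial>M \<partial>lebesgue_on {0..T}) = (\<integral>\<^sup>+x. (case x of (s, \<omega>) \<Rightarrow> f s \<omega>) \<partial>TM)"
    using nn_integral_fst[OF assms] by simp
qed

lemma time_integral_measurable:
  fixes q :: "real \<times> 'a \<Rightarrow> 'b::euclidean_space"
  assumes "q \<in> borel_measurable TM"
  shows "(\<lambda>\<omega>. LINT t|lebesgue_on {0..T}. q (t, \<omega>)) \<in> borel_measurable M"
proof -
  interpret P: pair_sigma_finite "lebesgue_on {0..T}" M by (rule pair_sigma_finite_TM)
  have "(\<lambda>(\<omega>, t). q (t, \<omega>)) \<in> borel_measurable (M \<Otimes>\<^sub>M lebesgue_on {0..T})"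
    using measurable_compose[OF measurable_pair_swap' assms] by (simp add: split_beta')
  then show ?thesis by (rule P.M1.borel_measurable_lebesgue_integral)
qed

lemma adapted_processD:
  assumes "adapted_process M w T v"
  shows "(\<lambda>(s, \<omega>). v s \<omega>) \<in> borel_measurable TM" "t \<in> {0..T} \<Longrightarrow> v t \<in> borel_measurable (F t)"
    "t \<in> {0..T} \<Longrightarrow> v t \<in> borel_measurable M"
    "\<omega> \<in> space M \<Longrightarrow> (\<lambda>s. v s \<omega>) \<in> borel_measurable (lebesgue_on {0..T})"
proof -
  have adapted_1: "(\<lambda>(s, \<omega>). v s \<omega>) \<in> borel_measurable TM"
    using assms by (simp add: adapted_process_def)
  show "(\<lambda>(s, \<omega>). v s \<omega>) \<in> borel_measurable TM" "t \<in> {0..T} \<Longrightarrow> v t \<in> borel_measurable (F t)"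
    "t \<in> {0..T} \<Longrightarrow> v t \<in> borel_measurable M"
    "\<omega> \<in> space M \<Longrightarrow> (\<lambda>s. v s \<omega>) \<in> borel_measurable (lebesgue_on {0..T})"
  using assms F_measurable_M[of "v t" t borel]
    measurable_compose[OF measurable_Pair2' adapted_1, of \<omega>]
  unfolding adapted_process_def by auto
qed

lemma L_class_22_iff:
  "v \<in> L_class M w T 2 2 \<longleftrightarrow> adapted_process M w T v \<and> square_integrable TM (\<lambda>(s, \<omega>). v s \<omega>)"
proof (cases "adapted_process M w T v")
  case True
  note m = adapted_processD[OF True]
  let ?L = "lebesgue_on {0..T}"
  interpret P: pair_sigma_finite ?L M by (rule pair_sigma_finite_TM)
  have p2: "norm (v t \<omega>) powr 2 = (norm (v t \<omega>))\<^sup>2" for t \<omega> by simp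
  have q: "((LINT t|?L. (norm (v t \<omega>))\<^sup>2) powr (1/2))\<^sup>2 = (LINT t|?L. (norm (v t \<omega>))\<^sup>2)" for \<omega>
    by (simp add: powr_half_sqrt)
  have sq: "(\<lambda>(s, \<omega>). (norm (v s \<omega>))\<^sup>2) \<in> borel_measurable TM"
    using borel_measurable_power[OF measurable_compose[OF m(1) borel_measurable_norm], of 2] by (simp add: split_beta')
  have "v \<in> L_class M w T 2 2 \<longleftrightarrow> (AE \<omega> in M. integrable ?L (\<lambda>t. (norm (v t \<omega>))\<^sup>2)) \<and>
       integrable M (\<lambda>\<omega>. LINT t|?L. (norm (v t \<omega>))\<^sup>2)"
    unfolding L_class_def p2 using True by (simp add: q)
  also have "\<dots> \<longleftrightarrow> integrable TM (\<lambda>(s, \<omega>). (norm (v s \<omega>))\<^sup>2)"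
  proof
    assume *: "(AE \<omega> in M. integrable ?L (\<lambda>t. (norm (v t \<omega>))\<^sup>2)) \<and> integrable M (\<lambda>\<omega>. LINT t|?L. (norm (v t \<omega>))\<^sup>2)"
    interpret Q: pair_sigma_finite M ?L using pair_sigma_finite_TM by (simp add: pair_sigma_finite_def) 
    have "integrable (M \<Otimes>\<^sub>M ?L) (\<lambda>(\<omega>, s). (norm (v s \<omega>))\<^sup>2)"
      by (rule Q.Fubini_integrable)
        (use * measurable_compose[OF measurable_pair_swap' sq] in \<open>auto simp: split_beta'\<close>)
    from Q.integrable_product_swap[OF this] show "integrable TM (\<lambda>(s, \<omega>). (norm (v s \<omega>))\<^sup>2)"
      by simp
  next
    assume *: "integrable TM (\<lambda>(s, \<omega>). (norm (v s \<omega>))\<^sup>2)"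
    show "(AE \<omega> in M. integrable ?L (\<lambda>t. (norm (v t \<omega>))\<^sup>2)) \<and> integrable M (\<lambda>\<omega>. LINT t|?L. (norm (v t \<omega>))\<^sup>2)"
      using P.AE_integrable_snd[OF *] P.integrable_snd[OF *] by simp
  qed
  also have "\<dots> \<longleftrightarrow> square_integrable TM (\<lambda>(s, \<omega>). v s \<omega>)"
    unfolding square_integrable_def using m(1) by (simp add: split_beta')
  finally show ?thesis using True by simp
qed (simp add: L_class_def)

text \<open>The simple process as a function on the product space, on which its distance to an integrand is
  measured.\<close>

definition process :: "nat \<Rightarrow> (nat \<Rightarrow> real) \<Rightarrow> (nat \<Rightarrow> 'a \<Rightarrow> real ^ 'd ^ 'n) \<Rightarrow> real \<times> 'a \<Rightarrow> real ^ 'd ^ 'n" where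
  "process m ts \<xi> = (\<lambda>(s, \<omega>). simple_process m ts \<xi> s \<omega>)"

lemma process_square_integrable: "simple_integrand M w T m ts \<xi> \<Longrightarrow> square_integrable TM (process m ts \<xi>)"
  unfolding process_def by (rule simple_process_square_integrable)

lemma process_distance:
  fixes k :: "real \<Rightarrow> 'a \<Rightarrow> real ^ 'd ^ 'n"
  assumes S: "simple_integrand M w T m ts \<xi>" and [measurable]: "(\<lambda>(s, \<omega>). k s \<omega>) \<in> borel_measurable TM"
  shows "(\<integral>\<^sup>+\<omega>. \<integral>\<^sup>+s. ennreal ((norm (simple_process m ts \<xi> s \<omega> - k s \<omega>))\<^sup>2) \<partial>lebesgue_on {0..T} \<partial>M)
     = (\<integral>\<^sup>+x. ennreal ((norm (process m ts \<xi> x - (case x of (s, \<omega>) \<Rightarrow> k s \<omega>)))\<^sup>2) \<partial>TM)"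
proof (subst nn_integral_TM(1))
  have [measurable]: "process m ts \<xi> \<in> borel_measurable TM"
    by (rule square_integrableD(1)[OF process_square_integrable[OF S]])
  have "(\<lambda>x. ennreal ((norm (process m ts \<xi> x - (case x of (s, \<omega>) \<Rightarrow> k s \<omega>)))\<^sup>2)) \<in> borel_measurable TM"
    by measurable
  then show "(\<lambda>(s, \<omega>). ennreal ((norm (simple_process m ts \<xi> s \<omega> - k s \<omega>))\<^sup>2)) \<in> borel_measurable TM"
    by (simp add: process_def split_beta')
qed (simp add: process_def split_beta')

lemma ito_integrand:
  assumes "has_ito_integral M w T k t I"
  shows "adapted_process M w T k" "square_integrable TM (\<lambda>(s, \<omega>). k s \<omega>)"
proof -
  have "k \<in> L_class M w T 2 2" using assms unfolding has_ito_integral_def by (rule conjunct1)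
  then show "adapted_process M w T k" "square_integrable TM (\<lambda>(s, \<omega>). k s \<omega>)"
    unfolding L_class_22_iff by (rule conjunct1, rule conjunct2)
qed

lemma has_ito_integralI:
  fixes k :: "real \<Rightarrow> 'a \<Rightarrow> real ^ 'd ^ 'n"
  assumes k: "adapted_process M w T k" "square_integrable TM (\<lambda>(s, \<omega>). k s \<omega>)"
    and I: "I \<in> borel_measurable M"
    and S: "\<And>j. simple_integrand M w T (m j) (ts j) (\<xi> j)"
    and lim: "L2_tendsto TM (\<lambda>j. process (m j) (ts j) (\<xi> j)) (\<lambda>(s, \<omega>). k s \<omega>)"
      "L2_tendsto M (\<lambda>j. simple_integral w (m j) (ts j) (\<xi> j) t) I"
  shows "has_ito_integral M w T k t I"
  unfolding has_ito_integral_def L_class_22_iff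
proof (intro conjI exI allI)
  show "(\<lambda>j. \<integral>\<^sup>+\<omega>. \<integral>\<^sup>+s. ennreal ((norm (simple_process (m j) (ts j) (\<xi> j) s \<omega> - k s \<omega>))\<^sup>2)
               \<partial>lebesgue_on {0..T} \<partial>M) \<longlonglongrightarrow> 0"
    using lim(1) unfolding L2_tendsto_def by (simp only: process_distance[OF S adapted_processD(1)[OF k(1)]])
qed (use k I S lim(2) in \<open>simp_all add: L2_tendsto_def\<close>)

lemma ito_approximation:
  fixes k :: "real \<Rightarrow> 'a \<Rightarrow> real ^ 'd ^ 'n"
  assumes I: "has_ito_integral M w T k t I"
  obtains m ts \<xi> where "\<And>j. simple_integrand M w T (m j) (ts j) (\<xi> j)"
    "L2_tendsto TM (\<lambda>j. process (m j) (ts j) (\<xi> j)) (\<lambda>(s, \<omega>). k s \<omega>)"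
    "L2_tendsto M (\<lambda>j. simple_integral w (m j) (ts j) (\<xi> j) t) I"
proof -
  from I obtain m ts \<xi> where *: "\<And>j. simple_integrand M w T (m j) (ts j) (\<xi> j)"
    "(\<lambda>j. \<integral>\<^sup>+\<omega>. \<integral>\<^sup>+s. ennreal ((norm (simple_process (m j) (ts j) (\<xi> j) s \<omega> - k s \<omega>))\<^sup>2)
               \<partial>lebesgue_on {0..T} \<partial>M) \<longlonglongrightarrow> 0"
    "(\<lambda>j. \<integral>\<^sup>+\<omega>. ennreal ((norm (simple_integral w (m j) (ts j) (\<xi> j) t \<omega> - I \<omega>))\<^sup>2) \<partial>M) \<longlonglongrightarrow> 0"
    unfolding has_ito_integral_def by blast
  show ?thesis
  proof (rule that)
    show "L2_tendsto TM (\<lambda>j. process (m j) (ts j) (\<xi> j)) (\<lambda>(s, \<omega>). k s \<omega>)"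
      using *(2) unfolding L2_tendsto_def
      by (simp only: process_distance[OF *(1) adapted_processD(1)[OF ito_integrand(1)[OF I]]])
  qed (use * in \<open>simp_all add: L2_tendsto_def\<close>)
qed

lemma ito_square_integrable:
  fixes k :: "real \<Rightarrow> 'a \<Rightarrow> real ^ 'd ^ 'n"
  assumes I: "has_ito_integral M w T k t I" and t: "t \<in> {0..T}"
  shows "square_integrable M I"
proof -
  obtain m ts \<xi> where *: "\<And>j. simple_integrand M w T (m j) (ts j) (\<xi> j)"
    "L2_tendsto TM (\<lambda>j. process (m j) (ts j) (\<xi> j)) (\<lambda>(s, \<omega>). k s \<omega>)"
    "L2_tendsto M (\<lambda>j. simple_integral w (m j) (ts j) (\<xi> j) t) I"
    by (rule ito_approximation[OF I]) blast
  show ?thesis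
    by (rule L2_tendsto_square_integrable[OF *(3)])
      (use * t I in \<open>auto simp: has_ito_integral_def intro: simple_integral_square_integrable\<close>)
qed

lemma L2_tendsto_indicator:
  fixes fs :: "nat \<Rightarrow> real \<times> 'a \<Rightarrow> 'b::euclidean_space"
  assumes "L2_tendsto TM fs f" "\<And>j. fs j \<in> borel_measurable TM" "f \<in> borel_measurable TM"
  shows "L2_tendsto TM (\<lambda>j (s, \<omega>). indicator {..t} s *\<^sub>R fs j (s, \<omega>)) (\<lambda>(s, \<omega>). indicator {..t} s *\<^sub>R f (s, \<omega>))"
  by (rule L2_tendsto_dominated[OF assms, of _ _ 1]) (auto simp: indicator_def)

lemma square_integrable_indicator:
  fixes f :: "real \<times> 'a \<Rightarrow> 'b::euclidean_space"
  assumes f: "square_integrable TM f"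
  shows "square_integrable TM (\<lambda>(s, \<omega>). indicator {..t} s *\<^sub>R f (s, \<omega>))"
proof (rule square_integrable_bound[OF f, of _ 1])
  have "(\<lambda>x. indicat_real {..t} (fst x)) \<in> borel_measurable TM"
    by (rule measurable_compose[OF measurable_compose[OF measurable_fst measurable_ident_lebesgue_on]]) simp
  then have "(\<lambda>x. indicat_real {..t} (fst x) *\<^sub>R f x) \<in> borel_measurable TM"
    using square_integrableD(1)[OF f] by (rule borel_measurable_scaleR)
  then show "(\<lambda>(s, \<omega>). indicator {..t} s *\<^sub>R f (s, \<omega>)) \<in> borel_measurable TM"
    by (simp add: split_beta')
qed (auto simp: indicator_def)

text \<open>Both sides are mean square limits of the corresponding sides of \<open>simple_isometry\<close>.\<close>

lemma ito_isometry:
  fixes k k' :: "real \<Rightarrow> 'a \<Rightarrow> real ^ 'd ^ 'n"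
  assumes I: "has_ito_integral M w T k t I" and I': "has_ito_integral M w T k' t' I'"
    and t: "t \<in> {0..T}" "t' \<in> {0..T}"
  shows "(LINT \<omega>|M. I \<omega> \<bullet> I' \<omega>) = (LINT (s, \<omega>)|TM. indicator {..min t t'} s * (k s \<omega> \<bullet> k' s \<omega>))"
proof -
  obtain m ts \<xi> where
    a: "\<And>j. simple_integrand M w T (m j) (ts j) (\<xi> j)"
    "L2_tendsto TM (\<lambda>j. process (m j) (ts j) (\<xi> j)) (\<lambda>(s, \<omega>). k s \<omega>)"
    "L2_tendsto M (\<lambda>j. simple_integral w (m j) (ts j) (\<xi> j) t) I"
    by (rule ito_approximation[OF I]) blast
  obtain m' ts' \<xi>' where
    a': "\<And>j. simple_integrand M w T (m' j) (ts' j) (\<xi>' j)"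
    "L2_tendsto TM (\<lambda>j. process (m' j) (ts' j) (\<xi>' j)) (\<lambda>(s, \<omega>). k' s \<omega>)"
    "L2_tendsto M (\<lambda>j. simple_integral w (m' j) (ts' j) (\<xi>' j) t') I'"
    by (rule ito_approximation[OF I']) blast
  let ?\<phi> = "\<lambda>j. process (m j) (ts j) (\<xi> j)" and ?\<phi>' = "\<lambda>j. process (m' j) (ts' j) (\<xi>' j)"
  let ?ind = "\<lambda>f (s, \<omega>). indicator {..min t t'} s *\<^sub>R f (s, \<omega>)"
  note sq = process_square_integrable[OF a(1)] process_square_integrable[OF a'(1)]
  note kq = ito_integrand(2)[OF I] ito_integrand(2)[OF I']
  have 1: "(\<lambda>j. LINT \<omega>|M. simple_integral w (m j) (ts j) (\<xi> j) t \<omega> \<bullet> simple_integral w (m' j) (ts' j) (\<xi>' j) t' \<omega>)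
      \<longlonglongrightarrow> (LINT \<omega>|M. I \<omega> \<bullet> I' \<omega>)"
    using t by (intro L2_tendsto_inner a(3) a'(3) simple_integral_square_integrable a(1) a'(1)
        ito_square_integrable[OF I] ito_square_integrable[OF I'])
  have 2: "(\<lambda>j. LINT x|TM. ?ind (?\<phi> j) x \<bullet> ?\<phi>' j x) \<longlonglongrightarrow> (LINT x|TM. ?ind (\<lambda>(s, \<omega>). k s \<omega>) x \<bullet> (case x of (s, \<omega>) \<Rightarrow> k' s \<omega>))"
    using sq kq
    by (intro L2_tendsto_inner a'(2) L2_tendsto_indicator a(2) square_integrable_indicator)
      (auto dest: square_integrableD(1))
  have "(LINT \<omega>|M. simple_integral w (m j) (ts j) (\<xi> j) t \<omega> \<bullet> simple_integral w (m' j) (ts' j) (\<xi>' j) t' \<omega>)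
      = (LINT x|TM. ?ind (?\<phi> j) x \<bullet> ?\<phi>' j x)" for j
    using simple_isometry[OF a(1)[of j] a'(1)[of j] t]
    by (simp add: has_bochner_integral_iff process_def split_beta')
  with 1 2 have "(LINT \<omega>|M. I \<omega> \<bullet> I' \<omega>) = (LINT x|TM. ?ind (\<lambda>(s, \<omega>). k s \<omega>) x \<bullet> (case x of (s, \<omega>) \<Rightarrow> k' s \<omega>))"
    using LIMSEQ_unique by fastforce
  then show ?thesis by (simp add: split_beta')
qed

text \<open>The isometry is bilinear in the pair of simple processes although their difference is not a simple
  process on either partition, so the square of the difference is expanded.\<close>

lemma simple_integral_diff_le:
  fixes \<xi> \<xi>' :: "nat \<Rightarrow> 'a \<Rightarrow> real ^ 'd ^ 'n"
  assumes S: "simple_integrand M w T m ts \<xi>" and S': "simple_integrand M w T m' ts' \<xi>'" and t: "t \<in> {0..T}"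
  shows "(\<integral>\<^sup>+\<omega>. ennreal ((norm (simple_integral w m ts \<xi> t \<omega> - simple_integral w m' ts' \<xi>' t \<omega>))\<^sup>2) \<partial>M)
       \<le> (\<integral>\<^sup>+x. ennreal ((norm (process m ts \<xi> x - process m' ts' \<xi>' x))\<^sup>2) \<partial>TM)"
proof -
  let ?J = "simple_integral w m ts \<xi> t" and ?J' = "simple_integral w m' ts' \<xi>' t"
  let ?p = "process m ts \<xi>" and ?p' = "process m' ts' \<xi>'"
  let ?ind = "\<lambda>f (s, \<omega>). indicator {..t} s *\<^sub>R f (s, \<omega>)"
  note sq = process_square_integrable[OF S] process_square_integrable[OF S']
  note J = simple_integral_square_integrable[OF S t] simple_integral_square_integrable[OF S' t]
  note d = square_integrable_diff[OF sq] and dJ = square_integrable_diff[OF J]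
  have iso: "(LINT \<omega>|M. simple_integral w m1 ts1 \<xi>1 t \<omega> \<bullet> simple_integral w m2 ts2 \<xi>2 t \<omega>)
     = (LINT x|TM. ?ind (process m1 ts1 \<xi>1) x \<bullet> process m2 ts2 \<xi>2 x)"
    if "simple_integrand M w T m1 ts1 \<xi>1" "simple_integrand M w T m2 ts2 \<xi>2"
    for m1 m2 ts1 ts2 and \<xi>1 \<xi>2 :: "nat \<Rightarrow> 'a \<Rightarrow> real ^ 'd ^ 'n"
    using simple_isometry[OF that t t] by (simp add: has_bochner_integral_iff process_def split_beta')
  note Ji = square_integrable_inner(2)[OF J(1) J(1)] square_integrable_inner(2)[OF J(1) J(2)]
    square_integrable_inner(2)[OF J(2) J(1)] square_integrable_inner(2)[OF J(2) J(2)]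
  note pi = square_integrable_inner(2)[OF square_integrable_indicator[OF sq(1), of t] sq(1)]
    square_integrable_inner(2)[OF square_integrable_indicator[OF sq(1), of t] sq(2)]
    square_integrable_inner(2)[OF square_integrable_indicator[OF sq(2), of t] sq(1)]
    square_integrable_inner(2)[OF square_integrable_indicator[OF sq(2), of t] sq(2)]
  have "(LINT \<omega>|M. (norm (?J \<omega> - ?J' \<omega>))\<^sup>2)
     = (LINT \<omega>|M. ?J \<omega> \<bullet> ?J \<omega> - ?J \<omega> \<bullet> ?J' \<omega> - ?J' \<omega> \<bullet> ?J \<omega> + ?J' \<omega> \<bullet> ?J' \<omega>)"
    by (intro Bochner_Integration.integral_cong)
      (auto simp: power2_norm_eq_inner inner_diff_left inner_diff_right)
  also have "\<dots> = (LINT \<omega>|M. ?J \<omega> \<bullet> ?J \<omega>) - (LINT \<omega>|M. ?J \<omega> \<bullet> ?J' \<omega>)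
      - (LINT \<omega>|M. ?J' \<omega> \<bullet> ?J \<omega>) + (LINT \<omega>|M. ?J' \<omega> \<bullet> ?J' \<omega>)"
    by (simp only: Bochner_Integration.integral_add Bochner_Integration.integral_diff
       Bochner_Integration.integrable_add Bochner_Integration.integrable_diff Ji)
  also have "\<dots> = (LINT x|TM. ?ind ?p x \<bullet> ?p x) - (LINT x|TM. ?ind ?p x \<bullet> ?p' x)
      - (LINT x|TM. ?ind ?p' x \<bullet> ?p x) + (LINT x|TM. ?ind ?p' x \<bullet> ?p' x)"
    by (simp only: iso S S')
  also have "\<dots> = (LINT x|TM. ?ind ?p x \<bullet> ?p x - ?ind ?p x \<bullet> ?p' x - ?ind ?p' x \<bullet> ?p x + ?ind ?p' x \<bullet> ?p' x)"
    by (simp only: Bochner_Integration.integral_add Bochner_Integration.integral_diff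
       Bochner_Integration.integrable_add Bochner_Integration.integrable_diff pi)
  also have "\<dots> \<le> (LINT x|TM. (norm (?p x - ?p' x))\<^sup>2)"
  proof (intro integral_mono Bochner_Integration.integrable_add Bochner_Integration.integrable_diff pi
        square_integrableD(2)[OF d])
    fix x
    have "?ind ?p x \<bullet> ?p x - ?ind ?p x \<bullet> ?p' x - ?ind ?p' x \<bullet> ?p x + ?ind ?p' x \<bullet> ?p' x
       = indicator {..t} (fst x) * (norm (?p x - ?p' x))\<^sup>2"
      by (cases x) (simp add: power2_norm_eq_inner inner_diff_left inner_diff_right algebra_simps)
    also have "\<dots> \<le> (norm (?p x - ?p' x))\<^sup>2" by (simp add: indicator_def)
    finally show "?ind ?p x \<bullet> ?p x - ?ind ?p x \<bullet> ?p' x - ?ind ?p' x \<bullet> ?p x + ?ind ?p' x \<bullet> ?p' x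
      \<le> (norm (?p x - ?p' x))\<^sup>2" .
  qed
  finally have "(LINT \<omega>|M. (norm (?J \<omega> - ?J' \<omega>))\<^sup>2) \<le> (LINT x|TM. (norm (?p x - ?p' x))\<^sup>2)" .
  then have "ennreal (LINT \<omega>|M. (norm (?J \<omega> - ?J' \<omega>))\<^sup>2) \<le> ennreal (LINT x|TM. (norm (?p x - ?p' x))\<^sup>2)"
    by (rule ennreal_leI)
  also have "ennreal (LINT \<omega>|M. (norm (?J \<omega> - ?J' \<omega>))\<^sup>2) = (\<integral>\<^sup>+\<omega>. ennreal ((norm (?J \<omega> - ?J' \<omega>))\<^sup>2) \<partial>M)"
    using square_integrableD(2)[OF dJ] by (intro nn_integral_eq_integral[symmetric]) auto
  also have "ennreal (LINT x|TM. (norm (?p x - ?p' x))\<^sup>2) = (\<integral>\<^sup>+x. ennreal ((norm (?p x - ?p' x))\<^sup>2) \<partial>TM)"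
    using square_integrableD(2)[OF d] by (intro nn_integral_eq_integral[symmetric]) auto
  finally show ?thesis .
qed

text \<open>Two sequences that approximate \<open>k\<close> are close to each other, and then so are their integrals. One
  sequence therefore serves for all times \<open>t\<close> at once.\<close>

lemma ito_integral_any_approximation:
  fixes k :: "real \<Rightarrow> 'a \<Rightarrow> real ^ 'd ^ 'n"
  assumes I: "has_ito_integral M w T k t I" and t: "t \<in> {0..T}"
    and S: "\<And>j. simple_integrand M w T (m j) (ts j) (\<xi> j)"
    and lim: "L2_tendsto TM (\<lambda>j. process (m j) (ts j) (\<xi> j)) (\<lambda>(s, \<omega>). k s \<omega>)"
  shows "L2_tendsto M (\<lambda>j. simple_integral w (m j) (ts j) (\<xi> j) t) I"
proof -
  obtain m' ts' \<xi>' where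
    a: "\<And>j. simple_integrand M w T (m' j) (ts' j) (\<xi>' j)"
    "L2_tendsto TM (\<lambda>j. process (m' j) (ts' j) (\<xi>' j)) (\<lambda>(s, \<omega>). k s \<omega>)"
    "L2_tendsto M (\<lambda>j. simple_integral w (m' j) (ts' j) (\<xi>' j) t) I"
    by (rule ito_approximation[OF I]) blast
  let ?\<phi> = "\<lambda>j. process (m j) (ts j) (\<xi> j)" and ?\<phi>' = "\<lambda>j. process (m' j) (ts' j) (\<xi>' j)"
  let ?k = "\<lambda>(s, \<omega>). k s \<omega>"
  let ?J = "\<lambda>j. simple_integral w (m j) (ts j) (\<xi> j) t" and ?J' = "\<lambda>j. simple_integral w (m' j) (ts' j) (\<xi>' j) t"
  note sm = square_integrableD(1)[OF process_square_integrable[OF S]]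
    square_integrableD(1)[OF process_square_integrable[OF a(1)]]
    square_integrableD(1)[OF ito_integrand(2)[OF I]]
  have "(\<lambda>j. 2 * (\<integral>\<^sup>+x. ennreal ((norm (?\<phi> j x - ?k x))\<^sup>2) \<partial>TM)
     + 2 * (\<integral>\<^sup>+x. ennreal ((norm (?\<phi>' j x - ?k x))\<^sup>2) \<partial>TM)) \<longlonglongrightarrow> 2 * 0 + 2 * 0"
    using lim a(2) unfolding L2_tendsto_def by (intro tendsto_add ennreal_tendsto_cmult) auto
  then have z: "(\<lambda>j. 2 * (\<integral>\<^sup>+x. ennreal ((norm (?\<phi> j x - ?k x))\<^sup>2) \<partial>TM)
     + 2 * (\<integral>\<^sup>+x. ennreal ((norm (?\<phi>' j x - ?k x))\<^sup>2) \<partial>TM)) \<longlonglongrightarrow> 0" by simp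
  have le: "(\<integral>\<^sup>+\<omega>. ennreal ((norm (?J j \<omega> - ?J' j \<omega>))\<^sup>2) \<partial>M)
      \<le> 2 * (\<integral>\<^sup>+x. ennreal ((norm (?\<phi> j x - ?k x))\<^sup>2) \<partial>TM)
     + 2 * (\<integral>\<^sup>+x. ennreal ((norm (?\<phi>' j x - ?k x))\<^sup>2) \<partial>TM)" for j
    using order_trans[OF simple_integral_diff_le[OF S a(1) t] nn_integral_norm_diff_triangle[OF sm(1,3,2)], of j j]
    by (simp only: norm_minus_commute[of "?k _" "?\<phi>' _ _"])
  have "(\<lambda>j. \<integral>\<^sup>+\<omega>. ennreal ((norm (?J j \<omega> - ?J' j \<omega>))\<^sup>2) \<partial>M) \<longlonglongrightarrow> 0"
    using z by (rule tendsto_sandwich[OF _ _ tendsto_const, rotated 2]) (auto intro!: always_eventually le)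
  then show ?thesis
    by (rule L2_tendsto_trans[OF _ a(3)])
      (use I in \<open>auto simp: has_ito_integral_def intro: square_integrableD(1) simple_integral_square_integrable S a(1) t\<close>)
qed

text \<open>The martingale property: the increment after \<open>t\<close> is orthogonal to the past. One approximating
  sequence has to be used for both times.\<close>

lemma ito_orthogonal:
  fixes k :: "real \<Rightarrow> 'a \<Rightarrow> real ^ 'd ^ 'n"
  assumes I: "has_ito_integral M w T k t I" and I': "has_ito_integral M w T k t' I'"
    and t: "0 \<le> t" "t \<le> t'" "t' \<le> T"
    and \<eta>: "\<eta> \<in> borel_measurable (F t)" "square_integrable M \<eta>"
  shows "(LINT \<omega>|M. (I' \<omega> - I \<omega>) \<bullet> \<eta> \<omega>) = 0"
proof -
  have tT: "t \<in> {0..T}" "t' \<in> {0..T}" using t by auto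
  obtain m ts \<xi> where
    a: "\<And>j. simple_integrand M w T (m j) (ts j) (\<xi> j)"
    "L2_tendsto TM (\<lambda>j. process (m j) (ts j) (\<xi> j)) (\<lambda>(s, \<omega>). k s \<omega>)"
    "L2_tendsto M (\<lambda>j. simple_integral w (m j) (ts j) (\<xi> j) t) I"
    by (rule ito_approximation[OF I]) blast
  note a' = ito_integral_any_approximation[OF I' tT(2) a(1,2)]
  let ?J = "\<lambda>t j. simple_integral w (m j) (ts j) (\<xi> j) t"
  have c: "L2_tendsto M (\<lambda>j. \<eta>) \<eta>" by (simp add: L2_tendsto_def)
  note sq = simple_integral_square_integrable[OF a(1) tT(1)] simple_integral_square_integrable[OF a(1) tT(2)]
    ito_square_integrable[OF I tT(1)] ito_square_integrable[OF I' tT(2)]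
  have "(\<lambda>j. (LINT \<omega>|M. ?J t' j \<omega> \<bullet> \<eta> \<omega>) - (LINT \<omega>|M. ?J t j \<omega> \<bullet> \<eta> \<omega>))
      \<longlonglongrightarrow> (LINT \<omega>|M. I' \<omega> \<bullet> \<eta> \<omega>) - (LINT \<omega>|M. I \<omega> \<bullet> \<eta> \<omega>)"
    by (intro tendsto_diff L2_tendsto_inner a' a(3) c \<eta>(2) sq)
  moreover have "(LINT \<omega>|M. ?J t' j \<omega> \<bullet> \<eta> \<omega>) - (LINT \<omega>|M. ?J t j \<omega> \<bullet> \<eta> \<omega>) = 0" for j
    using simple_integral_orthogonal[OF a(1) t \<eta>, of j]
      Bochner_Integration.integral_diff[OF square_integrable_inner(2)[OF sq(2)[of j] \<eta>(2)] square_integrable_inner(2)[OF sq(1)[of j] \<eta>(2)]]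
    by (simp add: inner_diff_left)
  ultimately have "(LINT \<omega>|M. I' \<omega> \<bullet> \<eta> \<omega>) - (LINT \<omega>|M. I \<omega> \<bullet> \<eta> \<omega>) = 0"
    by (simp add: LIMSEQ_const_iff)
  then show ?thesis
    using Bochner_Integration.integral_diff[OF square_integrable_inner(2)[OF sq(4) \<eta>(2)] square_integrable_inner(2)[OF sq(3) \<eta>(2)]]
    by (simp add: inner_diff_left)
qed

text \<open>The limit of a subsequence is a version that is adapted.\<close>

lemma ito_F_measurable:
  fixes k :: "real \<Rightarrow> 'a \<Rightarrow> real ^ 'd ^ 'n"
  assumes I: "has_ito_integral M w T k t I" and t: "t \<in> {0..T}"
  shows "I \<in> borel_measurable (F t)"
proof -
  obtain m ts \<xi> where
    a: "\<And>j. simple_integrand M w T (m j) (ts j) (\<xi> j)"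
    "L2_tendsto TM (\<lambda>j. process (m j) (ts j) (\<xi> j)) (\<lambda>(s, \<omega>). k s \<omega>)"
    "L2_tendsto M (\<lambda>j. simple_integral w (m j) (ts j) (\<xi> j) t) I"
    by (rule ito_approximation[OF I]) blast
  note sq = simple_integral_square_integrable[OF a(1) t] ito_square_integrable[OF I t]
  from L2_tendsto_AE_subseq[OF a(3) sq] obtain r where
    r: "AE \<omega> in M. (\<lambda>n. simple_integral w (m (r n)) (ts (r n)) (\<xi> (r n)) t \<omega>) \<longlonglongrightarrow> I \<omega>" by blast
  show ?thesis
  proof (rule F_measurable_AE_eq)
    show "(\<lambda>\<omega>. lim (\<lambda>n. simple_integral w (m (r n)) (ts (r n)) (\<xi> (r n)) t \<omega>)) \<in> borel_measurable (F t)"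
      by (intro borel_measurable_lim_metric simple_integral_F_measurable a(1) t)
    show "AE \<omega> in M. lim (\<lambda>n. simple_integral w (m (r n)) (ts (r n)) (\<xi> (r n)) t \<omega>) = I \<omega>"
      using r by eventually_elim (rule limI)
  qed (use t square_integrableD(1)[OF sq(2)] in auto)
qed

text \<open>A constant matrix commutes with the integral, because it does so for simple processes.\<close>

lemma ito_matrix_mult:
  fixes k :: "real \<Rightarrow> 'a \<Rightarrow> real ^ 'd ^ 'n" and P :: "real ^ 'n ^ 'n"
  assumes I: "has_ito_integral M w T k t I" and t: "t \<in> {0..T}"
  shows "has_ito_integral M w T (\<lambda>s \<omega>. P ** k s \<omega>) t (\<lambda>\<omega>. P *v I \<omega>)"
proof -
  note k = ito_integrand[OF I]
  note km = adapted_processD[OF k(1)]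
  note bbm = bounded_bilinear_matrix_mult and bb = bounded_bilinear_matrix_vector_mult
  have [measurable]: "I \<in> borel_measurable M" by (rule square_integrableD(1)[OF ito_square_integrable[OF I t]])
  obtain m ts \<xi> where
    a: "\<And>j. simple_integrand M w T (m j) (ts j) (\<xi> j)"
    "L2_tendsto TM (\<lambda>j. process (m j) (ts j) (\<xi> j)) (\<lambda>(s, \<omega>). k s \<omega>)"
    "L2_tendsto M (\<lambda>j. simple_integral w (m j) (ts j) (\<xi> j) t) I"
    by (rule ito_approximation[OF I]) blast
  have Pk_m: "(\<lambda>x. P ** (case x of (s, \<omega>) \<Rightarrow> k s \<omega>)) \<in> borel_measurable TM"
    by (intro matrix_mult_borel km(1)) simp
  show ?thesis
  proof (rule has_ito_integralI[of _ _ m ts "\<lambda>j i \<omega>. P ** \<xi> j i \<omega>"])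
    show "adapted_process M w T (\<lambda>s \<omega>. P ** k s \<omega>)"
      unfolding adapted_process_def
    proof (intro conjI ballI)
      show "(\<lambda>(s, \<omega>). P ** k s \<omega>) \<in> borel_measurable TM" using Pk_m by (simp add: split_beta')
      show "(\<lambda>\<omega>. P ** k t \<omega>) \<in> borel_measurable (F t)" if "t \<in> {0..T}" for t
        by (intro matrix_mult_borel km(2) that) simp
    qed
    show "square_integrable TM (\<lambda>(s, \<omega>). P ** k s \<omega>)"
      by (rule square_integrable_bound[OF k(2), of _ "norm P"])
        (use Pk_m norm_matrix_mult_le in \<open>auto simp: split_beta'\<close>)
    show "(\<lambda>\<omega>. P *v I \<omega>) \<in> borel_measurable M" by measurable
    show "simple_integrand M w T (m j) (ts j) (\<lambda>i \<omega>. P ** \<xi> j i \<omega>)" for j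
    proof -
      note S = a(1)[of j, unfolded simple_integrand_def]
      from S obtain C where C: "\<forall>i<m j. \<forall>\<omega>\<in>space M. norm (\<xi> j i \<omega>) \<le> C" by blast
      have "norm (P ** \<xi> j i \<omega>) \<le> norm P * C" if "i < m j" "\<omega> \<in> space M" for i \<omega>
        using C that by (intro order_trans[OF norm_matrix_mult_le] mult_left_mono) auto
      moreover have "(\<lambda>\<omega>. P ** \<xi> j i \<omega>) \<in> borel_measurable (F (ts j i))" if "i < m j" for i
        using S that by (intro matrix_mult_borel) auto
      ultimately show ?thesis using S unfolding simple_integrand_def by blast
    qed
    have p: "process (m j) (ts j) (\<lambda>i \<omega>. P ** \<xi> j i \<omega>) x = P ** process (m j) (ts j) (\<xi> j) x" for j x
      by (simp add: process_def split_beta' simple_process_def bounded_bilinear.sum_right[OF bbm]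
          bounded_bilinear.scaleR_right[OF bbm])
    show "L2_tendsto TM (\<lambda>j. process (m j) (ts j) (\<lambda>i \<omega>. P ** \<xi> j i \<omega>)) (\<lambda>(s, \<omega>). P ** k s \<omega>)"
    proof (rule L2_tendsto_dominated[OF a(2), of _ _ "norm P"])
      fix j x
      have "process (m j) (ts j) (\<lambda>i \<omega>. P ** \<xi> j i \<omega>) x - (case x of (s, \<omega>) \<Rightarrow> P ** k s \<omega>)
         = P ** (process (m j) (ts j) (\<xi> j) x - (case x of (s, \<omega>) \<Rightarrow> k s \<omega>))"
        by (simp add: p split_beta' bounded_bilinear.diff_right[OF bbm])
      then show "norm (process (m j) (ts j) (\<lambda>i \<omega>. P ** \<xi> j i \<omega>) x - (case x of (s, \<omega>) \<Rightarrow> P ** k s \<omega>))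
         \<le> norm P * norm (process (m j) (ts j) (\<xi> j) x - (case x of (s, \<omega>) \<Rightarrow> k s \<omega>))"
        by (simp only: norm_matrix_mult_le)
    qed (use km(1) square_integrableD(1)[OF process_square_integrable[OF a(1)]] in auto)
    have q: "simple_integral w (m j) (ts j) (\<lambda>i \<omega>. P ** \<xi> j i \<omega>) t \<omega> = P *v simple_integral w (m j) (ts j) (\<xi> j) t \<omega>" for j \<omega>
      by (simp add: simple_integral_def bounded_bilinear.sum_right[OF bb] matrix_vector_mul_assoc)
    show "L2_tendsto M (\<lambda>j. simple_integral w (m j) (ts j) (\<lambda>i \<omega>. P ** \<xi> j i \<omega>) t) (\<lambda>\<omega>. P *v I \<omega>)"
      by (rule L2_tendsto_dominated[OF a(3), of _ _ "norm P"])
        (auto simp: q matrix_vector_mult_diff_distrib[symmetric] norm_matrix_vector_mult_le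
          intro!: square_integrableD(1)[OF simple_integral_square_integrable[OF a(1) t]])
  qed
qed

end

section \<open>Continuous versions of the stochastic integral\<close>

context wiener_space
begin

text \<open>Kolmogorov's inequality. Stop at the first grid point where the bound is exceeded: what happens
  later is orthogonal to the past, so the second moment at \<open>T\<close> cannot be smaller than the one at that
  point.\<close>

lemma maximal_inequality:
  fixes D :: "real \<Rightarrow> 'a \<Rightarrow> real ^ 'n" and g :: "nat \<Rightarrow> real"
  assumes D: "\<And>t. t \<in> {0..T} \<Longrightarrow> D t \<in> borel_measurable (F t)"
    and sq: "\<And>t. t \<in> {0..T} \<Longrightarrow> square_integrable M (D t)"
    and orth: "\<And>t \<eta>. t \<in> {0..T} \<Longrightarrow> \<eta> \<in> borel_measurable (F t) \<Longrightarrow> square_integrable M \<eta>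
        \<Longrightarrow> (LINT \<omega>|M. (D T \<omega> - D t \<omega>) \<bullet> \<eta> \<omega>) = 0"
    and g: "\<And>i. i \<le> N \<Longrightarrow> g i \<in> {0..T}" "\<And>i j. i \<le> j \<Longrightarrow> j \<le> N \<Longrightarrow> g i \<le> g j"
    and l: "0 < l"
  shows "l\<^sup>2 * prob {\<omega>\<in>space M. \<exists>i\<le>N. l \<le> norm (D (g i) \<omega>)} \<le> (LINT \<omega>|M. (norm (D T \<omega>))\<^sup>2)"
proof -
  have TT: "T \<in> {0..T}" using T_pos by auto
  \<comment> \<open>The bound is exceeded at the grid point \<open>i\<close> for the first time.\<close>
  define A where "A i = {\<omega>\<in>space M. l \<le> norm (D (g i) \<omega>) \<and> (\<forall>j<i. norm (D (g j) \<omega>) < l)}" for i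
  have A_F: "A i \<in> sets (F (g i))" if "i \<le> N" for i
  proof -
    have m: "D (g j) \<in> borel_measurable (F (g i))" if "j \<le> i" for j
      using F_measurable_mono[OF D[OF g(1)] g(2)] that \<open>i \<le> N\<close> by simp
    have "{\<omega>\<in>space (F (g i)). l \<le> norm (D (g i) \<omega>) \<and> (\<forall>j\<in>{..<i}. norm (D (g j) \<omega>) < l)} \<in> sets (F (g i))"
      using m[of i] m by (intro sets.sets_Collect_conj sets.sets_Collect_finite_All
          borel_measurable_le borel_measurable_less borel_measurable_norm borel_measurable_const) auto
    then show ?thesis by (simp only: A_def Ball_def lessThan_iff space_F)
  qed
  have A_M: "A i \<in> sets M" if "i \<le> N" for i
    using A_F[OF that] sets_F_subset[of "g i"] g(1)[OF that] by auto
  have disj: "disjoint_family_on A {..N}"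
    unfolding disjoint_family_on_def
  proof (intro ballI impI)
    fix i j :: nat assume "i \<noteq> j"
    then consider "i < j" | "j < i" by linarith
    then show "A i \<inter> A j = {}" by cases (force simp: A_def)+
  qed
  have U: "{\<omega>\<in>space M. \<exists>i\<le>N. l \<le> norm (D (g i) \<omega>)} = (\<Union>i\<in>{..N}. A i)"
  proof (intro equalityI subsetI)
    fix \<omega> assume "\<omega> \<in> {\<omega>\<in>space M. \<exists>i\<le>N. l \<le> norm (D (g i) \<omega>)}"
    then have w: "\<omega> \<in> space M" "\<exists>i. i \<le> N \<and> l \<le> norm (D (g i) \<omega>)" by auto
    define i where "i = (LEAST i. i \<le> N \<and> l \<le> norm (D (g i) \<omega>))"
    have "i \<le> N \<and> l \<le> norm (D (g i) \<omega>)" unfolding i_def using w(2) by (rule LeastI_ex)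
    moreover have "norm (D (g j) \<omega>) < l" if "j < i" for j
      using not_less_Least[OF that[unfolded i_def]] that calculation by auto
    ultimately show "\<omega> \<in> (\<Union>i\<in>{..N}. A i)" using w(1) by (auto simp: A_def)
  qed (auto simp: A_def)
  let ?E = "\<lambda>i. LINT \<omega>|M. indicator (A i) \<omega> * (norm (D T \<omega>))\<^sup>2"
  have int: "integrable M (\<lambda>\<omega>. indicat_real (A i) \<omega> * (norm (D T \<omega>))\<^sup>2)" if "i \<le> N" for i
    using integrable_mult_indicator[OF A_M[OF that] square_integrableD(2)[OF sq[OF TT]]] by simp
  have le: "l\<^sup>2 * prob (A i) \<le> ?E i" if i: "i \<le> N" for i
  proof -
    define \<eta> where "\<eta> \<omega> = indicat_real (A i) \<omega> *\<^sub>R D (g i) \<omega>" for \<omega>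
    have \<eta>F: "\<eta> \<in> borel_measurable (F (g i))"
      unfolding \<eta>_def using A_F[OF i] D[OF g(1)[OF i]] by (intro borel_measurable_scaleR) auto
    have \<eta>: "square_integrable M \<eta>"
      by (rule square_integrable_bound[OF sq[OF g(1)[OF i]], of _ 1])
        (use F_measurable_M[OF \<eta>F] g(1)[OF i] in \<open>auto simp: \<eta>_def indicator_def\<close>)
    have d: "square_integrable M (\<lambda>\<omega>. D T \<omega> - D (g i) \<omega>)"
      by (intro square_integrable_diff sq g(1) i TT)
    have o: "(LINT \<omega>|M. (D T \<omega> - D (g i) \<omega>) \<bullet> \<eta> \<omega>) = 0"
      by (rule orth[OF g(1)[OF i] \<eta>F \<eta>])
    have "l\<^sup>2 * prob (A i) = (LINT \<omega>|M. l\<^sup>2 * indicator (A i) \<omega>)"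
      using A_M[OF i] by simp
    also have "\<dots> \<le> (LINT \<omega>|M. indicator (A i) \<omega> * (norm (D T \<omega>))\<^sup>2 - 2 * ((D T \<omega> - D (g i) \<omega>) \<bullet> \<eta> \<omega>))"
    proof (rule integral_mono)
      show "integrable M (\<lambda>\<omega>. l\<^sup>2 * indicator (A i) \<omega>)"
        using A_M[OF i] by (simp add: less_top[symmetric])
      show "integrable M (\<lambda>\<omega>. indicator (A i) \<omega> * (norm (D T \<omega>))\<^sup>2 - 2 * ((D T \<omega> - D (g i) \<omega>) \<bullet> \<eta> \<omega>))"
        by (intro Bochner_Integration.integrable_diff int i integrable_mult_right square_integrable_inner(2) d \<eta>)
      fix \<omega>
      show "l\<^sup>2 * indicator (A i) \<omega> \<le> indicator (A i) \<omega> * (norm (D T \<omega>))\<^sup>2 - 2 * ((D T \<omega> - D (g i) \<omega>) \<bullet> \<eta> \<omega>)"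
      proof (cases "\<omega> \<in> A i")
        case True
        then have "l\<^sup>2 \<le> (norm (D (g i) \<omega>))\<^sup>2" using l by (intro power_mono) (auto simp: A_def)
        also have "\<dots> \<le> (norm (D (g i) \<omega>))\<^sup>2 + (norm (D T \<omega> - D (g i) \<omega>))\<^sup>2" by simp
        also have "\<dots> = (norm (D T \<omega>))\<^sup>2 - 2 * ((D T \<omega> - D (g i) \<omega>) \<bullet> D (g i) \<omega>)"
          by (simp add: power2_norm_eq_inner inner_diff_left inner_diff_right inner_commute)
        finally show ?thesis using True by (simp add: \<eta>_def)
      qed (simp add: \<eta>_def)
    qed
    also have "\<dots> = ?E i"
      using int[OF i] square_integrable_inner(2)[OF d \<eta>] o by simp
    finally show ?thesis .
  qed
  have "l\<^sup>2 * prob {\<omega>\<in>space M. \<exists>i\<le>N. l \<le> norm (D (g i) \<omega>)} = (\<Sum>i\<le>N. l\<^sup>2 * prob (A i))"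
    unfolding U using A_M disj
    by (subst finite_measure_finite_Union) (auto simp: sum_distrib_left)
  also have "\<dots> \<le> (\<Sum>i\<le>N. ?E i)" by (intro sum_mono le) simp
  also have "\<dots> = (LINT \<omega>|M. (\<Sum>i\<le>N. indicator (A i) \<omega> * (norm (D T \<omega>))\<^sup>2))"
    using int by (intro Bochner_Integration.integral_sum[symmetric]) auto
  also have "\<dots> \<le> (LINT \<omega>|M. (norm (D T \<omega>))\<^sup>2)"
  proof (rule integral_mono)
    show "integrable M (\<lambda>\<omega>. \<Sum>i\<le>N. indicator (A i) \<omega> * (norm (D T \<omega>))\<^sup>2)"
      using int by (intro Bochner_Integration.integrable_sum) auto
    show "integrable M (\<lambda>\<omega>. (norm (D T \<omega>))\<^sup>2)" by (rule square_integrableD(2)[OF sq[OF TT]])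
    fix \<omega>
    have "(\<Sum>i\<le>N. indicator (A i) \<omega> :: real) = indicator (\<Union>i\<in>{..N}. A i) \<omega>"
      by (rule indicator_UN_disjoint[symmetric]) (auto simp: disj)
    then show "(\<Sum>i\<le>N. indicator (A i) \<omega> * (norm (D T \<omega>))\<^sup>2) \<le> (norm (D T \<omega>))\<^sup>2"
      by (simp add: sum_distrib_right[symmetric] indicator_def)
  qed
  finally show ?thesis .
qed

definition dyadic :: "nat \<Rightarrow> nat \<Rightarrow> real" where "dyadic n i = real i * T / 2 ^ n"

lemma dyadic_mem: "i \<le> 2 ^ n \<Longrightarrow> dyadic n i \<in> {0..T}"
proof -
  assume "i \<le> 2 ^ n"
  then have "real i \<le> 2 ^ n" by (metis of_nat_le_iff of_nat_numeral of_nat_power)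
  then have "real i * T \<le> 2 ^ n * T" using T_pos by (intro mult_right_mono) auto
  then show ?thesis using T_pos by (simp add: dyadic_def field_simps)
qed

text \<open>The dyadic grids increase with \<open>n\<close>, so the bound survives the union over all of them.\<close>

lemma maximal_inequality_dyadic:
  fixes D :: "real \<Rightarrow> 'a \<Rightarrow> real ^ 'n"
  assumes D: "\<And>t. t \<in> {0..T} \<Longrightarrow> D t \<in> borel_measurable (F t)"
    and sq: "\<And>t. t \<in> {0..T} \<Longrightarrow> square_integrable M (D t)"
    and orth: "\<And>t \<eta>. t \<in> {0..T} \<Longrightarrow> \<eta> \<in> borel_measurable (F t) \<Longrightarrow> square_integrable M \<eta>
        \<Longrightarrow> (LINT \<omega>|M. (D T \<omega> - D t \<omega>) \<bullet> \<eta> \<omega>) = 0"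
    and l: "0 < l"
  defines "B \<equiv> {\<omega>\<in>space M. \<exists>n. \<exists>i\<le>2^n. l \<le> norm (D (dyadic n i) \<omega>)}"
  shows "B \<in> sets M" "prob B \<le> (LINT \<omega>|M. (norm (D T \<omega>))\<^sup>2) / l\<^sup>2"
proof -
  define C where "C n = {\<omega>\<in>space M. \<exists>i\<le>2^n. l \<le> norm (D (dyadic n i) \<omega>)}" for n :: nat
  have Dm: "D t \<in> borel_measurable M" if "t \<in> {0..T}" for t by (rule square_integrableD(1)[OF sq[OF that]])
  have C: "C n \<in> sets M" for n
  proof -
    have "{\<omega>\<in>space M. \<exists>i\<in>{..2^n}. l \<le> norm (D (dyadic n i) \<omega>)} \<in> sets M"
      using Dm dyadic_mem by (intro sets.sets_Collect_finite_Ex borel_measurable_le borel_measurable_norm) auto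
    moreover have "C n = {\<omega>\<in>space M. \<exists>i\<in>{..2^n}. l \<le> norm (D (dyadic n i) \<omega>)}"
      by (auto simp only: C_def atMost_iff)
    ultimately show ?thesis by (simp only:)
  qed
  have B: "B = (\<Union>n. C n)" by (auto simp: B_def C_def)
  show "B \<in> sets M" unfolding B using C by auto
  have inc: "incseq C"
  proof (rule incseq_SucI, rule subsetI)
    fix n \<omega> assume "\<omega> \<in> C n"
    then obtain i where i: "\<omega> \<in> space M" "i \<le> 2^n" "l \<le> norm (D (dyadic n i) \<omega>)" by (auto simp: C_def)
    have "dyadic (Suc n) (2 * i) = dyadic n i" by (simp add: dyadic_def)
    then show "\<omega> \<in> C (Suc n)" using i by (auto simp: C_def intro!: exI[of _ "2 * i"])
  qed
  have "prob (C n) \<le> (LINT \<omega>|M. (norm (D T \<omega>))\<^sup>2) / l\<^sup>2" for n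
  proof -
    have "dyadic n i \<le> dyadic n j" if "i \<le> j" for i j
      using that T_pos by (auto simp: dyadic_def intro!: divide_right_mono mult_right_mono)
    then have "l\<^sup>2 * prob (C n) \<le> (LINT \<omega>|M. (norm (D T \<omega>))\<^sup>2)"
      unfolding C_def by (intro maximal_inequality[where g="dyadic n"] D sq orth l dyadic_mem) auto
    then show ?thesis using l by (simp add: field_simps)
  qed
  moreover have "(\<lambda>n. prob (C n)) \<longlonglongrightarrow> prob B"
    unfolding B using C inc by (intro finite_Lim_measure_incseq) auto
  ultimately show "prob B \<le> (LINT \<omega>|M. (norm (D T \<omega>))\<^sup>2) / l\<^sup>2"
    by (intro LIMSEQ_le_const2) auto
qed

definition dyadic_index :: "nat \<Rightarrow> real \<Rightarrow> nat" where "dyadic_index n t = nat \<lfloor>t * 2 ^ n / T\<rfloor>"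

lemma dyadic_index:
  assumes t: "t \<in> {0..T}"
  shows "dyadic_index n t \<le> 2 ^ n" "(\<lambda>n. dyadic n (dyadic_index n t)) \<longlonglongrightarrow> t"
proof -
  define i where "i n = dyadic_index n t" for n
  have pos: "0 \<le> t * 2 ^ n / T" for n :: nat using t T_pos by auto
  have i_le: "real (i n) \<le> t * 2 ^ n / T" and i_gt: "t * 2 ^ n / T < real (i n) + 1" for n
    using pos[of n] by (simp_all add: i_def dyadic_index_def)
  have i2: "i n \<le> 2 ^ n" for n
  proof -
    have "t * 2 ^ n / T \<le> 2 ^ n" using t T_pos by (simp add: field_simps)
    then have "real (i n) \<le> 2 ^ n" using i_le[of n] by linarith
    then have "real (i n) \<le> real (2 ^ n)" by (simp only: of_nat_power of_nat_numeral)
    then show ?thesis by (simp only: of_nat_le_iff)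
  qed
  have "\<bar>dyadic n (i n) - t\<bar> \<le> T * (1/2) ^ n" for n
  proof -
    have "\<bar>real (i n) * T - t * 2 ^ n\<bar> \<le> T"
      using i_le[of n] i_gt[of n] T_pos by (simp add: abs_le_iff field_simps)
    then have "\<bar>real (i n) * T - t * 2 ^ n\<bar> / 2 ^ n \<le> T / 2 ^ n" by (rule divide_right_mono) simp
    moreover have "dyadic n (i n) - t = (real (i n) * T - t * 2 ^ n) / 2 ^ n"
      by (simp add: dyadic_def diff_divide_distrib)
    ultimately show ?thesis by (simp add: abs_divide power_one_over)
  qed
  then have bound: "norm (dyadic n (i n) - t) \<le> T * (1/2) ^ n" for n
    by (simp only: real_norm_def)
  have "(\<lambda>n. T * (1/2) ^ n) \<longlonglongrightarrow> 0"
    by (intro tendsto_mult_right_zero LIMSEQ_power_zero) simp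
  then have "(\<lambda>n. dyadic n (i n) - t) \<longlonglongrightarrow> 0"
    by (rule Lim_null_comparison[OF always_eventually[OF allI[OF bound]]])
  then have "(\<lambda>n. dyadic n (i n)) \<longlonglongrightarrow> t" by (simp add: LIM_zero_iff)
  then show "(\<lambda>n. dyadic n (dyadic_index n t)) \<longlonglongrightarrow> t" by (simp only: i_def)
  show "dyadic_index n t \<le> 2 ^ n" using i2[of n] by (simp only: i_def)
qed

lemma dyadic_bound_continuous:
  fixes x :: "real \<Rightarrow> 'b::real_normed_vector"
  assumes x: "continuous_on {0..T} x" and bd: "\<And>n i. i \<le> 2^n \<Longrightarrow> norm (x (dyadic n i)) \<le> l"
    and t: "t \<in> {0..T}"
  shows "norm (x t) \<le> l"
proof -
  have "(\<lambda>n. x (dyadic n (dyadic_index n t))) \<longlonglongrightarrow> x t"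
    by (rule continuous_on_tendsto_compose[OF x dyadic_index(2)[OF t] t])
      (use dyadic_mem[OF dyadic_index(1)[OF t]] in auto)
  then have "(\<lambda>n. norm (x (dyadic n (dyadic_index n t)))) \<longlonglongrightarrow> norm (x t)" by (rule tendsto_norm)
  then show ?thesis by (rule LIMSEQ_le_const2) (use bd[OF dyadic_index(1)[OF t]] in auto)
qed

text \<open>Membership in the closure of the simple processes, phrased with one process for each error. In this
  form closedness under limits is a triangle inequality.\<close>

definition approximable :: "(real \<Rightarrow> 'a \<Rightarrow> real ^ 'd ^ 'n) \<Rightarrow> bool" where
  "approximable k \<longleftrightarrow> (\<forall>e>0. \<exists>m ts \<xi>. simple_integrand M w T m ts \<xi> \<and>
      (\<integral>\<^sup>+x. ennreal ((norm (process m ts \<xi> x - (case x of (s, \<omega>) \<Rightarrow> k s \<omega>)))\<^sup>2) \<partial>TM) \<le> ennreal e)"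

lemma simple_integral_continuous:
  fixes \<xi> :: "nat \<Rightarrow> 'a \<Rightarrow> real ^ 'd ^ 'n"
  assumes S: "simple_integrand M w T m ts \<xi>" and c: "continuous_on {0..T} (\<lambda>t. w t \<omega>)"
  shows "continuous_on {0..T} (\<lambda>t. simple_integral w m ts \<xi> t \<omega>)"
proof -
  note D = simple_integrandD[OF S]
  have "continuous_on {0..T} (\<lambda>t. w (min t (ts i)) \<omega>)" if "i \<le> m" for i
    by (rule continuous_on_compose2[OF c]) (use D(1,2)[OF that] in \<open>auto intro!: continuous_intros\<close>)
  then show ?thesis unfolding simple_integral_def
    by (intro continuous_on_sum bounded_bilinear.continuous_on[OF bounded_bilinear_matrix_vector_mult]
         continuous_on_const continuous_on_diff) auto
qed

text \<open>Integrals of a rapidly converging sequence of simple processes converge uniformly in time,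
  almost surely, by the maximal inequality and the Borel--Cantelli lemma.\<close>

lemma ito_continuous_version:
  fixes k :: "real \<Rightarrow> 'a \<Rightarrow> real ^ 'd ^ 'n"
  assumes k: "adapted_process M w T k" "square_integrable TM (\<lambda>(s, \<omega>). k s \<omega>)" and ap: "approximable k"
  obtains X where "\<And>\<omega>. \<omega> \<in> space M \<Longrightarrow> continuous_on {0..T} (\<lambda>t. X t \<omega>)"
    "\<And>t. t \<in> {0..T} \<Longrightarrow> has_ito_integral M w T k t (X t)"
proof -
  let ?k = "\<lambda>(s, \<omega>). k s \<omega>"
  \<comment> \<open>Chebyshev at the level \<open>(1/2)\<^sup>j\<close> then bounds the probability of a large jump by \<open>(1/4)\<^sup>j\<close>.\<close>
  define \<epsilon> :: "nat \<Rightarrow> real" where "\<epsilon> j = (1/16) ^ j / 4" for j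
  have \<epsilon>: "0 < \<epsilon> j" for j by (simp add: \<epsilon>_def)
  have \<epsilon>_mono: "\<epsilon> j \<le> \<epsilon> i" if "i \<le> j" for i j
    unfolding \<epsilon>_def using that by (intro divide_right_mono power_decreasing) auto
  have "\<forall>j. \<exists>m ts \<xi>. simple_integrand M w T m ts \<xi> \<and>
      (\<integral>\<^sup>+x. ennreal ((norm (process m ts \<xi> x - ?k x))\<^sup>2) \<partial>TM) \<le> ennreal (\<epsilon> j)"
    using ap \<epsilon> unfolding approximable_def by blast
  then have "\<exists>m ts \<xi>. \<forall>j. simple_integrand M w T (m j) (ts j) (\<xi> j) \<and>
      (\<integral>\<^sup>+x. ennreal ((norm (process (m j) (ts j) (\<xi> j) x - ?k x))\<^sup>2) \<partial>TM) \<le> ennreal (\<epsilon> j)"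
    unfolding choice_iff .
  then obtain m ts \<xi> where S: "\<And>j. simple_integrand M w T (m j) (ts j) (\<xi> j)"
    and close: "\<And>j. (\<integral>\<^sup>+x. ennreal ((norm (process (m j) (ts j) (\<xi> j) x - ?k x))\<^sup>2) \<partial>TM) \<le> ennreal (\<epsilon> j)"
    by blast
  let ?\<phi> = "\<lambda>j. process (m j) (ts j) (\<xi> j)"
  define J where "J j t \<omega> = simple_integral w (m j) (ts j) (\<xi> j) t \<omega>" for j t \<omega>
  have Jfun: "J j t = simple_integral w (m j) (ts j) (\<xi> j) t" for j t by (auto simp: J_def)
  have Jsq: "square_integrable M (J j t)" if "t \<in> {0..T}" for j t
    unfolding Jfun by (rule simple_integral_square_integrable[OF S that])
  have JF: "J j t \<in> borel_measurable (F t)" if "t \<in> {0..T}" for j t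
    unfolding Jfun by (rule simple_integral_F_measurable[OF S that])
  have Jorth: "(LINT \<omega>|M. (J j T \<omega> - J j t \<omega>) \<bullet> \<eta> \<omega>) = 0"
    if "t \<in> {0..T}" "\<eta> \<in> borel_measurable (F t)" "square_integrable M \<eta>" for j t \<eta>
    unfolding Jfun using that by (intro simple_integral_orthogonal S) auto
  have TT: "T \<in> {0..T}" using T_pos by auto
  have \<phi>m: "?\<phi> j \<in> borel_measurable TM" for j
    by (rule square_integrableD(1)[OF process_square_integrable[OF S]])
  have km: "?k \<in> borel_measurable TM" by (rule square_integrableD(1)[OF k(2)])
  have J_dist: "(\<integral>\<^sup>+\<omega>. ennreal ((norm (J i t \<omega> - J j t \<omega>))\<^sup>2) \<partial>M) \<le> ennreal (2 * \<epsilon> i + 2 * \<epsilon> j)"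
    if t: "t \<in> {0..T}" for i j t
  proof -
    have "(\<integral>\<^sup>+\<omega>. ennreal ((norm (J i t \<omega> - J j t \<omega>))\<^sup>2) \<partial>M)
       \<le> (\<integral>\<^sup>+x. ennreal ((norm (?\<phi> i x - ?\<phi> j x))\<^sup>2) \<partial>TM)"
      unfolding J_def by (rule simple_integral_diff_le[OF S S t])
    also have "\<dots> \<le> 2 * (\<integral>\<^sup>+x. ennreal ((norm (?\<phi> i x - ?k x))\<^sup>2) \<partial>TM)
        + 2 * (\<integral>\<^sup>+x. ennreal ((norm (?k x - ?\<phi> j x))\<^sup>2) \<partial>TM)"
      by (rule nn_integral_norm_diff_triangle[OF \<phi>m km \<phi>m])
    also have "\<dots> \<le> 2 * ennreal (\<epsilon> i) + 2 * ennreal (\<epsilon> j)"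
      using close[of i] close[of j] by (intro add_mono mult_left_mono) (auto simp: norm_minus_commute)
    also have "\<dots> = ennreal (2 * \<epsilon> i + 2 * \<epsilon> j)"
      using \<epsilon>[of i] \<epsilon>[of j] by (simp add: ennreal_mult' less_imp_le)
    finally show ?thesis .
  qed
  define D where "D j t \<omega> = J (Suc j) t \<omega> - J j t \<omega>" for j t \<omega>
  have Dsq: "square_integrable M (D j t)" if "t \<in> {0..T}" for j t
    unfolding D_def by (intro square_integrable_diff Jsq that)
  have DT: "(LINT \<omega>|M. (norm (D j T \<omega>))\<^sup>2) \<le> (1/16) ^ j" for j
  proof -
    have "ennreal (LINT \<omega>|M. (norm (D j T \<omega>))\<^sup>2) = (\<integral>\<^sup>+\<omega>. ennreal ((norm (D j T \<omega>))\<^sup>2) \<partial>M)"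
      using square_integrableD(2)[OF Dsq[OF TT]] by (intro nn_integral_eq_integral[symmetric]) auto
    also have "\<dots> \<le> ennreal (2 * \<epsilon> (Suc j) + 2 * \<epsilon> j)" unfolding D_def by (rule J_dist[OF TT])
    finally have "(LINT \<omega>|M. (norm (D j T \<omega>))\<^sup>2) \<le> 2 * \<epsilon> (Suc j) + 2 * \<epsilon> j"
      using \<epsilon>[of "Suc j"] \<epsilon>[of j] by (subst (asm) ennreal_le_iff) auto
    also have "\<dots> \<le> (1/16) ^ j" by (simp add: \<epsilon>_def)
    finally show ?thesis .
  qed
  define B where "B j = {\<omega>\<in>space M. \<exists>n. \<exists>i\<le>2^n. (1/2) ^ j \<le> norm (D j (dyadic n i) \<omega>)}" for j
  have B: "B j \<in> sets M \<and> prob (B j) \<le> (1/4) ^ j" for j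
  proof -
    have DF: "D j t \<in> borel_measurable (F t)" if "t \<in> {0..T}" for t
      unfolding D_def by (intro borel_measurable_diff JF that)
    have Dorth: "(LINT \<omega>|M. (D j T \<omega> - D j t \<omega>) \<bullet> \<eta> \<omega>) = 0"
      if "t \<in> {0..T}" "\<eta> \<in> borel_measurable (F t)" "square_integrable M \<eta>" for t \<eta>
    proof -
      have i: "integrable M (\<lambda>\<omega>. (J j T \<omega> - J j t \<omega>) \<bullet> \<eta> \<omega>)" for j
        by (intro square_integrable_inner(2) square_integrable_diff Jsq TT that)
      have "(LINT \<omega>|M. (D j T \<omega> - D j t \<omega>) \<bullet> \<eta> \<omega>)
        = (LINT \<omega>|M. (J (Suc j) T \<omega> - J (Suc j) t \<omega>) \<bullet> \<eta> \<omega> - (J j T \<omega> - J j t \<omega>) \<bullet> \<eta> \<omega>)"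
        by (intro Bochner_Integration.integral_cong) (auto simp: D_def inner_diff_left)
      also have "\<dots> = 0"
        by (subst Bochner_Integration.integral_diff[OF i i]) (simp add: Jorth[OF that])
      finally show ?thesis .
    qed
    have pos: "0 < (1/2::real) ^ j" by simp
    note * = maximal_inequality_dyadic[OF DF Dsq Dorth pos, folded B_def]
    have "(LINT \<omega>|M. (norm (D j T \<omega>))\<^sup>2) / ((1/2) ^ j)\<^sup>2 \<le> (1/16) ^ j / ((1/2) ^ j)\<^sup>2"
      by (intro divide_right_mono DT) simp
    also have "\<dots> = (1/4) ^ j"
    proof -
      have "((1/2::real) ^ j)\<^sup>2 = (1/4) ^ j"
        by (simp add: power2_eq_square power_mult_distrib[symmetric])
      moreover have "(1/16::real) ^ j = (1/4) ^ j * (1/4) ^ j"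
        by (simp add: power_mult_distrib[symmetric])
      ultimately show ?thesis by simp
    qed
    finally have le: "(LINT \<omega>|M. (norm (D j T \<omega>))\<^sup>2) / ((1/2) ^ j)\<^sup>2 \<le> (1/4) ^ j" .
    show ?thesis by (rule conjI[OF *(1) order_trans[OF *(2) le]])
  qed
  have "AE \<omega> in M. eventually (\<lambda>j. \<omega> \<in> space M - B j) sequentially"
  proof (rule borel_cantelli_AE1)
    show "summable (\<lambda>j. prob (B j))"
      by (rule summable_comparison_test'[of "\<lambda>j. (1/4::real) ^ j" 0])
        (use B in \<open>auto intro!: summable_geometric\<close>)
  qed (use B in \<open>auto simp: less_top[symmetric]\<close>)
  with w_continuous have "AE \<omega> in M. continuous_on {0..T} (\<lambda>t. w t \<omega>) \<and> eventually (\<lambda>j. \<omega> \<in> space M - B j) sequentially"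
    by eventually_elim auto
  from AE_E[OF this] obtain N where
    N': "{\<omega>\<in>space M. \<not> (continuous_on {0..T} (\<lambda>t. w t \<omega>) \<and> eventually (\<lambda>j. \<omega> \<in> space M - B j) sequentially)} \<subseteq> N"
      "emeasure M N = 0" "N \<in> sets M" by blast
  have N: "N \<in> null_sets M" using N' by (simp add: null_sets_def)
  have good: "continuous_on {0..T} (\<lambda>t. w t \<omega>)" "eventually (\<lambda>j. \<omega> \<in> space M - B j) sequentially"
    if "\<omega> \<in> space M - N" for \<omega>
    using that N'(1) by blast+
  have Jc: "continuous_on {0..T} (\<lambda>t. J j t \<omega>)" if "\<omega> \<in> space M - N" for j \<omega>
    unfolding J_def by (intro simple_integral_continuous S good that)
  have unif: "uniform_limit {0..T} (\<lambda>n t. J n t \<omega>) (\<lambda>t. lim (\<lambda>n. J n t \<omega>)) sequentially"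
    if \<omega>: "\<omega> \<in> space M - N" for \<omega>
  proof -
    have ev: "eventually (\<lambda>j. \<forall>t\<in>{0..T}. norm (D j t \<omega>) \<le> (1/2) ^ j) sequentially"
    proof -
      have "eventually (\<lambda>j. \<omega> \<in> space M - B j) sequentially" by (rule good(2)[OF \<omega>])
      then show ?thesis
      proof eventually_elim
        case (elim j)
        have "continuous_on {0..T} (\<lambda>t. D j t \<omega>)"
          unfolding D_def by (intro continuous_on_diff Jc \<omega>)
        moreover have "norm (D j (dyadic n i) \<omega>) \<le> (1/2) ^ j" if "i \<le> 2 ^ n" for n i
          using elim that by (force simp: B_def)
        ultimately show ?case by (auto intro: dyadic_bound_continuous)
      qed
    qed
    have "uniform_limit {0..T} (\<lambda>n t. \<Sum>j<n. D j t \<omega>) (\<lambda>t. \<Sum>j. D j t \<omega>) sequentially"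
      by (rule Weierstrass_m_test_ev[OF ev]) (simp add: summable_geometric)
    then have "uniform_limit {0..T} (\<lambda>n t. J 0 t \<omega> + (\<Sum>j<n. D j t \<omega>)) (\<lambda>t. J 0 t \<omega> + (\<Sum>j. D j t \<omega>)) sequentially"
      by (intro uniform_limit_add uniform_limit_const)
    moreover have "J 0 t \<omega> + (\<Sum>j<n. D j t \<omega>) = J n t \<omega>" for n t
      using sum_lessThan_telescope[of "\<lambda>j. J j t \<omega>" n] by (simp add: D_def)
    ultimately have u: "uniform_limit {0..T} (\<lambda>n t. J n t \<omega>) (\<lambda>t. J 0 t \<omega> + (\<Sum>j. D j t \<omega>)) sequentially"
      by simp
    have "lim (\<lambda>n. J n t \<omega>) = J 0 t \<omega> + (\<Sum>j. D j t \<omega>)" if "t \<in> {0..T}" for t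
      by (rule limI[OF tendsto_uniform_limitI[OF u that]])
    then show ?thesis using u by (subst uniform_limit_cong'[where g="\<lambda>n t. J n t \<omega>" and i="\<lambda>t. J 0 t \<omega> + (\<Sum>j. D j t \<omega>)"]) auto
  qed
  define X where "X t \<omega> = (if \<omega> \<in> N then 0 else lim (\<lambda>n. J n t \<omega>))" for t \<omega>
  have Xlim: "(\<lambda>n. J n t \<omega>) \<longlonglongrightarrow> X t \<omega>" if "\<omega> \<in> space M - N" "t \<in> {0..T}" for t \<omega>
    using tendsto_uniform_limitI[OF unif[OF that(1)] that(2)] that(1) by (simp add: X_def)
  have N_sets [measurable]: "N \<in> sets M" using N by auto
  have Xm: "X t \<in> borel_measurable M" if "t \<in> {0..T}" for t
  proof -
    have [measurable]: "J n t \<in> borel_measurable M" for n by (rule square_integrableD(1)[OF Jsq[OF that]])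
    show ?thesis unfolding X_def by measurable
  qed
  \<comment> \<open>Fatou's lemma along the pathwise limit.\<close>
  have X_dist: "(\<integral>\<^sup>+\<omega>. ennreal ((norm (J i t \<omega> - X t \<omega>))\<^sup>2) \<partial>M) \<le> ennreal (4 * \<epsilon> i)" if t: "t \<in> {0..T}" for i t
  proof -
    have [measurable]: "J n t \<in> borel_measurable M" for n by (rule square_integrableD(1)[OF Jsq[OF t]])
    have "AE \<omega> in M. \<omega> \<notin> N" by (rule AE_not_in[OF N])
    then have "AE \<omega> in M. ennreal ((norm (J i t \<omega> - X t \<omega>))\<^sup>2) = liminf (\<lambda>n. ennreal ((norm (J i t \<omega> - J n t \<omega>))\<^sup>2))"
      using AE_space
    proof eventually_elim
      case (elim \<omega>)
      then have "(\<lambda>n. ennreal ((norm (J i t \<omega> - J n t \<omega>))\<^sup>2)) \<longlonglongrightarrow> ennreal ((norm (J i t \<omega> - X t \<omega>))\<^sup>2)"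
        by (intro tendsto_ennrealI tendsto_intros Xlim t) auto
      from lim_imp_Liminf[OF _ this] show ?case by simp
    qed
    then have "(\<integral>\<^sup>+\<omega>. ennreal ((norm (J i t \<omega> - X t \<omega>))\<^sup>2) \<partial>M)
       = (\<integral>\<^sup>+\<omega>. liminf (\<lambda>n. ennreal ((norm (J i t \<omega> - J n t \<omega>))\<^sup>2)) \<partial>M)"
      by (rule nn_integral_cong_AE)
    also have "\<dots> \<le> liminf (\<lambda>n. \<integral>\<^sup>+\<omega>. ennreal ((norm (J i t \<omega> - J n t \<omega>))\<^sup>2) \<partial>M)"
      by (intro nn_integral_liminf) measurable
    also have "\<dots> \<le> limsup (\<lambda>n. \<integral>\<^sup>+\<omega>. ennreal ((norm (J i t \<omega> - J n t \<omega>))\<^sup>2) \<partial>M)"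
      by (rule Liminf_le_Limsup) simp
    also have "\<dots> \<le> ennreal (4 * \<epsilon> i)"
    proof (rule Limsup_bounded)
      show "eventually (\<lambda>n. (\<integral>\<^sup>+\<omega>. ennreal ((norm (J i t \<omega> - J n t \<omega>))\<^sup>2) \<partial>M) \<le> ennreal (4 * \<epsilon> i)) sequentially"
        using eventually_ge_at_top[of i]
      proof eventually_elim
        case (elim n)
        show ?case using J_dist[OF t, of i n] \<epsilon>_mono[OF elim]
          by (elim order_trans) (auto intro!: ennreal_leI)
      qed
    qed
    finally show ?thesis .
  qed
  have \<epsilon>0: "\<epsilon> \<longlonglongrightarrow> 0"
    unfolding \<epsilon>_def[abs_def] by (intro tendsto_divide_zero LIMSEQ_power_zero) simp
  show thesis
  proof (rule that)
    show "continuous_on {0..T} (\<lambda>t. X t \<omega>)" if "\<omega> \<in> space M" for \<omega>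
    proof (cases "\<omega> \<in> N")
      case False
      then have "continuous_on {0..T} (\<lambda>t. lim (\<lambda>n. J n t \<omega>))"
        using that by (intro uniform_limit_theorem[OF _ unif] always_eventually allI Jc) auto
      then show ?thesis using False by (simp add: X_def)
    qed (simp add: X_def)
    show "has_ito_integral M w T k t (X t)" if t: "t \<in> {0..T}" for t
    proof (rule has_ito_integralI[OF k Xm[OF t] S])
      show "L2_tendsto TM ?\<phi> ?k" unfolding L2_tendsto_def
      proof (rule tendsto_sandwich[OF _ _ tendsto_const])
        show "(\<lambda>j. ennreal (\<epsilon> j)) \<longlonglongrightarrow> 0" using tendsto_ennrealI[OF \<epsilon>0] by simp
      qed (auto intro!: always_eventually close)
      show "L2_tendsto M (\<lambda>j. simple_integral w (m j) (ts j) (\<xi> j) t) (X t)" unfolding L2_tendsto_def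
      proof (rule tendsto_sandwich[OF _ _ tendsto_const])
        show "(\<lambda>j. ennreal (4 * \<epsilon> j)) \<longlonglongrightarrow> 0" using tendsto_ennrealI[OF tendsto_mult_right_zero[OF \<epsilon>0, of 4]] by simp
      qed (use X_dist[OF t] in \<open>auto intro!: always_eventually simp: J_def\<close>)
    qed
  qed
qed

end

section \<open>Approximation by simple processes\<close>

lemma sum_lessThan_add: "(\<Sum>q<a + b. f q) = (\<Sum>q<a. f q) + (\<Sum>r<b. f (a + r))"
  for f :: "nat \<Rightarrow> 'b::comm_monoid_add"
  by (induction b) (auto simp: add.assoc)

lemma sum_lessThan_mult: "(\<Sum>q<m * N. f q) = (\<Sum>i<m. \<Sum>r<N. f (i * N + r))"
  for f :: "nat \<Rightarrow> 'b::comm_monoid_add"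
proof (induction m)
  case (Suc m)
  have "(\<Sum>q<Suc m * N. f q) = (\<Sum>q<m * N + N. f q)" by (simp add: add.commute)
  then show ?case using Suc sum_lessThan_add[of f "m * N" N] by simp
qed simp

lemma sum_indicator_partition:
  fixes a :: "nat \<Rightarrow> real"
  assumes "\<And>r. r < N \<Longrightarrow> a r \<le> a (Suc r)"
  shows "(\<Sum>r<N. indicator {a r<..a (Suc r)} s) = (indicator {a 0<..a N} s :: real)"
  using assms
proof (induction N)
  case (Suc N)
  have "a 0 \<le> a N" using Suc.prems
    by (induction N) (auto intro: order_trans)
  moreover have "a N \<le> a (Suc N)" using Suc.prems by simp
  moreover have "(\<Sum>r<Suc N. indicator {a r<..a (Suc r)} s)
     = (indicator {a 0<..a N} s + indicator {a N<..a (Suc N)} s :: real)"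
    using Suc.IH Suc.prems by simp
  ultimately show ?case by (auto simp: indicator_def)
qed simp

context wiener_space
begin

text \<open>The squared norm of a sum is at most twice the sum of the squares, hence the quarters of \<open>e\<close>.\<close>

lemma approximable_limit:
  fixes k :: "real \<Rightarrow> 'a \<Rightarrow> real ^ 'd ^ 'n"
  assumes k: "(\<lambda>(s, \<omega>). k s \<omega>) \<in> borel_measurable TM"
    and lim: "\<And>e. 0 < e \<Longrightarrow> \<exists>k'. approximable k' \<and> (\<lambda>(s, \<omega>). k' s \<omega>) \<in> borel_measurable TM \<and>
      (\<integral>\<^sup>+x. ennreal ((norm ((case x of (s, \<omega>) \<Rightarrow> k' s \<omega>) - (case x of (s, \<omega>) \<Rightarrow> k s \<omega>)))\<^sup>2) \<partial>TM) \<le> ennreal e"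
  shows "approximable k"
  unfolding approximable_def
proof (intro allI impI)
  fix e :: real assume e: "0 < e"
  then have e4: "0 < e / 4" by simp
  obtain k' where k': "approximable k'" "(\<lambda>(s, \<omega>). k' s \<omega>) \<in> borel_measurable TM"
    "(\<integral>\<^sup>+x. ennreal ((norm ((case x of (s, \<omega>) \<Rightarrow> k' s \<omega>) - (case x of (s, \<omega>) \<Rightarrow> k s \<omega>)))\<^sup>2) \<partial>TM) \<le> ennreal (e / 4)"
    using lim[OF e4] by blast
  obtain m ts \<xi> where S: "simple_integrand M w T m ts \<xi>"
    "(\<integral>\<^sup>+x. ennreal ((norm (process m ts \<xi> x - (case x of (s, \<omega>) \<Rightarrow> k' s \<omega>)))\<^sup>2) \<partial>TM) \<le> ennreal (e / 4)"
    using k'(1) e4 unfolding approximable_def by blast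
  have "(\<integral>\<^sup>+x. ennreal ((norm (process m ts \<xi> x - (case x of (s, \<omega>) \<Rightarrow> k s \<omega>)))\<^sup>2) \<partial>TM)
     \<le> 2 * (\<integral>\<^sup>+x. ennreal ((norm (process m ts \<xi> x - (case x of (s, \<omega>) \<Rightarrow> k' s \<omega>)))\<^sup>2) \<partial>TM)
      + 2 * (\<integral>\<^sup>+x. ennreal ((norm ((case x of (s, \<omega>) \<Rightarrow> k' s \<omega>) - (case x of (s, \<omega>) \<Rightarrow> k s \<omega>)))\<^sup>2) \<partial>TM)"
    by (rule nn_integral_norm_diff_triangle[OF square_integrableD(1)[OF process_square_integrable[OF S(1)]] k'(2) k])
  also have "\<dots> \<le> 2 * ennreal (e / 4) + 2 * ennreal (e / 4)"
    by (intro add_mono mult_left_mono S(2) k'(3)) auto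
  also have "\<dots> = ennreal e"
  proof -
    have "2 * ennreal (e / 4) = ennreal (e / 2)"
      using e ennreal_mult'[of "2::real" "e / 4"] by simp
    then show ?thesis using e by (simp add: ennreal_plus[symmetric] del: ennreal_plus)
  qed
  finally show "\<exists>m ts \<xi>. simple_integrand M w T m ts \<xi> \<and>
      (\<integral>\<^sup>+x. ennreal ((norm (process m ts \<xi> x - (case x of (s, \<omega>) \<Rightarrow> k s \<omega>)))\<^sup>2) \<partial>TM) \<le> ennreal e"
    using S(1) by blast
qed

lemma approximable_L2_tendsto:
  fixes k :: "real \<Rightarrow> 'a \<Rightarrow> real ^ 'd ^ 'n"
  assumes k: "(\<lambda>(s, \<omega>). k s \<omega>) \<in> borel_measurable TM"
    and ks: "\<And>j. approximable (ks j)" "\<And>j. (\<lambda>(s, \<omega>). ks j s \<omega>) \<in> borel_measurable TM"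
    and lim: "L2_tendsto TM (\<lambda>j (s, \<omega>). ks j s \<omega>) (\<lambda>(s, \<omega>). k s \<omega>)"
  shows "approximable k"
proof (rule approximable_limit[OF k])
  fix e :: real assume "0 < e"
  then have "eventually (\<lambda>j. (\<integral>\<^sup>+x. ennreal ((norm ((case x of (s, \<omega>) \<Rightarrow> ks j s \<omega>) - (case x of (s, \<omega>) \<Rightarrow> k s \<omega>)))\<^sup>2) \<partial>TM) < ennreal e) sequentially"
    using lim unfolding L2_tendsto_def by (intro order_tendstoD) auto
  then obtain j where "(\<integral>\<^sup>+x. ennreal ((norm ((case x of (s, \<omega>) \<Rightarrow> ks j s \<omega>) - (case x of (s, \<omega>) \<Rightarrow> k s \<omega>)))\<^sup>2) \<partial>TM) < ennreal e"
    by (auto simp: eventually_sequentially)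
  then show "\<exists>k'. approximable k' \<and> (\<lambda>(s, \<omega>). k' s \<omega>) \<in> borel_measurable TM \<and>
      (\<integral>\<^sup>+x. ennreal ((norm ((case x of (s, \<omega>) \<Rightarrow> k' s \<omega>) - (case x of (s, \<omega>) \<Rightarrow> k s \<omega>)))\<^sup>2) \<partial>TM) \<le> ennreal e"
    using ks by (intro exI[of _ "ks j"]) auto
qed

text \<open>Divide every interval of the partition into \<open>N\<close> equal parts and freeze \<open>\<rho>\<close> at the left end point of
  each part. By uniform continuity of \<open>\<rho>\<close> the error is uniformly small.\<close>

lemma approximable_continuous_mult_simple:
  fixes \<xi> :: "nat \<Rightarrow> 'a \<Rightarrow> real ^ 'd ^ 'n" and \<rho> :: "real \<Rightarrow> real ^ 'n ^ 'n"
  assumes S: "simple_integrand M w T m ts \<xi>" and \<rho>: "continuous_on {0..T} \<rho>"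
  shows "approximable (\<lambda>s \<omega>. \<rho> s ** simple_process m ts \<xi> s \<omega>)"
  unfolding approximable_def
proof (intro allI impI)
  fix e :: real assume e: "0 < e"
  note D = simple_integrandD[OF S]
  note bbm = bounded_bilinear_matrix_mult
  interpret TM: finite_measure TM by (rule finite_measure_TM)
  obtain C0 where C0: "\<And>i \<omega>. i < m \<Longrightarrow> \<omega> \<in> space M \<Longrightarrow> norm (\<xi> i \<omega>) \<le> C0" using D(6) by blast
  define C where "C = \<bar>C0\<bar> + 1"
  have C: "0 < C" "norm (\<xi> i \<omega>) \<le> C" if "i < m" "\<omega> \<in> space M" for i \<omega>
    using C0[OF that] by (auto simp: C_def)
  have Cpos: "0 < C" by (simp add: C_def)
  obtain L where L: "0 < L" "\<And>s. s \<in> {0..T} \<Longrightarrow> norm (\<rho> s) \<le> L"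
    using continuous_on_interval_norm_bound[OF \<rho>] by blast
  \<comment> \<open>With \<open>d\<close> as the tolerance for \<open>\<rho>\<close>, the squared error times the total mass is at most \<open>e\<close>. The
    summands \<open>1\<close> avoid division by zero.\<close>
  define V where "V = measure TM (space TM) + 1"
  have V: "0 < V" by (simp add: V_def add_nonneg_pos)
  define d where "d = sqrt (e / V) / ((real m + 1) * C)"
  have d: "0 < d" using e V Cpos by (simp add: d_def)
  have "uniformly_continuous_on {0..T} \<rho>" by (rule compact_uniformly_continuous[OF \<rho>]) simp
  then obtain h where h: "0 < h" "\<And>s s'. s \<in> {0..T} \<Longrightarrow> s' \<in> {0..T} \<Longrightarrow> dist s' s < h \<Longrightarrow> dist (\<rho> s') (\<rho> s) < d"
    using d unfolding uniformly_continuous_on_def by metis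
  obtain N :: nat where "T / h < real N" using reals_Archimedean2 by blast
  moreover from this have "0 < N"
    using T_pos h(1) less_trans[of 0 "T / h" "real N"] by simp
  ultimately have N: "0 < N" "T / real N < h"
    using h(1) by (auto simp: pos_divide_less_eq mult.commute)
  define a where "a i r = ts i + real r / real N * (ts (Suc i) - ts i)" for i r
  define ts' where "ts' q = a (q div N) (q mod N)" for q
  define \<xi>' where "\<xi>' q \<omega> = \<rho> (ts' q) ** \<xi> (q div N) \<omega>" for q \<omega>
  have lt: "ts i < ts (Suc i)" if "i < m" for i using S that by (simp add: simple_integrand_def)
  have a0: "a i 0 = ts i" for i by (simp add: a_def)
  have aN: "a i N = ts (Suc i)" for i using N(1) by (simp add: a_def)
  have a_less: "a i r < a i (Suc r)" if "i < m" for i r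
    using lt[OF that] N(1) by (simp add: a_def field_simps)
  have a_step: "a i (Suc r) - a i r \<le> T / N" if "i < m" for i r
  proof -
    have "real (Suc r) / real N - real r / real N = 1 / real N"
      by (simp add: diff_divide_distrib[symmetric])
    then have "a i (Suc r) - a i r = 1 / real N * (ts (Suc i) - ts i)"
      by (simp only: a_def left_diff_distrib[symmetric] add_diff_cancel_left)
    also have "\<dots> = (ts (Suc i) - ts i) / N" by simp
    also have "\<dots> \<le> T / N" using D(1)[of i] D(2)[of "Suc i"] that by (intro divide_right_mono) auto
    finally show ?thesis .
  qed
  have a_mem: "a i r \<in> {ts i..ts (Suc i)}" if "i < m" "r \<le> N" for i r
  proof -
    have "0 \<le> real r / real N * (ts (Suc i) - ts i)" using lt[OF that(1)] by simp
    moreover have "real r / real N * (ts (Suc i) - ts i) \<le> 1 * (ts (Suc i) - ts i)"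
      using lt[OF that(1)] that(2) N(1) by (intro mult_right_mono) auto
    ultimately show ?thesis by (simp add: a_def)
  qed
  have a_T: "a i r \<in> {0..T}" if "i < m" "r \<le> N" for i r
    using a_mem[OF that] D(1)[of i] D(2)[of "Suc i"] that(1) by auto
  have ts'_eq: "ts' (i * N + r) = a i r" if "r < N" for i r
    using that by (simp add: ts'_def)
  have ts'_Suc: "ts' (Suc (i * N + r)) = a i (Suc r)" if "r < N" for i r
  proof (cases "Suc r = N")
    case True
    then have "Suc (i * N + r) = Suc i * N + 0" by simp
    then have "ts' (Suc (i * N + r)) = a (Suc i) 0" using ts'_eq[of 0 "Suc i"] N(1) by metis
    then show ?thesis using True a0 aN by metis
  next
    case False
    then show ?thesis using ts'_eq[of "Suc r" i] that by simp
  qed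
  have \<xi>'_eq: "\<xi>' (i * N + r) \<omega> = \<rho> (a i r) ** \<xi> i \<omega>" if "r < N" for i r \<omega>
    using that by (simp add: \<xi>'_def ts'_eq)
  have split: "\<exists>i r. q = i * N + r \<and> i < m \<and> r < N" if "q < m * N" for q
    using that N(1) by (intro exI[of _ "q div N"] exI[of _ "q mod N"]) (auto simp: less_mult_imp_div_less)
  have S': "simple_integrand M w T (m * N) ts' \<xi>'"
    unfolding simple_integrand_def
  proof (intro conjI allI impI)
    show "0 \<le> ts' 0" using D(1)[of 0] by (simp add: ts'_def a0)
    show "ts' (m * N) \<le> T" using D(2)[of m] N(1) by (simp add: ts'_def a0)
    show "ts' q < ts' (Suc q)" if q: "q < m * N" for q
    proof -
      obtain i r where "q = i * N + r" "i < m" "r < N" using split[OF q] by blast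
      then show ?thesis using a_less ts'_eq ts'_Suc by simp
    qed
    show "\<xi>' q \<in> borel_measurable (F (ts' q))" if q: "q < m * N" for q
    proof -
      obtain i r where ir: "q = i * N + r" "i < m" "r < N" using split[OF q] by blast
      have "\<xi> i \<in> borel_measurable (F (a i r))"
        by (rule F_measurable_mono[OF D(4)[OF ir(2)]]) (use a_mem[of i r] ir in auto)
      then have "(\<lambda>\<omega>. \<rho> (a i r) ** \<xi> i \<omega>) \<in> borel_measurable (F (a i r))"
        by (intro matrix_mult_borel) auto
      moreover have "\<xi>' q = (\<lambda>\<omega>. \<rho> (a i r) ** \<xi> i \<omega>)" using \<xi>'_eq[OF ir(3)] ir(1) by auto
      ultimately show ?thesis using ts'_eq[OF ir(3)] ir(1) by simp
    qed
    show "\<exists>C. \<forall>i<m * N. \<forall>\<omega>\<in>space M. norm (\<xi>' i \<omega>) \<le> C"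
    proof (intro exI[of _ "L * C"] allI impI ballI)
      fix q \<omega> assume q: "q < m * N" and \<omega>: "\<omega> \<in> space M"
      obtain i r where ir: "q = i * N + r" "i < m" "r < N" using split[OF q] by blast
      have "norm (\<rho> (a i r) ** \<xi> i \<omega>) \<le> norm (\<rho> (a i r)) * norm (\<xi> i \<omega>)" by (rule norm_matrix_mult_le)
      also have "\<dots> \<le> L * C" using L(1) L(2)[OF a_T[of i r]] C(2)[OF ir(2) \<omega>] ir by (intro mult_mono) auto
      finally show "norm (\<xi>' q \<omega>) \<le> L * C" using \<xi>'_eq[OF ir(3)] ir(1) by simp
    qed
  qed
  let ?ind = "\<lambda>i r s. indicat_real {a i r<..a i (Suc r)} s"
  have part: "(\<Sum>r<N. ?ind i r s) = indicator {ts i<..ts (Suc i)} s" if "i < m" for i s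
    using sum_indicator_partition[of N "a i" s] a_less[OF that] by (simp add: a0 aN less_imp_le)
  have diff: "norm (simple_process (m * N) ts' \<xi>' s \<omega> - \<rho> s ** simple_process m ts \<xi> s \<omega>) \<le> real m * (d * C)"
    if s: "s \<in> {0..T}" and \<omega>: "\<omega> \<in> space M" for s \<omega>
  proof -
    have 1: "simple_process (m * N) ts' \<xi>' s \<omega> = (\<Sum>i<m. \<Sum>r<N. ?ind i r s *\<^sub>R (\<rho> (a i r) ** \<xi> i \<omega>))"
      unfolding simple_process_def sum_lessThan_mult
      by (intro sum.cong refl) (simp add: ts'_eq ts'_Suc \<xi>'_eq)
    have "\<rho> s ** simple_process m ts \<xi> s \<omega> = (\<Sum>i<m. \<rho> s ** ((\<Sum>r<N. ?ind i r s) *\<^sub>R \<xi> i \<omega>))"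
      unfolding simple_process_def bounded_bilinear.sum_right[OF bbm] by (intro sum.cong refl) (simp add: part)
    also have "\<dots> = (\<Sum>i<m. \<Sum>r<N. ?ind i r s *\<^sub>R (\<rho> s ** \<xi> i \<omega>))"
      by (simp only: scaleR_sum_left bounded_bilinear.sum_right[OF bbm] bounded_bilinear.scaleR_right[OF bbm])
    finally have "simple_process (m * N) ts' \<xi>' s \<omega> - \<rho> s ** simple_process m ts \<xi> s \<omega>
       = (\<Sum>i<m. \<Sum>r<N. ?ind i r s *\<^sub>R ((\<rho> (a i r) - \<rho> s) ** \<xi> i \<omega>))"
      unfolding 1 by (simp only: sum_subtractf scaleR_diff_right bounded_bilinear.diff_left[OF bbm])
    also have "norm \<dots> \<le> (\<Sum>i<m. d * C)"
    proof (rule sum_norm_le)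
      fix i assume "i \<in> {..<m}"
      then have i: "i < m" by simp
      have "norm (\<Sum>r<N. ?ind i r s *\<^sub>R ((\<rho> (a i r) - \<rho> s) ** \<xi> i \<omega>)) \<le> (\<Sum>r<N. ?ind i r s * (d * C))"
      proof (rule sum_norm_le)
        fix r assume "r \<in> {..<N}"
        then have r: "r < N" by simp
        show "norm (?ind i r s *\<^sub>R ((\<rho> (a i r) - \<rho> s) ** \<xi> i \<omega>)) \<le> ?ind i r s * (d * C)"
        proof (cases "s \<in> {a i r<..a i (Suc r)}")
          case True
          then have "dist (a i r) s < h" using a_step[OF i, of r] N(2) by (auto simp: dist_real_def)
          then have "norm (\<rho> (a i r) - \<rho> s) \<le> d"
            using h(2)[OF s a_T[of i r]] i r by (auto simp: dist_norm)
          then have "norm (\<rho> (a i r) - \<rho> s) * norm (\<xi> i \<omega>) \<le> d * C"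
            using C(2)[OF i \<omega>] d by (intro mult_mono) auto
          then show ?thesis using True norm_matrix_mult_le[of "\<rho> (a i r) - \<rho> s" "\<xi> i \<omega>"] by simp
        qed simp
      qed
      also have "\<dots> = indicator {ts i<..ts (Suc i)} s * (d * C)"
        by (simp add: sum_distrib_right[symmetric] part[OF i])
      also have "\<dots> \<le> d * C" using d Cpos by (auto simp: indicator_def)
      finally show "norm (\<Sum>r<N. ?ind i r s *\<^sub>R ((\<rho> (a i r) - \<rho> s) ** \<xi> i \<omega>)) \<le> d * C" .
    qed
    finally show ?thesis by simp
  qed
  have mdC: "(real m * (d * C))\<^sup>2 \<le> e / V"
  proof -
    have "d * C = sqrt (e / V) / (real m + 1)"
    proof -
      have "q / (p * C) * C = q / p" if "0 < p" for p q :: real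
        using Cpos that by (simp add: field_simps)
      from this[of "real m + 1"] show ?thesis unfolding d_def by (simp add: add_nonneg_pos)
    qed
    then have "real m * (d * C) = real m / (real m + 1) * sqrt (e / V)" by simp
    also have "\<dots> \<le> 1 * sqrt (e / V)" using e V by (intro mult_right_mono) auto
    finally have "(real m * (d * C))\<^sup>2 \<le> (sqrt (e / V))\<^sup>2"
      using d Cpos by (intro power_mono) auto
    then show ?thesis using e V by simp
  qed
  have "(\<integral>\<^sup>+x. ennreal ((norm (process (m * N) ts' \<xi>' x - (case x of (s, \<omega>) \<Rightarrow> \<rho> s ** simple_process m ts \<xi> s \<omega>)))\<^sup>2) \<partial>TM)
     \<le> (\<integral>\<^sup>+x. ennreal (e / V) \<partial>TM)"
  proof (rule nn_integral_mono)
    fix x assume "x \<in> space TM"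
    then obtain s \<omega> where x: "x = (s, \<omega>)" "s \<in> {0..T}" "\<omega> \<in> space M" by (auto simp: space_pair_measure)
    have "(norm (simple_process (m * N) ts' \<xi>' s \<omega> - \<rho> s ** simple_process m ts \<xi> s \<omega>))\<^sup>2 \<le> (real m * (d * C))\<^sup>2"
      by (intro power_mono diff x) simp
    then show "ennreal ((norm (process (m * N) ts' \<xi>' x - (case x of (s, \<omega>) \<Rightarrow> \<rho> s ** simple_process m ts \<xi> s \<omega>)))\<^sup>2) \<le> ennreal (e / V)"
      unfolding x(1) process_def using mdC by (auto intro!: ennreal_leI)
  qed
  also have "\<dots> = ennreal (e / V) * ennreal (measure TM (space TM))"
    by (simp add: TM.emeasure_eq_measure)
  also have "\<dots> = ennreal (e / V * measure TM (space TM))"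
    by (rule ennreal_mult'[symmetric]) (use e V in simp)
  also have "\<dots> \<le> ennreal e"
  proof (rule ennreal_leI)
    have "e / V * measure TM (space TM) \<le> e / V * V" using e V by (intro mult_left_mono) (auto simp: V_def)
    then show "e / V * measure TM (space TM) \<le> e" using V by simp
  qed
  finally show "\<exists>m' ts' \<xi>'. simple_integrand M w T m' ts' \<xi>' \<and>
      (\<integral>\<^sup>+x. ennreal ((norm (process m' ts' \<xi>' x - (case x of (s, \<omega>) \<Rightarrow> \<rho> s ** simple_process m ts \<xi> s \<omega>)))\<^sup>2) \<partial>TM) \<le> ennreal e"
    using S' by blast
qed

lemma continuous_mult_measurable:
  fixes k :: "real \<Rightarrow> 'a \<Rightarrow> real ^ 'd ^ 'n" and \<rho> :: "real \<Rightarrow> real ^ 'n ^ 'n"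
  assumes "\<rho> \<in> borel_measurable (lebesgue_on {0..T})" "(\<lambda>(s, \<omega>). k s \<omega>) \<in> borel_measurable TM"
  shows "(\<lambda>(s, \<omega>). \<rho> s ** k s \<omega>) \<in> borel_measurable TM"
proof -
  have "(\<lambda>x. \<rho> (fst x) ** (case x of (s, \<omega>) \<Rightarrow> k s \<omega>)) \<in> borel_measurable TM"
    by (intro matrix_mult_borel measurable_compose[OF measurable_fst assms(1)] assms(2))
  then show ?thesis by (simp add: split_beta')
qed

text \<open>Multiplication by the bounded function \<open>\<rho>\<close> is continuous in mean square, so it is enough to know
  the claim for simple processes.\<close>

lemma approximable_continuous_mult:
  fixes k :: "real \<Rightarrow> 'a \<Rightarrow> real ^ 'd ^ 'n" and \<rho> :: "real \<Rightarrow> real ^ 'n ^ 'n"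
  assumes I: "has_ito_integral M w T k t I" and \<rho>: "continuous_on {0..T} \<rho>"
  shows "approximable (\<lambda>s \<omega>. \<rho> s ** k s \<omega>)"
proof -
  obtain L where L: "0 < L" "\<And>s. s \<in> {0..T} \<Longrightarrow> norm (\<rho> s) \<le> L"
    using continuous_on_interval_norm_bound[OF \<rho>] by blast
  note km = square_integrableD(1)[OF ito_integrand(2)[OF I]]
  note \<rho>m = continuous_on_borel_lebesgue_on[OF \<rho>]
  obtain m ts \<xi> where
    a: "\<And>j. simple_integrand M w T (m j) (ts j) (\<xi> j)"
    "L2_tendsto TM (\<lambda>j. process (m j) (ts j) (\<xi> j)) (\<lambda>(s, \<omega>). k s \<omega>)"
    "L2_tendsto M (\<lambda>j. simple_integral w (m j) (ts j) (\<xi> j) t) I"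
    by (rule ito_approximation[OF I]) blast
  note pm = square_integrableD(1)[OF process_square_integrable[OF a(1)]]
  show ?thesis
  proof (rule approximable_L2_tendsto)
    show "(\<lambda>(s, \<omega>). \<rho> s ** k s \<omega>) \<in> borel_measurable TM"
      by (rule continuous_mult_measurable[OF \<rho>m km])
    show "approximable (\<lambda>s \<omega>. \<rho> s ** simple_process (m j) (ts j) (\<xi> j) s \<omega>)" for j
      by (rule approximable_continuous_mult_simple[OF a(1) \<rho>])
    show "(\<lambda>(s, \<omega>). \<rho> s ** simple_process (m j) (ts j) (\<xi> j) s \<omega>) \<in> borel_measurable TM" for j
      by (rule continuous_mult_measurable[OF \<rho>m]) (use pm[of j] in \<open>simp add: process_def\<close>)
    show "L2_tendsto TM (\<lambda>j (s, \<omega>). \<rho> s ** simple_process (m j) (ts j) (\<xi> j) s \<omega>) (\<lambda>(s, \<omega>). \<rho> s ** k s \<omega>)"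
    proof (rule L2_tendsto_dominated[OF a(2) pm km, of _ _ L])
      fix j x assume "x \<in> space TM"
      then obtain s \<omega> where x: "x = (s, \<omega>)" "s \<in> {0..T}" by (auto simp: space_pair_measure)
      have "norm (\<rho> s ** (simple_process (m j) (ts j) (\<xi> j) s \<omega> - k s \<omega>))
          \<le> norm (\<rho> s) * norm (simple_process (m j) (ts j) (\<xi> j) s \<omega> - k s \<omega>)"
        by (rule norm_matrix_mult_le)
      also have "\<dots> \<le> L * norm (simple_process (m j) (ts j) (\<xi> j) s \<omega> - k s \<omega>)"
        by (intro mult_right_mono L x) simp
      finally show "norm ((case x of (s, \<omega>) \<Rightarrow> \<rho> s ** simple_process (m j) (ts j) (\<xi> j) s \<omega>)
           - (case x of (s, \<omega>) \<Rightarrow> \<rho> s ** k s \<omega>))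
         \<le> L * norm (process (m j) (ts j) (\<xi> j) x - (case x of (s, \<omega>) \<Rightarrow> k s \<omega>))"
        by (simp add: x(1) process_def bounded_bilinear.diff_right[OF bounded_bilinear_matrix_mult])
    qed
  qed
qed

text \<open>The dominating function for the squared distance is \<open>4 |h|\<^sup>2\<close>.\<close>

lemma L2_tendsto_dominated_convergence:
  fixes fs :: "nat \<Rightarrow> 'x \<Rightarrow> 'b::euclidean_space"
  assumes [measurable]: "\<And>j. fs j \<in> borel_measurable N" "f \<in> borel_measurable N"
    and h: "square_integrable N h"
    and bd: "\<And>j. AE x in N. norm (fs j x) \<le> norm (h x)"
    and lim: "AE x in N. (\<lambda>j. fs j x) \<longlonglongrightarrow> f x"
  shows "L2_tendsto N fs f"
proof -
  note [measurable] = square_integrableD(1)[OF h]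
  have all_bd: "AE x in N. \<forall>j. norm (fs j x) \<le> norm (h x)"
    by (subst AE_all_countable) (use bd in auto)
  have "(\<lambda>j. \<integral>\<^sup>+x. ennreal ((norm (fs j x - f x))\<^sup>2) \<partial>N) \<longlonglongrightarrow> (\<integral>\<^sup>+x. 0 \<partial>N)"
  proof (rule nn_integral_dominated_convergence[where w="\<lambda>x. ennreal (4 * (norm (h x))\<^sup>2)"])
    show "AE x in N. ennreal ((norm (fs j x - f x))\<^sup>2) \<le> ennreal (4 * (norm (h x))\<^sup>2)" for j
      using lim all_bd
    proof eventually_elim
      case (elim x)
      have "norm (f x) \<le> norm (h x)"
        by (rule LIMSEQ_le_const2[OF tendsto_norm[OF elim(1)]]) (use elim(2) in auto)
      moreover have "norm (fs j x) \<le> norm (h x)" using elim(2) by blast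
      ultimately have "norm (fs j x - f x) \<le> 2 * norm (h x)"
        using norm_triangle_ineq4[of "fs j x" "f x"] by linarith
      then have "(norm (fs j x - f x))\<^sup>2 \<le> (2 * norm (h x))\<^sup>2" by (intro power_mono) auto
      then show ?case by (intro ennreal_leI) (simp add: power_mult_distrib)
    qed
    show "(\<integral>\<^sup>+x. ennreal (4 * (norm (h x))\<^sup>2) \<partial>N) < \<infinity>"
      using square_integrableD(2)[OF h] by (simp add: nn_integral_eq_integral)
    show "AE x in N. (\<lambda>j. ennreal ((norm (fs j x - f x))\<^sup>2)) \<longlonglongrightarrow> 0"
      using lim
    proof eventually_elim
      case (elim x)
      have "(\<lambda>j. (norm (fs j x - f x))\<^sup>2) \<longlonglongrightarrow> (norm (f x - f x))\<^sup>2"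
        by (intro tendsto_intros elim)
      from tendsto_ennrealI[OF this] show ?case by simp
    qed
  qed measurable
  then show ?thesis by (simp add: L2_tendsto_def)
qed

end

section \<open>The Gramian\<close>

lemma transpose_scaleR: "transpose (r *\<^sub>R X) = r *\<^sub>R transpose X" for X :: "real ^ 'm ^ 'n"
  by (simp add: transpose_def vec_eq_iff)

lemma powr_integral:
  fixes p T s :: real
  assumes "s \<le> T" "- 1 < p"
  shows "integrable (lebesgue_on {s..T}) (\<lambda>t. (T - t) powr p)"
    and "(LINT t|lebesgue_on {s..T}. (T - t) powr p) = (T - s) powr (p + 1) / (p + 1)"
proof -
  have "((\<lambda>t. (T - t) powr p) has_integral (- ((T - T) powr (p + 1) / (p + 1)) - - ((T - s) powr (p + 1) / (p + 1)))) {s..T}"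
  proof (rule fundamental_theorem_of_calculus_interior[OF assms(1)])
    have "continuous_on {s..T} (\<lambda>t. (T - t) powr (p + 1))"
      by (intro continuous_on_powr' continuous_intros) (use assms in auto)
    then show "continuous_on {s..T} (\<lambda>t. - ((T - t) powr (p + 1) / (p + 1)))"
      using assms by (intro continuous_on_minus continuous_on_divide continuous_on_const) auto
    fix t assume t: "t \<in> {s<..<T}"
    have p1: "p + 1 \<noteq> 0" using assms by simp
    have "((\<lambda>t. T - t) has_real_derivative -1) (at t)" by (auto intro!: derivative_eq_intros)
    from DERIV_fun_powr[OF this, of "p + 1"] t
    have "((\<lambda>t. (T - t) powr (p + 1)) has_real_derivative (p + 1) * (T - t) powr (p + 1 - 1) * - 1) (at t)"
      by simp
    from DERIV_minus[OF DERIV_cdivide[OF this, of "p + 1"]]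
    have "((\<lambda>t. - ((T - t) powr (p + 1) / (p + 1))) has_real_derivative (T - t) powr p) (at t)"
      using p1 by simp
    then show "((\<lambda>t. - ((T - t) powr (p + 1) / (p + 1))) has_vector_derivative (T - t) powr p) (at t)"
      by (simp add: has_real_derivative_iff_has_vector_derivative)
  qed
  then have hi: "((\<lambda>t. (T - t) powr p) has_integral ((T - s) powr (p + 1) / (p + 1))) {s..T}"
    using assms by simp
  then have "(\<lambda>t. (T - t) powr p) absolutely_integrable_on {s..T}"
    by (intro nonnegative_absolutely_integrable_1) auto
  then show i: "integrable (lebesgue_on {s..T}) (\<lambda>t. (T - t) powr p)"
    by (simp add: set_integrable_def integrable_restrict_space)
  show "(LINT t|lebesgue_on {s..T}. (T - t) powr p) = (T - s) powr (p + 1) / (p + 1)"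
    using has_integral_integral_lebesgue_on[OF i] hi by (auto intro: has_integral_unique)
qed

text \<open>The end point is a null set, and all subsets of null sets are Lebesgue measurable.\<close>

lemma measurable_lebesgue_on_endpoint:
  fixes h :: "real \<Rightarrow> 'b::topological_space"
  assumes h: "h \<in> borel_measurable (lebesgue_on {s..<T})"
  shows "h \<in> borel_measurable (lebesgue_on {s..T})"
proof (rule measurableI)
  fix B :: "'b set" assume B: "B \<in> sets borel"
  have "h -` B \<inter> {s..<T} \<in> sets lebesgue"
    using measurable_sets[OF h B] by (simp add: sets_restrict_space_iff)
  moreover have "h -` B \<inter> {s..T} \<inter> {T} \<in> sets lebesgue"
    by (rule negligible_imp_sets, rule negligible_subset[of "{T}"]) auto
  ultimately have "(h -` B \<inter> {s..<T}) \<union> (h -` B \<inter> {s..T} \<inter> {T}) \<in> sets lebesgue" by auto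
  also have "(h -` B \<inter> {s..<T}) \<union> (h -` B \<inter> {s..T} \<inter> {T}) = h -` B \<inter> {s..T}" by auto
  finally show "h -` B \<inter> space (lebesgue_on {s..T}) \<in> sets (lebesgue_on {s..T})"
    by (simp add: sets_restrict_space_iff)
qed simp

lemma AE_lebesgue_on_less: "AE t in lebesgue_on {s..T::real}. t \<in> {s..<T}"
proof (rule AE_I')
  have "negligible ({T} \<inter> {s..T})" by (rule negligible_subset[of "{T}"]) auto
  then show "{T} \<inter> {s..T} \<in> null_sets (lebesgue_on {s..T})"
    by (simp add: null_sets_restrict_space negligible_iff_null_sets)
qed auto

text \<open>Each column of the inverse is the preimage of a unit vector, and the Frobenius norm is at most the
  sum of the norms of the columns.\<close>

lemma norm_matrix_inv_le:
  fixes X :: "real ^ 'n ^ 'n"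
  assumes m: "0 < m" and X: "\<And>x. m * norm x \<le> norm (X *v x)"
  shows "invertible X" "norm (matrix_inv X) \<le> real CARD('n) / m"
proof -
  show inv: "invertible X"
  proof (rule invertible_if_kernel_trivial)
    fix x :: "real ^ 'n" assume "x \<noteq> 0"
    then have "0 < m * norm x" using m by simp
    then show "X *v x \<noteq> 0" using X[of x] by auto
  qed
  let ?Y = "matrix_inv X"
  have col: "norm (transpose ?Y $ j) \<le> 1 / m" for j
  proof -
    have "transpose ?Y $ j = ?Y *v axis j 1"
      by (simp add: matrix_vector_mul_component vec_eq_iff transpose_def matrix_vector_mult_def axis_def if_distrib cong: if_cong)
    moreover have "m * norm (?Y *v axis j 1) \<le> norm (X *v (?Y *v axis j 1))" by (rule X)
    moreover have "X *v (?Y *v axis j 1) = axis j 1"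
      by (simp add: matrix_vector_mul_assoc matrix_inv_both[OF inv])
    ultimately have "m * norm (transpose ?Y $ j) \<le> 1" by simp
    then show ?thesis using m by (simp add: field_simps)
  qed
  have "norm ?Y = norm (transpose ?Y)" by (simp add: norm_transpose)
  also have "\<dots> \<le> (\<Sum>j\<in>UNIV. norm (transpose ?Y $ j))"
    unfolding norm_vec_def[of "transpose ?Y"] by (rule L2_set_le_sum) simp
  also have "\<dots> \<le> (\<Sum>j\<in>(UNIV::'n set). 1 / m)" by (intro sum_mono col)
  finally show "norm ?Y \<le> real CARD('n) / m" by simp
qed

text \<open>The standing assumptions with explicit constants; the bound for the second moment of \<open>k\<^sub>f\<close> is stated
  almost everywhere instead of with the essential supremum.\<close>

locale control_problem = wiener_space M T w
  for M :: "'a measure" and T and w :: "real \<Rightarrow> 'a \<Rightarrow> real ^ 'd" +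
  fixes f :: "'a \<Rightarrow> real ^ 'n" and k\<^sub>f :: "real \<Rightarrow> 'a \<Rightarrow> real ^ 'd ^ 'n"
    and g :: "real \<Rightarrow> real" and G \<Gamma> :: "real \<Rightarrow> real ^ 'n ^ 'n" and A b :: "real ^ 'n ^ 'n" and a :: "real ^ 'n"
    and c \<alpha> \<theta> KG KI Kf :: real
  assumes f_ito: "has_ito_integral M w T k\<^sub>f T (\<lambda>\<omega>. f \<omega> - expectation f)"
    and \<theta>: "0 < \<theta>" "\<theta> < T"
    and kf_bound: "AE t in lebesgue_on {\<theta>..T}. (\<integral>\<^sup>+\<omega>. ennreal ((norm (k\<^sub>f t \<omega>))\<^sup>2) \<partial>M) \<le> ennreal Kf"
    and g_meas0: "g \<in> borel_measurable (lebesgue_on {0..<T})"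
    and c: "0 < c" and \<alpha>: "1/2 < \<alpha>" "\<alpha> < 1"
    and g: "\<And>t. t \<in> {0..<T} \<Longrightarrow> 0 < g t" "\<And>t. t \<in> {0..<T} \<Longrightarrow> g t \<le> c * (T - t) powr \<alpha>"
      "\<And>t. t \<in> {0..<T} \<Longrightarrow> inverse (g t) \<le> c * (1 + (T - t) powr (- \<alpha>))"
    and G_meas0: "G \<in> borel_measurable (lebesgue_on {0..<T})"
    and G_spd: "\<And>t. t \<in> {0..<T} \<Longrightarrow> sym_pos_def (G t)"
    and KG: "0 < KG" "\<And>t. t \<in> {0..<T} \<Longrightarrow> norm (G t) \<le> KG"
    and KI: "0 < KI" "\<And>t. t \<in> {0..<T} \<Longrightarrow> norm (matrix_inv (G t)) \<le> KI"
    and \<Gamma>: "\<And>t. t \<in> {0..<T} \<Longrightarrow> \<Gamma> t = g t *\<^sub>R G t"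
    and b: "invertible b"
begin

abbreviation L :: "real measure" where "L \<equiv> lebesgue_on {0..T}"
abbreviation E :: "real \<Rightarrow> real ^ 'n ^ 'n" where "E t \<equiv> mat_exp ((T - t) *\<^sub>R A)"
abbreviation R :: "real \<Rightarrow> real ^ 'n ^ 'n" where "R \<equiv> R_mat T A b \<Gamma>"
abbreviation Q :: "real \<Rightarrow> real ^ 'n ^ 'n" where "Q \<equiv> Q_mat T A b \<Gamma>"
abbreviation k\<^sub>\<mu> :: "real \<Rightarrow> 'a \<Rightarrow> real ^ 'd ^ 'n" where "k\<^sub>\<mu> \<equiv> k_mu T A b \<Gamma> k\<^sub>f"

text \<open>The response of the state at time \<open>T\<close> to a control impulse at time \<open>t\<close>.\<close>

definition Bt :: "real \<Rightarrow> real ^ 'n ^ 'n" where "Bt t = E t ** b"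

lemma AE_L_less: "AE t in L. t \<in> {0..<T}"
  by (rule AE_lebesgue_on_less)

lemma AE_TM_less: "AE x in TM. fst x \<in> {0..<T}"
proof -
  interpret P: pair_sigma_finite L M by (rule pair_sigma_finite_TM)
  show ?thesis
  proof (rule P.AE_pair_measure)
    have "{x \<in> space TM. fst x \<in> {0..<T}} = ({0..<T} \<inter> space L) \<times> space M"
      by (auto simp: space_pair_measure)
    also have "\<dots> \<in> sets TM" by (intro pair_measureI) (auto simp: sets_restrict_space_iff)
    finally show "{x \<in> space TM. fst x \<in> {0..<T}} \<in> sets TM" .
    show "AE t in L. AE \<omega> in M. fst (t, \<omega>) \<in> {0..<T}" using AE_L_less by eventually_elim simp
  qed
qed

lemma g_meas: "g \<in> borel_measurable L"
  by (rule measurable_lebesgue_on_endpoint[OF g_meas0])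

lemma \<Gamma>_spd: "t \<in> {0..<T} \<Longrightarrow> sym_pos_def (\<Gamma> t)"
  using G_spd[of t] g(1)[of t]
  by (auto simp: sym_pos_def_def \<Gamma> scaleR_matrix_vector_assoc[symmetric] transpose_scaleR)

lemma \<Gamma>_meas: "\<Gamma> \<in> borel_measurable L"
proof (rule measurable_lebesgue_on_endpoint)
  have "(\<lambda>t. g t *\<^sub>R G t) \<in> borel_measurable (lebesgue_on {0..<T})"
    using g_meas0 G_meas0 by (rule borel_measurable_scaleR)
  then show "\<Gamma> \<in> borel_measurable (lebesgue_on {0..<T})"
    by (subst measurable_cong[where g="\<lambda>t. g t *\<^sub>R G t"]) (auto simp: \<Gamma>)
qed

lemma \<Gamma>inv_meas: "(\<lambda>t. matrix_inv (\<Gamma> t)) \<in> borel_measurable L"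
proof (rule measurable_lebesgue_on_endpoint, rule borel_measurable_matrix_inv)
  show "\<Gamma> \<in> borel_measurable (lebesgue_on {0..<T})"
  proof -
    have "(\<lambda>t. g t *\<^sub>R G t) \<in> borel_measurable (lebesgue_on {0..<T})"
      using g_meas0 G_meas0 by (rule borel_measurable_scaleR)
    then show ?thesis by (subst measurable_cong[where g="\<lambda>t. g t *\<^sub>R G t"]) (auto simp: \<Gamma>)
  qed
qed (rule sym_pos_def_invertible[OF \<Gamma>_spd], simp)

lemma \<Gamma>inv_eq: "t \<in> {0..<T} \<Longrightarrow> matrix_inv (\<Gamma> t) = inverse (g t) *\<^sub>R matrix_inv (G t)"
  using scaleR_matrix_inv[OF sym_pos_def_invertible[OF G_spd], of t "g t"] g(1)[of t] by (simp add: \<Gamma>)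

lemma ginv_integrable: "integrable L (\<lambda>t. inverse (g t))"
proof (rule Bochner_Integration.integrable_bound)
  show "integrable L (\<lambda>t. c * (1 + (T - t) powr (- \<alpha>)))"
    using powr_integral(1)[of 0 T "- \<alpha>"] \<alpha> T_pos finite_measure.integrable_const[OF finite_measure_interval]
    by (intro integrable_mult_right Bochner_Integration.integrable_add) auto
  show "(\<lambda>t. inverse (g t)) \<in> borel_measurable L" using g_meas by measurable
  show "AE t in L. norm (inverse (g t)) \<le> norm (c * (1 + (T - t) powr (- \<alpha>)))"
    using AE_L_less
  proof eventually_elim
    case (elim t)
    have "0 \<le> c * (1 + (T - t) powr (- \<alpha>))" using c by (intro mult_nonneg_nonneg add_nonneg_nonneg) auto
    then show ?case using g(1,3)[OF elim] by simp
  qed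
qed

lemma E_continuous: "continuous_on S E"
  by (rule continuous_on_mat_exp_minus)

lemma Bt_continuous: "continuous_on S Bt"
  unfolding Bt_def[abs_def] by (intro bounded_bilinear.continuous_on[OF bounded_bilinear_matrix_mult] E_continuous continuous_on_const)

lemma Bt_meas: "Bt \<in> borel_measurable L"
  by (rule continuous_on_borel_lebesgue_on[OF Bt_continuous])

lemma Bt_bound: obtains K where "0 < K" "\<And>t. t \<in> {0..T} \<Longrightarrow> norm (Bt t) \<le> K"
  using continuous_on_interval_norm_bound[OF Bt_continuous] by blast

lemma transpose_Bt: "transpose (Bt t) = transpose b ** mat_exp ((T - t) *\<^sub>R transpose A)"
  by (simp add: Bt_def matrix_transpose_mul transpose_mat_exp transpose_scaleR)

lemma Q_eq: "Q t = Bt t ** matrix_inv (\<Gamma> t) ** transpose (Bt t)"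
  unfolding transpose_Bt by (simp add: Q_mat_def Bt_def matrix_mul_assoc)

text \<open>\<open>B(t)\<close> has the inverse \<open>b\<^sup>-\<^sup>1 e\<^sup>-\<^sup>A\<^sup>(\<^sup>T\<^sup>-\<^sup>t\<^sup>)\<close>, which is bounded on \<open>[0, T]\<close>.\<close>

lemma transpose_Bt_lower_bound:
  obtains K where "0 < K" "\<And>t x. t \<in> {0..T} \<Longrightarrow> norm x \<le> K * norm (transpose (Bt t) *v x)"
proof -
  let ?V = "\<lambda>t. mat_exp ((- (T - t)) *\<^sub>R A)"
  have "continuous_on {0..T} ?V"
    by (rule continuous_on_compose2[OF continuous_on_mat_exp[of UNIV A]]) (auto intro!: continuous_intros)
  then obtain K1 where K1: "0 < K1" "\<And>t. t \<in> {0..T} \<Longrightarrow> norm (?V t) \<le> K1"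
    using continuous_on_interval_norm_bound by blast
  let ?b = "norm (matrix_inv b)"
  have "norm x \<le> (K1 * ?b + 1) * norm (transpose (Bt t) *v x)" if t: "t \<in> {0..T}" for t x
  proof -
    let ?W = "matrix_inv b ** ?V t"
    have "Bt t ** ?W = E t ** (b ** matrix_inv b) ** ?V t"
      by (simp add: Bt_def matrix_mul_assoc)
    also have "\<dots> = mat 1" using mat_exp_inverse[of "T - t" A] by (simp add: matrix_inv_both[OF b])
    finally have "transpose (Bt t ** ?W) = mat 1" by (simp add: transpose_mat)
    then have "transpose ?W *v (transpose (Bt t) *v x) = x"
      by (simp only: matrix_vector_mul_assoc matrix_transpose_mul[symmetric] matrix_vector_mul_lid)
    then have "norm x \<le> norm (transpose ?W) * norm (transpose (Bt t) *v x)"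
      using norm_matrix_vector_mult_le[of "transpose ?W" "transpose (Bt t) *v x"] by simp
    also have "norm (transpose ?W) \<le> ?b * norm (?V t)" by (simp only: norm_transpose norm_matrix_mult_le)
    also have "\<dots> \<le> K1 * ?b + 1"
      using mult_left_mono[OF K1(2)[OF t], of ?b] by (simp add: mult.commute)
    finally show ?thesis by (simp add: mult_right_mono)
  qed
  moreover have "0 < K1 * ?b + 1" using K1(1) by (simp add: add_nonneg_pos)
  ultimately show ?thesis using that by blast
qed

lemma Q_meas: "Q \<in> borel_measurable L"
proof -
  have "(\<lambda>t. transpose (Bt t)) \<in> borel_measurable L"
    by (rule continuous_on_borel_lebesgue_on[OF bounded_linear.continuous_on[OF bounded_linear_transpose Bt_continuous]])
  then have "(\<lambda>t. Bt t ** matrix_inv (\<Gamma> t) ** transpose (Bt t)) \<in> borel_measurable L"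
    by (intro matrix_mult_borel Bt_meas \<Gamma>inv_meas)
  then show ?thesis by (simp add: Q_eq[abs_def])
qed

lemma Q_integrable: "integrable L Q"
proof -
  obtain K where K: "0 < K" "\<And>t. t \<in> {0..T} \<Longrightarrow> norm (Bt t) \<le> K" by (rule Bt_bound) blast
  show ?thesis
  proof (rule Bochner_Integration.integrable_bound)
    show "integrable L (\<lambda>t. K * KI * K * inverse (g t))" using ginv_integrable by simp
    show "AE t in L. norm (Q t) \<le> norm (K * KI * K * inverse (g t))"
      using AE_L_less
    proof eventually_elim
      case (elim t)
      then have t: "t \<in> {0..T}" by auto
      have "norm (Q t) \<le> norm (Bt t ** matrix_inv (\<Gamma> t)) * norm (transpose (Bt t))"
        unfolding Q_eq by (rule norm_matrix_mult_le)
      also have "\<dots> \<le> (norm (Bt t) * norm (matrix_inv (\<Gamma> t))) * norm (Bt t)"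
        unfolding norm_transpose by (intro mult_right_mono norm_matrix_mult_le) simp
      also have "norm (matrix_inv (\<Gamma> t)) = inverse (g t) * norm (matrix_inv (G t))"
        using g(1)[OF elim] by (simp add: \<Gamma>inv_eq[OF elim])
      also have "(norm (Bt t) * (inverse (g t) * norm (matrix_inv (G t)))) * norm (Bt t)
          \<le> (K * (inverse (g t) * KI)) * K"
        using K(1) K(2)[OF t] KI(1) KI(2)[OF elim] g(1)[OF elim] by (intro mult_mono) auto
      finally show ?case using K(1) KI(1) g(1)[OF elim] by (simp add: abs_mult mult_ac)
    qed
  qed (rule Q_meas)
qed

lemma Q_lower_bound:
  obtains \<kappa> where "0 < \<kappa>" "\<And>t x. t \<in> {0..<T} \<Longrightarrow> \<kappa> * (T - t) powr (- \<alpha>) * (norm x)\<^sup>2 \<le> x \<bullet> (Q t *v x)"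
proof -
  obtain K where K: "0 < K" "\<And>t x. t \<in> {0..T} \<Longrightarrow> norm x \<le> K * norm (transpose (Bt t) *v x)"
    by (rule transpose_Bt_lower_bound) blast
  let ?\<kappa> = "inverse c / KG / K\<^sup>2"
  have "?\<kappa> * (T - t) powr (- \<alpha>) * (norm x)\<^sup>2 \<le> x \<bullet> (Q t *v x)" if t: "t \<in> {0..<T}" for t x
  proof -
    let ?y = "transpose (Bt t) *v x"
    have tT: "t \<in> {0..T}" "0 < T - t" using t by auto
    have "inverse c * (T - t) powr (- \<alpha>) = inverse (c * (T - t) powr \<alpha>)" by (simp add: powr_minus)
    also have "\<dots> \<le> inverse (g t)" using g(1,2)[OF t] by (intro le_imp_inverse_le) auto
    finally have gi: "inverse c * (T - t) powr (- \<alpha>) \<le> inverse (g t)" .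
    have "(norm x)\<^sup>2 \<le> (K * norm ?y)\<^sup>2" by (intro power_mono K(2) tT) simp
    then have "(norm x)\<^sup>2 / K\<^sup>2 \<le> (norm ?y)\<^sup>2" using K(1) by (simp add: power_mult_distrib field_simps)
    then have "(norm x)\<^sup>2 / K\<^sup>2 / KG \<le> (norm ?y)\<^sup>2 / KG" using KG(1) by (intro divide_right_mono) auto
    also have "\<dots> \<le> ?y \<bullet> (matrix_inv (G t) *v ?y)"
      by (rule sym_pos_def_inverse_lower_bound[OF G_spd[OF t] KG(2)[OF t] KG(1)])
    finally have y: "(norm x)\<^sup>2 / K\<^sup>2 / KG \<le> ?y \<bullet> (matrix_inv (G t) *v ?y)" .
    have "inverse c * (T - t) powr (- \<alpha>) * ((norm x)\<^sup>2 / K\<^sup>2 / KG) \<le> inverse (g t) * (?y \<bullet> (matrix_inv (G t) *v ?y))"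
      using gi y g(1)[OF t] KG(1) by (intro mult_mono) auto
    also have "\<dots> = ?y \<bullet> (matrix_inv (\<Gamma> t) *v ?y)"
      by (simp add: \<Gamma>inv_eq[OF t] scaleR_matrix_vector_assoc[symmetric])
    also have "\<dots> = x \<bullet> (Q t *v x)"
      by (simp add: Q_eq matrix_vector_mul_assoc[symmetric] inner_transpose_mult[of x "Bt t"] del: transpose_matrix_vector)
    finally show ?thesis by (simp add: field_simps)
  qed
  moreover have "0 < ?\<kappa>" using c KG(1) K(1) by simp
  ultimately show ?thesis using that by blast
qed

lemma Q_integrable_sub: "s \<in> {0..T} \<Longrightarrow> integrable (lebesgue_on {s..T}) Q"
  by (rule integrable_lebesgue_on_subset[OF Q_integrable]) auto

text \<open>Integrate the lower bound for \<open>Q\<close> over \<open>[s, T]\<close>.\<close>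

lemma R_coercive:
  obtains \<kappa> where "0 < \<kappa>" "\<And>s x. s \<in> {0..<T} \<Longrightarrow> \<kappa> * (T - s) powr (1 - \<alpha>) * norm x \<le> norm (R s *v x)"
proof -
  obtain \<kappa> where \<kappa>: "0 < \<kappa>" "\<And>t x. t \<in> {0..<T} \<Longrightarrow> \<kappa> * (T - t) powr (- \<alpha>) * (norm x)\<^sup>2 \<le> x \<bullet> (Q t *v x)"
    by (rule Q_lower_bound) blast
  let ?k = "\<kappa> / (1 - \<alpha>)"
  have "?k * (T - s) powr (1 - \<alpha>) * norm x \<le> norm (R s *v x)" if s: "s \<in> {0..<T}" for s x
  proof (cases "x = 0")
    case False
    let ?N = "lebesgue_on {s..T}"
    have sT: "s \<le> T" "s \<in> {0..T}" using s by auto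
    note Qi = Q_integrable_sub[OF sT(2)]
    have bl: "bounded_linear (\<lambda>X::real ^ 'n ^ 'n. x \<bullet> (X *v x))"
      by (intro bounded_linear_compose[OF bounded_linear_inner_right]
          bounded_bilinear.bounded_linear_left[OF bounded_bilinear_matrix_vector_mult])
    have "(T - s) powr (1 - \<alpha>) / (1 - \<alpha>) * (\<kappa> * (norm x)\<^sup>2) = (LINT t|?N. (T - t) powr (- \<alpha>) * (\<kappa> * (norm x)\<^sup>2))"
      using powr_integral(2)[OF sT(1), of "- \<alpha>"] \<alpha> by simp
    also have "\<dots> \<le> (LINT t|?N. x \<bullet> (Q t *v x))"
    proof (rule integral_mono_AE)
      show "integrable ?N (\<lambda>t. (T - t) powr (- \<alpha>) * (\<kappa> * (norm x)\<^sup>2))"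
        using powr_integral(1)[OF sT(1), of "- \<alpha>"] \<alpha> by simp
      show "integrable ?N (\<lambda>t. x \<bullet> (Q t *v x))" by (rule integrable_bounded_linear[OF bl Qi])
      show "AE t in ?N. (T - t) powr (- \<alpha>) * (\<kappa> * (norm x)\<^sup>2) \<le> x \<bullet> (Q t *v x)"
        using AE_lebesgue_on_less[of s T]
      proof eventually_elim
        case (elim t)
        then show ?case using \<kappa>(2)[of t x] s by (simp add: mult_ac)
      qed
    qed
    also have "\<dots> = x \<bullet> (R s *v x)" unfolding R_mat_def by (rule integral_bounded_linear[OF bl Qi])
    also have "\<dots> \<le> norm x * norm (R s *v x)" by (rule norm_cauchy_schwarz)
    finally have "norm x * (?k * (T - s) powr (1 - \<alpha>) * norm x) \<le> norm x * norm (R s *v x)"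
      by (simp add: power2_eq_square mult_ac)
    then show ?thesis by (rule mult_left_le_imp_le) (use False in simp)
  qed simp
  moreover have "0 < ?k" using \<kappa>(1) \<alpha> by simp
  ultimately show ?thesis using that by blast
qed

lemma R_invertible: "s \<in> {0..<T} \<Longrightarrow> invertible (R s)"
proof -
  assume s: "s \<in> {0..<T}"
  obtain \<kappa> where \<kappa>: "0 < \<kappa>" "\<And>s x. s \<in> {0..<T} \<Longrightarrow> \<kappa> * (T - s) powr (1 - \<alpha>) * norm x \<le> norm (R s *v x)"
    by (rule R_coercive) blast
  have "0 < \<kappa> * (T - s) powr (1 - \<alpha>)" using \<kappa>(1) s by simp
  from norm_matrix_inv_le(1)[OF this \<kappa>(2)[OF s]] show ?thesis .
qed

lemma Rinv_bound:
  obtains K where "0 < K" "\<And>s. s \<in> {0..<T} \<Longrightarrow> norm (matrix_inv (R s)) \<le> K * (T - s) powr (\<alpha> - 1)"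
proof -
  obtain \<kappa> where \<kappa>: "0 < \<kappa>" "\<And>s x. s \<in> {0..<T} \<Longrightarrow> \<kappa> * (T - s) powr (1 - \<alpha>) * norm x \<le> norm (R s *v x)"
    by (rule R_coercive) blast
  have "norm (matrix_inv (R s)) \<le> real CARD('n) / \<kappa> * (T - s) powr (\<alpha> - 1)" if s: "s \<in> {0..<T}" for s
  proof -
    have "0 < \<kappa> * (T - s) powr (1 - \<alpha>)" using \<kappa>(1) s by simp
    from norm_matrix_inv_le(2)[OF this \<kappa>(2)[OF s]]
    have "norm (matrix_inv (R s)) \<le> real CARD('n) / (\<kappa> * (T - s) powr (1 - \<alpha>))" .
    also have "\<dots> = real CARD('n) / \<kappa> * (T - s) powr (- (1 - \<alpha>))"
      unfolding powr_minus by (simp add: field_simps)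
    finally show ?thesis by simp
  qed
  moreover have "0 < real CARD('n) / \<kappa>" using \<kappa>(1) by simp
  ultimately show ?thesis using that by blast
qed

lemma R_continuous: "continuous_on {0..T} R"
proof -
  let ?Z = "\<lambda>t. LINT s|lebesgue_on {0..t}. Q s"
  have eq: "R s = R 0 - ?Z s" if s: "s \<in> {0..T}" for s
  proof -
    have i: "integrable (lebesgue_on {0..s}) Q" "integrable (lebesgue_on {s..T}) Q"
      using s by (auto intro!: integrable_lebesgue_on_subset[OF Q_integrable])
    have "(Q has_integral (?Z s + R s)) {0..T}"
      unfolding R_mat_def using s
      by (intro has_integral_combine[OF _ _ has_integral_integral_lebesgue_on[OF i(1)] has_integral_integral_lebesgue_on[OF i(2)]]) auto
    moreover have "(Q has_integral R 0) {0..T}"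
      unfolding R_mat_def by (rule has_integral_integral_lebesgue_on[OF Q_integrable]) auto
    ultimately have "?Z s + R s = R 0" by (rule has_integral_unique)
    then show ?thesis by (simp add: algebra_simps)
  qed
  have "continuous_on {0..T} (\<lambda>s. R 0 - ?Z s)"
    by (intro continuous_on_diff continuous_on_const continuous_on_indefinite_integral[OF Q_integrable])
  then show ?thesis by (subst continuous_on_cong[OF refl eq]) auto
qed

lemma Rinv_meas: "(\<lambda>s. matrix_inv (R s)) \<in> borel_measurable L"
proof (rule measurable_lebesgue_on_endpoint, rule borel_measurable_matrix_inv)
  have "R \<in> borel_measurable L" by (rule continuous_on_borel_lebesgue_on[OF R_continuous])
  then have "R \<in> borel_measurable (restrict_space L {0..<T})" by (rule measurable_restrict_space1)
  moreover have "restrict_space L {0..<T} = lebesgue_on {0..<T}"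
    by (rule lebesgue_on_subset_eq[symmetric]) auto
  ultimately show "R \<in> borel_measurable (lebesgue_on {0..<T})" by simp
qed (auto intro: R_invertible)

text \<open>Freezing \<open>R\<^sup>-\<^sup>1\<close> at \<open>T - \<delta>\<close> removes its singularity at \<open>T\<close> and so gives a continuous factor.\<close>

lemma Rinv_continuous:
  assumes "0 < \<delta>" "\<delta> < T"
  shows "continuous_on {0..T} (\<lambda>s. matrix_inv (R (min s (T - \<delta>))))"
proof (rule continuous_on_compose2[OF continuous_on_matrix_inv])
  show "continuous_on {0..T} (\<lambda>s. R (min s (T - \<delta>)))"
    by (rule continuous_on_compose2[OF R_continuous]) (use assms in \<open>auto intro!: continuous_intros\<close>)
qed (use assms in \<open>auto intro!: R_invertible\<close>)

section \<open>The integrand of the multiplier process\<close>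

lemma kf: "adapted_process M w T k\<^sub>f" "square_integrable TM (\<lambda>(s, \<omega>). k\<^sub>f s \<omega>)"
  by (rule ito_integrand[OF f_ito])+

lemma k\<^sub>\<mu>_eq: "k\<^sub>\<mu> s \<omega> = matrix_inv (R s) ** k\<^sub>f s \<omega>"
  by (simp add: k_mu_def)

text \<open>The factor \<open>(T - s)\<^sup>\<alpha>\<^sup>-\<^sup>1\<close> bounds \<open>R\<^sup>-\<^sup>1\<close>. Before \<open>\<theta>\<close> it is bounded; after \<open>\<theta>\<close> its square, which has the
  exponent \<open>2 \<alpha> - 2 > -1\<close>, is integrable and the second moment of \<open>k\<^sub>f\<close> is bounded.\<close>

lemma weighted_kf_square_integrable:
  "square_integrable TM (\<lambda>(s, \<omega>). (T - s) powr (\<alpha> - 1) *\<^sub>R k\<^sub>f s \<omega>)"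
proof -
  let ?e = "\<lambda>s. \<integral>\<^sup>+\<omega>. ennreal ((norm (k\<^sub>f s \<omega>))\<^sup>2) \<partial>M"
  let ?p = "2 * \<alpha> - 2"
  note km = square_integrableD(1)[OF kf(2)]
  have pm: "(\<lambda>s. (T - s) powr q) \<in> borel_measurable L" for q
    using measurable_ident_lebesgue_on[of "{0..T}"] by measurable
  have hm: "(\<lambda>x. (T - fst x) powr (\<alpha> - 1) *\<^sub>R (case x of (s, \<omega>) \<Rightarrow> k\<^sub>f s \<omega>)) \<in> borel_measurable TM"
    by (intro borel_measurable_scaleR measurable_compose[OF measurable_fst pm] km)
  have kn: "(\<lambda>x. ennreal ((norm (case x of (s, \<omega>) \<Rightarrow> k\<^sub>f s \<omega>))\<^sup>2)) \<in> borel_measurable TM"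
    using km by measurable
  have em: "?e \<in> borel_measurable L"
    using borel_measurable_nn_integral_fst[OF kn] by simp
  have sq: "(norm ((T - s) powr (\<alpha> - 1) *\<^sub>R v))\<^sup>2 = (T - s) powr ?p * (norm v)\<^sup>2" for s and v :: "real ^ 'd ^ 'n"
  proof -
    have "((T - s) powr (\<alpha> - 1))\<^sup>2 = (T - s) powr ?p"
      by (simp add: power2_eq_square powr_add[symmetric])
    then show ?thesis by (simp add: power_mult_distrib)
  qed
  have e_fin: "(\<integral>\<^sup>+s. ?e s \<partial>L) < \<infinity>"
  proof -
    have "(\<integral>\<^sup>+s. ?e s \<partial>L) = (\<integral>\<^sup>+x. ennreal ((norm (case x of (s, \<omega>) \<Rightarrow> k\<^sub>f s \<omega>))\<^sup>2) \<partial>TM)"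
      using nn_integral_fst[OF kn] by simp
    then show ?thesis using kf(2) unfolding square_integrable_iff_nn by simp
  qed
  have AE_bound: "AE s in L. s \<ge> \<theta> \<longrightarrow> ?e s \<le> ennreal Kf"
  proof -
    have "{\<theta>..T} \<subseteq> {0..T}" using \<theta> by auto
    then have r: "lebesgue_on {\<theta>..T} = restrict_space L {\<theta>..T}" by (rule lebesgue_on_subset_eq) auto
    have "{\<theta>..T} \<inter> space L \<in> sets L" using \<theta> by (auto simp: sets_restrict_space_iff)
    from AE_restrict_space_iff[OF this, of "\<lambda>s. ?e s \<le> ennreal Kf"] kf_bound
    have "AE s in L. s \<in> {\<theta>..T} \<longrightarrow> ?e s \<le> ennreal Kf" by (simp only: r)
    then show ?thesis using AE_space by eventually_elim auto
  qed
  have "(\<integral>\<^sup>+x. ennreal ((norm ((T - fst x) powr (\<alpha> - 1) *\<^sub>R (case x of (s, \<omega>) \<Rightarrow> k\<^sub>f s \<omega>)))\<^sup>2) \<partial>TM)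
     = (\<integral>\<^sup>+s. \<integral>\<^sup>+\<omega>. ennreal ((norm ((T - s) powr (\<alpha> - 1) *\<^sub>R k\<^sub>f s \<omega>))\<^sup>2) \<partial>M \<partial>L)"
  proof -
    have "(\<lambda>x. ennreal ((norm ((T - fst x) powr (\<alpha> - 1) *\<^sub>R (case x of (s, \<omega>) \<Rightarrow> k\<^sub>f s \<omega>)))\<^sup>2)) \<in> borel_measurable TM"
      using borel_measurable_power[OF measurable_compose[OF hm borel_measurable_norm], of 2] by (rule measurable_compose) simp
    from nn_integral_fst[OF this] show ?thesis by simp
  qed
  also have "\<dots> = (\<integral>\<^sup>+s. ennreal ((T - s) powr ?p) * ?e s \<partial>L)"
  proof (rule nn_integral_cong)
    fix s assume "s \<in> space L"
    have "k\<^sub>f s \<in> borel_measurable M" using adapted_processD(3)[OF kf(1), of s] \<open>s \<in> space L\<close> by simp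
    then have "(\<integral>\<^sup>+\<omega>. ennreal ((T - s) powr ?p) * ennreal ((norm (k\<^sub>f s \<omega>))\<^sup>2) \<partial>M) = ennreal ((T - s) powr ?p) * ?e s"
      by (intro nn_integral_cmult) measurable
    then show "(\<integral>\<^sup>+\<omega>. ennreal ((norm ((T - s) powr (\<alpha> - 1) *\<^sub>R k\<^sub>f s \<omega>))\<^sup>2) \<partial>M) = ennreal ((T - s) powr ?p) * ?e s"
      unfolding sq by (simp add: ennreal_mult')
  qed
  also have "\<dots> \<le> (\<integral>\<^sup>+s. ennreal ((T - \<theta>) powr ?p) * ?e s + ennreal Kf * ennreal ((T - s) powr ?p) \<partial>L)"
  proof (rule nn_integral_mono_AE)
    show "AE s in L. ennreal ((T - s) powr ?p) * ?e s
       \<le> ennreal ((T - \<theta>) powr ?p) * ?e s + ennreal Kf * ennreal ((T - s) powr ?p)"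
      using AE_bound
    proof eventually_elim
      case (elim s)
      show ?case
      proof (cases "\<theta> \<le> s")
        case True
        then have "ennreal ((T - s) powr ?p) * ?e s \<le> ennreal ((T - s) powr ?p) * ennreal Kf"
          using elim by (intro mult_left_mono) auto
        also have "\<dots> = ennreal Kf * ennreal ((T - s) powr ?p)" by (rule mult.commute)
        finally show ?thesis by (rule order_trans) simp
      next
        case False
        then have "(T - s) powr ?p \<le> (T - \<theta>) powr ?p" using \<theta> \<alpha> by (intro powr_mono2') auto
        then have "ennreal ((T - s) powr ?p) * ?e s \<le> ennreal ((T - \<theta>) powr ?p) * ?e s"
          by (intro mult_right_mono ennreal_leI) auto
        then show ?thesis by (rule order_trans) simp
      qed
    qed
  qed
  also have "\<dots> = ennreal ((T - \<theta>) powr ?p) * (\<integral>\<^sup>+s. ?e s \<partial>L) + ennreal Kf * (\<integral>\<^sup>+s. ennreal ((T - s) powr ?p) \<partial>L)"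
    using em pm by (subst nn_integral_add) (auto simp: nn_integral_cmult)
  also have "\<dots> < \<infinity>"
  proof -
    have "integrable L (\<lambda>s. (T - s) powr ?p)" using powr_integral(1)[of 0 T ?p] T_pos \<alpha> by simp
    then have "(\<integral>\<^sup>+s. ennreal ((T - s) powr ?p) \<partial>L) < \<infinity>" by (simp add: nn_integral_eq_integral)
    with e_fin show ?thesis by (simp add: ennreal_mult_less_top)
  qed
  finally show ?thesis
    unfolding square_integrable_iff_nn using hm by (simp add: split_beta')
qed

lemma k\<^sub>\<mu>_measurable: "(\<lambda>(s, \<omega>). k\<^sub>\<mu> s \<omega>) \<in> borel_measurable TM"
  unfolding k\<^sub>\<mu>_eq[abs_def]
  by (rule continuous_mult_measurable[OF Rinv_meas square_integrableD(1)[OF kf(2)]])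

lemma k\<^sub>\<mu>_adapted: "adapted_process M w T k\<^sub>\<mu>"
  unfolding adapted_process_def
proof (intro conjI ballI)
  show "k\<^sub>\<mu> t \<in> borel_measurable (F t)" if "t \<in> {0..T}" for t
    unfolding k\<^sub>\<mu>_eq[abs_def] by (intro matrix_mult_borel adapted_processD(2)[OF kf(1) that]) simp
qed (rule k\<^sub>\<mu>_measurable)

lemma k\<^sub>\<mu>_square_integrable: "square_integrable TM (\<lambda>(s, \<omega>). k\<^sub>\<mu> s \<omega>)"
proof -
  obtain K where K: "0 < K" "\<And>s. s \<in> {0..<T} \<Longrightarrow> norm (matrix_inv (R s)) \<le> K * (T - s) powr (\<alpha> - 1)"
    by (rule Rinv_bound) blast
  show ?thesis
  proof (rule square_integrable_bound[OF weighted_kf_square_integrable k\<^sub>\<mu>_measurable])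
    show "AE x in TM. norm (case x of (s, \<omega>) \<Rightarrow> k\<^sub>\<mu> s \<omega>) \<le> K * norm (case x of (s, \<omega>) \<Rightarrow> (T - s) powr (\<alpha> - 1) *\<^sub>R k\<^sub>f s \<omega>)"
      using AE_TM_less
    proof eventually_elim
      case (elim x)
      obtain s \<omega> where x: "x = (s, \<omega>)" by (cases x)
      have "norm (matrix_inv (R s) ** k\<^sub>f s \<omega>) \<le> norm (matrix_inv (R s)) * norm (k\<^sub>f s \<omega>)" by (rule norm_matrix_mult_le)
      also have "\<dots> \<le> (K * (T - s) powr (\<alpha> - 1)) * norm (k\<^sub>f s \<omega>)"
        using elim by (intro mult_right_mono K(2)) (auto simp: x)
      finally show ?case by (simp add: x k\<^sub>\<mu>_eq mult.assoc)
    qed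
  qed
qed

text \<open>By dominated convergence, as the frozen factors tend to \<open>R\<^sup>-\<^sup>1\<close>. They stay below the bound for \<open>R\<^sup>-\<^sup>1\<close>
  because \<open>(T - s)\<^sup>\<alpha>\<^sup>-\<^sup>1\<close> increases in \<open>s\<close>.\<close>

lemma k\<^sub>\<mu>_approximable: "approximable k\<^sub>\<mu>"
proof -
  obtain K where K: "0 < K" "\<And>s. s \<in> {0..<T} \<Longrightarrow> norm (matrix_inv (R s)) \<le> K * (T - s) powr (\<alpha> - 1)"
    by (rule Rinv_bound) blast
  define \<delta> where "\<delta> j = T * inverse (real (Suc (Suc j)))" for j :: nat
  have \<delta>: "0 < \<delta> j" "\<delta> j < T" for j
  proof -
    have "0 < inverse (real (Suc (Suc j)))" "inverse (real (Suc (Suc j))) < 1" by (simp_all add: inverse_less_1_iff)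
    from mult_strict_left_mono[OF this(2) T_pos] mult_pos_pos[OF T_pos this(1)]
    show "0 < \<delta> j" "\<delta> j < T" by (simp_all only: \<delta>_def mult_1_right)
  qed
  have \<delta>_lim: "\<delta> \<longlonglongrightarrow> 0"
    unfolding \<delta>_def[abs_def]
    by (intro tendsto_mult_right_zero LIMSEQ_Suc[OF LIMSEQ_inverse_real_of_nat])
  define \<rho> where "\<rho> j s = matrix_inv (R (min s (T - \<delta> j)))" for j s
  have \<rho>c: "continuous_on {0..T} (\<rho> j)" for j
    unfolding \<rho>_def[abs_def] by (rule Rinv_continuous[OF \<delta>])
  let ?h = "\<lambda>(s, \<omega>). (T - s) powr (\<alpha> - 1) *\<^sub>R k\<^sub>f s \<omega>"
  have h: "square_integrable TM (\<lambda>x. K *\<^sub>R ?h x)"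
    by (rule square_integrable_bound[OF weighted_kf_square_integrable, of _ K])
      (use K(1) square_integrableD(1)[OF weighted_kf_square_integrable] in auto)
  have \<rho>m: "(\<lambda>(s, \<omega>). \<rho> j s ** k\<^sub>f s \<omega>) \<in> borel_measurable TM" for j
    by (rule continuous_mult_measurable[OF continuous_on_borel_lebesgue_on[OF \<rho>c] square_integrableD(1)[OF kf(2)]])
  show ?thesis
  proof (rule approximable_L2_tendsto[OF k\<^sub>\<mu>_measurable])
    show "approximable (\<lambda>s \<omega>. \<rho> j s ** k\<^sub>f s \<omega>)" for j
      by (rule approximable_continuous_mult[OF f_ito \<rho>c])
    show "L2_tendsto TM (\<lambda>j (s, \<omega>). \<rho> j s ** k\<^sub>f s \<omega>) (\<lambda>(s, \<omega>). k\<^sub>\<mu> s \<omega>)"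
    proof (rule L2_tendsto_dominated_convergence[OF \<rho>m k\<^sub>\<mu>_measurable h])
      show "AE x in TM. norm (case x of (s, \<omega>) \<Rightarrow> \<rho> j s ** k\<^sub>f s \<omega>) \<le> norm (K *\<^sub>R ?h x)" for j
        using AE_TM_less
      proof eventually_elim
        case (elim x)
        obtain s \<omega> where x: "x = (s, \<omega>)" by (cases x)
        then have s: "s \<in> {0..<T}" using elim by simp
        have "norm (\<rho> j s) \<le> K * (T - min s (T - \<delta> j)) powr (\<alpha> - 1)"
          unfolding \<rho>_def using s \<delta>[of j] by (intro K(2)) auto
        also have "\<dots> \<le> K * (T - s) powr (\<alpha> - 1)"
          using K(1) s \<alpha> by (intro mult_left_mono powr_mono2') auto
        finally have "norm (\<rho> j s) * norm (k\<^sub>f s \<omega>) \<le> (K * (T - s) powr (\<alpha> - 1)) * norm (k\<^sub>f s \<omega>)"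
          by (intro mult_right_mono) auto
        then show ?case using norm_matrix_mult_le[of "\<rho> j s" "k\<^sub>f s \<omega>"] K(1) by (simp add: x mult.assoc)
      qed
      show "AE x in TM. (\<lambda>j. case x of (s, \<omega>) \<Rightarrow> \<rho> j s ** k\<^sub>f s \<omega>) \<longlonglongrightarrow> (case x of (s, \<omega>) \<Rightarrow> k\<^sub>\<mu> s \<omega>)"
        using AE_TM_less
      proof eventually_elim
        case (elim x)
        obtain s \<omega> where x: "x = (s, \<omega>)" by (cases x)
        then have s: "0 < T - s" using elim by simp
        have "eventually (\<lambda>j. \<delta> j < T - s) sequentially" using \<delta>_lim s by (rule order_tendstoD)
        then have "eventually (\<lambda>j. \<rho> j s ** k\<^sub>f s \<omega> = k\<^sub>\<mu> s \<omega>) sequentially"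
          by eventually_elim (simp add: \<rho>_def k\<^sub>\<mu>_eq min_absorb1)
        then show ?case unfolding x by (simp add: tendsto_eventually)
      qed
    qed
  qed (rule \<rho>m)
qed

lemma mu_exists: "\<exists>\<mu>. ito_process M w T y k\<^sub>\<mu> \<mu>"
proof -
  obtain X where X: "\<And>\<omega>. \<omega> \<in> space M \<Longrightarrow> continuous_on {0..T} (\<lambda>t. X t \<omega>)"
    "\<And>t. t \<in> {0..T} \<Longrightarrow> has_ito_integral M w T k\<^sub>\<mu> t (X t)"
    by (rule ito_continuous_version[OF k\<^sub>\<mu>_adapted k\<^sub>\<mu>_square_integrable k\<^sub>\<mu>_approximable]) blast
  have "ito_process M w T y k\<^sub>\<mu> (\<lambda>t \<omega>. y + X t \<omega>)"
    unfolding ito_process_def using X by (auto intro!: continuous_intros)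
  then show ?thesis by blast
qed

end

section \<open>Square integrals with a weight in time\<close>

context wiener_space
begin

lemma fst_measurable_TM: "q \<in> borel_measurable (lebesgue_on {0..T}) \<Longrightarrow> (\<lambda>x. q (fst x)) \<in> borel_measurable TM"
  by (rule measurable_compose[OF measurable_fst])

lemma snd_measurable_TM: "q \<in> borel_measurable M \<Longrightarrow> (\<lambda>x. q (snd x)) \<in> borel_measurable TM"
  by (rule measurable_compose[OF measurable_snd])

text \<open>A continuous process is the limit of its values at dyadic times.\<close>

lemma continuous_process_measurable:
  fixes v :: "real \<Rightarrow> 'a \<Rightarrow> 'b::euclidean_space"
  assumes c: "\<And>\<omega>. \<omega> \<in> space M \<Longrightarrow> continuous_on {0..T} (\<lambda>t. v t \<omega>)"
    and m: "\<And>t. t \<in> {0..T} \<Longrightarrow> v t \<in> borel_measurable M"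
  shows "(\<lambda>(t, \<omega>). v t \<omega>) \<in> borel_measurable TM"
proof (rule borel_measurable_LIMSEQ_metric)
  let ?v = "\<lambda>n i \<omega>. v (min T (dyadic n i)) \<omega>"
  show "(\<lambda>x. ?v n (dyadic_index n (fst x)) (snd x)) \<in> borel_measurable TM" for n
  proof (rule measurable_compose_countable)
    show "(\<lambda>x. ?v n i (snd x)) \<in> borel_measurable TM" for i
      using T_pos by (intro snd_measurable_TM m) (auto simp: dyadic_def)
    have [measurable]: "(\<lambda>x. fst x) \<in> borel_measurable TM"
      by (rule fst_measurable_TM[OF measurable_ident_lebesgue_on])
    have [measurable]: "(\<lambda>x::real. \<lfloor>x\<rfloor>) \<in> measurable borel (count_space UNIV)"
      by (rule measurable_real_floor)
    have "(\<lambda>x. \<lfloor>fst x * 2 ^ n / T\<rfloor>) \<in> measurable TM (count_space UNIV)" by measurable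
    then show "(\<lambda>x. dyadic_index n (fst x)) \<in> measurable TM (count_space UNIV)"
      unfolding dyadic_index_def by (rule measurable_compose) simp
  qed
  fix x assume "x \<in> space TM"
  then obtain t \<omega> where x: "x = (t, \<omega>)" "t \<in> {0..T}" "\<omega> \<in> space M" by (auto simp: space_pair_measure)
  have mem: "dyadic n (dyadic_index n t) \<in> {0..T}" for n by (rule dyadic_mem[OF dyadic_index(1)[OF x(2)]])
  have "(\<lambda>n. v (dyadic n (dyadic_index n t)) \<omega>) \<longlonglongrightarrow> v t \<omega>"
    by (rule continuous_on_tendsto_compose[OF c[OF x(3)] dyadic_index(2)[OF x(2)] x(2)]) (use mem in auto)
  moreover have "min T (dyadic n (dyadic_index n t)) = dyadic n (dyadic_index n t)" for n
    using mem[of n] by auto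
  ultimately show "(\<lambda>n. ?v n (dyadic_index n (fst x)) (snd x)) \<longlonglongrightarrow> (case x of (t, \<omega>) \<Rightarrow> v t \<omega>)"
    by (simp add: x(1))
qed

text \<open>A weight that is integrable in time may be singular at \<open>T\<close>; the second moment of \<open>v\<close> is bounded
  uniformly in time, so Fubini's theorem applies.\<close>

lemma weighted_integrable:
  fixes v :: "real \<Rightarrow> 'a \<Rightarrow> 'b::euclidean_space" and q :: "real \<Rightarrow> real"
  assumes q: "integrable (lebesgue_on {0..T}) q" "\<And>t. t \<in> {0..T} \<Longrightarrow> 0 \<le> q t"
    and v: "(\<lambda>(t, \<omega>). v t \<omega>) \<in> borel_measurable TM"
    and K: "\<And>t. t \<in> {0..T} \<Longrightarrow> square_integrable M (v t)" "\<And>t. t \<in> {0..T} \<Longrightarrow> (LINT \<omega>|M. (norm (v t \<omega>))\<^sup>2) \<le> K"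
  shows "integrable TM (\<lambda>(t, \<omega>). q t * (norm (v t \<omega>))\<^sup>2)"
proof -
  interpret P: pair_sigma_finite "lebesgue_on {0..T}" M by (rule pair_sigma_finite_TM)
  show ?thesis
  proof (rule P.Fubini_integrable)
    have "(\<lambda>x. q (fst x) * (norm (case x of (t, \<omega>) \<Rightarrow> v t \<omega>))\<^sup>2) \<in> borel_measurable TM"
      using fst_measurable_TM[of q] q(1) borel_measurable_power[OF measurable_compose[OF v borel_measurable_norm], of 2]
      by (intro borel_measurable_times) auto
    then show m: "(\<lambda>(t, \<omega>). q t * (norm (v t \<omega>))\<^sup>2) \<in> borel_measurable TM" by (simp add: split_beta')
    show "AE t in lebesgue_on {0..T}. integrable M (\<lambda>\<omega>. case (t, \<omega>) of (t, \<omega>) \<Rightarrow> q t * (norm (v t \<omega>))\<^sup>2)"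
      using square_integrableD(2)[OF K(1)] by (intro AE_I2) auto
    show "integrable (lebesgue_on {0..T}) (\<lambda>t. LINT \<omega>|M. norm (case (t, \<omega>) of (t, \<omega>) \<Rightarrow> q t * (norm (v t \<omega>))\<^sup>2))"
    proof (rule Bochner_Integration.integrable_bound)
      show "integrable (lebesgue_on {0..T}) (\<lambda>t. K * q t)" using q(1) by simp
      have "(\<lambda>x. norm (case x of (t, \<omega>) \<Rightarrow> q t * (norm (v t \<omega>))\<^sup>2)) \<in> borel_measurable TM"
        by (rule measurable_compose[OF m borel_measurable_norm])
      then show "(\<lambda>t. LINT \<omega>|M. norm (case (t, \<omega>) of (t, \<omega>) \<Rightarrow> q t * (norm (v t \<omega>))\<^sup>2)) \<in> borel_measurable (lebesgue_on {0..T})"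
        by (intro borel_measurable_lebesgue_integral) (simp add: split_beta')
      show "AE t in lebesgue_on {0..T}. norm (LINT \<omega>|M. norm (case (t, \<omega>) of (t, \<omega>) \<Rightarrow> q t * (norm (v t \<omega>))\<^sup>2)) \<le> norm (K * q t)"
      proof (rule AE_I2)
        fix t assume "t \<in> space (lebesgue_on {0..T})"
        then have t: "t \<in> {0..T}" by simp
        have "(LINT \<omega>|M. norm (case (t, \<omega>) of (t, \<omega>) \<Rightarrow> q t * (norm (v t \<omega>))\<^sup>2)) = q t * (LINT \<omega>|M. (norm (v t \<omega>))\<^sup>2)"
          using q(2)[OF t] by (simp add: abs_mult)
        also have "\<dots> \<le> q t * K" by (intro mult_left_mono K(2) q(2) t)
        finally have "(LINT \<omega>|M. norm (case (t, \<omega>) of (t, \<omega>) \<Rightarrow> q t * (norm (v t \<omega>))\<^sup>2)) \<le> \<bar>K * q t\<bar>"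
          by (simp add: mult.commute)
        moreover have "0 \<le> (LINT \<omega>|M. norm (case (t, \<omega>) of (t, \<omega>) \<Rightarrow> q t * (norm (v t \<omega>))\<^sup>2))" by simp
        ultimately show "norm (LINT \<omega>|M. norm (case (t, \<omega>) of (t, \<omega>) \<Rightarrow> q t * (norm (v t \<omega>))\<^sup>2)) \<le> norm (K * q t)"
          by (simp only: real_norm_def abs_of_nonneg)
      qed
    qed
  qed
qed

text \<open>Cauchy--Schwarz for the measure \<open>q dt\<close> bounds the square of the time integral.\<close>

lemma weighted_integral_square_integrable:
  fixes v :: "real \<Rightarrow> 'a \<Rightarrow> 'b::euclidean_space" and q :: "real \<Rightarrow> real"
  assumes q: "integrable (lebesgue_on {0..T}) q" "\<And>t. t \<in> {0..T} \<Longrightarrow> 0 \<le> q t"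
    and v: "(\<lambda>(t, \<omega>). v t \<omega>) \<in> borel_measurable TM"
    and K: "\<And>t. t \<in> {0..T} \<Longrightarrow> square_integrable M (v t)" "\<And>t. t \<in> {0..T} \<Longrightarrow> (LINT \<omega>|M. (norm (v t \<omega>))\<^sup>2) \<le> K"
  shows "AE \<omega> in M. integrable (lebesgue_on {0..T}) (\<lambda>t. q t * norm (v t \<omega>))"
    and "square_integrable M (\<lambda>\<omega>. LINT t|lebesgue_on {0..T}. q t * norm (v t \<omega>))"
proof -
  let ?L = "lebesgue_on {0..T}"
  interpret P: pair_sigma_finite ?L M by (rule pair_sigma_finite_TM)
  note i = weighted_integrable[OF assms]
  define c where "c = (LINT t|?L. q t)"
  have qm [measurable]: "q \<in> borel_measurable ?L" using q(1) by auto
  have sqrt_q: "square_integrable ?L (\<lambda>t. sqrt (q t))"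
    unfolding square_integrable_def
  proof
    show "integrable ?L (\<lambda>t. (norm (sqrt (q t)))\<^sup>2)"
      using q by (subst Bochner_Integration.integrable_cong[where g=q]) auto
  qed measurable
  have v\<omega>: "(\<lambda>t. v t \<omega>) \<in> borel_measurable ?L" if "\<omega> \<in> space M" for \<omega>
    using measurable_compose[OF measurable_Pair2'[OF that] v] by simp
  have key: "integrable ?L (\<lambda>t. q t * norm (v t \<omega>)) \<and>
      (LINT t|?L. q t * norm (v t \<omega>))\<^sup>2 \<le> c * (LINT t|?L. q t * (norm (v t \<omega>))\<^sup>2)"
    if \<omega>: "\<omega> \<in> space M" and i\<omega>: "integrable ?L (\<lambda>t. q t * (norm (v t \<omega>))\<^sup>2)" for \<omega>
  proof -
    have [measurable]: "(\<lambda>t. v t \<omega>) \<in> borel_measurable ?L" by (rule v\<omega>[OF \<omega>])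
    have s: "square_integrable ?L (\<lambda>t. sqrt (q t) * norm (v t \<omega>))"
      unfolding square_integrable_def
    proof
      show "integrable ?L (\<lambda>t. (norm (sqrt (q t) * norm (v t \<omega>)))\<^sup>2)"
        using q i\<omega> by (subst Bochner_Integration.integrable_cong[where g="\<lambda>t. q t * (norm (v t \<omega>))\<^sup>2"])
          (auto simp: power_mult_distrib abs_mult)
    qed measurable
    have e1: "\<bar>sqrt (q t)\<bar> * \<bar>sqrt (q t) * norm (v t \<omega>)\<bar> = q t * norm (v t \<omega>)" if "t \<in> {0..T}" for t
      using q(2)[OF that] by (simp add: abs_mult mult.assoc[symmetric])
    have "integrable ?L (\<lambda>t. q t * norm (v t \<omega>))"
      using square_integrable_inner(1)[OF sqrt_q s]
      by (subst Bochner_Integration.integrable_cong[where g="\<lambda>t. norm (sqrt (q t)) * norm (sqrt (q t) * norm (v t \<omega>))"])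
        (auto simp: e1)
    moreover have "(LINT t|?L. norm (sqrt (q t)) * norm (sqrt (q t) * norm (v t \<omega>))) = (LINT t|?L. q t * norm (v t \<omega>))"
      by (intro Bochner_Integration.integral_cong) (auto simp: e1)
    moreover have "(LINT t|?L. (norm (sqrt (q t)))\<^sup>2) = c"
      unfolding c_def using q by (intro Bochner_Integration.integral_cong) auto
    moreover have "(LINT t|?L. (norm (sqrt (q t) * norm (v t \<omega>)))\<^sup>2) = (LINT t|?L. q t * (norm (v t \<omega>))\<^sup>2)"
      using q by (intro Bochner_Integration.integral_cong) (auto simp: power_mult_distrib abs_mult)
    ultimately show ?thesis using integral_Cauchy_Schwarz(1)[OF sqrt_q s] by simp
  qed
  have ae: "AE \<omega> in M. integrable ?L (\<lambda>t. q t * (norm (v t \<omega>))\<^sup>2)"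
    using P.AE_integrable_snd[OF i] by simp
  show "AE \<omega> in M. integrable ?L (\<lambda>t. q t * norm (v t \<omega>))"
    using ae AE_space by eventually_elim (use key in auto)
  show "square_integrable M (\<lambda>\<omega>. LINT t|?L. q t * norm (v t \<omega>))"
    unfolding square_integrable_def
  proof
    have vn: "(\<lambda>x. q (fst x) * norm (case x of (t, \<omega>) \<Rightarrow> v t \<omega>)) \<in> borel_measurable TM"
      by (intro borel_measurable_times fst_measurable_TM qm measurable_compose[OF v borel_measurable_norm])
    show m: "(\<lambda>\<omega>. LINT t|?L. q t * norm (v t \<omega>)) \<in> borel_measurable M"
      using time_integral_measurable[OF vn] by simp
    show "integrable M (\<lambda>\<omega>. (norm (LINT t|?L. q t * norm (v t \<omega>)))\<^sup>2)"
    proof (rule Bochner_Integration.integrable_bound)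
      show "integrable M (\<lambda>\<omega>. c * (LINT t|?L. q t * (norm (v t \<omega>))\<^sup>2))"
        using P.integrable_snd[OF i] by simp
      show "(\<lambda>\<omega>. (norm (LINT t|?L. q t * norm (v t \<omega>)))\<^sup>2) \<in> borel_measurable M" using m by measurable
      show "AE \<omega> in M. norm ((norm (LINT t|?L. q t * norm (v t \<omega>)))\<^sup>2) \<le> norm (c * (LINT t|?L. q t * (norm (v t \<omega>))\<^sup>2))"
        using ae AE_space
      proof eventually_elim
        case (elim \<omega>)
        have "(LINT t|?L. q t * norm (v t \<omega>))\<^sup>2 \<le> c * (LINT t|?L. q t * (norm (v t \<omega>))\<^sup>2)"
          using key[OF elim(2,1)] by blast
        then show ?case by simp
      qed
    qed
  qed
qed

lemma L_class_21_iff: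
  fixes v :: "real \<Rightarrow> 'a \<Rightarrow> 'b::euclidean_space"
  shows "v \<in> L_class M w T 2 1 \<longleftrightarrow> adapted_process M w T v \<and>
     (AE \<omega> in M. integrable (lebesgue_on {0..T}) (\<lambda>t. v t \<omega>)) \<and>
     square_integrable M (\<lambda>\<omega>. LINT t|lebesgue_on {0..T}. norm (v t \<omega>))"
proof (cases "adapted_process M w T v")
  case True
  let ?L = "lebesgue_on {0..T}"
  note m = adapted_processD[OF True]
  have n: "norm (v t \<omega>) powr 1 = norm (v t \<omega>)" for t \<omega> by simp
  have q: "((LINT t|?L. norm (v t \<omega>)) powr (1 / 1)) powr 2 = (norm (LINT t|?L. norm (v t \<omega>)))\<^sup>2" for \<omega>
    by simp
  have meas: "(\<lambda>\<omega>. LINT t|?L. norm (v t \<omega>)) \<in> borel_measurable M"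
    using time_integral_measurable[OF measurable_compose[OF m(1) borel_measurable_norm]] by simp
  have "(AE \<omega> in M. integrable ?L (\<lambda>t. norm (v t \<omega>))) \<longleftrightarrow> (AE \<omega> in M. integrable ?L (\<lambda>t. v t \<omega>))"
    by (rule AE_cong) (simp add: integrable_norm_iff m(4))
  then show ?thesis
    unfolding L_class_def mem_Collect_eq n q square_integrable_def using True meas by simp
qed (simp add: L_class_def)

end

section \<open>The end point reached by the candidate\<close>

locale candidate = control_problem M T w f k\<^sub>f g G \<Gamma> A b a c \<alpha> \<theta> KG KI Kf
  for M :: "'a measure" and T and w :: "real \<Rightarrow> 'a \<Rightarrow> real ^ 'd"
    and f :: "'a \<Rightarrow> real ^ 'n" and k\<^sub>f :: "real \<Rightarrow> 'a \<Rightarrow> real ^ 'd ^ 'n"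
    and g G \<Gamma> A b a c \<alpha> \<theta> KG KI Kf +
  fixes \<mu> :: "real \<Rightarrow> 'a \<Rightarrow> real ^ 'n"
  assumes \<mu>: "ito_process M w T (mu_bar M T A b a \<Gamma> f) k\<^sub>\<mu> \<mu>"
begin

abbreviation y0 :: "real ^ 'n" where "y0 \<equiv> mu_bar M T A b a \<Gamma> f"
abbreviation u :: "real \<Rightarrow> 'a \<Rightarrow> real ^ 'n" where "u \<equiv> u_hat T A b \<Gamma> \<mu>"

text \<open>The martingale part of \<open>\<mu>\<close>.\<close>

definition m :: "real \<Rightarrow> 'a \<Rightarrow> real ^ 'n" where "m t \<omega> = \<mu> t \<omega> - y0"

lemma \<mu>_continuous: "\<omega> \<in> space M \<Longrightarrow> continuous_on {0..T} (\<lambda>t. \<mu> t \<omega>)"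
  using \<mu> by (simp add: ito_process_def)

lemma m_ito: "t \<in> {0..T} \<Longrightarrow> has_ito_integral M w T k\<^sub>\<mu> t (m t)"
  using \<mu> by (simp add: ito_process_def m_def[abs_def])

lemma m_sq: "t \<in> {0..T} \<Longrightarrow> square_integrable M (m t)"
  by (rule ito_square_integrable[OF m_ito])

lemma const_square_integrable: "square_integrable M (\<lambda>_. y)"
  by (simp add: square_integrable_def)

lemma \<mu>_sq: "t \<in> {0..T} \<Longrightarrow> square_integrable M (\<mu> t)"
  using square_integrable_add[OF m_sq const_square_integrable[of y0]] by (simp add: m_def)

lemma \<mu>_F: "t \<in> {0..T} \<Longrightarrow> \<mu> t \<in> borel_measurable (F t)"
proof -
  assume "t \<in> {0..T}"
  from ito_F_measurable[OF m_ito[OF this] this] have "(\<lambda>\<omega>. m t \<omega> + y0) \<in> borel_measurable (F t)" by simp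
  then show ?thesis by (simp add: m_def)
qed

lemma m_bound: "t \<in> {0..T} \<Longrightarrow> (LINT \<omega>|M. (norm (m t \<omega>))\<^sup>2) \<le> (LINT (s, \<omega>)|TM. (norm (k\<^sub>\<mu> s \<omega>))\<^sup>2)"
proof -
  assume t: "t \<in> {0..T}"
  have ki: "integrable TM (\<lambda>(s, \<omega>). (norm (k\<^sub>\<mu> s \<omega>))\<^sup>2)"
    using square_integrableD(2)[OF k\<^sub>\<mu>_square_integrable] by (simp add: split_beta')
  have "(LINT \<omega>|M. (norm (m t \<omega>))\<^sup>2) = (LINT (s, \<omega>)|TM. indicator {..t} s * (k\<^sub>\<mu> s \<omega> \<bullet> k\<^sub>\<mu> s \<omega>))"
    using ito_isometry[OF m_ito[OF t] m_ito[OF t] t t] by (simp add: power2_norm_eq_inner)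
  also have "\<dots> \<le> (LINT (s, \<omega>)|TM. (norm (k\<^sub>\<mu> s \<omega>))\<^sup>2)"
  proof (rule integral_mono)
    have "integrable TM (\<lambda>x. (case x of (s, \<omega>) \<Rightarrow> indicat_real {..t} s *\<^sub>R (case (s, \<omega>) of (s, \<omega>) \<Rightarrow> k\<^sub>\<mu> s \<omega>)) \<bullet> (case x of (s, \<omega>) \<Rightarrow> k\<^sub>\<mu> s \<omega>))"
      by (rule square_integrable_inner(2)[OF square_integrable_indicator[OF k\<^sub>\<mu>_square_integrable] k\<^sub>\<mu>_square_integrable])
    then show "integrable TM (\<lambda>(s, \<omega>). indicator {..t} s * (k\<^sub>\<mu> s \<omega> \<bullet> k\<^sub>\<mu> s \<omega>))" by (simp add: split_beta')
    show "integrable TM (\<lambda>(s, \<omega>). (norm (k\<^sub>\<mu> s \<omega>))\<^sup>2)" by (rule ki)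
    show "(case x of (s, \<omega>) \<Rightarrow> indicator {..t} s * (k\<^sub>\<mu> s \<omega> \<bullet> k\<^sub>\<mu> s \<omega>)) \<le> (case x of (s, \<omega>) \<Rightarrow> (norm (k\<^sub>\<mu> s \<omega>))\<^sup>2)" for x
      by (cases x) (simp add: indicator_def power2_norm_eq_inner)
  qed
  finally show ?thesis .
qed

lemma \<mu>_bound: obtains K where "\<And>t. t \<in> {0..T} \<Longrightarrow> (LINT \<omega>|M. (norm (\<mu> t \<omega>))\<^sup>2) \<le> K"
proof -
  let ?K = "LINT (s, \<omega>)|TM. (norm (k\<^sub>\<mu> s \<omega>))\<^sup>2"
  have "(LINT \<omega>|M. (norm (\<mu> t \<omega>))\<^sup>2) \<le> 2 * ?K + 2 * (norm y0)\<^sup>2" if t: "t \<in> {0..T}" for t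
  proof -
    have i: "integrable M (\<lambda>\<omega>. (norm (m t \<omega>))\<^sup>2)" by (rule square_integrableD(2)[OF m_sq[OF t]])
    have "(LINT \<omega>|M. (norm (\<mu> t \<omega>))\<^sup>2) \<le> (LINT \<omega>|M. 2 * (norm (m t \<omega>))\<^sup>2 + 2 * (norm y0)\<^sup>2)"
    proof (rule integral_mono)
      show "integrable M (\<lambda>\<omega>. (norm (\<mu> t \<omega>))\<^sup>2)" by (rule square_integrableD(2)[OF \<mu>_sq[OF t]])
      show "(norm (\<mu> t \<omega>))\<^sup>2 \<le> 2 * (norm (m t \<omega>))\<^sup>2 + 2 * (norm y0)\<^sup>2" for \<omega>
        using norm_add_square_le[of "m t \<omega>" y0] by (simp add: m_def)
    qed (use i in simp)
    also have "\<dots> = 2 * (LINT \<omega>|M. (norm (m t \<omega>))\<^sup>2) + 2 * (norm y0)\<^sup>2"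
      using i by (simp add: prob_space)
    finally show ?thesis using m_bound[OF t] by simp
  qed
  then show ?thesis by (rule that)
qed

lemma \<mu>_TM: "(\<lambda>(t, \<omega>). \<mu> t \<omega>) \<in> borel_measurable TM"
  by (rule continuous_process_measurable) (use \<mu>_continuous square_integrableD(1)[OF \<mu>_sq] in auto)

lemma m_TM: "(\<lambda>(t, \<omega>). m t \<omega>) \<in> borel_measurable TM"
proof -
  have "(\<lambda>x. (case x of (t, \<omega>) \<Rightarrow> \<mu> t \<omega>) - y0) \<in> borel_measurable TM"
    by (intro borel_measurable_diff \<mu>_TM) simp
  then show ?thesis by (simp add: split_beta' m_def)
qed

text \<open>The random part of the end point that the candidate reaches.\<close>

definition Y :: "'a \<Rightarrow> real ^ 'n" where "Y \<omega> = (LINT t|L. Q t *v m t \<omega>)"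

lemma normQ: "integrable L (\<lambda>t. norm (Q t))"
  using Q_integrable by simp

lemma Qm_TM: "(\<lambda>(t, \<omega>). Q t *v m t \<omega>) \<in> borel_measurable TM"
proof -
  have "(\<lambda>x. Q (fst x) *v (case x of (t, \<omega>) \<Rightarrow> m t \<omega>)) \<in> borel_measurable TM"
    by (intro matrix_vector_mult_borel fst_measurable_TM Q_meas m_TM)
  then show ?thesis by (simp add: split_beta')
qed

lemma Qm_integrable: "AE \<omega> in M. integrable L (\<lambda>t. Q t *v m t \<omega>)"
proof -
  have "AE \<omega> in M. integrable L (\<lambda>t. norm (Q t) * norm (m t \<omega>))"
    by (rule weighted_integral_square_integrable(1)[OF normQ _ m_TM m_sq m_bound]) simp
  then show ?thesis using AE_space
  proof eventually_elim
    case (elim \<omega>)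
    show ?case
    proof (rule Bochner_Integration.integrable_bound[OF elim(1)])
      show "(\<lambda>t. Q t *v m t \<omega>) \<in> borel_measurable L"
        using measurable_compose[OF measurable_Pair2'[OF elim(2)] Qm_TM] by simp
    qed (simp add: norm_matrix_vector_mult_le)
  qed
qed

lemma Y_sq: "square_integrable M Y"
proof (rule square_integrable_bound)
  show "square_integrable M (\<lambda>\<omega>. LINT t|L. norm (Q t) * norm (m t \<omega>))"
    by (rule weighted_integral_square_integrable(2)[OF normQ _ m_TM m_sq m_bound]) simp
  show "Y \<in> borel_measurable M"
    unfolding Y_def[abs_def] using time_integral_measurable[OF Qm_TM] by simp
  have "AE \<omega> in M. integrable L (\<lambda>t. norm (Q t) * norm (m t \<omega>))"
    by (rule weighted_integral_square_integrable(1)[OF normQ _ m_TM m_sq m_bound]) simp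
  then show "AE \<omega> in M. norm (Y \<omega>) \<le> 1 * norm (LINT t|L. norm (Q t) * norm (m t \<omega>))"
    using Qm_integrable
  proof eventually_elim
    case (elim \<omega>)
    have "norm (Y \<omega>) \<le> (LINT t|L. norm (Q t *v m t \<omega>))" unfolding Y_def by (rule integral_norm_bound)
    also have "\<dots> \<le> (LINT t|L. norm (Q t) * norm (m t \<omega>))"
      using elim by (intro integral_mono) (auto simp: norm_matrix_vector_mult_le)
    finally show ?case by simp
  qed
qed

lemma Y_inner:
  assumes J: "square_integrable M J"
  shows "(LINT \<omega>|M. Y \<omega> \<bullet> J \<omega>) = (LINT t|L. LINT \<omega>|M. (Q t *v m t \<omega>) \<bullet> J \<omega>)"
proof -
  interpret P: pair_sigma_finite L M by (rule pair_sigma_finite_TM)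
  have Jm: "J \<in> borel_measurable M" by (rule square_integrableD(1)[OF J])
  have i: "integrable TM (\<lambda>(t, \<omega>). (Q t *v m t \<omega>) \<bullet> J \<omega>)"
  proof (rule Bochner_Integration.integrable_bound)
    have 1: "integrable TM (\<lambda>(t, \<omega>). norm (Q t) * (norm (m t \<omega>))\<^sup>2)"
      by (rule weighted_integrable[OF normQ _ m_TM m_sq m_bound]) simp
    have 2: "integrable TM (\<lambda>(t, \<omega>). norm (Q t) * (norm (J \<omega>))\<^sup>2)"
      using has_bochner_integral_pair_mult[OF _ _ normQ square_integrableD(2)[OF J]] pair_sigma_finite_TM
      by (simp add: pair_sigma_finite_def has_bochner_integral_iff)
    show "integrable TM (\<lambda>x. (case x of (t, \<omega>) \<Rightarrow> norm (Q t) * (norm (m t \<omega>))\<^sup>2) + (case x of (t, \<omega>) \<Rightarrow> norm (Q t) * (norm (J \<omega>))\<^sup>2))"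
      using 1 2 by (rule Bochner_Integration.integrable_add)
    have "(\<lambda>x. (case x of (t, \<omega>) \<Rightarrow> Q t *v m t \<omega>) \<bullet> J (snd x)) \<in> borel_measurable TM"
      by (intro borel_measurable_inner Qm_TM snd_measurable_TM Jm)
    then show "(\<lambda>(t, \<omega>). (Q t *v m t \<omega>) \<bullet> J \<omega>) \<in> borel_measurable TM" by (simp add: split_beta')
    show "AE x in TM. norm (case x of (t, \<omega>) \<Rightarrow> (Q t *v m t \<omega>) \<bullet> J \<omega>)
       \<le> norm ((case x of (t, \<omega>) \<Rightarrow> norm (Q t) * (norm (m t \<omega>))\<^sup>2) + (case x of (t, \<omega>) \<Rightarrow> norm (Q t) * (norm (J \<omega>))\<^sup>2))"
    proof (rule AE_I2, clarify)
      fix t \<omega>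
      have "\<bar>(Q t *v m t \<omega>) \<bullet> J \<omega>\<bar> \<le> norm (Q t *v m t \<omega>) * norm (J \<omega>)" by (rule Cauchy_Schwarz_ineq2)
      also have "\<dots> \<le> (norm (Q t) * norm (m t \<omega>)) * norm (J \<omega>)"
        by (intro mult_right_mono norm_matrix_vector_mult_le) simp
      also have "\<dots> \<le> norm (Q t) * ((norm (m t \<omega>))\<^sup>2 + (norm (J \<omega>))\<^sup>2)"
        unfolding mult.assoc by (intro mult_left_mono norm_mult_le_sum_squares) simp
      finally show "norm ((Q t *v m t \<omega>) \<bullet> J \<omega>) \<le> norm (norm (Q t) * (norm (m t \<omega>))\<^sup>2 + norm (Q t) * (norm (J \<omega>))\<^sup>2)"
        by (simp add: distrib_left)
    qed
  qed
  have "(LINT \<omega>|M. Y \<omega> \<bullet> J \<omega>) = (LINT \<omega>|M. LINT t|L. (Q t *v m t \<omega>) \<bullet> J \<omega>)"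
  proof (rule integral_cong_AE)
    show "(\<lambda>\<omega>. Y \<omega> \<bullet> J \<omega>) \<in> borel_measurable M"
      using square_integrable_inner(2)[OF Y_sq J] by auto
    show "(\<lambda>\<omega>. LINT t|L. (Q t *v m t \<omega>) \<bullet> J \<omega>) \<in> borel_measurable M"
      using P.integrable_snd[OF i] by auto
    show "AE \<omega> in M. Y \<omega> \<bullet> J \<omega> = (LINT t|L. (Q t *v m t \<omega>) \<bullet> J \<omega>)"
      using Qm_integrable
      by eventually_elim (simp add: Y_def integral_inner_left)
  qed
  also have "\<dots> = (LINT t|L. LINT \<omega>|M. (Q t *v m t \<omega>) \<bullet> J \<omega>)"
    using P.integral_fst[OF i] P.integral_snd[OF i] by simp
  finally show ?thesis .
qed

abbreviation N :: "'a \<Rightarrow> real ^ 'n" where "N \<equiv> (\<lambda>\<omega>. f \<omega> - expectation f)"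

lemma T_mem: "T \<in> {0..T}" using T_pos by simp

text \<open>The inner product of \<open>Q(t) m(t)\<close> with a stochastic integral is a time integral by the isometry, and
  integrating it over \<open>t\<close> first replaces \<open>Q\<close> by the Gramian, since only the times \<open>t \<ge> s\<close> count.\<close>

lemma stochastic_Fubini_weak:
  fixes k' :: "real \<Rightarrow> 'a \<Rightarrow> real ^ 'd ^ 'n"
  assumes J: "has_ito_integral M w T k' t' J" and t': "t' \<in> {0..T}"
  shows "(LINT \<omega>|M. Y \<omega> \<bullet> J \<omega>) = (LINT \<omega>|M. N \<omega> \<bullet> J \<omega>)"
proof -
  interpret TMf: finite_measure TM by (rule finite_measure_TM)
  interpret Lf: finite_measure L by (rule finite_measure_interval)
  interpret PP: pair_sigma_finite L TM ..
  note bbm = bounded_bilinear_matrix_mult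
  note k' = ito_integrand[OF J]
  let ?i = "\<lambda>t s. indicat_real {..min t t'} s"
  let ?h = "\<lambda>t x. case x of (s, \<omega>) \<Rightarrow> ?i t s * ((Q t ** k\<^sub>\<mu> s \<omega>) \<bullet> k' s \<omega>)"
  have Qi_sub: "integrable (lebesgue_on {s..T}) Q" if "s \<in> {0..T}" for s by (rule Q_integrable_sub[OF that])
  have hint: "integrable (L \<Otimes>\<^sub>M TM) (\<lambda>(t, x). ?h t x)"
  proof (rule Bochner_Integration.integrable_bound)
    have "integrable TM (\<lambda>x. norm (case x of (s, \<omega>) \<Rightarrow> k\<^sub>\<mu> s \<omega>) * norm (case x of (s, \<omega>) \<Rightarrow> k' s \<omega>))"
      by (rule square_integrable_inner(1)[OF k\<^sub>\<mu>_square_integrable k'(2)])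
    from has_bochner_integral_pair_mult[OF Lf.sigma_finite_measure_axioms TMf.sigma_finite_measure_axioms normQ this]
    show "integrable (L \<Otimes>\<^sub>M TM) (\<lambda>(t, x). norm (Q t) * (norm (case x of (s, \<omega>) \<Rightarrow> k\<^sub>\<mu> s \<omega>) * norm (case x of (s, \<omega>) \<Rightarrow> k' s \<omega>)))"
      by (simp add: has_bochner_integral_iff)
    have c1: "(\<lambda>z. Q (fst z)) \<in> borel_measurable (L \<Otimes>\<^sub>M TM)" by (rule measurable_compose[OF measurable_fst Q_meas])
    have c2: "(\<lambda>z. case snd z of (s, \<omega>) \<Rightarrow> k\<^sub>\<mu> s \<omega>) \<in> borel_measurable (L \<Otimes>\<^sub>M TM)"
      by (rule measurable_compose[OF measurable_snd k\<^sub>\<mu>_measurable])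
    have c3: "(\<lambda>z. case snd z of (s, \<omega>) \<Rightarrow> k' s \<omega>) \<in> borel_measurable (L \<Otimes>\<^sub>M TM)"
      by (rule measurable_compose[OF measurable_snd square_integrableD(1)[OF k'(2)]])
    have [measurable]: "(\<lambda>z. fst z) \<in> borel_measurable (L \<Otimes>\<^sub>M TM)"
      by (rule measurable_compose[OF measurable_fst measurable_ident_lebesgue_on])
    have [measurable]: "(\<lambda>z. fst (snd z)) \<in> borel_measurable (L \<Otimes>\<^sub>M TM)"
      by (rule measurable_compose[OF measurable_snd fst_measurable_TM[OF measurable_ident_lebesgue_on]])
    have c4: "(\<lambda>z. if fst (snd z) \<le> min (fst z) t' then 1 else 0 :: real) \<in> borel_measurable (L \<Otimes>\<^sub>M TM)"
      by measurable
    have "(\<lambda>z. (if fst (snd z) \<le> min (fst z) t' then 1 else 0) * ((Q (fst z) ** (case snd z of (s, \<omega>) \<Rightarrow> k\<^sub>\<mu> s \<omega>)) \<bullet> (case snd z of (s, \<omega>) \<Rightarrow> k' s \<omega>))) \<in> borel_measurable (L \<Otimes>\<^sub>M TM)"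
      by (intro borel_measurable_times c4 borel_measurable_inner matrix_mult_borel c1 c2 c3)
    then show "(\<lambda>(t, x). ?h t x) \<in> borel_measurable (L \<Otimes>\<^sub>M TM)"
      by (simp add: split_beta' indicator_def of_bool_def)
    show "AE z in L \<Otimes>\<^sub>M TM. norm (case z of (t, x) \<Rightarrow> ?h t x)
       \<le> norm (case z of (t, x) \<Rightarrow> norm (Q t) * (norm (case x of (s, \<omega>) \<Rightarrow> k\<^sub>\<mu> s \<omega>) * norm (case x of (s, \<omega>) \<Rightarrow> k' s \<omega>)))"
    proof (rule AE_I2, clarify)
      fix t s \<omega>
      have "\<bar>(Q t ** k\<^sub>\<mu> s \<omega>) \<bullet> k' s \<omega>\<bar> \<le> norm (Q t ** k\<^sub>\<mu> s \<omega>) * norm (k' s \<omega>)" by (rule Cauchy_Schwarz_ineq2)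
      also have "\<dots> \<le> (norm (Q t) * norm (k\<^sub>\<mu> s \<omega>)) * norm (k' s \<omega>)"
        by (intro mult_right_mono norm_matrix_mult_le) simp
      finally have "\<bar>(Q t ** k\<^sub>\<mu> s \<omega>) \<bullet> k' s \<omega>\<bar> \<le> norm (Q t) * (norm (k\<^sub>\<mu> s \<omega>) * norm (k' s \<omega>))" by (simp add: mult.assoc)
      then show "norm (?i t s * ((Q t ** k\<^sub>\<mu> s \<omega>) \<bullet> k' s \<omega>)) \<le> norm (norm (Q t) * (norm (k\<^sub>\<mu> s \<omega>) * norm (k' s \<omega>)))"
        by (simp add: indicator_def)
    qed
  qed
  have "(LINT \<omega>|M. Y \<omega> \<bullet> J \<omega>) = (LINT t|L. LINT \<omega>|M. (Q t *v m t \<omega>) \<bullet> J \<omega>)"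
    by (rule Y_inner[OF ito_square_integrable[OF J t']])
  also have "\<dots> = (LINT t|L. LINT x|TM. ?h t x)"
  proof (rule Bochner_Integration.integral_cong[OF refl])
    fix t assume "t \<in> space L"
    then have t: "t \<in> {0..T}" by simp
    show "(LINT \<omega>|M. (Q t *v m t \<omega>) \<bullet> J \<omega>) = (LINT x|TM. ?h t x)"
      by (rule ito_isometry[OF ito_matrix_mult[OF m_ito[OF t] t] J t t'])
  qed
  also have "\<dots> = (LINT x|TM. LINT t|L. ?h t x)"
    using PP.integral_fst[OF hint] PP.integral_snd[OF hint] by simp
  also have "\<dots> = (LINT (s, \<omega>)|TM. indicator {..min T t'} s * (k\<^sub>f s \<omega> \<bullet> k' s \<omega>))"
  proof (rule integral_cong_AE)
    show "(\<lambda>x. LINT t|L. ?h t x) \<in> borel_measurable TM" using PP.integrable_snd[OF hint] by auto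
    have "(\<lambda>x. (case x of (s, \<omega>) \<Rightarrow> indicat_real {..min T t'} s *\<^sub>R (case (s, \<omega>) of (s, \<omega>) \<Rightarrow> k\<^sub>f s \<omega>)) \<bullet> (case x of (s, \<omega>) \<Rightarrow> k' s \<omega>)) \<in> borel_measurable TM"
      by (intro borel_measurable_inner square_integrableD(1)[OF square_integrable_indicator[OF kf(2)]] square_integrableD(1)[OF k'(2)])
    then show "(\<lambda>(s, \<omega>). indicator {..min T t'} s * (k\<^sub>f s \<omega> \<bullet> k' s \<omega>)) \<in> borel_measurable TM"
      by (simp add: split_beta')
    show "AE x in TM. (LINT t|L. ?h t x) = (case x of (s, \<omega>) \<Rightarrow> indicator {..min T t'} s * (k\<^sub>f s \<omega> \<bullet> k' s \<omega>))"
      using AE_TM_less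
    proof eventually_elim
      case (elim x)
      obtain s \<omega> where x: "x = (s, \<omega>)" by (cases x)
      with elim have s: "s \<in> {0..<T}" "s \<in> {0..T}" by auto
      have bl: "bounded_linear (\<lambda>X. (X ** k\<^sub>\<mu> s \<omega>) \<bullet> k' s \<omega>)"
        by (intro bounded_linear_compose[OF bounded_linear_inner_left] bounded_bilinear.bounded_linear_left[OF bbm])
      have "(LINT t|L. ?h t x) = (LINT t|L. indicat_real {..t'} s * (indicat_real {s..T} t *\<^sub>R ((Q t ** k\<^sub>\<mu> s \<omega>) \<bullet> k' s \<omega>)))"
        unfolding x by (intro Bochner_Integration.integral_cong) (auto simp: indicator_def)
      also have "\<dots> = indicator {..t'} s * (LINT t|L. indicat_real {s..T} t *\<^sub>R ((Q t ** k\<^sub>\<mu> s \<omega>) \<bullet> k' s \<omega>))"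
        by (rule integral_mult_right_zero)
      also have "(LINT t|L. indicat_real {s..T} t *\<^sub>R ((Q t ** k\<^sub>\<mu> s \<omega>) \<bullet> k' s \<omega>)) = (LINT t|lebesgue_on {s..T}. (Q t ** k\<^sub>\<mu> s \<omega>) \<bullet> k' s \<omega>)"
        by (rule integral_lebesgue_on_subset(1)[symmetric]) (use s in auto)
      also have "\<dots> = (R s ** k\<^sub>\<mu> s \<omega>) \<bullet> k' s \<omega>"
        unfolding R_mat_def by (rule integral_bounded_linear[OF bl Qi_sub[OF s(2)]])
      also have "R s ** k\<^sub>\<mu> s \<omega> = k\<^sub>f s \<omega>"
        by (simp add: k\<^sub>\<mu>_eq matrix_mul_assoc matrix_inv_both[OF R_invertible[OF s(1)]])
      finally show ?case using s by (simp add: x indicator_def)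
    qed
  qed
  also have "\<dots> = (LINT \<omega>|M. N \<omega> \<bullet> J \<omega>)"
    by (rule ito_isometry[OF f_ito J T_mem t', symmetric])
  finally show ?thesis .
qed

text \<open>The difference of the two sides is orthogonal to all stochastic integrals, hence to \<open>N\<close>, and to \<open>Y\<close>,
  which is a time integral of stochastic integrals. So it is orthogonal to itself.\<close>

lemma stochastic_Fubini: "AE \<omega> in M. Y \<omega> = N \<omega>"
proof -
  have N_sq: "square_integrable M N" by (rule ito_square_integrable[OF f_ito T_mem])
  have d_sq: "square_integrable M (\<lambda>\<omega>. Y \<omega> - N \<omega>)" by (rule square_integrable_diff[OF Y_sq N_sq])
  have orth: "(LINT \<omega>|M. J \<omega> \<bullet> (Y \<omega> - N \<omega>)) = 0"
    if J: "has_ito_integral M w T k' t' J" "t' \<in> {0..T}" for k' :: "real \<Rightarrow> 'a \<Rightarrow> real ^ 'd ^ 'n" and t' J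
  proof -
    note Jsq = ito_square_integrable[OF J]
    have "(LINT \<omega>|M. J \<omega> \<bullet> (Y \<omega> - N \<omega>)) = (LINT \<omega>|M. Y \<omega> \<bullet> J \<omega> - N \<omega> \<bullet> J \<omega>)"
      by (intro Bochner_Integration.integral_cong refl) (simp only: inner_diff_right inner_commute)
    also have "\<dots> = (LINT \<omega>|M. Y \<omega> \<bullet> J \<omega>) - (LINT \<omega>|M. N \<omega> \<bullet> J \<omega>)"
      by (rule Bochner_Integration.integral_diff[OF square_integrable_inner(2)[OF Y_sq Jsq] square_integrable_inner(2)[OF N_sq Jsq]])
    finally show ?thesis using stochastic_Fubini_weak[OF J] by simp
  qed
  have 1: "(LINT \<omega>|M. N \<omega> \<bullet> (Y \<omega> - N \<omega>)) = 0" by (rule orth[OF f_ito T_mem])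
  have "(LINT \<omega>|M. Y \<omega> \<bullet> (Y \<omega> - N \<omega>)) = (LINT t|L. LINT \<omega>|M. (Q t *v m t \<omega>) \<bullet> (Y \<omega> - N \<omega>))"
    by (rule Y_inner[OF d_sq])
  also have "\<dots> = (LINT t|L. 0)"
    by (intro Bochner_Integration.integral_cong refl orth[OF ito_matrix_mult[OF m_ito]]) auto
  finally have 2: "(LINT \<omega>|M. Y \<omega> \<bullet> (Y \<omega> - N \<omega>)) = 0" by simp
  have "(LINT \<omega>|M. (norm (Y \<omega> - N \<omega>))\<^sup>2) = (LINT \<omega>|M. Y \<omega> \<bullet> (Y \<omega> - N \<omega>) - N \<omega> \<bullet> (Y \<omega> - N \<omega>))"
    by (intro Bochner_Integration.integral_cong refl) (simp only: power2_norm_eq_inner inner_diff_left)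
  also have "\<dots> = 0"
    by (subst Bochner_Integration.integral_diff[OF square_integrable_inner(2)[OF Y_sq d_sq] square_integrable_inner(2)[OF N_sq d_sq]])
      (simp only: 1 2 diff_self)
  finally have "AE \<omega> in M. (norm (Y \<omega> - N \<omega>))\<^sup>2 = 0"
    using integral_nonneg_eq_0_iff_AE[OF square_integrableD(2)[OF d_sq]] by simp
  then show ?thesis by eventually_elim simp
qed

end

section \<open>Admissible controls and feasibility of the candidate\<close>

context wiener_space
begin

lemma adapted_process_diff:
  fixes v v' :: "real \<Rightarrow> 'a \<Rightarrow> 'b::euclidean_space"
  assumes v: "adapted_process M w T v" and v': "adapted_process M w T v'"
  shows "adapted_process M w T (\<lambda>t \<omega>. v t \<omega> - v' t \<omega>)"
  unfolding adapted_process_def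
proof (intro conjI ballI)
  have "(\<lambda>x. (case x of (t, \<omega>) \<Rightarrow> v t \<omega>) - (case x of (t, \<omega>) \<Rightarrow> v' t \<omega>)) \<in> borel_measurable TM"
    by (intro borel_measurable_diff adapted_processD(1) v v')
  then show "(\<lambda>(t, \<omega>). v t \<omega> - v' t \<omega>) \<in> borel_measurable TM" by (simp add: split_beta')
  show "(\<lambda>\<omega>. v t \<omega> - v' t \<omega>) \<in> borel_measurable (F t)" if "t \<in> {0..T}" for t
    by (intro borel_measurable_diff adapted_processD(2)[OF v that] adapted_processD(2)[OF v' that])
qed

end

context control_problem
begin

text \<open>At \<open>T\<close> nothing is known about \<open>g\<close>, not even its sign. The absolute value makes the weight
  nonnegative everywhere and changes it on a null set only.\<close>

lemma weighted_energy_iff: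
  fixes v :: "real \<Rightarrow> 'a \<Rightarrow> real ^ 'n"
  assumes v: "(\<lambda>(t, \<omega>). v t \<omega>) \<in> borel_measurable TM"
  shows "(\<integral>\<^sup>+\<omega>. \<integral>\<^sup>+t. ennreal (g t * (norm (v t \<omega>))\<^sup>2) \<partial>L \<partial>M) < \<infinity>
     \<longleftrightarrow> integrable TM (\<lambda>(t, \<omega>). \<bar>g t\<bar> * (norm (v t \<omega>))\<^sup>2)"
proof -
  have vn: "(\<lambda>x. (norm (case x of (t, \<omega>) \<Rightarrow> v t \<omega>))\<^sup>2) \<in> borel_measurable TM"
    using borel_measurable_power[OF measurable_compose[OF v borel_measurable_norm], of 2] by simp
  have 1: "(\<lambda>(t, \<omega>). g t * (norm (v t \<omega>))\<^sup>2) \<in> borel_measurable TM"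
    using borel_measurable_times[OF fst_measurable_TM[OF g_meas] vn] by (simp add: split_beta')
  have 2: "(\<lambda>(t, \<omega>). \<bar>g t\<bar> * (norm (v t \<omega>))\<^sup>2) \<in> borel_measurable TM"
    using borel_measurable_times[OF borel_measurable_abs[OF fst_measurable_TM[OF g_meas]] vn] by (simp add: split_beta')
  have "(\<lambda>(t, \<omega>). ennreal (g t * (norm (v t \<omega>))\<^sup>2)) \<in> borel_measurable TM"
    using measurable_compose[OF 1 measurable_ennreal] by (simp add: split_beta')
  then have "(\<integral>\<^sup>+\<omega>. \<integral>\<^sup>+t. ennreal (g t * (norm (v t \<omega>))\<^sup>2) \<partial>L \<partial>M)
     = (\<integral>\<^sup>+x. (case x of (t, \<omega>) \<Rightarrow> ennreal (g t * (norm (v t \<omega>))\<^sup>2)) \<partial>TM)"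
    by (rule nn_integral_TM(1))
  also have "\<dots> = (\<integral>\<^sup>+x. ennreal (norm (case x of (t, \<omega>) \<Rightarrow> \<bar>g t\<bar> * (norm (v t \<omega>))\<^sup>2)) \<partial>TM)"
  proof (rule nn_integral_cong_AE)
    show "AE x in TM. (case x of (t, \<omega>) \<Rightarrow> ennreal (g t * (norm (v t \<omega>))\<^sup>2))
        = ennreal (norm (case x of (t, \<omega>) \<Rightarrow> \<bar>g t\<bar> * (norm (v t \<omega>))\<^sup>2))"
      using AE_TM_less
    proof eventually_elim
      case (elim x)
      then show ?case using g(1)[of "fst x"] by (simp add: split_beta abs_mult)
    qed
  qed
  finally show ?thesis using 2 by (simp only: integrable_iff_bounded simp_thms)
qed

lemma control_set_iff:
  fixes v :: "real \<Rightarrow> 'a \<Rightarrow> real ^ 'n"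
  shows "v \<in> control_set M w T g \<longleftrightarrow> adapted_process M w T v \<and>
     (AE \<omega> in M. integrable L (\<lambda>t. v t \<omega>)) \<and> square_integrable M (\<lambda>\<omega>. LINT t|L. norm (v t \<omega>)) \<and>
     integrable TM (\<lambda>(t, \<omega>). \<bar>g t\<bar> * (norm (v t \<omega>))\<^sup>2)"
  unfolding control_set_def mem_Collect_eq L_class_21_iff
  using weighted_energy_iff[of v] adapted_processD(1)[of v] by blast

lemma control_set_diff:
  fixes v v' :: "real \<Rightarrow> 'a \<Rightarrow> real ^ 'n"
  assumes v: "v \<in> control_set M w T g" and v': "v' \<in> control_set M w T g"
  shows "(\<lambda>t \<omega>. v t \<omega> - v' t \<omega>) \<in> control_set M w T g"
proof -
  note V = v[unfolded control_set_iff] and V' = v'[unfolded control_set_iff]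
  have ad: "adapted_process M w T (\<lambda>t \<omega>. v t \<omega> - v' t \<omega>)" by (rule adapted_process_diff) (use V V' in auto)
  note mt = adapted_processD(1)[OF ad]
  have ai: "AE \<omega> in M. integrable L (\<lambda>t. v t \<omega>) \<and> integrable L (\<lambda>t. v' t \<omega>)" using V V' by auto
  have "square_integrable M (\<lambda>\<omega>. LINT t|L. norm (v t \<omega> - v' t \<omega>))"
  proof (rule square_integrable_bound)
    show "square_integrable M (\<lambda>\<omega>. (LINT t|L. norm (v t \<omega>)) + (LINT t|L. norm (v' t \<omega>)))"
      using V V' by (intro square_integrable_add) auto
    show "(\<lambda>\<omega>. LINT t|L. norm (v t \<omega> - v' t \<omega>)) \<in> borel_measurable M"
      using time_integral_measurable[OF measurable_compose[OF mt borel_measurable_norm]] by simp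
    show "AE \<omega> in M. norm (LINT t|L. norm (v t \<omega> - v' t \<omega>))
        \<le> 1 * norm ((LINT t|L. norm (v t \<omega>)) + (LINT t|L. norm (v' t \<omega>)))"
      using ai
    proof eventually_elim
      case (elim \<omega>)
      have "(LINT t|L. norm (v t \<omega> - v' t \<omega>)) \<le> (LINT t|L. norm (v t \<omega>) + norm (v' t \<omega>))"
        using elim by (intro integral_mono) (auto intro: norm_triangle_ineq4)
      also have "\<dots> = (LINT t|L. norm (v t \<omega>)) + (LINT t|L. norm (v' t \<omega>))"
        using elim by (intro Bochner_Integration.integral_add) auto
      finally show ?case by simp
    qed
  qed
  moreover have "integrable TM (\<lambda>(t, \<omega>). \<bar>g t\<bar> * (norm (v t \<omega> - v' t \<omega>))\<^sup>2)"
  proof (rule Bochner_Integration.integrable_bound)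
    show "integrable TM (\<lambda>x. 2 * (case x of (t, \<omega>) \<Rightarrow> \<bar>g t\<bar> * (norm (v t \<omega>))\<^sup>2) + 2 * (case x of (t, \<omega>) \<Rightarrow> \<bar>g t\<bar> * (norm (v' t \<omega>))\<^sup>2))"
      using V V' by (intro Bochner_Integration.integrable_add integrable_mult_right) auto
    show "(\<lambda>(t, \<omega>). \<bar>g t\<bar> * (norm (v t \<omega> - v' t \<omega>))\<^sup>2) \<in> borel_measurable TM"
      using borel_measurable_times[OF borel_measurable_abs[OF fst_measurable_TM[OF g_meas]]
         borel_measurable_power[OF measurable_compose[OF mt borel_measurable_norm], of 2]]
      by (simp add: split_beta')
    show "AE x in TM. norm (case x of (t, \<omega>) \<Rightarrow> \<bar>g t\<bar> * (norm (v t \<omega> - v' t \<omega>))\<^sup>2)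
       \<le> norm (2 * (case x of (t, \<omega>) \<Rightarrow> \<bar>g t\<bar> * (norm (v t \<omega>))\<^sup>2) + 2 * (case x of (t, \<omega>) \<Rightarrow> \<bar>g t\<bar> * (norm (v' t \<omega>))\<^sup>2))"
    proof (rule AE_I2, clarify)
      fix t \<omega>
      have "\<bar>g t\<bar> * (norm (v t \<omega> - v' t \<omega>))\<^sup>2 \<le> \<bar>g t\<bar> * (2 * (norm (v t \<omega>))\<^sup>2 + 2 * (norm (v' t \<omega>))\<^sup>2)"
        using norm_add_square_le[of "v t \<omega>" "- v' t \<omega>"] by (intro mult_left_mono) auto
      then show "norm (\<bar>g t\<bar> * (norm (v t \<omega> - v' t \<omega>))\<^sup>2) \<le> norm (2 * (\<bar>g t\<bar> * (norm (v t \<omega>))\<^sup>2) + 2 * (\<bar>g t\<bar> * (norm (v' t \<omega>))\<^sup>2))"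
        by (simp add: abs_mult algebra_simps)
    qed
  qed
  ultimately show ?thesis unfolding control_set_iff using ad ai by auto
qed

lemma form_integrable:
  fixes v v' :: "real \<Rightarrow> 'a \<Rightarrow> real ^ 'n"
  assumes v: "v \<in> control_set M w T g" and v': "v' \<in> control_set M w T g"
  shows "integrable TM (\<lambda>(t, \<omega>). v t \<omega> \<bullet> (\<Gamma> t *v v' t \<omega>))"
proof (rule Bochner_Integration.integrable_bound)
  note V = v[unfolded control_set_iff] and V' = v'[unfolded control_set_iff]
  show "integrable TM (\<lambda>x. KG * ((case x of (t, \<omega>) \<Rightarrow> \<bar>g t\<bar> * (norm (v t \<omega>))\<^sup>2) + (case x of (t, \<omega>) \<Rightarrow> \<bar>g t\<bar> * (norm (v' t \<omega>))\<^sup>2)))"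
    using V V' by (intro Bochner_Integration.integrable_add integrable_mult_right) auto
  have "(\<lambda>x. (case x of (t, \<omega>) \<Rightarrow> v t \<omega>) \<bullet> (\<Gamma> (fst x) *v (case x of (t, \<omega>) \<Rightarrow> v' t \<omega>))) \<in> borel_measurable TM"
    using V V' by (intro borel_measurable_inner matrix_vector_mult_borel fst_measurable_TM \<Gamma>_meas adapted_processD(1)) auto
  then show "(\<lambda>(t, \<omega>). v t \<omega> \<bullet> (\<Gamma> t *v v' t \<omega>)) \<in> borel_measurable TM" by (simp add: split_beta')
  show "AE x in TM. norm (case x of (t, \<omega>) \<Rightarrow> v t \<omega> \<bullet> (\<Gamma> t *v v' t \<omega>))
     \<le> norm (KG * ((case x of (t, \<omega>) \<Rightarrow> \<bar>g t\<bar> * (norm (v t \<omega>))\<^sup>2) + (case x of (t, \<omega>) \<Rightarrow> \<bar>g t\<bar> * (norm (v' t \<omega>))\<^sup>2)))"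
    using AE_TM_less
  proof eventually_elim
    case (elim x)
    obtain t \<omega> where x: "x = (t, \<omega>)" by (cases x)
    with elim have t: "t \<in> {0..<T}" by simp
    let ?a = "norm (v t \<omega>)" and ?b = "norm (v' t \<omega>)"
    have "norm (\<Gamma> t) \<le> \<bar>g t\<bar> * KG"
      using KG(2)[OF t] by (simp add: \<Gamma>[OF t] mult_left_mono)
    have "\<bar>v t \<omega> \<bullet> (\<Gamma> t *v v' t \<omega>)\<bar> \<le> ?a * norm (\<Gamma> t *v v' t \<omega>)" by (rule Cauchy_Schwarz_ineq2)
    also have "\<dots> \<le> ?a * ((\<bar>g t\<bar> * KG) * ?b)"
      using \<open>norm (\<Gamma> t) \<le> \<bar>g t\<bar> * KG\<close>
      by (intro mult_left_mono order_trans[OF norm_matrix_vector_mult_le] mult_right_mono) auto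
    also have "\<dots> = KG * \<bar>g t\<bar> * (?a * ?b)" by simp
    also have "\<dots> \<le> KG * \<bar>g t\<bar> * (?a\<^sup>2 + ?b\<^sup>2)"
      using KG(1) by (intro mult_left_mono norm_mult_le_sum_squares) simp
    also have "\<dots> = KG * (\<bar>g t\<bar> * ?a\<^sup>2 + \<bar>g t\<bar> * ?b\<^sup>2)" by (simp add: algebra_simps)
    finally show ?case by (simp add: x)
  qed
qed

lemma cost_eq:
  fixes v :: "real \<Rightarrow> 'a \<Rightarrow> real ^ 'n"
  assumes "v \<in> control_set M w T g"
  shows "cost M T \<Gamma> v = (LINT (t, \<omega>)|TM. v t \<omega> \<bullet> (\<Gamma> t *v v t \<omega>))"
proof -
  interpret P: pair_sigma_finite L M by (rule pair_sigma_finite_TM)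
  show ?thesis unfolding cost_def by (rule P.integral_snd[OF form_integrable[OF assms assms]])
qed

lemma feasible_constraint:
  fixes v :: "real \<Rightarrow> 'a \<Rightarrow> real ^ 'n"
  assumes "v \<in> feasible_controls M w T g A b a f"
  shows "AE \<omega> in M. f \<omega> = mat_exp (T *\<^sub>R A) *v a + (LINT t|L. Bt t *v v t \<omega>)"
proof -
  from assms obtain x where v: "v \<in> control_set M w T g"
    and x: "AE \<omega> in M. state_path T A b a (\<lambda>t. v t \<omega>) (\<lambda>t. x t \<omega>) \<and> x T \<omega> = f \<omega>"
    unfolding feasible_controls_def by blast
  have "AE \<omega> in M. integrable L (\<lambda>t. v t \<omega>)" using v[unfolded control_set_iff] by blast
  with x show ?thesis
  proof eventually_elim
    case (elim \<omega>)
    then have "x T \<omega> = mat_exp (T *\<^sub>R A) *v a + (LINT s|L. E s *v (b *v v s \<omega>))"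
      using T_pos by (intro state_path_endpoint) auto
    then show ?case using elim by (simp add: Bt_def matrix_vector_mul_assoc)
  qed
qed

end

context candidate
begin

definition W :: "real \<Rightarrow> real ^ 'n ^ 'n" where "W t = matrix_inv (\<Gamma> t) ** transpose (Bt t)"

lemma u_eq: "u t \<omega> = W t *v \<mu> t \<omega>"
  unfolding u_hat_def W_def transpose_Bt by (simp only: matrix_vector_mul_assoc matrix_mul_assoc)

lemma W_meas: "W \<in> borel_measurable L"
proof -
  have "(\<lambda>t. transpose (Bt t)) \<in> borel_measurable L"
    by (rule continuous_on_borel_lebesgue_on[OF bounded_linear.continuous_on[OF bounded_linear_transpose Bt_continuous]])
  then show ?thesis unfolding W_def[abs_def] by (intro matrix_mult_borel \<Gamma>inv_meas)
qed

lemma W_bound: obtains K where "0 < K" "\<And>t. t \<in> {0..<T} \<Longrightarrow> norm (W t) \<le> K * \<bar>inverse (g t)\<bar>"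
proof -
  obtain K where K: "0 < K" "\<And>t. t \<in> {0..T} \<Longrightarrow> norm (Bt t) \<le> K" by (rule Bt_bound) blast
  have "norm (W t) \<le> (KI * K) * \<bar>inverse (g t)\<bar>" if t: "t \<in> {0..<T}" for t
  proof -
    have "norm (W t) \<le> norm (matrix_inv (\<Gamma> t)) * norm (Bt t)"
      unfolding W_def using norm_matrix_mult_le[of "matrix_inv (\<Gamma> t)" "transpose (Bt t)"] by (simp only: norm_transpose)
    also have "\<dots> = \<bar>inverse (g t)\<bar> * norm (matrix_inv (G t)) * norm (Bt t)" by (simp add: \<Gamma>inv_eq[OF t])
    also have "\<dots> \<le> \<bar>inverse (g t)\<bar> * KI * K"
      using KI(1) KI(2)[OF t] K(2)[of t] t by (intro mult_mono) auto
    finally show ?thesis by (simp add: mult_ac)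
  qed
  moreover have "0 < KI * K" using KI(1) K(1) by simp
  ultimately show ?thesis using that by blast
qed

lemma W_integrable: "integrable L (\<lambda>t. norm (W t))"
proof -
  obtain K where K: "0 < K" "\<And>t. t \<in> {0..<T} \<Longrightarrow> norm (W t) \<le> K * \<bar>inverse (g t)\<bar>" by (rule W_bound) blast
  show ?thesis
  proof (rule Bochner_Integration.integrable_bound)
    show "integrable L (\<lambda>t. K * \<bar>inverse (g t)\<bar>)" using ginv_integrable by (intro integrable_mult_right integrable_abs)
    show "AE t in L. norm (norm (W t)) \<le> norm (K * \<bar>inverse (g t)\<bar>)"
      using AE_L_less
    proof eventually_elim
      case (elim t)
      have "0 \<le> K * \<bar>inverse (g t)\<bar>" using K(1) by simp
      with K(2)[OF elim] show ?case by simp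
    qed
  qed (use W_meas in measurable)
qed

lemma u_adapted: "adapted_process M w T u"
  unfolding adapted_process_def
proof (intro conjI ballI)
  have "(\<lambda>x. W (fst x) *v (case x of (t, \<omega>) \<Rightarrow> \<mu> t \<omega>)) \<in> borel_measurable TM"
    by (intro matrix_vector_mult_borel fst_measurable_TM W_meas \<mu>_TM)
  then show "(\<lambda>(t, \<omega>). u t \<omega>) \<in> borel_measurable TM" by (simp add: split_beta' u_eq)
  show "u t \<in> borel_measurable (F t)" if "t \<in> {0..T}" for t
    unfolding u_eq[abs_def] by (intro matrix_vector_mult_borel \<mu>_F that) simp
qed

text \<open>With \<open>|u| \<le> C |\<mu>| / g\<close> both integrability conditions follow from the integrability of \<open>1 / g\<close> and the
  bounded second moment of \<open>\<mu>\<close>.\<close>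

lemma u_control: "u \<in> control_set M w T g"
proof -
  obtain K where K: "\<And>t. t \<in> {0..T} \<Longrightarrow> (LINT \<omega>|M. (norm (\<mu> t \<omega>))\<^sup>2) \<le> K" by (rule \<mu>_bound) blast
  note ut = adapted_processD(1)[OF u_adapted]
  have ae0: "AE \<omega> in M. integrable L (\<lambda>t. norm (W t) * norm (\<mu> t \<omega>))"
    by (rule weighted_integral_square_integrable(1)[OF W_integrable _ \<mu>_TM \<mu>_sq K]) simp
  have ae: "AE \<omega> in M. integrable L (\<lambda>t. u t \<omega>)"
    using ae0 AE_space
  proof eventually_elim
    case (elim \<omega>)
    show ?case
      by (rule Bochner_Integration.integrable_bound[OF elim(1) adapted_processD(4)[OF u_adapted elim(2)]])
        (simp add: u_eq norm_matrix_vector_mult_le)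
  qed
  moreover have "square_integrable M (\<lambda>\<omega>. LINT t|L. norm (u t \<omega>))"
  proof (rule square_integrable_bound)
    show "square_integrable M (\<lambda>\<omega>. LINT t|L. norm (W t) * norm (\<mu> t \<omega>))"
      by (rule weighted_integral_square_integrable(2)[OF W_integrable _ \<mu>_TM \<mu>_sq K]) simp
    show "(\<lambda>\<omega>. LINT t|L. norm (u t \<omega>)) \<in> borel_measurable M"
      using time_integral_measurable[OF measurable_compose[OF ut borel_measurable_norm]] by simp
    show "AE \<omega> in M. norm (LINT t|L. norm (u t \<omega>)) \<le> 1 * norm (LINT t|L. norm (W t) * norm (\<mu> t \<omega>))"
      using ae0 ae
    proof eventually_elim
      case (elim \<omega>)
      have "(LINT t|L. norm (u t \<omega>)) \<le> (LINT t|L. norm (W t) * norm (\<mu> t \<omega>))"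
        using elim by (intro integral_mono) (auto simp: u_eq norm_matrix_vector_mult_le)
      then show ?case by simp
    qed
  qed
  moreover have "integrable TM (\<lambda>(t, \<omega>). \<bar>g t\<bar> * (norm (u t \<omega>))\<^sup>2)"
  proof -
    obtain C where C: "0 < C" "\<And>t. t \<in> {0..<T} \<Longrightarrow> norm (W t) \<le> C * \<bar>inverse (g t)\<bar>" by (rule W_bound) blast
    have w: "integrable TM (\<lambda>(t, \<omega>). \<bar>inverse (g t)\<bar> * (norm (\<mu> t \<omega>))\<^sup>2)"
      by (rule weighted_integrable[OF integrable_abs[OF ginv_integrable] _ \<mu>_TM \<mu>_sq K]) simp
    show ?thesis
    proof (rule Bochner_Integration.integrable_bound)
      show "integrable TM (\<lambda>x. C\<^sup>2 * (case x of (t, \<omega>) \<Rightarrow> \<bar>inverse (g t)\<bar> * (norm (\<mu> t \<omega>))\<^sup>2))"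
        by (rule integrable_mult_right) (rule w)
      show "(\<lambda>(t, \<omega>). \<bar>g t\<bar> * (norm (u t \<omega>))\<^sup>2) \<in> borel_measurable TM"
        using borel_measurable_times[OF borel_measurable_abs[OF fst_measurable_TM[OF g_meas]]
           borel_measurable_power[OF measurable_compose[OF ut borel_measurable_norm], of 2]]
        by (simp add: split_beta')
      show "AE x in TM. norm (case x of (t, \<omega>) \<Rightarrow> \<bar>g t\<bar> * (norm (u t \<omega>))\<^sup>2)
         \<le> norm (C\<^sup>2 * (case x of (t, \<omega>) \<Rightarrow> \<bar>inverse (g t)\<bar> * (norm (\<mu> t \<omega>))\<^sup>2))"
        using AE_TM_less
      proof eventually_elim
        case (elim x)
        obtain t \<omega> where x: "x = (t, \<omega>)" by (cases x)
        with elim have t: "t \<in> {0..<T}" by simp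
        note gt = g(1)[OF t]
        have "norm (u t \<omega>) \<le> norm (W t) * norm (\<mu> t \<omega>)" by (simp add: u_eq norm_matrix_vector_mult_le)
        also have "\<dots> \<le> (C * \<bar>inverse (g t)\<bar>) * norm (\<mu> t \<omega>)" by (intro mult_right_mono C(2) t) simp
        finally have "(norm (u t \<omega>))\<^sup>2 \<le> ((C * \<bar>inverse (g t)\<bar>) * norm (\<mu> t \<omega>))\<^sup>2" by (rule power_mono) simp
        then have "g t * (norm (u t \<omega>))\<^sup>2 \<le> g t * ((C * inverse (g t)) * norm (\<mu> t \<omega>))\<^sup>2"
          using gt by (intro mult_left_mono) auto
        also have "\<dots> = C\<^sup>2 * (inverse (g t) * (norm (\<mu> t \<omega>))\<^sup>2)"
          using gt by (simp add: power2_eq_square field_simps)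
        finally have "\<bar>g t\<bar> * (norm (u t \<omega>))\<^sup>2 \<le> C\<^sup>2 * (\<bar>inverse (g t)\<bar> * (norm (\<mu> t \<omega>))\<^sup>2)" using gt by simp
        then show ?case by (simp add: x abs_mult)
      qed
    qed
  qed
  ultimately show ?thesis unfolding control_set_iff using u_adapted by blast
qed

text \<open>The end point is \<open>q + R(0) y0 + Y\<close>, since \<open>B u = Q \<mu>\<close>; here \<open>R(0) y0 = E f - q\<close> by the choice of \<open>y0\<close>,
  and \<open>Y = f - E f\<close> by the stochastic Fubini theorem.\<close>

lemma u_feasible: "u \<in> feasible_controls M w T g A b a f"
proof -
  let ?q = "mat_exp (T *\<^sub>R A) *v a"
  have ae: "AE \<omega> in M. integrable L (\<lambda>t. u t \<omega>)" using u_control[unfolded control_set_iff] by blast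
  define x where "x t \<omega> = (SOME x. state_path T A b a (\<lambda>t. u t \<omega>) x) t" for t \<omega>
  have "AE \<omega> in M. state_path T A b a (\<lambda>t. u t \<omega>) (\<lambda>t. x t \<omega>) \<and> x T \<omega> = f \<omega>"
    using ae Qm_integrable stochastic_Fubini
  proof eventually_elim
    case (elim \<omega>)
    have sp: "state_path T A b a (\<lambda>t. u t \<omega>) (\<lambda>t. x t \<omega>)"
      unfolding x_def by (rule someI_ex[OF state_path_exists[OF elim(1)]])
    have "x T \<omega> = ?q + (LINT t|L. E t *v (b *v u t \<omega>))"
      using T_pos by (intro state_path_endpoint elim sp) auto
    also have "(LINT t|L. E t *v (b *v u t \<omega>)) = (LINT t|L. Q t *v y0 + Q t *v m t \<omega>)"
    proof (intro Bochner_Integration.integral_cong refl)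
      fix t
      have "E t *v (b *v u t \<omega>) = Q t *v \<mu> t \<omega>"
        unfolding u_eq Q_eq W_def Bt_def by (simp only: matrix_vector_mul_assoc matrix_mul_assoc)
      then show "E t *v (b *v u t \<omega>) = Q t *v y0 + Q t *v m t \<omega>"
        by (simp add: m_def matrix_vector_right_distrib[symmetric])
    qed
    also have "\<dots> = (LINT t|L. Q t *v y0) + Y \<omega>"
      unfolding Y_def
      by (rule Bochner_Integration.integral_add[OF integrable_bounded_linear[OF
            bounded_bilinear.bounded_linear_left[OF bounded_bilinear_matrix_vector_mult] Q_integrable] elim(2)])
    also have "(LINT t|L. Q t *v y0) = R 0 *v y0"
      unfolding R_mat_def
      by (rule integral_bounded_linear[OF bounded_bilinear.bounded_linear_left[OF bounded_bilinear_matrix_vector_mult] Q_integrable])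
    also have "R 0 *v y0 = expectation f - ?q"
      using T_pos by (simp add: mu_bar_def matrix_vector_mul_assoc matrix_inv_both[OF R_invertible])
    finally have "x T \<omega> = f \<omega>" using elim(3) by simp
    with sp show ?case by simp
  qed
  then show ?thesis unfolding feasible_controls_def using u_control by blast
qed

section \<open>Optimality and uniqueness\<close>

text \<open>\<open>u \<bullet> \<Gamma> h = \<mu> \<bullet> B h\<close>. Under the expectation \<open>\<mu>(t)\<close> may be replaced by \<open>\<mu>(T)\<close>, because \<open>\<mu>\<close> is a
  martingale and \<open>B h(t)\<close> is known at time \<open>t\<close>; it is square integrable for almost every \<open>t\<close> because
  the weighted energy of \<open>h\<close> is finite. Then \<open>\<mu>(T)\<close> leaves the time integral, which vanishes.\<close>

lemma cross_term_zero:
  fixes h :: "real \<Rightarrow> 'a \<Rightarrow> real ^ 'n"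
  assumes h: "h \<in> control_set M w T g" and h0: "AE \<omega> in M. (LINT t|L. Bt t *v h t \<omega>) = 0"
  shows "(LINT (t, \<omega>)|TM. u t \<omega> \<bullet> (\<Gamma> t *v h t \<omega>)) = 0"
proof -
  interpret P: pair_sigma_finite L M by (rule pair_sigma_finite_TM)
  interpret Q: pair_sigma_finite M L using pair_sigma_finite_TM by (simp add: pair_sigma_finite_def)
  note H = h[unfolded control_set_iff]
  have had: "adapted_process M w T h" using H by blast
  note ht = adapted_processD(1)[OF had]
  obtain C where C: "0 < C" "\<And>t. t \<in> {0..T} \<Longrightarrow> norm (Bt t) \<le> C" by (rule Bt_bound) blast
  have Bh: "(\<lambda>x. Bt (fst x) *v (case x of (t, \<omega>) \<Rightarrow> h t \<omega>)) \<in> borel_measurable TM"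
    by (intro matrix_vector_mult_borel fst_measurable_TM Bt_meas ht)
  have m1: "(\<lambda>(t, \<omega>). \<mu> t \<omega> \<bullet> (Bt t *v h t \<omega>)) \<in> borel_measurable TM"
    using borel_measurable_inner[OF \<mu>_TM Bh] by (simp add: split_beta')
  have m2: "(\<lambda>(t, \<omega>). \<mu> T \<omega> \<bullet> (Bt t *v h t \<omega>)) \<in> borel_measurable TM"
    using borel_measurable_inner[OF snd_measurable_TM[OF square_integrableD(1)[OF \<mu>_sq[OF T_mem]]] Bh] by (simp add: split_beta')
  note m0 = borel_measurable_integrable[OF form_integrable[OF u_control h]]
  have eq: "AE x in TM. (case x of (t, \<omega>) \<Rightarrow> u t \<omega> \<bullet> (\<Gamma> t *v h t \<omega>)) = (case x of (t, \<omega>) \<Rightarrow> \<mu> t \<omega> \<bullet> (Bt t *v h t \<omega>))"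
    using AE_TM_less
  proof eventually_elim
    case (elim x)
    obtain t \<omega> where x: "x = (t, \<omega>)" by (cases x)
    with elim have t: "t \<in> {0..<T}" by simp
    note S = \<Gamma>_spd[OF t]
    have "\<Gamma> t *v u t \<omega> = (\<Gamma> t ** matrix_inv (\<Gamma> t)) *v (transpose (Bt t) *v \<mu> t \<omega>)"
      unfolding u_eq W_def by (simp only: matrix_vector_mul_assoc matrix_mul_assoc)
    also have "\<dots> = transpose (Bt t) *v \<mu> t \<omega>"
      by (simp only: matrix_inv_both[OF sym_pos_def_invertible[OF S]] matrix_vector_mul_lid)
    finally have "u t \<omega> \<bullet> (\<Gamma> t *v h t \<omega>) = h t \<omega> \<bullet> (transpose (Bt t) *v \<mu> t \<omega>)"
      using sym_pos_def_inner_commute[OF S, of "u t \<omega>" "h t \<omega>"] by simp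
    also have "\<dots> = \<mu> t \<omega> \<bullet> (Bt t *v h t \<omega>)"
      unfolding inner_transpose_mult[of "\<mu> t \<omega>"] by (rule inner_commute)
    finally show ?case by (simp add: x)
  qed
  have i1: "integrable TM (\<lambda>(t, \<omega>). \<mu> t \<omega> \<bullet> (Bt t *v h t \<omega>))"
    using form_integrable[OF u_control h] integrable_cong_AE[OF m0 m1 eq] by simp
  have i2: "integrable TM (\<lambda>(t, \<omega>). \<mu> T \<omega> \<bullet> (Bt t *v h t \<omega>))"
  proof -
    have le: "norm (\<mu> T \<omega> \<bullet> (Bt t *v h t \<omega>)) \<le> (C * norm (\<mu> T \<omega>)) * norm (h t \<omega>)" if t: "t \<in> {0..T}" for t \<omega>
    proof -
      have "norm (\<mu> T \<omega> \<bullet> (Bt t *v h t \<omega>)) \<le> norm (\<mu> T \<omega>) * norm (Bt t *v h t \<omega>)"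
        unfolding real_norm_def by (rule Cauchy_Schwarz_ineq2)
      also have "\<dots> \<le> norm (\<mu> T \<omega>) * (C * norm (h t \<omega>))"
        by (intro mult_left_mono order_trans[OF norm_matrix_vector_mult_le] mult_right_mono C(2) t) auto
      finally show ?thesis by (simp add: mult_ac)
    qed
    have sw: "(\<lambda>(\<omega>, t). \<mu> T \<omega> \<bullet> (Bt t *v h t \<omega>)) \<in> borel_measurable (M \<Otimes>\<^sub>M L)"
      using measurable_compose[OF measurable_pair_swap' m2] by (simp add: split_beta')
    have hi: "AE \<omega> in M. integrable L (\<lambda>t. h t \<omega>)" using H by blast
    have aei: "AE \<omega> in M. integrable L (\<lambda>t. \<mu> T \<omega> \<bullet> (Bt t *v h t \<omega>))"
      using hi AE_space
    proof eventually_elim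
      case (elim \<omega>)
      show ?case
      proof (rule Bochner_Integration.integrable_bound)
        show "integrable L (\<lambda>t. (C * norm (\<mu> T \<omega>)) * norm (h t \<omega>))" using elim(1) by simp
        show "(\<lambda>t. \<mu> T \<omega> \<bullet> (Bt t *v h t \<omega>)) \<in> borel_measurable L"
          using measurable_compose[OF measurable_Pair2'[OF elim(2)] m2] by simp
        show "AE t in L. norm (\<mu> T \<omega> \<bullet> (Bt t *v h t \<omega>)) \<le> norm ((C * norm (\<mu> T \<omega>)) * norm (h t \<omega>))"
          by (rule AE_I2, rule order_trans[OF le]) auto
      qed
    qed
    have "integrable (M \<Otimes>\<^sub>M L) (\<lambda>(\<omega>, t). \<mu> T \<omega> \<bullet> (Bt t *v h t \<omega>))"
    proof (rule Q.Fubini_integrable[OF sw])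
      show "AE \<omega> in M. integrable L (\<lambda>t. case (\<omega>, t) of (\<omega>, t) \<Rightarrow> \<mu> T \<omega> \<bullet> (Bt t *v h t \<omega>))" using aei by simp
      show "integrable M (\<lambda>\<omega>. LINT t|L. norm (case (\<omega>, t) of (\<omega>, t) \<Rightarrow> \<mu> T \<omega> \<bullet> (Bt t *v h t \<omega>)))"
      proof (rule Bochner_Integration.integrable_bound)
        have "square_integrable M (\<lambda>\<omega>. norm (\<mu> T \<omega>))"
          using \<mu>_sq[OF T_mem] measurable_compose[OF _ borel_measurable_norm, of "\<mu> T" M]
          by (simp add: square_integrable_def)
        moreover have "square_integrable M (\<lambda>\<omega>. LINT t|L. norm (h t \<omega>))" using H by blast
        ultimately have "integrable M (\<lambda>\<omega>. norm (\<mu> T \<omega>) \<bullet> (LINT t|L. norm (h t \<omega>)))"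
          by (rule square_integrable_inner(2))
        then show "integrable M (\<lambda>\<omega>. C * (norm (\<mu> T \<omega>) * (LINT t|L. norm (h t \<omega>))))" by simp
        show "(\<lambda>\<omega>. LINT t|L. norm (case (\<omega>, t) of (\<omega>, t) \<Rightarrow> \<mu> T \<omega> \<bullet> (Bt t *v h t \<omega>))) \<in> borel_measurable M"
          using time_integral_measurable[OF measurable_compose[OF m2 borel_measurable_norm]] by simp
        show "AE \<omega> in M. norm (LINT t|L. norm (case (\<omega>, t) of (\<omega>, t) \<Rightarrow> \<mu> T \<omega> \<bullet> (Bt t *v h t \<omega>)))
           \<le> norm (C * (norm (\<mu> T \<omega>) * (LINT t|L. norm (h t \<omega>))))"
          using hi aei
        proof eventually_elim
          case (elim \<omega>)
          have "(LINT t|L. norm (\<mu> T \<omega> \<bullet> (Bt t *v h t \<omega>))) \<le> (LINT t|L. (C * norm (\<mu> T \<omega>)) * norm (h t \<omega>))"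
            using elim le by (intro integral_mono) auto
          also have "\<dots> = C * (norm (\<mu> T \<omega>) * (LINT t|L. norm (h t \<omega>)))" by simp
          finally show ?case
            by simp
        qed
      qed
    qed
    from Q.integrable_product_swap[OF this] show ?thesis by simp
  qed
  have "(LINT (t, \<omega>)|TM. u t \<omega> \<bullet> (\<Gamma> t *v h t \<omega>)) = (LINT (t, \<omega>)|TM. \<mu> t \<omega> \<bullet> (Bt t *v h t \<omega>))"
    by (rule integral_cong_AE[OF m0 m1 eq])
  also have "\<dots> = (LINT t|L. LINT \<omega>|M. \<mu> t \<omega> \<bullet> (Bt t *v h t \<omega>))"
    by (rule P.integral_fst[OF i1, symmetric])
  also have "\<dots> = (LINT t|L. LINT \<omega>|M. \<mu> T \<omega> \<bullet> (Bt t *v h t \<omega>))"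
  proof (rule integral_cong_AE)
    show "(\<lambda>t. LINT \<omega>|M. \<mu> t \<omega> \<bullet> (Bt t *v h t \<omega>)) \<in> borel_measurable L" using P.integrable_fst[OF i1] by auto
    show "(\<lambda>t. LINT \<omega>|M. \<mu> T \<omega> \<bullet> (Bt t *v h t \<omega>)) \<in> borel_measurable L" using P.integrable_fst[OF i2] by auto
    have "AE t in L. integrable M (\<lambda>\<omega>. \<bar>g t\<bar> * (norm (h t \<omega>))\<^sup>2)"
      using P.AE_integrable_fst[of "\<lambda>t \<omega>. \<bar>g t\<bar> * (norm (h t \<omega>))\<^sup>2"] H by blast
    then show "AE t in L. (LINT \<omega>|M. \<mu> t \<omega> \<bullet> (Bt t *v h t \<omega>)) = (LINT \<omega>|M. \<mu> T \<omega> \<bullet> (Bt t *v h t \<omega>))"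
      using AE_L_less
    proof eventually_elim
      case (elim t)
      then have t: "t \<in> {0..T}" "0 \<le> t" "t \<le> T" by auto
      \<comment> \<open>For almost every \<open>t\<close> the energy density is finite, and \<open>g t > 0\<close>.\<close>
      have "integrable M (\<lambda>\<omega>. inverse \<bar>g t\<bar> * (\<bar>g t\<bar> * (norm (h t \<omega>))\<^sup>2))"
        using elim(1) by (rule integrable_mult_right)
      moreover have "inverse \<bar>g t\<bar> * (\<bar>g t\<bar> * (norm (h t \<omega>))\<^sup>2) = (norm (h t \<omega>))\<^sup>2" for \<omega>
        using g(1)[OF elim(2)] by simp
      ultimately have hsq: "square_integrable M (h t)"
        unfolding square_integrable_def using adapted_processD(3)[OF had t(1)] by simp
      have \<eta>F: "(\<lambda>\<omega>. Bt t *v h t \<omega>) \<in> borel_measurable (F t)"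
        by (intro matrix_vector_mult_borel adapted_processD(2)[OF had t(1)]) simp
      have \<eta>: "square_integrable M (\<lambda>\<omega>. Bt t *v h t \<omega>)"
        by (rule square_integrable_bound[OF hsq F_measurable_M[OF \<eta>F t(3)], of "norm (Bt t)"])
          (simp add: norm_matrix_vector_mult_le)
      have "(LINT \<omega>|M. \<mu> T \<omega> \<bullet> (Bt t *v h t \<omega>)) - (LINT \<omega>|M. \<mu> t \<omega> \<bullet> (Bt t *v h t \<omega>))
         = (LINT \<omega>|M. \<mu> T \<omega> \<bullet> (Bt t *v h t \<omega>) - \<mu> t \<omega> \<bullet> (Bt t *v h t \<omega>))"
        by (intro Bochner_Integration.integral_diff[symmetric] square_integrable_inner(2) \<mu>_sq T_mem t(1) \<eta>)
      also have "\<dots> = (LINT \<omega>|M. (m T \<omega> - m t \<omega>) \<bullet> (Bt t *v h t \<omega>))"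
        by (intro Bochner_Integration.integral_cong refl) (simp add: m_def inner_diff_left)
      also have "\<dots> = 0"
        by (rule ito_orthogonal[OF m_ito[OF t(1)] m_ito[OF T_mem] t(2,3) order_refl \<eta>F \<eta>])
      finally show ?case by simp
    qed
  qed
  also have "\<dots> = (LINT \<omega>|M. LINT t|L. \<mu> T \<omega> \<bullet> (Bt t *v h t \<omega>))"
    using P.integral_fst[OF i2] P.integral_snd[OF i2] by simp
  also have "\<dots> = (LINT \<omega>|M. 0)"
  proof (rule integral_cong_AE)
    show "(\<lambda>\<omega>. LINT t|L. \<mu> T \<omega> \<bullet> (Bt t *v h t \<omega>)) \<in> borel_measurable M" using P.integrable_snd[OF i2] by auto
    have hi: "AE \<omega> in M. integrable L (\<lambda>t. h t \<omega>)" using H by blast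
    then show "AE \<omega> in M. (LINT t|L. \<mu> T \<omega> \<bullet> (Bt t *v h t \<omega>)) = 0"
      using h0
    proof eventually_elim
      case (elim \<omega>)
      have "integrable L (\<lambda>t. Bt t *v h t \<omega>)"
        by (rule integrable_bounded_matrix_mult[OF elim(1) Bt_meas C(2)]) simp
      then show ?case using elim(2) by (simp add: integral_inner_right)
    qed
  qed simp
  finally show ?thesis by simp
qed

text \<open>Expand the quadratic form at \<open>v = u + h\<close>. The difference \<open>h\<close> of two feasible controls does not move
  the end point, so the cross term vanishes.\<close>

lemma cost_decomposition:
  assumes v: "v \<in> feasible_controls M w T g A b a f"
  shows "cost M T \<Gamma> v = cost M T \<Gamma> u + (LINT (t, \<omega>)|TM. (v t \<omega> - u t \<omega>) \<bullet> (\<Gamma> t *v (v t \<omega> - u t \<omega>)))"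
proof -
  define h where "h t \<omega> = v t \<omega> - u t \<omega>" for t \<omega>
  have vc: "v \<in> control_set M w T g" using v by (simp add: feasible_controls_def)
  have h: "h \<in> control_set M w T g"
    unfolding h_def[abs_def] by (rule control_set_diff[OF vc u_control])
  have vi: "AE \<omega> in M. integrable L (\<lambda>t. v t \<omega>)" and ui: "AE \<omega> in M. integrable L (\<lambda>t. u t \<omega>)"
    using vc u_control unfolding control_set_iff by blast+
  obtain C where C: "0 < C" "\<And>t. t \<in> {0..T} \<Longrightarrow> norm (Bt t) \<le> C" by (rule Bt_bound) blast
  have h0: "AE \<omega> in M. (LINT t|L. Bt t *v h t \<omega>) = 0"
    using feasible_constraint[OF v] feasible_constraint[OF u_feasible] vi ui
  proof eventually_elim
    case (elim \<omega>)
    have i: "integrable L (\<lambda>t. Bt t *v y t)" if "integrable L y" for y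
      by (rule integrable_bounded_matrix_mult[OF that Bt_meas C(2)]) simp
    have "(LINT t|L. Bt t *v h t \<omega>) = (LINT t|L. Bt t *v v t \<omega> - Bt t *v u t \<omega>)"
      by (simp add: h_def matrix_vector_mult_diff_distrib)
    also have "\<dots> = (LINT t|L. Bt t *v v t \<omega>) - (LINT t|L. Bt t *v u t \<omega>)"
      by (rule Bochner_Integration.integral_diff[OF i[OF elim(3)] i[OF elim(4)]])
    also have "\<dots> = 0" using elim(1,2) by (simp add: algebra_simps)
    finally show ?case .
  qed
  let ?q = "\<lambda>v v' (t, \<omega>). v t \<omega> \<bullet> (\<Gamma> t *v v' t \<omega>)"
  note iu = form_integrable[OF u_control u_control] and iuh = form_integrable[OF u_control h]
    and ih = form_integrable[OF h h]
  have "cost M T \<Gamma> v = (LINT x|TM. ?q u u x + 2 * ?q u h x + ?q h h x)"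
    unfolding cost_eq[OF vc]
  proof (rule integral_cong_AE)
    show "?q v v \<in> borel_measurable TM" using form_integrable[OF vc vc] by auto
    show "(\<lambda>x. ?q u u x + 2 * ?q u h x + ?q h h x) \<in> borel_measurable TM"
      using iu iuh ih by (intro borel_measurable_add borel_measurable_times borel_measurable_const borel_measurable_integrable)
    show "AE x in TM. ?q v v x = ?q u u x + 2 * ?q u h x + ?q h h x"
      using AE_TM_less
    proof eventually_elim
      case (elim x)
      obtain t \<omega> where x: "x = (t, \<omega>)" by (cases x)
      with elim have t: "t \<in> {0..<T}" by simp
      have "v t \<omega> = u t \<omega> + h t \<omega>" by (simp add: h_def)
      then show ?case
        using sym_pos_def_inner_commute[OF \<Gamma>_spd[OF t], of "h t \<omega>" "u t \<omega>"]
        by (simp add: x matrix_vector_right_distrib inner_add_left inner_add_right)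
    qed
  qed
  also have "\<dots> = (LINT x|TM. ?q u u x) + 2 * (LINT x|TM. ?q u h x) + (LINT x|TM. ?q h h x)"
    using iu iuh ih by (simp only: Bochner_Integration.integral_add Bochner_Integration.integrable_add
       integrable_mult_right integral_mult_right_zero)
  also have "\<dots> = cost M T \<Gamma> u + (LINT x|TM. ?q h h x)"
    using cross_term_zero[OF h h0] cost_eq[OF u_control] by simp
  finally show ?thesis by (simp add: h_def split_beta')
qed

lemma u_unique_optimal: "unique_optimal_control M w T g \<Gamma> A b a f u"
proof -
  have nn: "AE x in TM. 0 \<le> (case x of (t, \<omega>) \<Rightarrow> (v t \<omega> - u t \<omega>) \<bullet> (\<Gamma> t *v (v t \<omega> - u t \<omega>)))" for v
    using AE_TM_less by eventually_elim (auto simp: split_beta intro!: sym_pos_def_nonneg \<Gamma>_spd)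
  have "u \<in> optimal_controls M w T g \<Gamma> A b a f"
    unfolding optimal_controls_def
  proof (intro CollectI conjI ballI u_feasible)
    fix v assume v: "v \<in> feasible_controls M w T g A b a f"
    show "cost M T \<Gamma> u \<le> cost M T \<Gamma> v"
      using cost_decomposition[OF v] integral_nonneg_AE[OF nn[of v]] by linarith
  qed
  moreover have "AE_equal_processes M T u v" if "v \<in> optimal_controls M w T g \<Gamma> A b a f" for v
  proof -
    let ?e = "\<lambda>(t, \<omega>). (v t \<omega> - u t \<omega>) \<bullet> (\<Gamma> t *v (v t \<omega> - u t \<omega>))"
    have v: "v \<in> feasible_controls M w T g A b a f" "cost M T \<Gamma> v \<le> cost M T \<Gamma> u"
      using that u_feasible by (auto simp: optimal_controls_def)
    have hc: "(\<lambda>t \<omega>. v t \<omega> - u t \<omega>) \<in> control_set M w T g"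
      using v(1) by (intro control_set_diff u_control) (simp add: feasible_controls_def)
    have "(LINT x|TM. ?e x) = 0"
      using cost_decomposition[OF v(1)] v(2) integral_nonneg_AE[OF nn[of v]] by linarith
    then have "AE x in TM. ?e x = 0"
      using integral_nonneg_eq_0_iff_AE[OF form_integrable[OF hc hc] nn] by simp
    then show ?thesis unfolding AE_equal_processes_def
      using AE_TM_less
    proof eventually_elim
      case (elim x)
      obtain t \<omega> where x: "x = (t, \<omega>)" by (cases x)
      have "sym_pos_def (\<Gamma> t)" by (rule \<Gamma>_spd) (use elim x in simp)
      then have "v t \<omega> - u t \<omega> \<noteq> 0 \<Longrightarrow> 0 < (v t \<omega> - u t \<omega>) \<bullet> (\<Gamma> t *v (v t \<omega> - u t \<omega>))"
        unfolding sym_pos_def_def by blast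
      then have "v t \<omega> - u t \<omega> = 0" using elim(1) unfolding x prod.case by (metis less_irrefl)
      then show ?case by (simp add: x)
    qed
  qed
  ultimately show ?thesis unfolding unique_optimal_control_def by blast
qed

end

theorem theorem2p2:
  fixes M :: "'a measure"
    and T :: real
    and w :: "real \<Rightarrow> 'a \<Rightarrow> real ^ 'd"
    and f :: "'a \<Rightarrow> real ^ 'n"
    and k\<^sub>f :: "real \<Rightarrow> 'a \<Rightarrow> real ^ 'd ^ 'n"
    and g :: "real \<Rightarrow> real"
    and G \<Gamma> :: "real \<Rightarrow> real ^ 'n ^ 'n"
    and A b :: "real ^ 'n ^ 'n"
    and a :: "real ^ 'n"
  assumes "prob_space M"
    and "0 < T"
    and "wiener_process M T w"
    and "f \<in> borel_measurable (wiener_filtration M w T)"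
    and "integrable M (\<lambda>\<omega>. (norm (f \<omega>))\<^sup>2)"
    and "has_ito_integral M w T k\<^sub>f T (\<lambda>\<omega>. f \<omega> - prob_space.expectation M f)"
    and "\<exists>\<theta>\<in>{0<..<T}.
           esssup (lebesgue_on {\<theta>..T}) (\<lambda>t. \<integral>\<^sup>+\<omega>. ennreal ((norm (k\<^sub>f t \<omega>))\<^sup>2) \<partial>M) < \<infinity>"
    and "g \<in> borel_measurable (lebesgue_on {0..<T})"
    and "\<exists>c>0. \<exists>\<alpha>\<in>{1/2<..<1}. \<forall>t\<in>{0..<T}.
           0 < g t \<and> g t \<le> c * (T - t) powr \<alpha> \<and>
           inverse (g t) \<le> c * (1 + (T - t) powr (- \<alpha>))"
    and "G \<in> borel_measurable (lebesgue_on {0..<T})"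
    and "\<forall>t\<in>{0..<T}. sym_pos_def (G t)"
    and "bounded (G ` {0..<T})"
    and "bounded ((\<lambda>t. matrix_inv (G t)) ` {0..<T})"
    and "\<forall>t\<in>{0..<T}. \<Gamma> t = g t *\<^sub>R G t"
    and "invertible b"
  shows "(\<forall>t\<in>{0..<T}. invertible (R_mat T A b \<Gamma> t)) \<and>
         (\<exists>\<mu>. ito_process M w T (mu_bar M T A b a \<Gamma> f) (k_mu T A b \<Gamma> k\<^sub>f) \<mu>) \<and>
         (\<forall>\<mu>. ito_process M w T (mu_bar M T A b a \<Gamma> f) (k_mu T A b \<Gamma> k\<^sub>f) \<mu> \<longrightarrow>
              unique_optimal_control M w T g \<Gamma> A b a f (u_hat T A b \<Gamma> \<mu>))"
proof -
  interpret W: wiener_space M T w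
    by (intro wiener_space.intro wiener_space_axioms.intro assms(1-3))
  obtain \<theta> where \<theta>: "0 < \<theta>" "\<theta> < T"
    and ess: "esssup (lebesgue_on {\<theta>..T}) (\<lambda>t. \<integral>\<^sup>+\<omega>. ennreal ((norm (k\<^sub>f t \<omega>))\<^sup>2) \<partial>M) < \<infinity>"
    using assms(7) by auto
  define Kf where "Kf = enn2real (esssup (lebesgue_on {\<theta>..T}) (\<lambda>t. \<integral>\<^sup>+\<omega>. ennreal ((norm (k\<^sub>f t \<omega>))\<^sup>2) \<partial>M))"
  have kf: "AE t in lebesgue_on {\<theta>..T}. (\<integral>\<^sup>+\<omega>. ennreal ((norm (k\<^sub>f t \<omega>))\<^sup>2) \<partial>M) \<le> ennreal Kf"
  proof -
    have "ennreal Kf = esssup (lebesgue_on {\<theta>..T}) (\<lambda>t. \<integral>\<^sup>+\<omega>. ennreal ((norm (k\<^sub>f t \<omega>))\<^sup>2) \<partial>M)"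
      unfolding Kf_def using ess by (intro ennreal_enn2real) (simp add: less_top)
    then show ?thesis by (simp only: esssup_AE)
  qed
  obtain c \<alpha> where c: "0 < c" "1/2 < \<alpha>" "\<alpha> < 1" and g: "\<forall>t\<in>{0..<T}. 0 < g t \<and> g t \<le> c * (T - t) powr \<alpha> \<and>
           inverse (g t) \<le> c * (1 + (T - t) powr (- \<alpha>))"
    using assms(9) by auto
  obtain KG where KG: "0 < KG" "\<forall>t\<in>{0..<T}. norm (G t) \<le> KG"
    using assms(12) unfolding bounded_pos by auto
  obtain KI where KI: "0 < KI" "\<forall>t\<in>{0..<T}. norm (matrix_inv (G t)) \<le> KI"
    using assms(13) unfolding bounded_pos by auto
  interpret C: control_problem M T w f k\<^sub>f g G \<Gamma> A b a c \<alpha> \<theta> KG KI Kf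
    by unfold_locales (use assms \<theta> kf c g KG KI in auto)
  have "unique_optimal_control M w T g \<Gamma> A b a f (u_hat T A b \<Gamma> \<mu>)"
    if "ito_process M w T (mu_bar M T A b a \<Gamma> f) (k_mu T A b \<Gamma> k\<^sub>f) \<mu>" for \<mu>
  proof -
    interpret candidate M T w f k\<^sub>f g G \<Gamma> A b a c \<alpha> \<theta> KG KI Kf \<mu>
      by unfold_locales (rule that)
    show ?thesis by (rule u_unique_optimal)
  qed
  then show ?thesis using C.R_invertible C.mu_exists by blast
qed

end
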